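(* Let $V_{si}$, $V_{fi}$ ($i=1,\dots,N-1$) and $V_s$ be the slow and fast spaces defined from decompositions $H^{1/2}_{00}(\Gamma_i)=Y_{si}\oplus Y_{fi}$. Assume that $V_{si}$ and $V_{fi}$ are $a$-orthogonal for $i\in\{1,\dots,N-1\}$ and any $y\in D$. Let $u_\Gamma(y)\in V_\Gamma$ be the solution to the interface problem and $\tilde u_\Gamma(y)$ the approximate interface solution related to the decomposition $V_s\oplus V_{f1}\oplus\cdots\oplus V_{f(N-1)}$. Assume that the fast interaction term $\epsilon_f$ is sufficiently small. Then there exists $C$ independent of $y$, $u$ and $\epsilon_f$ such that $$\|u_\Gamma(y)-\tilde u_\Gamma(y)\|_E\le C\,\epsilon_f\,\|u_\Gamma(y)\|_E\quad\text{for any } y\in D.$$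
   Context: Geometry: $N>2$; $r_1,r_2:(0,1)\to\mathbb R$ are sufficiently regular functions with $r_1(t)<r_2(t)$ for all $t\in(0,1)$; $\Omega_1=\{(x_1,x_2): x_1\in(0,1),\ r_1(x_1)<x_2<r_2(x_1)\}$; $\Omega_{i+1}=\{(x_1,x_2): (2i-x_1,x_2)\in\Omega_i\}$ for $i=1,\dots,N-1$; $\Gamma_i=\partial\Omega_i\cap\partial\Omega_{i+1}$; $\Omega=\mathrm{int}(\bigcup_{i=1}^N\overline\Omega_i)$. For $\omega\subseteq\Omega$, $(\cdot,\cdot)_\omega$ and $\|\cdot\|_\omega$ are the $L^2(\omega)$ inner product and norm. Problem: $D\subset(m,M)^N$ with $m,M>0$, $f\in L^2(\Omega)$, $L(v)=(f,v)_\Omega$; for $y\in D$, $a(z,v)=a(y;z,v)=\sum_{i=1}^N y_i(\nabla z,\nabla v)_{\Omega_i}$ on $H^1_0(\Omega)$ and $\|v\|_E=a(v,v)^{1/2}$ (both depend on $y$); $u(y)\in H^1_0(\Omega)$ satisfies $a(u(y),v)=L(v)$ for all $v\in H^1_0(\Omega)$. Spaces: $V_{\Omega_i}$ is the space of functions of $H^1_0(\Omega)$ supported in $\Omega_i$ (zero extensions of $H^1_0(\Omega_i)$); $V_\Gamma=\{u\in H^1_0(\Omega): (\nabla u,\nabla v)_\Omega=0\ \forall v\in V_{\Omega_j},\ j=1,\dots,N\}$; $V_{\Gamma_i}=\{v\in V_\Gamma: v|_{\Gamma_j}=0\ \text{for } j\in\{1,\dots,N-1\},\ j\ne i\}$.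 One has $V_\Gamma=\bigoplus_{i=1}^{N-1}V_{\Gamma_i}$. The interface trace space on $\Gamma_i$ is $H^{1/2}_{00}(\Gamma_i)$. Given decompositions $H^{1/2}_{00}(\Gamma_i)=Y_{si}\oplus Y_{fi}$, put $V_{fi}=\{v\in V_{\Gamma_i}: v|_{\Gamma_i}\in Y_{fi}\}$, $V_{si}=\{v\in V_{\Gamma_i}: v|_{\Gamma_i}\in Y_{si}\}$, $V_s=\bigoplus_{i=1}^{N-1}V_{si}$, so that $V_\Gamma=V_s\oplus V_{f1}\oplus\cdots\oplus V_{f(N-1)}$. Solutions: $u_\Gamma(y)\in V_\Gamma$ satisfies $a(u_\Gamma(y),v)=L(v)$ for all $v\in V_\Gamma$. The approximate interface solution is $\tilde u_\Gamma(y)=\sum_{i=1}^{N-1}\tilde u_{fi}(y)+\tilde u_s(y)$, where $\tilde u_{fi}(y)\in V_{fi}$ satisfies $a(\tilde u_{fi}(y),v)=L(v)$ for all $v\in V_{fi}$, and $\tilde u_s(y)\in V_s$ satisfies $a(\tilde u_s(y),v)=L(v)$ for all $v\in V_s$. Fast interaction term: $$\epsilon_f=\max_{i=1,\dots,N-2}\ \max_{z_{fi}\in V_{fi},\ z_{i+1}\in V_{\Gamma_{i+1}}}\frac{(\nabla z_{fi},\nabla z_{i+1})_{\Omega_{i+1}}}{\|\nabla z_{fi}\|_{\Omega_{i+1}}\|\nabla z_{i+1}\|_{\Omega_{i+1}}}$$ (nonzero $z_{fi},z_{i+1}$).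
   Formalization: C depends on a bound κ for the ratio to ε_f of the interaction of V_{f(N-1)} with V_{Γ_{N-2}} in Ω_{N-1}, which ε_f omits; without such a bound no C independent of ε_f exists (N=3, unit squares, Y_{f1}=span{sin kπx₂}, Y_{f2} everything). *)

theory Defs
  imports "HOL-Analysis.Analysis"
begin

text \<open>Functions stand for their almost-everywhere classes: no space below distinguishes functions
  that agree a.e. on the relevant set, and values off that set are never used.\<close>

definition L2 :: "'a::euclidean_space set \<Rightarrow> ('a \<Rightarrow> 'b::euclidean_space) set" where
  "L2 \<omega> = {f. f \<in> borel_measurable (lebesgue_on \<omega>) \<and>
              integrable (lebesgue_on \<omega>) (\<lambda>x. (norm (f x))\<^sup>2)}"

definition L2_ip :: "'a::euclidean_space set \<Rightarrow> ('a \<Rightarrow> 'b::euclidean_space) \<Rightarrow> ('a \<Rightarrow> 'b) \<Rightarrow> real" where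
  "L2_ip \<omega> f g = (LINT x|lebesgue_on \<omega>. f x \<bullet> g x)"

definition L2_norm :: "'a::euclidean_space set \<Rightarrow> ('a \<Rightarrow> 'b::euclidean_space) \<Rightarrow> real" where
  "L2_norm \<omega> f = sqrt (L2_ip \<omega> f f)"

primrec Ck :: "nat \<Rightarrow> ('a::euclidean_space \<Rightarrow> real) \<Rightarrow> bool" where
  "Ck 0 f \<longleftrightarrow> continuous_on UNIV f"
| "Ck (Suc k) f \<longleftrightarrow> f differentiable_on UNIV \<and>
     (\<forall>b\<in>Basis. Ck k (\<lambda>x. frechet_derivative f (at x) b))"

definition test_functions :: "'a::euclidean_space set \<Rightarrow> ('a \<Rightarrow> real) set" where
  "test_functions \<Omega> = {\<phi>. (\<forall>k. Ck k \<phi>) \<and> compact (closure {x. \<phi> x \<noteq> 0}) \<and>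
                         closure {x. \<phi> x \<noteq> 0} \<subseteq> \<Omega>}"

definition weak_gradient :: "'a::euclidean_space set \<Rightarrow> ('a \<Rightarrow> real) \<Rightarrow> ('a \<Rightarrow> 'a) \<Rightarrow> bool" where
  "weak_gradient \<Omega> v G \<longleftrightarrow> G \<in> L2 \<Omega> \<and>
     (\<forall>\<phi>\<in>test_functions \<Omega>. \<forall>b\<in>Basis.
        (LINT x|lebesgue_on \<Omega>. v x * frechet_derivative \<phi> (at x) b) =
        - (LINT x|lebesgue_on \<Omega>. (G x \<bullet> b) * \<phi> x))"

definition H1 :: "'a::euclidean_space set \<Rightarrow> ('a \<Rightarrow> real) set" where
  "H1 \<Omega> = {v \<in> L2 \<Omega>. \<exists>G. weak_gradient \<Omega> v G}"

text \<open>The weak gradient is unique only up to null sets; \<open>grad\<close> picks a representative.\<close>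

definition grad :: "'a::euclidean_space set \<Rightarrow> ('a \<Rightarrow> real) \<Rightarrow> 'a \<Rightarrow> 'a" where
  "grad \<Omega> v = (SOME G. weak_gradient \<Omega> v G)"

definition H1_norm :: "'a::euclidean_space set \<Rightarrow> ('a \<Rightarrow> real) \<Rightarrow> real" where
  "H1_norm \<Omega> v = sqrt ((L2_norm \<Omega> v)\<^sup>2 + (L2_norm \<Omega> (grad \<Omega> v))\<^sup>2)"

definition test_approx :: "'a::euclidean_space set \<Rightarrow> (nat \<Rightarrow> 'a \<Rightarrow> real) \<Rightarrow> ('a \<Rightarrow> real) \<Rightarrow> bool" where
  "test_approx \<Omega> \<phi> v \<longleftrightarrow> (\<forall>n. \<phi> n \<in> test_functions \<Omega>) \<and>
     (\<lambda>n. H1_norm \<Omega> (\<lambda>x. \<phi> n x - v x)) \<longlonglongrightarrow> 0"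

definition H10 :: "'a::euclidean_space set \<Rightarrow> ('a \<Rightarrow> real) set" where
  "H10 \<Omega> = {v \<in> H1 \<Omega>. \<exists>\<phi>. test_approx \<Omega> \<phi> v}"

text \<open>The trace of an \<open>H10\<close> function on a subset \<open>\<Gamma>\<close> of the line \<open>x\<^sub>1 = c\<close>, obtained by extending
  restriction of test functions by continuity. A function on \<open>\<Gamma>\<close> is written as a function of the
  second coordinate, so arc length on \<open>\<Gamma>\<close> becomes Lebesgue measure on the reals.\<close>

definition on_line :: "real \<Rightarrow> (real \<times> real) set \<Rightarrow> real set" where
  "on_line c \<Gamma> = {t. (c, t) \<in> \<Gamma>}"

definition has_trace ::
  "(real \<times> real) set \<Rightarrow> real \<Rightarrow> (real \<times> real) set \<Rightarrow> (real \<times> real \<Rightarrow> real) \<Rightarrow> (real \<Rightarrow> real) \<Rightarrow> bool" where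
  "has_trace \<Omega> c \<Gamma> v g \<longleftrightarrow> g \<in> L2 (on_line c \<Gamma>) \<and>
     (\<exists>\<phi>. test_approx \<Omega> \<phi> v \<and>
          (\<lambda>n. L2_norm (on_line c \<Gamma>) (\<lambda>t. \<phi> n (c, t) - g t)) \<longlonglongrightarrow> 0)"

subsection \<open>Geometry\<close>

text \<open>Indices start at 1; the value at 0 is a dummy.\<close>

fun subdomain :: "(real \<Rightarrow> real) \<Rightarrow> (real \<Rightarrow> real) \<Rightarrow> nat \<Rightarrow> (real \<times> real) set" where
  "subdomain r1 r2 0 = {}"
| "subdomain r1 r2 (Suc 0) = {(x1, x2). x1 \<in> {0<..<1} \<and> r1 x1 < x2 \<and> x2 < r2 x1}"
| "subdomain r1 r2 (Suc (Suc i)) =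
     {(x1, x2). (2 * real (Suc i) - x1, x2) \<in> subdomain r1 r2 (Suc i)}"

definition domain :: "nat \<Rightarrow> (real \<Rightarrow> real) \<Rightarrow> (real \<Rightarrow> real) \<Rightarrow> (real \<times> real) set" where
  "domain N r1 r2 = interior (\<Union>i\<in>{1..N}. closure (subdomain r1 r2 i))"

definition interface :: "(real \<Rightarrow> real) \<Rightarrow> (real \<Rightarrow> real) \<Rightarrow> nat \<Rightarrow> (real \<times> real) set" where
  "interface r1 r2 i = frontier (subdomain r1 r2 i) \<inter> frontier (subdomain r1 r2 (Suc i))"

text \<open>The interface with index \<open>i\<close> lies on the line \<open>x\<^sub>1 = i\<close>.\<close>

definition interface_trace ::
  "nat \<Rightarrow> (real \<Rightarrow> real) \<Rightarrow> (real \<Rightarrow> real) \<Rightarrow> nat \<Rightarrow> (real \<times> real \<Rightarrow> real) \<Rightarrow> (real \<Rightarrow> real) \<Rightarrow> bool" where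
  "interface_trace N r1 r2 i v g \<longleftrightarrow> has_trace (domain N r1 r2) (real i) (interface r1 r2 i) v g"

text \<open>The space usually written \<open>H\<close> with exponent 1/2 and index 00, defined as the space of traces on
  the interface of functions vanishing on the outer boundary.\<close>

definition H_half_00 :: "nat \<Rightarrow> (real \<Rightarrow> real) \<Rightarrow> (real \<Rightarrow> real) \<Rightarrow> nat \<Rightarrow> (real \<Rightarrow> real) set" where
  "H_half_00 N r1 r2 i = {g. \<exists>v\<in>H10 (domain N r1 r2). interface_trace N r1 r2 i v g}"

subsection \<open>Forms\<close>

definition grad_ip ::
  "nat \<Rightarrow> (real \<Rightarrow> real) \<Rightarrow> (real \<Rightarrow> real) \<Rightarrow> (real \<times> real) set \<Rightarrow>
   (real \<times> real \<Rightarrow> real) \<Rightarrow> (real \<times> real \<Rightarrow> real) \<Rightarrow> real" where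
  "grad_ip N r1 r2 \<omega> z v = L2_ip \<omega> (grad (domain N r1 r2) z) (grad (domain N r1 r2) v)"

definition grad_norm ::
  "nat \<Rightarrow> (real \<Rightarrow> real) \<Rightarrow> (real \<Rightarrow> real) \<Rightarrow> (real \<times> real) set \<Rightarrow> (real \<times> real \<Rightarrow> real) \<Rightarrow> real" where
  "grad_norm N r1 r2 \<omega> z = L2_norm \<omega> (grad (domain N r1 r2) z)"

definition bilin ::
  "nat \<Rightarrow> (real \<Rightarrow> real) \<Rightarrow> (real \<Rightarrow> real) \<Rightarrow> (nat \<Rightarrow> real) \<Rightarrow>
   (real \<times> real \<Rightarrow> real) \<Rightarrow> (real \<times> real \<Rightarrow> real) \<Rightarrow> real" where
  "bilin N r1 r2 y z v = (\<Sum>i = 1..N. y i * grad_ip N r1 r2 (subdomain r1 r2 i) z v)"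

definition energy_norm ::
  "nat \<Rightarrow> (real \<Rightarrow> real) \<Rightarrow> (real \<Rightarrow> real) \<Rightarrow> (nat \<Rightarrow> real) \<Rightarrow> (real \<times> real \<Rightarrow> real) \<Rightarrow> real" where
  "energy_norm N r1 r2 y v = sqrt (bilin N r1 r2 y v v)"

definition solves_in ::
  "nat \<Rightarrow> (real \<Rightarrow> real) \<Rightarrow> (real \<Rightarrow> real) \<Rightarrow> (nat \<Rightarrow> real) \<Rightarrow> (real \<times> real \<Rightarrow> real) \<Rightarrow>
   (real \<times> real \<Rightarrow> real) set \<Rightarrow> (real \<times> real \<Rightarrow> real) \<Rightarrow> bool" where
  "solves_in N r1 r2 y f V u \<longleftrightarrow>
     u \<in> V \<and> (\<forall>v\<in>V. bilin N r1 r2 y u v = L2_ip (domain N r1 r2) f v)"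

subsection \<open>Interface spaces\<close>

definition V_Omega :: "nat \<Rightarrow> (real \<Rightarrow> real) \<Rightarrow> (real \<Rightarrow> real) \<Rightarrow> nat \<Rightarrow> (real \<times> real \<Rightarrow> real) set" where
  "V_Omega N r1 r2 i = {v \<in> H10 (domain N r1 r2).
     \<exists>w\<in>H10 (subdomain r1 r2 i).
       AE x in lebesgue_on (domain N r1 r2). v x = (if x \<in> subdomain r1 r2 i then w x else 0)}"

definition V_Gamma :: "nat \<Rightarrow> (real \<Rightarrow> real) \<Rightarrow> (real \<Rightarrow> real) \<Rightarrow> (real \<times> real \<Rightarrow> real) set" where
  "V_Gamma N r1 r2 = {u \<in> H10 (domain N r1 r2).
     \<forall>j\<in>{1..N}. \<forall>v\<in>V_Omega N r1 r2 j. grad_ip N r1 r2 (domain N r1 r2) u v = 0}"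

definition V_Gamma_i :: "nat \<Rightarrow> (real \<Rightarrow> real) \<Rightarrow> (real \<Rightarrow> real) \<Rightarrow> nat \<Rightarrow> (real \<times> real \<Rightarrow> real) set" where
  "V_Gamma_i N r1 r2 i = {v \<in> V_Gamma N r1 r2.
     \<forall>j\<in>{1..N - 1}. j \<noteq> i \<longrightarrow> interface_trace N r1 r2 j v (\<lambda>_. 0)}"

definition lin_subspace :: "('a \<Rightarrow> real) set \<Rightarrow> bool" where
  "lin_subspace Y \<longleftrightarrow> (\<lambda>_. 0) \<in> Y \<and> (\<forall>g\<in>Y. \<forall>h\<in>Y. (\<lambda>t. g t + h t) \<in> Y) \<and>
     (\<forall>c. \<forall>g\<in>Y. (\<lambda>t. c * g t) \<in> Y)"

text \<open>Trivial intersection is meant modulo null sets: the last conjunct makes the common part of the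
  two subspaces the zero class, and thereby makes both closed under a.e. equality.\<close>

definition trace_decomposition ::
  "nat \<Rightarrow> (real \<Rightarrow> real) \<Rightarrow> (real \<Rightarrow> real) \<Rightarrow> nat \<Rightarrow> (real \<Rightarrow> real) set \<Rightarrow> (real \<Rightarrow> real) set \<Rightarrow> bool" where
  "trace_decomposition N r1 r2 i Ys Yf \<longleftrightarrow> lin_subspace Ys \<and> lin_subspace Yf \<and>
     H_half_00 N r1 r2 i = {(\<lambda>t. g t + h t) | g h. g \<in> Ys \<and> h \<in> Yf} \<and>
     Ys \<inter> Yf = {g \<in> H_half_00 N r1 r2 i.
                  AE t in lebesgue_on (on_line (real i) (interface r1 r2 i)). g t = 0}"

text \<open>Applied to the slow and to the fast part of a decomposition, this yields the slow and the fast
  space of interface \<open>i\<close>.\<close>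

definition V_part ::
  "nat \<Rightarrow> (real \<Rightarrow> real) \<Rightarrow> (real \<Rightarrow> real) \<Rightarrow> (nat \<Rightarrow> (real \<Rightarrow> real) set) \<Rightarrow> nat \<Rightarrow>
   (real \<times> real \<Rightarrow> real) set" where
  "V_part N r1 r2 Y i = {v \<in> V_Gamma_i N r1 r2 i. \<exists>g\<in>Y i. interface_trace N r1 r2 i v g}"

definition V_slow ::
  "nat \<Rightarrow> (real \<Rightarrow> real) \<Rightarrow> (real \<Rightarrow> real) \<Rightarrow> (nat \<Rightarrow> (real \<Rightarrow> real) set) \<Rightarrow>
   (real \<times> real \<Rightarrow> real) set" where
  "V_slow N r1 r2 Ys =
     {(\<lambda>x. \<Sum>i = 1..N - 1. w i x) | w. \<forall>i\<in>{1..N - 1}. w i \<in> V_part N r1 r2 Ys i}"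

text \<open>The insertion of 0 matters only if no pair of nonzero functions exists: otherwise changing the
  sign of \<open>z\<close> shows that the supremum of the quotients is nonnegative.\<close>

definition interaction ::
  "nat \<Rightarrow> (real \<Rightarrow> real) \<Rightarrow> (real \<Rightarrow> real) \<Rightarrow> (real \<times> real) set \<Rightarrow>
   (real \<times> real \<Rightarrow> real) set \<Rightarrow> (real \<times> real \<Rightarrow> real) set \<Rightarrow> real" where
  "interaction N r1 r2 \<omega> Z W = Sup (insert 0
     {grad_ip N r1 r2 \<omega> z w / (grad_norm N r1 r2 \<omega> z * grad_norm N r1 r2 \<omega> w) | z w.
        z \<in> Z \<and> w \<in> W \<and> \<not> (AE x in lebesgue_on (domain N r1 r2). z x = 0) \<and>
        \<not> (AE x in lebesgue_on (domain N r1 r2). w x = 0)})"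

definition fast_interaction ::
  "nat \<Rightarrow> (real \<Rightarrow> real) \<Rightarrow> (real \<Rightarrow> real) \<Rightarrow> (nat \<Rightarrow> (real \<Rightarrow> real) set) \<Rightarrow> real" where
  "fast_interaction N r1 r2 Yf = Max ((\<lambda>i.
     interaction N r1 r2 (subdomain r1 r2 (i + 1)) (V_part N r1 r2 Yf i)
       (V_Gamma_i N r1 r2 (i + 1))) ` {1..N - 2})"

text \<open>The quotients entering \<open>fast_interaction\<close> pair the fast space of interface \<open>i\<close> with the next
  interface. By reflection in interface \<open>i\<close> they also control the pairing with the previous
  interface, except for \<open>i = N - 1\<close>, which has no next interface. The following quantity measures
  that remaining pairing. It does enter the approximation error, and \<open>fast_interaction\<close> does not
  control it; an error constant that is uniform over all decompositions can therefore exist only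
  for a fixed bound on the quotient of the two.\<close>

definition last_interaction ::
  "nat \<Rightarrow> (real \<Rightarrow> real) \<Rightarrow> (real \<Rightarrow> real) \<Rightarrow> (nat \<Rightarrow> (real \<Rightarrow> real) set) \<Rightarrow> real" where
  "last_interaction N r1 r2 Yf = interaction N r1 r2 (subdomain r1 r2 (N - 1))
     (V_part N r1 r2 Yf (N - 1)) (V_Gamma_i N r1 r2 (N - 2))"

end

theory Submission
  imports Defs "HOL-Computational_Algebra.Polynomial"
begin

text \<open>Write \<open>u\<^sub>\<Gamma> = \<Sum>\<^sub>i (s\<^sub>i + f\<^sub>i)\<close> with \<open>s\<^sub>i\<close> slow and \<open>f\<^sub>i\<close> fast, and \<open>e\<^sub>i\<close>, \<open>e\<^sub>s\<close> for the errors of the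
  fast parts and of the slow part. Since slow and fast parts of one interface are orthogonal, the
  Galerkin equations become \<open>a(e\<^sub>i, v) = - \<Sum>\<^sub>j\<^sub>\<noteq>\<^sub>i a(s\<^sub>j + f\<^sub>j, v)\<close> for fast \<open>v\<close> of interface \<open>i\<close> and
  \<open>a(e\<^sub>s, v) = - \<Sum>\<^sub>j\<^sub>\<noteq>\<^sub>i a(f\<^sub>i, v\<^sub>j)\<close> for slow \<open>v = \<Sum>\<^sub>j v\<^sub>j\<close>. The right-hand sides only pair a fast
  function with a function of another interface. Such a pairing vanishes unless the interfaces are
  neighbours, because a harmonic function with zero traces on both sides of a subdomain has no energy
  there. The fast interaction bounds it if the other interface is the next one. The previous one is
  reduced to this case by reflection in interface \<open>i\<close>, about which \<open>V\<^sub>\<Gamma>\<^sub>i\<close> is symmetric. Finally the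
  splitting of \<open>V\<^sub>\<Gamma>\<close> into the \<open>V\<^sub>\<Gamma>\<^sub>i\<close> is stable in energy, because harmonic functions minimize the energy
  among all functions with the same traces.\<close>

section \<open>Square integrable functions\<close>

text \<open>The profiles may meet at the ends of the unit interval, so the domain may have cusps,
  and theorems on extensions and traces for Lipschitz domains are out of reach. Every analytic fact
  is therefore derived from one elementary estimate: the squared \<open>L2\<close> distance between
  the restrictions of a test function to two vertical lines is at most the distance of the lines
  times the energy between them. It yields the Poincare inequality, the existence of traces, and the
  possibility to truncate a function within \<open>H10\<close> at an interface where its trace
  vanishes. Functions matter only up to null sets and \<open>grad\<close> is an arbitrary choice, so
  identities are stated for gradients almost everywhere, and projections are built from sequences of
  test functions. No norm on the trace spaces appears: stability compares a harmonic function with a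
  polynomial multiple of any function that shares its trace, at a cost depending on the geometry
  alone. Estimates are made in the norm \<open>gnorm\<close> without coefficients, which keeps them
  uniform in \<open>y\<close>.\<close>

lemma L2_D:
  assumes "f \<in> L2 \<omega>"
  shows "f \<in> borel_measurable (lebesgue_on \<omega>)" "integrable (lebesgue_on \<omega>) (\<lambda>x. (norm (f x))\<^sup>2)"
  using assms by (auto simp: L2_def)

lemma L2_integrable_ip:
  fixes f g :: "'a::euclidean_space \<Rightarrow> 'b::euclidean_space"
  assumes f: "f \<in> L2 \<omega>" and g: "g \<in> L2 \<omega>"
  shows "integrable (lebesgue_on \<omega>) (\<lambda>x. f x \<bullet> g x)"
proof (rule Bochner_Integration.integrable_bound)
  show "integrable (lebesgue_on \<omega>) (\<lambda>x. (norm (f x))\<^sup>2 + (norm (g x))\<^sup>2)"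
    using L2_D[OF f] L2_D[OF g] by auto
  show "(\<lambda>x. f x \<bullet> g x) \<in> borel_measurable (lebesgue_on \<omega>)"
    using L2_D[OF f] L2_D[OF g] by (intro borel_measurable_inner)
  have "\<bar>u \<bullet> v\<bar> \<le> (norm u)\<^sup>2 + (norm v)\<^sup>2" for u v :: 'b
  proof -
    have "\<bar>u \<bullet> v\<bar> \<le> norm u * norm v" by (rule Cauchy_Schwarz_ineq2)
    moreover have "2 * (norm u * norm v) \<le> (norm u)\<^sup>2 + (norm v)\<^sup>2"
      using sum_squares_bound[of "norm u" "norm v"] by simp
    moreover have "0 \<le> norm u * norm v" by simp
    ultimately show ?thesis by linarith
  qed
  then show "AE x in lebesgue_on \<omega>. norm (f x \<bullet> g x) \<le> norm ((norm (f x))\<^sup>2 + (norm (g x))\<^sup>2)"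
    by auto
qed

text \<open>Membership of products with a bounded factor is typically obtained by this comparison.
  It asks for the bound on \<omega> only, because cutoffs and polynomials are controlled there and
  values elsewhere are irrelevant.\<close>

lemma L2_bound:
  fixes f :: "'a::euclidean_space \<Rightarrow> 'b::euclidean_space" and g :: "'a \<Rightarrow> 'c::euclidean_space"
  assumes "f \<in> L2 \<omega>" "g \<in> borel_measurable (lebesgue_on \<omega>)"
    and "\<And>x. x \<in> \<omega> \<Longrightarrow> norm (g x) \<le> c * norm (f x)"
  shows "g \<in> L2 \<omega>"
proof -
  have "integrable (lebesgue_on \<omega>) (\<lambda>x. (norm (g x))\<^sup>2)"
  proof (rule Bochner_Integration.integrable_bound)
    show "integrable (lebesgue_on \<omega>) (\<lambda>x. c\<^sup>2 * (norm (f x))\<^sup>2)"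
      using L2_D[OF assms(1)] by auto
    show "(\<lambda>x. (norm (g x))\<^sup>2) \<in> borel_measurable (lebesgue_on \<omega>)" using assms(2) by measurable
    have "(norm (g x))\<^sup>2 \<le> c\<^sup>2 * (norm (f x))\<^sup>2" if "x \<in> \<omega>" for x
      using power_mono[OF assms(3)[OF that], of 2] by (simp add: power_mult_distrib)
    then show "AE x in lebesgue_on \<omega>. norm ((norm (g x))\<^sup>2) \<le> norm (c\<^sup>2 * (norm (f x))\<^sup>2)"
      by (intro AE_I2) auto
  qed
  then show ?thesis using assms(2) by (simp add: L2_def)
qed

lemma L2_zero [simp]: "(\<lambda>x. 0) \<in> L2 \<omega>"
  by (simp add: L2_def)

lemma L2_scaleR:
  fixes f :: "'a::euclidean_space \<Rightarrow> 'b::euclidean_space"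
  assumes "f \<in> L2 \<omega>" shows "(\<lambda>x. c *\<^sub>R f x) \<in> L2 \<omega>"
  using L2_D[OF assms] by (intro L2_bound[OF assms, where c = "\<bar>c\<bar>"]) auto

lemma L2_mult: "f \<in> L2 \<omega> \<Longrightarrow> (\<lambda>x. c * f x :: real) \<in> L2 \<omega>"
  using L2_scaleR[of f \<omega> c] by simp

lemma L2_add:
  fixes f g :: "'a::euclidean_space \<Rightarrow> 'b::euclidean_space"
  assumes f: "f \<in> L2 \<omega>" and g: "g \<in> L2 \<omega>" shows "(\<lambda>x. f x + g x) \<in> L2 \<omega>"
proof -
  have "integrable (lebesgue_on \<omega>) (\<lambda>x. (norm (f x))\<^sup>2 + (norm (g x))\<^sup>2 + 2 * (f x \<bullet> g x))"
    using L2_D[OF f] L2_D[OF g] L2_integrable_ip[OF f g] by auto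
  moreover have "(norm (f x + g x))\<^sup>2 = (norm (f x))\<^sup>2 + (norm (g x))\<^sup>2 + 2 * (f x \<bullet> g x)" for x
    by (simp add: power2_norm_eq_inner inner_simps inner_commute)
  ultimately show ?thesis using L2_D[OF f] L2_D[OF g] by (simp add: L2_def)
qed

lemma L2_diff:
  fixes f g :: "'a::euclidean_space \<Rightarrow> 'b::euclidean_space"
  assumes "f \<in> L2 \<omega>" and "g \<in> L2 \<omega>" shows "(\<lambda>x. f x - g x) \<in> L2 \<omega>"
  using L2_add[OF assms(1) L2_scaleR[OF assms(2), of "-1"]] by simp

section \<open>Inner product, norm and the Cauchy-Schwarz inequality\<close>

lemma L2_ip_commute: "L2_ip \<omega> f g = L2_ip \<omega> g f"
  by (simp add: L2_ip_def inner_commute)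

lemma L2_ip_add_left:
  assumes "f \<in> L2 \<omega>" "g \<in> L2 \<omega>" "h \<in> L2 \<omega>"
  shows "L2_ip \<omega> (\<lambda>x. f x + g x) h = L2_ip \<omega> f h + L2_ip \<omega> g h"
  using L2_integrable_ip[OF assms(1,3)] L2_integrable_ip[OF assms(2,3)]
  by (simp add: L2_ip_def inner_add_left)

lemma L2_ip_diff_left:
  assumes "f \<in> L2 \<omega>" "g \<in> L2 \<omega>" "h \<in> L2 \<omega>"
  shows "L2_ip \<omega> (\<lambda>x. f x - g x) h = L2_ip \<omega> f h - L2_ip \<omega> g h"
  using L2_integrable_ip[OF assms(1,3)] L2_integrable_ip[OF assms(2,3)]
  by (simp add: L2_ip_def inner_diff_left)

lemma L2_ip_scaleR_left: "L2_ip \<omega> (\<lambda>x. c *\<^sub>R f x) h = c * L2_ip \<omega> f h"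
  by (simp add: L2_ip_def)

lemma L2_ip_add_right:
  assumes "f \<in> L2 \<omega>" "g \<in> L2 \<omega>" "h \<in> L2 \<omega>"
  shows "L2_ip \<omega> h (\<lambda>x. f x + g x) = L2_ip \<omega> h f + L2_ip \<omega> h g"
  using L2_ip_add_left[OF assms] by (simp add: L2_ip_commute)

lemma L2_ip_diff_right:
  assumes "f \<in> L2 \<omega>" "g \<in> L2 \<omega>" "h \<in> L2 \<omega>"
  shows "L2_ip \<omega> h (\<lambda>x. f x - g x) = L2_ip \<omega> h f - L2_ip \<omega> h g"
  using L2_ip_diff_left[OF assms] by (simp add: L2_ip_commute)

lemma L2_ip_scaleR_right: "L2_ip \<omega> f (\<lambda>x. c *\<^sub>R h x) = c * L2_ip \<omega> f h"
  by (simp add: L2_ip_def)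

lemma L2_ip_zero [simp]: "L2_ip \<omega> (\<lambda>x. 0) g = 0" "L2_ip \<omega> g (\<lambda>x. 0) = 0"
  by (simp_all add: L2_ip_def)

lemma L2_ip_cong_AE:
  assumes "f \<in> L2 \<omega>" "g \<in> L2 \<omega>" "f' \<in> L2 \<omega>" "g' \<in> L2 \<omega>"
    and "AE x in lebesgue_on \<omega>. f x = f' x" "AE x in lebesgue_on \<omega>. g x = g' x"
  shows "L2_ip \<omega> f g = L2_ip \<omega> f' g'"
  unfolding L2_ip_def using assms(5,6) L2_D(1)[OF assms(1)] L2_D(1)[OF assms(2)]
    L2_D(1)[OF assms(3)] L2_D(1)[OF assms(4)]
  by (intro integral_cong_AE) auto

lemma L2_ip_self: "L2_ip \<omega> f f = (LINT x|lebesgue_on \<omega>. (norm (f x))\<^sup>2)"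
  by (simp add: L2_ip_def power2_norm_eq_inner)

lemma L2_ip_self_nonneg [simp]: "0 \<le> L2_ip \<omega> f f"
  by (simp add: L2_ip_def)

lemma L2_norm_nonneg [simp]: "0 \<le> L2_norm \<omega> f"
  by (simp add: L2_norm_def)

lemma L2_norm_power2: "(L2_norm \<omega> f)\<^sup>2 = L2_ip \<omega> f f"
  by (simp add: L2_norm_def)

lemma L2_norm_zero [simp]: "L2_norm \<omega> (\<lambda>x. 0) = 0"
  by (simp add: L2_norm_def)

lemma L2_norm_cong_AE:
  assumes "f \<in> L2 \<omega>" "g \<in> L2 \<omega>" "AE x in lebesgue_on \<omega>. f x = g x"
  shows "L2_norm \<omega> f = L2_norm \<omega> g"
  using L2_ip_cong_AE[OF assms(1,1,2,2,3,3)] by (simp add: L2_norm_def)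

lemma L2_norm_eq_0_iff:
  assumes "f \<in> L2 \<omega>" shows "L2_norm \<omega> f = 0 \<longleftrightarrow> (AE x in lebesgue_on \<omega>. f x = 0)"
proof -
  have "L2_norm \<omega> f = 0 \<longleftrightarrow> (LINT x|lebesgue_on \<omega>. (norm (f x))\<^sup>2) = 0"
    by (simp add: L2_norm_def L2_ip_self)
  also have "\<dots> \<longleftrightarrow> (AE x in lebesgue_on \<omega>. (norm (f x))\<^sup>2 = 0)"
    using L2_D[OF assms] by (intro integral_nonneg_eq_0_iff_AE) auto
  finally show ?thesis by simp
qed

lemma L2_norm_scaleR: "L2_norm \<omega> (\<lambda>x. c *\<^sub>R f x) = \<bar>c\<bar> * L2_norm \<omega> f"
  by (simp add: L2_norm_def L2_ip_scaleR_left L2_ip_scaleR_right real_sqrt_mult flip: mult.assoc)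

lemma L2_norm_diff_commute: "L2_norm \<omega> (\<lambda>x. f x - g x) = L2_norm \<omega> (\<lambda>x. g x - f x)"
  using L2_norm_scaleR[of \<omega> "-1" "\<lambda>x. f x - g x"] by simp

text \<open>Besides the Cauchy-Schwarz inequality this serves the energy projection, where
  \<open>a\<close> is the distance of a functional value from the infimum and \<open>b\<close> a
  first variation. The case \<open>c = 0\<close> is included because a direction of variation may
  have zero energy.\<close>

lemma psd_quadratic_discriminant:
  fixes a b c :: real
  assumes "0 \<le> c" and "\<And>t. 0 \<le> a + 2 * t * b + t\<^sup>2 * c"
  shows "b\<^sup>2 \<le> a * c"
proof (cases "c = 0")
  case True
  have "b = 0"
  proof (rule ccontr)
    assume "b \<noteq> 0"
    \<comment> \<open>At this value of \<open>t\<close> the affine function equals -1.\<close>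
    then show False using assms(2)[of "- (a + 1) / (2 * b)"] True by (simp add: field_simps)
  qed
  then show ?thesis using True by simp
next
  case False
  then have c: "c > 0" using assms(1) by simp
  have "0 \<le> a + 2 * (- b / c) * b + (- b / c)\<^sup>2 * c" by (rule assms(2))
  also have "\<dots> = (a * c - b\<^sup>2) / c" using c by (simp add: field_simps power2_eq_square)
  finally show ?thesis using c by (simp add: zero_le_divide_iff)
qed

lemma L2_add_ip_self:
  assumes "f \<in> L2 \<omega>" "g \<in> L2 \<omega>"
  shows "L2_ip \<omega> (\<lambda>x. f x + g x) (\<lambda>x. f x + g x) = L2_ip \<omega> f f + 2 * L2_ip \<omega> f g + L2_ip \<omega> g g"
  using assms L2_add[OF assms] by (simp add: L2_ip_add_left L2_ip_add_right L2_ip_commute[of \<omega> g f])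

lemma L2_diff_ip_self:
  assumes "f \<in> L2 \<omega>" "g \<in> L2 \<omega>"
  shows "L2_ip \<omega> (\<lambda>x. f x - g x) (\<lambda>x. f x - g x) = L2_ip \<omega> f f - 2 * L2_ip \<omega> f g + L2_ip \<omega> g g"
  using assms L2_diff[OF assms] by (simp add: L2_ip_diff_left L2_ip_diff_right L2_ip_commute[of \<omega> g f])

lemma L2_Cauchy_Schwarz:
  assumes "f \<in> L2 \<omega>" "g \<in> L2 \<omega>"
  shows "\<bar>L2_ip \<omega> f g\<bar> \<le> L2_norm \<omega> f * L2_norm \<omega> g"
proof -
  have "0 \<le> L2_ip \<omega> f f + 2 * t * L2_ip \<omega> f g + t\<^sup>2 * L2_ip \<omega> g g" for t
    using L2_add_ip_self[OF assms(1) L2_scaleR[OF assms(2), of t]]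
      L2_ip_self_nonneg[of \<omega> "\<lambda>x. f x + t *\<^sub>R g x"]
    by (simp add: L2_ip_scaleR_left L2_ip_scaleR_right power2_eq_square mult.assoc)
  then have "(L2_ip \<omega> f g)\<^sup>2 \<le> L2_ip \<omega> f f * L2_ip \<omega> g g"
    by (intro psd_quadratic_discriminant) auto
  then have "(L2_ip \<omega> f g)\<^sup>2 \<le> (L2_norm \<omega> f * L2_norm \<omega> g)\<^sup>2"
    by (simp add: L2_norm_power2 power_mult_distrib)
  then show ?thesis by (metis abs_le_square_iff abs_of_nonneg L2_norm_nonneg mult_nonneg_nonneg)
qed

lemma L2_norm_triangle:
  assumes "f \<in> L2 \<omega>" "g \<in> L2 \<omega>"
  shows "L2_norm \<omega> (\<lambda>x. f x + g x) \<le> L2_norm \<omega> f + L2_norm \<omega> g"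
proof -
  have "(L2_norm \<omega> (\<lambda>x. f x + g x))\<^sup>2 = (L2_norm \<omega> f)\<^sup>2 + 2 * L2_ip \<omega> f g + (L2_norm \<omega> g)\<^sup>2"
    unfolding L2_norm_power2 by (rule L2_add_ip_self[OF assms])
  also have "\<dots> \<le> (L2_norm \<omega> f + L2_norm \<omega> g)\<^sup>2"
    using L2_Cauchy_Schwarz[OF assms] by (simp add: power2_sum)
  finally show ?thesis by (rule power2_le_imp_le) simp
qed

lemma L2_norm_triangle_diff:
  assumes "f \<in> L2 \<omega>" "g \<in> L2 \<omega>" "h \<in> L2 \<omega>"
  shows "L2_norm \<omega> (\<lambda>x. f x - h x) \<le> L2_norm \<omega> (\<lambda>x. f x - g x) + L2_norm \<omega> (\<lambda>x. g x - h x)"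
  using L2_norm_triangle[OF L2_diff[OF assms(1,2)] L2_diff[OF assms(2,3)]] by simp

lemma L2_norm_le_add:
  assumes "f \<in> L2 \<omega>" "g \<in> L2 \<omega>"
  shows "L2_norm \<omega> f \<le> L2_norm \<omega> (\<lambda>x. f x - g x) + L2_norm \<omega> g"
  using L2_norm_triangle[OF L2_diff[OF assms] assms(2)] by simp

lemma L2_norm_mono:
  assumes "f \<in> L2 \<omega>" "g \<in> L2 \<omega>" "\<And>x. x \<in> \<omega> \<Longrightarrow> norm (f x) \<le> c * norm (g x)" "0 \<le> c"
  shows "L2_norm \<omega> f \<le> c * L2_norm \<omega> g"
proof (rule power2_le_imp_le)
  have "(L2_norm \<omega> f)\<^sup>2 = (LINT x|lebesgue_on \<omega>. (norm (f x))\<^sup>2)"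
    by (simp add: L2_norm_power2 L2_ip_self)
  also have "\<dots> \<le> (LINT x|lebesgue_on \<omega>. c\<^sup>2 * (norm (g x))\<^sup>2)"
    using L2_D[OF assms(1)] L2_D[OF assms(2)] power_mono[OF assms(3), of _ 2]
    by (intro integral_mono) (auto simp: power_mult_distrib)
  also have "\<dots> = (c * L2_norm \<omega> g)\<^sup>2"
    by (simp add: L2_norm_power2 L2_ip_self power_mult_distrib)
  finally show "(L2_norm \<omega> f)\<^sup>2 \<le> (c * L2_norm \<omega> g)\<^sup>2" .
qed (use assms(4) in auto)

section \<open>Restriction, extension by zero and partition of the domain of integration\<close>

lemma L2_subset:
  assumes "f \<in> L2 \<omega>" "\<omega>' \<subseteq> \<omega>" "\<omega> \<in> sets lebesgue" "\<omega>' \<in> sets lebesgue"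
  shows "f \<in> L2 \<omega>'"
proof -
  have "f \<in> borel_measurable (lebesgue_on \<omega>')"
    by (rule measurable_restrict_mono[OF L2_D(1)[OF assms(1)] assms(2)])
  moreover have "integrable (lebesgue_on \<omega>') (\<lambda>x. (norm (f x))\<^sup>2)"
  proof -
    have "integrable lebesgue (\<lambda>x. indicator \<omega>' x *\<^sub>R (indicator \<omega> x *\<^sub>R (norm (f x))\<^sup>2))"
      using L2_D(2)[OF assms(1)] assms(3,4)
      by (intro integrable_mult_indicator[where A = \<omega>']) (auto simp: integrable_restrict_space)
    also have "(\<lambda>x. indicat_real \<omega>' x *\<^sub>R (indicat_real \<omega> x *\<^sub>R (norm (f x))\<^sup>2))
        = (\<lambda>x. indicator \<omega>' x *\<^sub>R (norm (f x))\<^sup>2)"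
      using assms(2) by (auto simp: indicator_def fun_eq_iff)
    finally show ?thesis using assms(4) by (simp add: integrable_restrict_space)
  qed
  ultimately show ?thesis by (simp add: L2_def)
qed

lemma L2_ip_indicator:
  assumes "\<omega> \<in> sets lebesgue"
  shows "L2_ip \<omega> f g = (LINT x|lebesgue. indicator \<omega> x * (f x \<bullet> g x))"
  unfolding L2_ip_def using assms by (subst integral_restrict_space) auto

lemma L2_ip_subset_indicator:
  assumes "\<omega>' \<subseteq> \<omega>" "\<omega> \<in> sets lebesgue" "\<omega>' \<in> sets lebesgue"
  shows "L2_ip \<omega>' f g = L2_ip \<omega> (\<lambda>x. indicator \<omega>' x *\<^sub>R f x) g"
  unfolding L2_ip_indicator[OF assms(2)] L2_ip_indicator[OF assms(3)]
  using assms(1) by (intro Bochner_Integration.integral_cong) (auto simp: indicator_def)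

lemma L2_indicator:
  fixes f :: "'a::euclidean_space \<Rightarrow> 'b::euclidean_space"
  assumes "f \<in> L2 \<omega>'" "\<omega>' \<subseteq> \<omega>" "\<omega> \<in> sets lebesgue" "\<omega>' \<in> sets lebesgue"
  shows "(\<lambda>x. indicator \<omega>' x *\<^sub>R f x) \<in> L2 \<omega>"
proof -
  have [simp]: "indicat_real \<omega> x * indicat_real \<omega>' x = indicat_real \<omega>' x" for x
    using assms(2) by (auto simp: indicator_def)
  have [simp]: "indicat_real \<omega> x * (indicat_real \<omega>' x * u)\<^sup>2 = indicat_real \<omega>' x * u\<^sup>2" for x u
    using assms(2) by (auto simp: indicator_def)
  have "(\<lambda>x. indicator \<omega>' x *\<^sub>R f x) \<in> borel_measurable (lebesgue_on \<omega>)"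
    using L2_D(1)[OF assms(1)] assms(3,4) by (simp add: borel_measurable_restrict_space_iff)
  moreover have "integrable (lebesgue_on \<omega>) (\<lambda>x. (norm (indicat_real \<omega>' x *\<^sub>R f x))\<^sup>2)"
    using L2_D(2)[OF assms(1)] assms(3,4) by (simp add: integrable_restrict_space)
  ultimately show ?thesis by (simp add: L2_def)
qed

lemma L2_norm_subset:
  assumes "f \<in> L2 \<omega>" "\<omega>' \<subseteq> \<omega>" "\<omega> \<in> sets lebesgue" "\<omega>' \<in> sets lebesgue"
  shows "L2_norm \<omega>' f \<le> L2_norm \<omega> f"
proof -
  have "L2_ip \<omega>' f f \<le> L2_ip \<omega> f f"
    unfolding L2_ip_indicator[OF assms(3)] L2_ip_indicator[OF assms(4)]
    using L2_integrable_ip[OF assms(1,1)] L2_integrable_ip[OF L2_subset[OF assms] L2_subset[OF assms]] assms(2-4)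
    by (intro integral_mono) (auto simp: integrable_restrict_space indicator_def)
  then show ?thesis by (simp add: L2_norm_def)
qed

text \<open>Covering up to a null set has to suffice: the subdomains miss the interfaces, whose
  inner parts do belong to the domain.\<close>

lemma L2_ip_partition:
  fixes A :: "'i \<Rightarrow> 'a::euclidean_space set"
  assumes fg: "f \<in> L2 \<omega>" "g \<in> L2 \<omega>" and I: "finite I" and w: "\<omega> \<in> sets lebesgue"
    and A: "\<And>i. i \<in> I \<Longrightarrow> A i \<in> sets lebesgue" "\<And>i. i \<in> I \<Longrightarrow> A i \<subseteq> \<omega>" "disjoint_family_on A I"
    and ae: "AE x in lebesgue_on \<omega>. x \<in> (\<Union>i\<in>I. A i)"
  shows "L2_ip \<omega> f g = (\<Sum>i\<in>I. L2_ip (A i) f g)"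
proof -
  have ae': "AE x in lebesgue. x \<in> \<omega> \<longrightarrow> x \<in> (\<Union>i\<in>I. A i)"
    using ae w by (subst (asm) AE_restrict_space_iff) auto
  have int: "integrable lebesgue (\<lambda>x. indicator (A i) x * (f x \<bullet> g x))" if "i \<in> I" for i
  proof -
    have "integrable (lebesgue_on (A i)) (\<lambda>x. f x \<bullet> g x)"
      using L2_subset[OF fg(1) A(2)[OF that] w A(1)[OF that]]
        L2_subset[OF fg(2) A(2)[OF that] w A(1)[OF that]] by (rule L2_integrable_ip)
    then show ?thesis using A(1)[OF that] by (simp add: integrable_restrict_space)
  qed
  have ind: "indicat_real \<omega> x = (\<Sum>i\<in>I. indicator (A i) x)" if cov: "x \<in> \<omega> \<longrightarrow> x \<in> (\<Union>i\<in>I. A i)" for x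
  proof (cases "x \<in> \<omega>")
    case True
    then obtain i where i: "i \<in> I" "x \<in> A i" using cov by auto
    then have "j \<in> I \<Longrightarrow> x \<in> A j \<longleftrightarrow> j = i" for j using A(3) by (auto simp: disjoint_family_on_def)
    then have "(\<Sum>j\<in>I. indicat_real (A j) x) = (\<Sum>j\<in>I. if j = i then 1 else 0)"
      by (intro sum.cong) (auto simp: indicator_def)
    then show ?thesis using i(1) I True by simp
  next
    case False
    then have "(\<Sum>i\<in>I. indicat_real (A i) x) = 0" using A(2) by (intro sum.neutral) (auto simp: indicator_def)
    then show ?thesis using False by simp
  qed
  have "L2_ip \<omega> f g = (LINT x|lebesgue. indicator \<omega> x * (f x \<bullet> g x))" by (rule L2_ip_indicator[OF w])
  also have "\<dots> = (LINT x|lebesgue. (\<Sum>i\<in>I. indicator (A i) x * (f x \<bullet> g x)))"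
  proof (rule integral_cong_AE)
    show "AE x in lebesgue. indicat_real \<omega> x * (f x \<bullet> g x) = (\<Sum>i\<in>I. indicator (A i) x * (f x \<bullet> g x))"
      using ae' by eventually_elim (simp only: ind flip: sum_distrib_right)
    show "(\<lambda>x. indicat_real \<omega> x * (f x \<bullet> g x)) \<in> borel_measurable lebesgue"
      using L2_integrable_ip[OF fg] w by (auto simp: integrable_restrict_space)
    show "(\<lambda>x. \<Sum>i\<in>I. indicat_real (A i) x * (f x \<bullet> g x)) \<in> borel_measurable lebesgue"
      using int by (intro borel_measurable_sum) auto
  qed
  also have "\<dots> = (\<Sum>i\<in>I. L2_ip (A i) f g)"
    using int A(1) by (subst Bochner_Integration.integral_sum) (auto simp: L2_ip_indicator)
  finally show ?thesis .
qed

section \<open>Completeness and passage to the limit\<close>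

text \<open>The Riesz-Fischer theorem at the level of functions. On a set of finite measure the
  \<open>L2\<close> norm controls the \<open>L1\<close> norm, so a subsequence is Cauchy almost
  everywhere; Fatou's lemma then identifies its pointwise limit as the limit in norm of the full
  sequence.\<close>

lemma L2_complete:
  fixes f :: "nat \<Rightarrow> 'a::euclidean_space \<Rightarrow> 'b::euclidean_space"
  assumes \<omega>: "\<omega> \<in> lmeasurable" and f: "\<And>n. f n \<in> L2 \<omega>"
    and Cauchy: "\<And>e. 0 < e \<Longrightarrow> \<exists>K. \<forall>i\<ge>K. \<forall>j\<ge>K. L2_norm \<omega> (\<lambda>x. f i x - f j x) < e"
  obtains g where "g \<in> L2 \<omega>" "(\<lambda>n. L2_norm \<omega> (\<lambda>x. f n x - g x)) \<longlonglongrightarrow> 0"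
proof -
  let ?M = "lebesgue_on \<omega>"
  interpret finite_measure ?M using \<omega> by (rule finite_measure_lebesgue_on)
  have one: "(\<lambda>x. 1::real) \<in> L2 \<omega>" by (auto simp: L2_def)
  have nf: "(\<lambda>x. norm (h x)) \<in> L2 \<omega>" if "h \<in> L2 \<omega>" for h :: "'a \<Rightarrow> 'b"
    using that by (auto simp: L2_def)
  have L1: "integrable ?M h" if "h \<in> L2 \<omega>" for h :: "'a \<Rightarrow> 'b"
    using L2_integrable_ip[OF nf[OF that] one] L2_D(1)[OF that] by (simp add: integrable_norm_iff)
  have L1_le: "(LINT x|?M. norm (h x)) \<le> L2_norm \<omega> h * L2_norm \<omega> (\<lambda>x. 1::real)"
    if "h \<in> L2 \<omega>" for h :: "'a \<Rightarrow> 'b"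
    using L2_Cauchy_Schwarz[OF nf[OF that] one] by (simp add: L2_ip_def L2_norm_def power2_norm_eq_inner
      flip: power2_eq_square)
  \<comment> \<open>The summand 1 keeps \<open>c\<close> positive even if \<omega> is a null
    set.\<close>
  define c where "c = L2_norm \<omega> (\<lambda>x::'a. 1::real) + 1"
  have c: "c > 0" by (simp add: c_def add_nonneg_pos)
  obtain r where r: "strict_mono r" and ae: "AE x in ?M. Cauchy (\<lambda>i. f (r i) x)"
  proof (rule cauchy_L1_AE_cauchy_subseq[of ?M f])
    show "integrable ?M (f n)" for n using L1[OF f] .
    fix e :: real assume "0 < e"
    then obtain K where K: "\<And>i j. i \<ge> K \<Longrightarrow> j \<ge> K \<Longrightarrow> L2_norm \<omega> (\<lambda>x. f i x - f j x) < e / c"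
      using Cauchy[of "e / c"] c by auto
    have "(LINT x|?M. norm (f i x - f j x)) < e" if "i \<ge> K" "j \<ge> K" for i j
    proof -
      have "(LINT x|?M. norm (f i x - f j x)) \<le> L2_norm \<omega> (\<lambda>x. f i x - f j x) * L2_norm \<omega> (\<lambda>x. 1::real)"
        by (rule L1_le[OF L2_diff[OF f f]])
      also have "\<dots> \<le> L2_norm \<omega> (\<lambda>x. f i x - f j x) * c" by (intro mult_left_mono) (auto simp: c_def)
      also have "\<dots> < e" using K[OF that] c by (simp add: field_simps)
      finally show ?thesis .
    qed
    then show "\<exists>K. \<forall>i\<ge>K. \<forall>j\<ge>K. (LINT x|?M. norm (f i x - f j x)) < e" by blast
  qed blast
  \<comment> \<open>\<open>lim\<close> is unspecified where the subsequence diverges, which happens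
    on a null set only.\<close>
  define g where "g = (\<lambda>x. lim (\<lambda>i. f (r i) x))"
  have g_meas: "g \<in> borel_measurable ?M"
    unfolding g_def using L2_D(1)[OF f] by (intro borel_measurable_lim_metric) auto
  have conv: "AE x in ?M. (\<lambda>i. f (r i) x) \<longlonglongrightarrow> g x"
    using ae by eventually_elim (simp add: g_def Cauchy_convergent_iff convergent_LIMSEQ_iff)
  \<comment> \<open>Fatou's lemma in the index of the subsequence: for fixed \<open>n\<close> beyond
    \<open>K\<close> the distance to every late member is below \<open>e\<close>, hence the distance
    to the limit is at most \<open>e\<close>.\<close>
  have key: "(\<integral>\<^sup>+x. ennreal ((norm (f n x - g x))\<^sup>2) \<partial>?M) \<le> ennreal (e\<^sup>2)"
    if "e > 0" and K: "\<And>i j. i \<ge> K \<Longrightarrow> j \<ge> K \<Longrightarrow> L2_norm \<omega> (\<lambda>x. f i x - f j x) < e" "n \<ge> K" for e K n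
  proof -
    have "(\<integral>\<^sup>+x. ennreal ((norm (f n x - g x))\<^sup>2) \<partial>?M)
        = (\<integral>\<^sup>+x. liminf (\<lambda>i. ennreal ((norm (f n x - f (r i) x))\<^sup>2)) \<partial>?M)"
    proof (rule nn_integral_cong_AE, use conv in eventually_elim)
      fix x assume "(\<lambda>i. f (r i) x) \<longlonglongrightarrow> g x"
      then have "(\<lambda>i. ennreal ((norm (f n x - f (r i) x))\<^sup>2)) \<longlonglongrightarrow> ennreal ((norm (f n x - g x))\<^sup>2)"
        by (intro tendsto_ennrealI tendsto_intros)
      then show "ennreal ((norm (f n x - g x))\<^sup>2) = liminf (\<lambda>i. ennreal ((norm (f n x - f (r i) x))\<^sup>2))"
        by (metis lim_imp_Liminf sequentially_bot)
    qed
    also have "\<dots> \<le> liminf (\<lambda>i. \<integral>\<^sup>+x. ennreal ((norm (f n x - f (r i) x))\<^sup>2) \<partial>?M)"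
      using L2_D(1)[OF f] by (intro nn_integral_liminf) auto
    also have "\<dots> \<le> liminf (\<lambda>i::nat. ennreal (e\<^sup>2))"
    proof (rule Liminf_mono)
      have "(\<integral>\<^sup>+x. ennreal ((norm (f n x - f (r i) x))\<^sup>2) \<partial>?M) \<le> ennreal (e\<^sup>2)" if "i \<ge> K" for i
      proof -
        have "r i \<ge> K" using seq_suble[OF r, of i] that by linarith
        then have "L2_norm \<omega> (\<lambda>x. f n x - f (r i) x) \<le> e" using K(1)[OF K(2)] less_imp_le by blast
        then have "(L2_norm \<omega> (\<lambda>x. f n x - f (r i) x))\<^sup>2 \<le> e\<^sup>2" by (intro power_mono) auto
        then show ?thesis using L2_D[OF L2_diff[OF f f, of n "r i"]]
          by (subst nn_integral_eq_integral) (auto simp: L2_norm_power2 L2_ip_self)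
      qed
      then show "\<forall>\<^sub>F i in sequentially. (\<integral>\<^sup>+x. ennreal ((norm (f n x - f (r i) x))\<^sup>2) \<partial>?M) \<le> ennreal (e\<^sup>2)"
        using eventually_sequentially by blast
    qed
    also have "\<dots> = ennreal (e\<^sup>2)" by (simp add: Liminf_const)
    finally show ?thesis .
  qed
  have diff_L2: "(\<lambda>x. f n x - g x) \<in> L2 \<omega>"
    if "e > 0" "\<And>i j. i \<ge> K \<Longrightarrow> j \<ge> K \<Longrightarrow> L2_norm \<omega> (\<lambda>x. f i x - f j x) < e" "n \<ge> K" for e K n
  proof -
    have "(\<integral>\<^sup>+x. ennreal ((norm (f n x - g x))\<^sup>2) \<partial>?M) < \<infinity>"
      by (rule order.strict_trans1[OF key[OF that]]) auto
    then show ?thesis using L2_D(1)[OF f[of n]] g_meas by (auto simp: L2_def integrable_iff_bounded)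
  qed
  obtain K1 where K1: "\<And>i j. i \<ge> K1 \<Longrightarrow> j \<ge> K1 \<Longrightarrow> L2_norm \<omega> (\<lambda>x. f i x - f j x) < 1"
    using Cauchy[of 1] by auto
  \<comment> \<open>Subtracting this difference from \<open>f K1\<close> shows that \<open>g\<close>
    itself is square integrable.\<close>
  have "(\<lambda>x. f K1 x - g x) \<in> L2 \<omega>" using diff_L2[OF _ K1, of K1] by simp
  from L2_diff[OF f[of K1] this] have g: "g \<in> L2 \<omega>" by simp
  have "(\<lambda>n. L2_norm \<omega> (\<lambda>x. f n x - g x)) \<longlonglongrightarrow> 0"
  proof (rule LIMSEQ_I)
    fix e :: real assume e: "0 < e"
    then obtain K where K: "\<And>i j. i \<ge> K \<Longrightarrow> j \<ge> K \<Longrightarrow> L2_norm \<omega> (\<lambda>x. f i x - f j x) < e / 2"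
      using Cauchy[of "e / 2"] by auto
    have "norm (L2_norm \<omega> (\<lambda>x. f n x - g x) - 0) < e" if "n \<ge> K" for n
    proof -
      have "ennreal ((L2_norm \<omega> (\<lambda>x. f n x - g x))\<^sup>2) \<le> ennreal ((e / 2)\<^sup>2)"
      proof -
        have "(\<integral>\<^sup>+x. ennreal ((norm (f n x - g x))\<^sup>2) \<partial>?M) \<le> ennreal ((e / 2)\<^sup>2)"
          by (rule key[of "e / 2" K]) (use e K that in auto)
        then show ?thesis using L2_D[OF L2_diff[OF f g, of n]]
          by (subst (asm) nn_integral_eq_integral) (auto simp: L2_norm_power2 L2_ip_self)
      qed
      then have "(L2_norm \<omega> (\<lambda>x. f n x - g x))\<^sup>2 \<le> (e / 2)\<^sup>2" by (simp add: ennreal_le_iff)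
      then have "L2_norm \<omega> (\<lambda>x. f n x - g x) \<le> e / 2" by (rule power2_le_imp_le) (use e in simp)
      then show ?thesis using e by simp
    qed
    then show "\<exists>K. \<forall>n\<ge>K. norm (L2_norm \<omega> (\<lambda>x. f n x - g x) - 0) < e" by blast
  qed
  with g show ?thesis by (rule that)
qed

lemma L2_ip_tendsto:
  assumes "\<And>n. f n \<in> L2 \<omega>" "g \<in> L2 \<omega>" "h \<in> L2 \<omega>" "(\<lambda>n. L2_norm \<omega> (\<lambda>x. f n x - g x)) \<longlonglongrightarrow> 0"
  shows "(\<lambda>n. L2_ip \<omega> (f n) h) \<longlonglongrightarrow> L2_ip \<omega> g h"
proof -
  have "(\<lambda>n. L2_ip \<omega> (f n) h - L2_ip \<omega> g h) \<longlonglongrightarrow> 0"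
  proof (rule Lim_null_comparison)
    show "\<forall>\<^sub>F n in sequentially. norm (L2_ip \<omega> (f n) h - L2_ip \<omega> g h)
        \<le> L2_norm \<omega> (\<lambda>x. f n x - g x) * L2_norm \<omega> h"
      using L2_Cauchy_Schwarz[OF L2_diff[OF assms(1,2)] assms(3)]
      by (intro always_eventually) (simp add: L2_ip_diff_left assms)
    show "(\<lambda>n. L2_norm \<omega> (\<lambda>x. f n x - g x) * L2_norm \<omega> h) \<longlonglongrightarrow> 0"
      using tendsto_mult[OF assms(4) tendsto_const[of "L2_norm \<omega> h"]] by simp
  qed
  then show ?thesis by (simp add: LIM_zero_iff)
qed

lemma L2_norm_tendsto:
  assumes "\<And>n. f n \<in> L2 \<omega>" "g \<in> L2 \<omega>" "(\<lambda>n. L2_norm \<omega> (\<lambda>x. f n x - g x)) \<longlonglongrightarrow> 0"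
  shows "(\<lambda>n. L2_norm \<omega> (f n)) \<longlonglongrightarrow> L2_norm \<omega> g"
proof -
  have "(\<lambda>n. L2_norm \<omega> (f n) - L2_norm \<omega> g) \<longlonglongrightarrow> 0"
  proof (rule Lim_null_comparison[OF _ assms(3)], intro always_eventually allI)
    fix n
    show "norm (L2_norm \<omega> (f n) - L2_norm \<omega> g) \<le> L2_norm \<omega> (\<lambda>x. f n x - g x)"
      using L2_norm_le_add[OF assms(1)[of n] assms(2)] L2_norm_le_add[OF assms(2,1), of n]
        L2_norm_diff_commute[of \<omega> "f n" g] by simp
  qed
  then show ?thesis by (simp add: LIM_zero_iff)
qed

lemma L2_norm_add_tendsto_0:
  assumes "\<And>n. f n \<in> L2 \<omega>" "\<And>n. g n \<in> L2 \<omega>"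
    "(\<lambda>n. L2_norm \<omega> (f n)) \<longlonglongrightarrow> 0" "(\<lambda>n. L2_norm \<omega> (g n)) \<longlonglongrightarrow> 0"
  shows "(\<lambda>n. L2_norm \<omega> (\<lambda>x. f n x + g n x)) \<longlonglongrightarrow> 0"
proof (rule Lim_null_comparison)
  show "\<forall>\<^sub>F n in sequentially. norm (L2_norm \<omega> (\<lambda>x. f n x + g n x)) \<le> L2_norm \<omega> (f n) + L2_norm \<omega> (g n)"
    using L2_norm_triangle[OF assms(1,2)] by (intro always_eventually) simp
  show "(\<lambda>n. L2_norm \<omega> (f n) + L2_norm \<omega> (g n)) \<longlonglongrightarrow> 0"
    using tendsto_add[OF assms(3,4)] by simp
qed

section \<open>Smooth functions\<close>

definition smooth :: "('a::euclidean_space \<Rightarrow> real) \<Rightarrow> bool" where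
  "smooth f \<longleftrightarrow> (\<forall>k. Ck k f)"

lemma Ck_continuous_on: "Ck k f \<Longrightarrow> continuous_on UNIV f"
  by (cases k) (auto intro: differentiable_imp_continuous_on)

lemma Ck_SucD: "Ck (Suc k) f \<Longrightarrow> Ck k f"
proof (induction k arbitrary: f)
  case 0 then show ?case by (auto intro: differentiable_imp_continuous_on)
next
  case (Suc k)
  from Suc.prems have "f differentiable_on UNIV"
    and "\<And>b. b \<in> Basis \<Longrightarrow> Ck (Suc k) (\<lambda>x. frechet_derivative f (at x) b)" by (auto simp only: Ck.simps)
  then show ?case using Suc.IH unfolding Ck.simps(2)[of k f] by blast
qed

text \<open>By uniqueness of derivatives any explicit derivative may stand for
  \<open>frechet_derivative\<close>. The inductive closure properties below go through this
  rule.\<close>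

lemma Ck_SucI:
  assumes "\<And>x. (f has_derivative f' x) (at x)" "\<And>b. b \<in> Basis \<Longrightarrow> Ck k (\<lambda>x. f' x b)"
  shows "Ck (Suc k) f"
proof -
  have "frechet_derivative f (at x) = f' x" for x
    using frechet_derivative_at[OF assms(1)] by simp
  then show ?thesis
    using assms unfolding Ck.simps differentiable_on_def differentiable_def
    by (auto intro: has_derivative_at_withinI)
qed

lemma Ck_SucE:
  assumes "Ck (Suc k) f"
  shows "(f has_derivative frechet_derivative f (at x)) (at x)"
    and "b \<in> Basis \<Longrightarrow> Ck k (\<lambda>x. frechet_derivative f (at x) b)"
  using assms by (auto simp: differentiable_on_def frechet_derivative_works)

lemma Ck_const: "Ck k (\<lambda>x::'a::euclidean_space. c)"
proof (induction k arbitrary: c)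
  case (Suc k) show ?case by (rule Ck_SucI[OF has_derivative_const]) (rule Suc.IH)
qed simp

lemma Ck_add: "Ck k f \<Longrightarrow> Ck k g \<Longrightarrow> Ck k (\<lambda>x. f x + g x)"
proof (induction k arbitrary: f g)
  case 0 then show ?case by (auto intro: continuous_on_add)
next
  case (Suc k)
  show ?case
    by (rule Ck_SucI[OF has_derivative_add[OF Ck_SucE(1)[OF Suc.prems(1)] Ck_SucE(1)[OF Suc.prems(2)]]])
       (intro Suc.IH Ck_SucE(2)[OF Suc.prems(1)] Ck_SucE(2)[OF Suc.prems(2)])
qed

lemma Ck_mult: "Ck k f \<Longrightarrow> Ck k g \<Longrightarrow> Ck k (\<lambda>x. f x * g x)"
proof (induction k arbitrary: f g)
  case 0 then show ?case by (auto intro: continuous_on_mult)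
next
  case (Suc k)
  \<comment> \<open>The product rule contains the undifferentiated factors, which are needed one
    order lower.\<close>
  show ?case
    by (rule Ck_SucI[OF has_derivative_mult[OF Ck_SucE(1)[OF Suc.prems(1)] Ck_SucE(1)[OF Suc.prems(2)]]])
       (intro Ck_add Suc.IH Ck_SucE(2)[OF Suc.prems(1)] Ck_SucE(2)[OF Suc.prems(2)] Suc.prems[THEN Ck_SucD])
qed

lemma Ck_sum: "(\<And>i. i \<in> I \<Longrightarrow> Ck k (f i)) \<Longrightarrow> Ck k (\<lambda>x. \<Sum>i\<in>I. f i x)"
  by (induction I rule: infinite_finite_induct) (auto intro: Ck_const Ck_add)

lemma Ck_prod: "(\<And>i. i \<in> I \<Longrightarrow> Ck k (f i)) \<Longrightarrow> Ck k (\<lambda>x. \<Prod>i\<in>I. f i x)"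
  by (induction I rule: infinite_finite_induct) (auto intro: Ck_const Ck_mult)

text \<open>The derivative of \<open>1 / f\<close> is a product of \<open>1 / f\<close>, the
  derivative of \<open>f\<close> and again \<open>1 / f\<close>, all of order \<open>k\<close>; this
  closes the induction.\<close>

lemma Ck_inverse:
  assumes "Ck k f" "\<And>x. f x \<noteq> 0" shows "Ck k (\<lambda>x. inverse (f x))"
  using assms
proof (induction k arbitrary: f)
  case 0 then show ?case by (auto intro: continuous_on_inverse)
next
  case (Suc k)
  have inv: "Ck k (\<lambda>x. inverse (f x))" by (rule Suc.IH[OF Ck_SucD[OF Suc.prems(1)] Suc.prems(2)])
  show ?case
  proof (rule Ck_SucI)
    show "((\<lambda>x. inverse (f x)) has_derivative
        (\<lambda>h. (-1) * (inverse (f x) * frechet_derivative f (at x) h * inverse (f x)))) (at x)" for x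
      using Deriv.has_derivative_inverse[OF Suc.prems(2) Ck_SucE(1)[OF Suc.prems(1)]] by simp
    show "Ck k (\<lambda>x. (-1) * (inverse (f x) * frechet_derivative f (at x) b * inverse (f x)))"
      if "b \<in> Basis" for b
      by (intro Ck_mult Ck_const inv Ck_SucE(2)[OF Suc.prems(1) that])
  qed
qed

lemma Ck_affine:
  fixes L :: "'a::euclidean_space \<Rightarrow> 'b::euclidean_space"
  assumes L: "bounded_linear L" and f: "Ck k f"
  shows "Ck k (\<lambda>x. f (L x + c))"
  using f
proof (induction k arbitrary: f)
  case 0
  have "continuous_on UNIV (\<lambda>x. L x + c)"
    by (intro continuous_on_add continuous_on_const linear_continuous_on L)
  then show ?case using 0 continuous_on_compose2 by force
next
  case (Suc k)
  note d = Ck_SucE[OF Suc.prems]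
  show ?case
  proof (rule Ck_SucI)
    show "((\<lambda>x. f (L x + c)) has_derivative (\<lambda>h. frechet_derivative f (at (L x + c)) (L h))) (at x)" for x
    proof -
      have "((\<lambda>x. L x + c) has_derivative L) (at x)"
        using bounded_linear_imp_has_derivative[OF L] by (auto intro!: derivative_eq_intros)
      from diff_chain_at[OF this d(1)] show ?thesis by (simp add: o_def)
    qed
    fix b :: 'a assume "b \<in> Basis"
    \<comment> \<open>\<open>Ck\<close> speaks of derivatives along basis vectors only, so the
      derivative in the direction \<open>L b\<close> is expanded in the basis.\<close>
    have "(\<lambda>x. frechet_derivative f (at (L x + c)) (L b))
        = (\<lambda>x. \<Sum>i\<in>Basis. (L b \<bullet> i) * frechet_derivative f (at (L x + c)) i)"
    proof
      fix x
      have lin: "linear (frechet_derivative f (at (L x + c)))"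
        using d(1) has_derivative_linear by blast
      have "frechet_derivative f (at (L x + c)) (\<Sum>i\<in>Basis. (L b \<bullet> i) *\<^sub>R i)
          = (\<Sum>i\<in>Basis. (L b \<bullet> i) * frechet_derivative f (at (L x + c)) i)"
        by (simp add: linear_sum[OF lin] linear_scale[OF lin])
      then show "frechet_derivative f (at (L x + c)) (L b)
          = (\<Sum>i\<in>Basis. (L b \<bullet> i) * frechet_derivative f (at (L x + c)) i)"
        by (simp add: euclidean_representation)
    qed
    moreover have "Ck k (\<lambda>x. \<Sum>i\<in>Basis. (L b \<bullet> i) * frechet_derivative f (at (L x + c)) i)"
      by (intro Ck_sum Ck_mult Ck_const Suc.IH[OF d(2)])
    ultimately show "Ck k (\<lambda>x. frechet_derivative f (at (L x + c)) (L b))" by simp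
  qed
qed

lemma Ck_inner: "Ck k (\<lambda>x::'a::euclidean_space. x \<bullet> a)"
proof (cases k)
  case 0 then show ?thesis by (simp add: continuous_on_inner)
next
  case (Suc n)
  have "((\<lambda>x. x \<bullet> a) has_derivative (\<lambda>h. h \<bullet> a)) (at x)" for x :: 'a
    by (auto intro!: derivative_eq_intros)
  then show ?thesis unfolding Suc by (rule Ck_SucI) (rule Ck_const)
qed

lemma smooth_intros:
  "smooth (\<lambda>x. c)" "smooth f \<Longrightarrow> smooth g \<Longrightarrow> smooth (\<lambda>x. f x + g x)"
  "smooth f \<Longrightarrow> smooth g \<Longrightarrow> smooth (\<lambda>x. f x * g x)"
  "smooth (\<lambda>x. x \<bullet> a)"
  by (auto simp: smooth_def intro: Ck_const Ck_add Ck_mult Ck_inner)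

lemma smooth_prod: "(\<And>i. i \<in> I \<Longrightarrow> smooth (f i)) \<Longrightarrow> smooth (\<lambda>x. \<Prod>i\<in>I. f i x)"
  by (auto simp: smooth_def intro: Ck_prod)

lemma smooth_affine:
  assumes "bounded_linear L" "smooth f" shows "smooth (\<lambda>x. f (L x + c))"
  using assms by (auto simp: smooth_def intro: Ck_affine)

lemma smooth_fst: "smooth (fst :: real \<times> real \<Rightarrow> real)"
proof -
  have "fst = (\<lambda>x :: real \<times> real. x \<bullet> (1, 0))" by (auto simp: fun_eq_iff)
  then show ?thesis by (metis smooth_intros(4))
qed

lemma smooth_continuous_on: "smooth f \<Longrightarrow> continuous_on S f"
  by (meson Ck_continuous_on continuous_on_subset smooth_def subset_UNIV)

lemma smooth_has_derivative: "smooth f \<Longrightarrow> (f has_derivative frechet_derivative f (at x)) (at x)"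
  unfolding smooth_def by (rule Ck_SucE(1)) blast

lemma smooth_partial: "smooth f \<Longrightarrow> b \<in> Basis \<Longrightarrow> smooth (\<lambda>x. frechet_derivative f (at x) b)"
  by (metis Ck_SucE(2) smooth_def)

text \<open>The class \<open>flat p\<close> is closed under differentiation, which makes \<open>flat 1\<close> a smooth function
  vanishing exactly on the nonpositive half line.\<close>

definition flat :: "real poly \<Rightarrow> real \<Rightarrow> real" where
  "flat p x = (if 0 < x then poly p (1 / x) * exp (- (1 / x)) else 0)"

lemma poly_mult_exp_minus_tendsto_0: "((\<lambda>y::real. poly p y * exp (- y)) \<longlongrightarrow> 0) at_top"
proof -
  have "((\<lambda>y::real. \<Sum>i\<le>degree p. coeff p i * (y ^ i / exp y)) \<longlongrightarrow> (\<Sum>i\<le>degree p. coeff p i * 0)) at_top"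
    by (intro tendsto_sum tendsto_mult tendsto_const tendsto_power_div_exp_0)
  moreover have "(\<lambda>y::real. \<Sum>i\<le>degree p. coeff p i * (y ^ i / exp y)) = (\<lambda>y. poly p y * exp (- y))"
    by (simp add: poly_altdef sum_distrib_right exp_minus divide_inverse mult.assoc)
  ultimately show ?thesis by simp
qed

text \<open>For positive \<open>x\<close> the derivative of \<open>p(1/x) exp(-1/x)\<close> is
  \<open>(1/x)^2 (p(1/x) - p'(1/x)) exp(-1/x)\<close>, and \<open>[:0, 0, 1:]\<close> is the
  polynomial \<open>X^2\<close>.\<close>

lemma flat_has_derivative:
  "(flat p has_real_derivative flat ([:0, 0, 1:] * (p - pderiv p)) x) (at x)"
proof -
  consider "x < 0" | "x = 0" | "0 < x" by linarith
  then show ?thesis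
  proof cases
    case 1
    have "((\<lambda>x. 0) has_real_derivative 0) (at x)" by simp
    then have "(flat p has_real_derivative 0) (at x)"
      by (rule has_field_derivative_transform_within_open[where S = "{..<0}"]) (use 1 in \<open>auto simp: flat_def\<close>)
    then show ?thesis using 1 by (simp add: flat_def)
  next
    case 3
    have "((\<lambda>x. poly p (1 / x) * exp (- (1 / x))) has_real_derivative
        flat ([:0, 0, 1:] * (p - pderiv p)) x) (at x)"
      using 3 by (auto intro!: derivative_eq_intros simp: flat_def field_simps power2_eq_square)
    then show ?thesis
      by (rule has_field_derivative_transform_within_open[where S = "{0<..}"]) (use 3 in \<open>auto simp: flat_def\<close>)
  next
    case 2
    \<comment> \<open>The difference quotient at 0 from the right is
      \<open>(1/h) p(1/h) exp(-1/h)\<close>, that is, the polynomial \<open>X p\<close> at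
      \<open>1/h\<close> times a decaying exponential.\<close>
    have "((\<lambda>y. poly ([:0, 1:] * p) y * exp (- y)) \<longlongrightarrow> 0) at_top"
      by (rule poly_mult_exp_minus_tendsto_0)
    then have "((\<lambda>h. poly ([:0, 1:] * p) (inverse h) * exp (- inverse h)) \<longlongrightarrow> 0) (at_right (0::real))"
      by (rule filterlim_compose) (rule filterlim_inverse_at_top_right)
    then have right: "((\<lambda>h. (flat p h - flat p 0) / (h - 0)) \<longlongrightarrow> 0) (at_right 0)"
      by (rule Lim_transform_eventually)
         (auto simp: eventually_at_right_field flat_def field_simps intro!: exI[of _ 1])
    have left: "((\<lambda>h. (flat p h - flat p 0) / (h - 0)) \<longlongrightarrow> 0) (at_left 0)"
      by (rule Lim_transform_eventually[OF tendsto_const])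
         (auto simp: eventually_at_left_field flat_def intro!: exI[of _ "-1"])
    have "((\<lambda>h. (flat p h - flat p 0) / (h - 0)) \<longlongrightarrow> 0) (at 0)"
      by (rule filterlim_split_at_real[OF left right])
    then show ?thesis using 2 by (simp add: has_field_derivative_iff flat_def)
  qed
qed

lemma Ck_SucI_real:
  assumes "\<And>x. (f has_real_derivative f' x) (at x)" "Ck k f'" shows "Ck (Suc k) f"
  by (rule Ck_SucI[where f' = "\<lambda>x h. f' x * h"])
     (use assms in \<open>auto simp: has_field_derivative_def\<close>)

lemma smooth_flat: "smooth (flat p)"
proof -
  have "Ck k (flat p)" for k
  proof (induction k arbitrary: p)
    case 0
    show ?case using flat_has_derivative DERIV_isCont by (fastforce simp: continuous_on_eq_continuous_at)
  next
    case (Suc k) then show ?case using Ck_SucI_real flat_has_derivative by blast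
  qed
  then show ?thesis by (simp add: smooth_def)
qed

lemma flat_1_pos_iff: "0 < flat 1 x \<longleftrightarrow> 0 < x" and flat_1_eq_0_iff: "flat 1 x = 0 \<longleftrightarrow> x \<le> 0"
  and flat_1_nonneg: "0 \<le> flat 1 x" and flat_1_le_1: "flat 1 x \<le> 1"
  by (auto simp: flat_def)

text \<open>The standard smooth transition from 0 on the nonpositive half line to 1 from 1 on. It is
  written with \<open>inverse\<close> to match the closure properties of \<open>Ck\<close>.\<close>

definition smooth_step :: "real \<Rightarrow> real" where
  "smooth_step x = flat 1 x * inverse (flat 1 x + flat 1 (1 - x))"

lemma smooth_step_denominator: "0 < flat 1 x + flat 1 (1 - x)"
  using flat_1_nonneg[of x] flat_1_nonneg[of "1 - x"] flat_1_pos_iff[of x] flat_1_pos_iff[of "1 - x"]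
  by (cases "0 < x") (auto intro: add_pos_nonneg add_nonneg_pos)

lemma smooth_smooth_step: "smooth smooth_step"
proof -
  have "smooth (\<lambda>x. flat 1 (- x + 1))"
    by (rule smooth_affine[OF _ smooth_flat]) (rule bounded_linear_minus[OF bounded_linear_ident])
  then have "smooth (\<lambda>x. flat 1 x + flat 1 (1 - x))"
    using smooth_intros(2)[OF smooth_flat[of 1], of "\<lambda>x. flat 1 (1 - x)"] by simp
  then have "smooth (\<lambda>x. inverse (flat 1 x + flat 1 (1 - x)))"
    unfolding smooth_def by (intro allI Ck_inverse) (auto simp: less_imp_neq[OF smooth_step_denominator, symmetric])
  then have "smooth (\<lambda>x. smooth_step x)"
    unfolding smooth_step_def by (intro smooth_intros smooth_flat)
  then show ?thesis .
qed

lemma smooth_step_eq_0: "x \<le> 0 \<Longrightarrow> smooth_step x = 0"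
  by (simp add: smooth_step_def flat_1_eq_0_iff)

lemma smooth_step_eq_1: "1 \<le> x \<Longrightarrow> smooth_step x = 1"
  using smooth_step_denominator[of x] by (simp add: smooth_step_def flat_1_eq_0_iff flat_def)

lemma smooth_step_bounds: "0 \<le> smooth_step x" "smooth_step x \<le> 1"
  using smooth_step_denominator[of x] flat_1_nonneg[of x] flat_1_nonneg[of "1 - x"]
  by (auto simp: smooth_step_def field_simps)

text \<open>The derivative is continuous and vanishes off the unit interval, hence it is bounded.
  This \<open>K\<close> becomes the constant of all cutoffs.\<close>

lemma smooth_step_deriv:
  obtains K s' where "\<And>x. (smooth_step has_real_derivative s' x) (at x)" "\<And>x. \<bar>s' x\<bar> \<le> K" "0 \<le> K"
    "\<And>x. x \<notin> {0..1} \<Longrightarrow> s' x = 0"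
proof -
  define s' where "s' = (\<lambda>x. frechet_derivative smooth_step (at x) 1)"
  have d: "(smooth_step has_real_derivative s' x) (at x)" for x
  proof -
    have D: "(smooth_step has_derivative frechet_derivative smooth_step (at x)) (at x)"
      by (rule smooth_has_derivative[OF smooth_smooth_step])
    moreover have "frechet_derivative smooth_step (at x) = (*) (s' x)"
    proof
      fix h
      show "frechet_derivative smooth_step (at x) h = s' x * h"
        using linear_scale[OF has_derivative_linear[OF D], of h 1] by (simp add: s'_def)
    qed
    ultimately show ?thesis by (simp add: has_field_derivative_def)
  qed
  have "continuous_on {0..1} s'"
    unfolding s'_def by (rule smooth_continuous_on[OF smooth_partial[OF smooth_smooth_step]]) simp
  then have "bounded (s' ` {0..1})" by (intro compact_imp_bounded compact_continuous_image) auto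
  then obtain K where K: "\<And>x. x \<in> {0..1} \<Longrightarrow> \<bar>s' x\<bar> \<le> K"
    unfolding bounded_iff by (metis image_eqI real_norm_def)
  have out: "s' x = 0" if x: "x \<notin> {0..1}" for x
  proof -
    consider "x < 0" | "1 < x" using x by force
    then show ?thesis
    proof cases
      case 1
      have "(smooth_step has_real_derivative 0) (at x)"
        by (rule has_field_derivative_transform_within_open[where S = "{..<0}" and f = "\<lambda>x. 0"])
           (use 1 in \<open>auto simp: smooth_step_eq_0\<close>)
      then show ?thesis using d DERIV_unique by blast
    next
      case 2
      have "(smooth_step has_real_derivative 0) (at x)"
        by (rule has_field_derivative_transform_within_open[where S = "{1<..}" and f = "\<lambda>x. 1"])
           (use 2 in \<open>auto simp: smooth_step_eq_1\<close>)
      then show ?thesis using d DERIV_unique by blast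
    qed
  qed
  have "0 \<le> K" using K[of 0] by force
  then show ?thesis using d K out by (intro that[of s' K]) (metis abs_zero)+
qed

section \<open>Test functions and weak gradients\<close>

definition classical_grad :: "('a::euclidean_space \<Rightarrow> real) \<Rightarrow> 'a \<Rightarrow> 'a" where
  "classical_grad \<phi> x = (\<Sum>b\<in>Basis. frechet_derivative \<phi> (at x) b *\<^sub>R b)"

lemma classical_grad_inner_Basis: "b \<in> Basis \<Longrightarrow> classical_grad \<phi> x \<bullet> b = frechet_derivative \<phi> (at x) b"
  by (simp add: classical_grad_def inner_sum_left inner_Basis if_distrib cong: if_cong)

lemma frechet_derivative_eq_inner:
  fixes \<phi> :: "'a::euclidean_space \<Rightarrow> real"
  assumes "\<phi> differentiable (at x)"
  shows "frechet_derivative \<phi> (at x) h = classical_grad \<phi> x \<bullet> h"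
proof -
  have lin: "linear (frechet_derivative \<phi> (at x))"
    using assms by (rule linear_frechet_derivative)
  have "frechet_derivative \<phi> (at x) (\<Sum>b\<in>Basis. (h \<bullet> b) *\<^sub>R b) = classical_grad \<phi> x \<bullet> h"
    by (simp add: linear_sum[OF lin] linear_scale[OF lin] classical_grad_def inner_sum_left
        inner_commute[of h] mult.commute)
  then show ?thesis by (simp add: euclidean_representation)
qed

lemma smooth_differentiable: "smooth f \<Longrightarrow> f differentiable (at x)"
  using smooth_has_derivative differentiable_def by blast

lemma smooth_has_gradient: "smooth f \<Longrightarrow> (f has_derivative (\<lambda>h. classical_grad f x \<bullet> h)) (at x)"
  using smooth_has_derivative[of f x] frechet_derivative_eq_inner[OF smooth_differentiable, of f x]
  by (metis (no_types, lifting) ext)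

lemma classical_grad_eqI:
  fixes f :: "'a::euclidean_space \<Rightarrow> real"
  assumes "(f has_derivative (\<lambda>h. G \<bullet> h)) (at x)" shows "classical_grad f x = G"
proof -
  have "frechet_derivative f (at x) = (\<lambda>h. G \<bullet> h)" using frechet_derivative_at[OF assms] by simp
  then show ?thesis by (simp add: classical_grad_def euclidean_representation)
qed

lemma classical_grad_add:
  assumes "smooth f" "smooth g"
  shows "classical_grad (\<lambda>x. f x + g x) x = classical_grad f x + classical_grad g x"
  using smooth_has_gradient[OF assms(1)] smooth_has_gradient[OF assms(2)]
  by (intro classical_grad_eqI) (auto intro!: derivative_eq_intros simp: inner_add_left)

lemma classical_grad_mult:
  assumes "smooth f" "smooth g"
  shows "classical_grad (\<lambda>x. f x * g x) x = f x *\<^sub>R classical_grad g x + g x *\<^sub>R classical_grad f x"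
  using smooth_has_gradient[OF assms(1)] smooth_has_gradient[OF assms(2)]
  by (intro classical_grad_eqI) (auto intro!: derivative_eq_intros simp: inner_add_left)

lemma classical_grad_const: "classical_grad (\<lambda>x::'a::euclidean_space. c) x = 0"
  by (rule classical_grad_eqI) simp

lemma classical_grad_cmult:
  assumes "smooth f" shows "classical_grad (\<lambda>x. c * f x) x = c *\<^sub>R classical_grad f x"
  using classical_grad_mult[OF smooth_intros(1) assms, of c x] by (simp add: classical_grad_const)

lemma continuous_on_classical_grad: "smooth f \<Longrightarrow> continuous_on S (classical_grad f)"
  unfolding classical_grad_def
  by (intro continuous_on_sum continuous_on_scaleR continuous_on_const smooth_continuous_on smooth_partial)

lemma test_smooth: "\<phi> \<in> test_functions \<Omega> \<Longrightarrow> smooth \<phi>"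
  by (simp add: test_functions_def smooth_def)

lemma test_functionsI:
  assumes "smooth \<phi>" "compact K" "K \<subseteq> \<Omega>" "\<And>x. x \<notin> K \<Longrightarrow> \<phi> x = 0"
  shows "\<phi> \<in> test_functions \<Omega>"
proof -
  have "closure {x. \<phi> x \<noteq> 0} \<subseteq> K"
    using assms(2,4) by (intro closure_minimal) (auto intro: compact_imp_closed)
  then show ?thesis
    using assms(1-3) compact_Int_closed[OF assms(2) closed_closure, of "{x. \<phi> x \<noteq> 0}"]
    by (auto simp: test_functions_def smooth_def Int_absorb1)
qed

text \<open>One compact set carries both the function and its gradient, because the function
  vanishes identically on the open complement of its support.\<close>

lemma test_functionsE:
  assumes "\<phi> \<in> test_functions \<Omega>"
  obtains K where "compact K" "K \<subseteq> \<Omega>" "\<And>x. x \<notin> K \<Longrightarrow> \<phi> x = 0" "\<And>x. x \<notin> K \<Longrightarrow> classical_grad \<phi> x = 0"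
proof -
  define K where "K = closure {x. \<phi> x \<noteq> 0}"
  have z: "\<phi> x = 0" if "x \<notin> K" for x
    using that closure_subset[of "{x. \<phi> x \<noteq> 0}"] by (auto simp: K_def)
  have K: "compact K" "K \<subseteq> \<Omega>" using assms by (auto simp: test_functions_def K_def)
  have "classical_grad \<phi> x = 0" if "x \<notin> K" for x
  proof (rule classical_grad_eqI)
    have "((\<lambda>x. 0) has_derivative (\<lambda>h. 0 \<bullet> h)) (at x)" by simp
    then show "(\<phi> has_derivative (\<lambda>h. 0 \<bullet> h)) (at x)"
      by (rule has_derivative_transform_within_open[where s = "- K"])
         (use that z K(1) in \<open>auto intro: compact_imp_closed\<close>)
  qed
  with K z show ?thesis using that by blast
qed

lemma test_zero: "\<phi> \<in> test_functions \<Omega> \<Longrightarrow> x \<notin> \<Omega> \<Longrightarrow> \<phi> x = 0"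
  and test_grad_zero: "\<phi> \<in> test_functions \<Omega> \<Longrightarrow> x \<notin> \<Omega> \<Longrightarrow> classical_grad \<phi> x = 0"
  by (metis subsetD test_functionsE)+

lemma test_mono: "\<phi> \<in> test_functions \<Omega> \<Longrightarrow> \<Omega> \<subseteq> \<Omega>' \<Longrightarrow> \<phi> \<in> test_functions \<Omega>'"
  by (auto simp: test_functions_def)

lemma test_zero_function: "(\<lambda>x. 0) \<in> test_functions \<Omega>"
  by (auto simp: test_functions_def Ck_const)

lemma test_mult_smooth:
  assumes "\<phi> \<in> test_functions \<Omega>" "smooth h" shows "(\<lambda>x. h x * \<phi> x) \<in> test_functions \<Omega>"
proof -
  obtain K where K: "compact K" "K \<subseteq> \<Omega>" "\<And>x. x \<notin> K \<Longrightarrow> \<phi> x = 0"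
    by (rule test_functionsE[OF assms(1)]) blast
  show ?thesis
    by (rule test_functionsI[OF smooth_intros(3)[OF assms(2) test_smooth[OF assms(1)]] K(1,2)]) (simp add: K(3))
qed

lemma test_cmult: "\<phi> \<in> test_functions \<Omega> \<Longrightarrow> (\<lambda>x. c * \<phi> x) \<in> test_functions \<Omega>"
  by (intro test_mult_smooth smooth_intros)

lemma test_add:
  assumes "\<phi> \<in> test_functions \<Omega>" "\<psi> \<in> test_functions \<Omega>"
  shows "(\<lambda>x. \<phi> x + \<psi> x) \<in> test_functions \<Omega>"
proof -
  obtain K where K: "compact K" "K \<subseteq> \<Omega>" "\<And>x. x \<notin> K \<Longrightarrow> \<phi> x = 0"
    by (rule test_functionsE[OF assms(1)]) blast
  obtain L where L: "compact L" "L \<subseteq> \<Omega>" "\<And>x. x \<notin> L \<Longrightarrow> \<psi> x = 0"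
    by (rule test_functionsE[OF assms(2)]) blast
  show ?thesis
    by (rule test_functionsI[OF smooth_intros(2)[OF assms[THEN test_smooth]] compact_Un[OF K(1) L(1)]])
       (use K L in auto)
qed

lemma test_diff:
  assumes "\<phi> \<in> test_functions \<Omega>" "\<psi> \<in> test_functions \<Omega>"
  shows "(\<lambda>x. \<phi> x - \<psi> x) \<in> test_functions \<Omega>"
  using test_add[OF assms(1) test_cmult[OF assms(2), of "-1"]] by simp

lemma classical_grad_diff:
  assumes "smooth f" "smooth g"
  shows "classical_grad (\<lambda>x. f x - g x) x = classical_grad f x - classical_grad g x"
  using classical_grad_add[OF assms(1) smooth_intros(3)[OF smooth_intros(1) assms(2)], of "-1" x]
  using classical_grad_cmult[OF assms(2), of "-1" x] by simp

lemma continuous_compact_support_L2: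
  fixes f :: "'a::euclidean_space \<Rightarrow> 'b::euclidean_space"
  assumes "continuous_on UNIV f" "compact K" "\<And>x. x \<notin> K \<Longrightarrow> f x = 0" "\<omega> \<in> sets lebesgue"
  shows "f \<in> L2 \<omega>"
proof -
  have meas: "f \<in> borel_measurable borel" using assms(1) by (rule borel_measurable_continuous_onI)
  have "integrable lborel (\<lambda>x. indicator K x *\<^sub>R (norm (f x))\<^sup>2)"
    using assms(1,2) by (intro borel_integrable_compact continuous_intros) (auto intro: continuous_on_subset)
  also have "(\<lambda>x. indicator K x *\<^sub>R (norm (f x))\<^sup>2) = (\<lambda>x. (norm (f x))\<^sup>2)"
    using assms(3) by (auto simp: indicator_def fun_eq_iff)
  finally have "integrable lebesgue (\<lambda>x. (norm (f x))\<^sup>2)" using meas by (simp add: integrable_completion)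
  then have "f \<in> L2 UNIV"
    using meas by (simp add: L2_def lebesgue_on_UNIV_eq measurable_completion)
  then show ?thesis by (rule L2_subset) (use assms(4) in auto)
qed

lemma test_L2:
  assumes "\<phi> \<in> test_functions \<Omega>'" "\<omega> \<in> sets lebesgue"
  shows "\<phi> \<in> L2 \<omega>" "classical_grad \<phi> \<in> L2 \<omega>"
proof -
  obtain K where K: "compact K" "\<And>x. x \<notin> K \<Longrightarrow> \<phi> x = 0" "\<And>x. x \<notin> K \<Longrightarrow> classical_grad \<phi> x = 0"
    by (rule test_functionsE[OF assms(1)]) blast
  show "\<phi> \<in> L2 \<omega>"
    by (rule continuous_compact_support_L2[OF smooth_continuous_on[OF test_smooth[OF assms(1)]] K(1,2) assms(2)])
  show "classical_grad \<phi> \<in> L2 \<omega>"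
    by (rule continuous_compact_support_L2[OF continuous_on_classical_grad[OF test_smooth[OF assms(1)]] K(1,3) assms(2)])
qed

section \<open>Integration by parts for test functions\<close>

lemma integrable_test:
  assumes phi: "\<phi> \<in> test_functions \<Omega>" shows "integrable lborel \<phi>"
proof -
  obtain K where K: "compact K" "\<And>x. x \<notin> K \<Longrightarrow> \<phi> x = 0" by (rule test_functionsE[OF phi]) blast
  have "integrable lborel (\<lambda>x. indicator K x *\<^sub>R \<phi> x)"
    using smooth_continuous_on[OF test_smooth[OF phi]] by (rule borel_integrable_compact[OF K(1)])
  also have "(\<lambda>x. indicator K x *\<^sub>R \<phi> x) = \<phi>" using K(2) by (auto simp: indicator_def fun_eq_iff)
  finally show "integrable lborel \<phi>" .
qed

text \<open>Translation invariance of Lebesgue measure makes the integral of every difference quotient vanish.\<close>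

lemma integral_partial_test:
  fixes \<phi> :: "'a::euclidean_space \<Rightarrow> real"
  assumes phi: "\<phi> \<in> test_functions \<Omega>"
  shows "(LINT x|lborel. classical_grad \<phi> x \<bullet> b) = 0"
proof -
  note sm = test_smooth[OF phi]
  obtain K where K: "compact K" "\<And>x. x \<notin> K \<Longrightarrow> \<phi> x = 0" "\<And>x. x \<notin> K \<Longrightarrow> classical_grad \<phi> x = 0"
    by (rule test_functionsE[OF phi]) blast
  obtain R where R: "\<And>x. x \<in> K \<Longrightarrow> norm x \<le> R"
    using compact_imp_bounded[OF K(1)] by (auto simp: bounded_iff)
  have "bounded (classical_grad \<phi> ` K)"
    by (intro compact_imp_bounded compact_continuous_image continuous_on_classical_grad sm K(1))
  then obtain B0 where B0: "\<And>x. x \<in> K \<Longrightarrow> norm (classical_grad \<phi> x) \<le> B0"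
    unfolding bounded_iff by (metis image_eqI)
  \<comment> \<open>The support may be empty; \<open>B0\<close> is then unconstrained and may be
    negative.\<close>
  define B where "B = max B0 0"
  have B: "norm (classical_grad \<phi> x) \<le> B" "0 \<le> B" for x
    using B0[of x] K(3)[of x] by (cases "x \<in> K"; simp add: B_def)+
  have lip: "norm (\<phi> x - \<phi> y) \<le> B * norm (x - y)" for x y
  proof (rule differentiable_bound[of UNIV \<phi> "\<lambda>x h. classical_grad \<phi> x \<bullet> h"])
    show "(\<phi> has_derivative (\<lambda>h. classical_grad \<phi> x \<bullet> h)) (at x within UNIV)" for x
      using smooth_has_gradient[OF sm] .
    show "onorm (\<lambda>h. classical_grad \<phi> x \<bullet> h) \<le> B" for x
      by (rule onorm_le) (metis B(1) Cauchy_Schwarz_ineq2 real_norm_def mult_right_mono norm_ge_zero order_trans)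
  qed auto
  define t where "t n = inverse (real (Suc n))" for n
  have t: "t n > 0" "t n \<le> 1" for n by (auto simp: t_def field_simps)
  define q where "q n x = (\<phi> (x + t n *\<^sub>R b) - \<phi> x) / t n" for n x
  have [measurable]: "\<phi> \<in> borel_measurable borel"
    using smooth_continuous_on[OF sm] by (rule borel_measurable_continuous_onI)
  have "(\<lambda>n. LINT x|lborel. q n x) \<longlonglongrightarrow> (LINT x|lborel. classical_grad \<phi> x \<bullet> b)"
  \<comment> \<open>The steps \<open>t n\<close> are at most 1, so all difference quotients vanish
    off this ball, and the Lipschitz constant \<open>B\<close> bounds them on it.\<close>
  proof (rule integral_dominated_convergence[where w = "\<lambda>x. indicator (cball 0 (R + norm b)) x *\<^sub>R (B * norm b)"])
    show "(\<lambda>x. classical_grad \<phi> x \<bullet> b) \<in> borel_measurable lborel"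
      by (auto intro!: borel_measurable_continuous_onI continuous_intros continuous_on_classical_grad sm)
    show "q n \<in> borel_measurable lborel" for n unfolding q_def by measurable
    show "integrable lborel (\<lambda>x. indicat_real (cball 0 (R + norm b)) x *\<^sub>R (B * norm b))"
      by (rule borel_integrable_compact) auto
    show "AE x in lborel. (\<lambda>n. q n x) \<longlonglongrightarrow> classical_grad \<phi> x \<bullet> b"
    proof (intro AE_I2)
      fix x
      have "((\<lambda>s. \<phi> (x + s *\<^sub>R b)) has_derivative (\<lambda>h. classical_grad \<phi> x \<bullet> (h *\<^sub>R b))) (at 0)"
      proof -
        have "((\<lambda>s. x + s *\<^sub>R b) has_derivative (\<lambda>h. h *\<^sub>R b)) (at 0)" by (auto intro!: derivative_eq_intros)
        moreover have "(\<phi> has_derivative (\<lambda>h. classical_grad \<phi> x \<bullet> h)) (at (x + 0 *\<^sub>R b))"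
          using smooth_has_gradient[OF sm] by simp
        ultimately show ?thesis using diff_chain_at by (fastforce simp: o_def)
      qed
      then have "((\<lambda>s. \<phi> (x + s *\<^sub>R b)) has_real_derivative (classical_grad \<phi> x \<bullet> b)) (at 0)"
        by (simp add: has_field_derivative_def mult_commute_abs)
      then have "((\<lambda>s. (\<phi> (x + s *\<^sub>R b) - \<phi> x) / s) \<longlongrightarrow> classical_grad \<phi> x \<bullet> b) (at 0)"
        by (simp add: has_field_derivative_iff)
      moreover have "filterlim t (at 0) sequentially"
        unfolding filterlim_at using t LIMSEQ_inverse_real_of_nat by (auto simp: t_def[abs_def] simp del: of_nat_Suc)
      ultimately show "(\<lambda>n. q n x) \<longlonglongrightarrow> classical_grad \<phi> x \<bullet> b"
        unfolding q_def by (rule filterlim_compose)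
    qed
    show "AE x in lborel. norm (q n x) \<le> indicat_real (cball 0 (R + norm b)) x *\<^sub>R (B * norm b)" for n
    proof (intro AE_I2)
      fix x
      show "norm (q n x) \<le> indicat_real (cball 0 (R + norm b)) x *\<^sub>R (B * norm b)"
      proof (cases "x \<in> cball 0 (R + norm b)")
        case True
        have "norm (\<phi> (x + t n *\<^sub>R b) - \<phi> x) \<le> B * (t n * norm b)"
          using lip[of "x + t n *\<^sub>R b" x] t(1)[of n] by simp
        then show ?thesis using True t(1)[of n] by (simp add: q_def field_simps)
      next
        case False
        have tb: "norm (t n *\<^sub>R b) \<le> norm b" using t[of n] mult_right_mono[of "t n" 1 "norm b"] by simp
        have "x \<notin> K" using False R[of x] norm_ge_zero[of b] by auto
        moreover have "x + t n *\<^sub>R b \<notin> K"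
        proof
          assume "x + t n *\<^sub>R b \<in> K"
          then have "norm (x + t n *\<^sub>R b) \<le> R" by (rule R)
          then have "norm x \<le> R + norm b" using tb norm_triangle_ineq4[of "x + t n *\<^sub>R b" "t n *\<^sub>R b"] by simp
          then show False using False by simp
        qed
        ultimately show ?thesis using False by (simp add: q_def K(2))
      qed
    qed
  qed
  moreover have "(LINT x|lborel. q n x) = 0" for n
  proof -
    have int: "integrable lborel \<phi>" by (rule integrable_test[OF phi])
    have sh: "distr lborel borel (\<lambda>x. x + t n *\<^sub>R b) = (lborel :: 'a measure)"
    proof -
      have "(\<lambda>x. x + t n *\<^sub>R b) = (+) (t n *\<^sub>R b)" by (auto simp: add.commute)
      then show ?thesis by (simp add: lborel_distr_plus)
    qed
    have "(LINT x|lborel. \<phi> (x + t n *\<^sub>R b)) = (LINT x|distr lborel borel (\<lambda>x. x + t n *\<^sub>R b). \<phi> x)"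
      by (rule integral_distr[symmetric]) auto
    moreover have "integrable lborel (\<lambda>x. \<phi> (x + t n *\<^sub>R b))"
      using int by (subst (asm) sh[symmetric]) (auto simp: integrable_distr_eq)
    ultimately show ?thesis using int by (simp add: q_def sh)
  qed
  ultimately show ?thesis by (simp add: LIMSEQ_const_iff)
qed

text \<open>Written with \<open>L2_ip\<close>, both sides of the defining identity are linear and
  continuous in the function and in its gradient. This makes sums, multiples and limits of weak
  gradients immediate.\<close>

lemma weak_gradient_iff:
  fixes v :: "'a::euclidean_space \<Rightarrow> real"
  shows "weak_gradient \<Omega> v G \<longleftrightarrow> G \<in> L2 \<Omega> \<and> (\<forall>\<phi>\<in>test_functions \<Omega>. \<forall>b\<in>Basis.
      L2_ip \<Omega> v (\<lambda>x. classical_grad \<phi> x \<bullet> b) = - L2_ip \<Omega> G (\<lambda>x. \<phi> x *\<^sub>R b))"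
  by (simp add: weak_gradient_def L2_ip_def classical_grad_inner_Basis mult.commute cong: ball_cong)

lemma test_L2_components:
  assumes "\<phi> \<in> test_functions \<Omega>'" "\<omega> \<in> sets lebesgue"
  shows "(\<lambda>x. classical_grad \<phi> x \<bullet> b) \<in> L2 \<omega>" "(\<lambda>x. \<phi> x *\<^sub>R b) \<in> L2 \<omega>"
proof -
  show "(\<lambda>x. classical_grad \<phi> x \<bullet> b) \<in> L2 \<omega>"
    using L2_D(1)[OF test_L2(2)[OF assms]]
    by (intro L2_bound[OF test_L2(2)[OF assms], where c = "norm b"])
       (auto simp: mult.commute[of "norm b"] Cauchy_Schwarz_ineq2)
  show "(\<lambda>x. \<phi> x *\<^sub>R b) \<in> L2 \<omega>"
    using L2_D(1)[OF test_L2(1)[OF assms]]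
    by (intro L2_bound[OF test_L2(1)[OF assms], where c = "norm b"]) auto
qed

text \<open>Integration by parts: the product of two test functions is a test function, and each of
  its partial derivatives has integral 0.\<close>

lemma weak_gradient_test:
  fixes \<phi> :: "'a::euclidean_space \<Rightarrow> real"
  assumes phi: "\<phi> \<in> test_functions \<Omega>" and \<Omega>: "\<Omega> \<in> sets lebesgue"
  shows "weak_gradient \<Omega> \<phi> (classical_grad \<phi>)"
  unfolding weak_gradient_iff
proof (intro conjI ballI test_L2(2)[OF phi \<Omega>])
  fix \<psi> b assume psi: "\<psi> \<in> test_functions \<Omega>" and b: "b \<in> (Basis :: 'a set)"
  have prod: "(\<lambda>x. \<phi> x * \<psi> x) \<in> test_functions \<Omega>" by (intro test_mult_smooth psi test_smooth[OF phi])
  have [measurable]: "\<phi> \<in> borel_measurable borel" "\<psi> \<in> borel_measurable borel"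
    "classical_grad \<phi> \<in> borel_measurable borel" "classical_grad \<psi> \<in> borel_measurable borel"
    using test_smooth[OF phi] test_smooth[OF psi]
    by (auto intro!: borel_measurable_continuous_onI smooth_continuous_on continuous_on_classical_grad)
  \<comment> \<open>It is enough that the second argument vanishes off \<Omega> to pass to the whole
    space, where \<open>lebesgue\<close> and \<open>lborel\<close> give Borel integrands the same
    integral.\<close>
  have lb: "L2_ip \<Omega> f g = (LINT x|lborel. f x \<bullet> g x)"
    if "(\<lambda>x. f x \<bullet> g x) \<in> borel_measurable borel" "\<And>x. x \<notin> \<Omega> \<Longrightarrow> g x = 0" for f g :: "'a \<Rightarrow> 'c::euclidean_space"
  proof -
    have "L2_ip \<Omega> f g = (LINT x|lebesgue. f x \<bullet> g x)"
      unfolding L2_ip_indicator[OF \<Omega>] using that(2)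
      by (intro Bochner_Integration.integral_cong) (auto simp: indicator_def)
    then show ?thesis using that(1) by (simp add: integral_completion)
  qed
  have int: "integrable lborel (\<lambda>x. \<phi> x * (classical_grad \<psi> x \<bullet> b))"
    "integrable lborel (\<lambda>x. (classical_grad \<phi> x \<bullet> b) * \<psi> x)"
    using L2_integrable_ip[OF test_L2(1)[OF phi] test_L2_components(1)[OF psi], of UNIV b]
      L2_integrable_ip[OF test_L2_components(1)[OF phi] test_L2(1)[OF psi], of UNIV b]
    by (simp_all add: lebesgue_on_UNIV_eq integrable_completion)
  have "0 = (LINT x|lborel. classical_grad (\<lambda>x. \<phi> x * \<psi> x) x \<bullet> b)"
    using integral_partial_test[OF prod] by simp
  also have "\<dots> = (LINT x|lborel. \<phi> x * (classical_grad \<psi> x \<bullet> b) + (classical_grad \<phi> x \<bullet> b) * \<psi> x)"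
    by (simp add: classical_grad_mult test_smooth[OF phi] test_smooth[OF psi] inner_add_left mult.commute)
  also have "\<dots> = (LINT x|lborel. \<phi> x * (classical_grad \<psi> x \<bullet> b)) + (LINT x|lborel. (classical_grad \<phi> x \<bullet> b) * \<psi> x)"
    using int by simp
  finally have "(LINT x|lborel. \<phi> x * (classical_grad \<psi> x \<bullet> b)) = - (LINT x|lborel. (classical_grad \<phi> x \<bullet> b) * \<psi> x)"
    by simp
  moreover have "L2_ip \<Omega> \<phi> (\<lambda>x. classical_grad \<psi> x \<bullet> b) = (LINT x|lborel. \<phi> x * (classical_grad \<psi> x \<bullet> b))"
    using test_grad_zero[OF psi] by (subst lb) auto
  moreover have "L2_ip \<Omega> (classical_grad \<phi>) (\<lambda>x. \<psi> x *\<^sub>R b) = (LINT x|lborel. (classical_grad \<phi> x \<bullet> b) * \<psi> x)"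
    using test_zero[OF psi] by (subst lb) (auto simp: mult.commute)
  ultimately show "L2_ip \<Omega> \<phi> (\<lambda>x. classical_grad \<psi> x \<bullet> b) = - L2_ip \<Omega> (classical_grad \<phi>) (\<lambda>x. \<psi> x *\<^sub>R b)"
    by simp
qed

lemma weak_gradient_add:
  fixes v w :: "'a::euclidean_space \<Rightarrow> real"
  assumes "\<Omega> \<in> sets lebesgue" "v \<in> L2 \<Omega>" "w \<in> L2 \<Omega>" "weak_gradient \<Omega> v G" "weak_gradient \<Omega> w H"
  shows "weak_gradient \<Omega> (\<lambda>x. v x + w x) (\<lambda>x. G x + H x)"
  using assms test_L2_components[OF _ assms(1)] unfolding weak_gradient_iff
  by (auto simp: L2_add L2_ip_add_left)

lemma weak_gradient_cmult:
  fixes v :: "'a::euclidean_space \<Rightarrow> real"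
  assumes "weak_gradient \<Omega> v G"
  shows "weak_gradient \<Omega> (\<lambda>x. c * v x) (\<lambda>x. c *\<^sub>R G x)"
  using assms L2_ip_scaleR_left[of \<Omega> c v] unfolding weak_gradient_iff
  by (auto simp: L2_scaleR L2_ip_scaleR_left)

text \<open>Weak differentiation is a closed operator: for a fixed test function both sides of the
  defining identity pass to the limit in \<open>L2\<close>.\<close>

lemma weak_gradient_limit:
  fixes v :: "'a::euclidean_space \<Rightarrow> real"
  assumes \<Omega>: "\<Omega> \<in> sets lebesgue" and vn: "\<And>n. vn n \<in> L2 \<Omega>" and Gn: "\<And>n. weak_gradient \<Omega> (vn n) (Gn n)"
    and v: "v \<in> L2 \<Omega>" and G: "G \<in> L2 \<Omega>"
    and cv: "(\<lambda>n. L2_norm \<Omega> (\<lambda>x. vn n x - v x)) \<longlonglongrightarrow> 0" and cG: "(\<lambda>n. L2_norm \<Omega> (\<lambda>x. Gn n x - G x)) \<longlonglongrightarrow> 0"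
  shows "weak_gradient \<Omega> v G"
  unfolding weak_gradient_iff
proof (intro conjI ballI G)
  fix \<phi> b assume phi: "\<phi> \<in> test_functions \<Omega>" and b: "b \<in> (Basis :: 'a set)"
  have GL: "Gn n \<in> L2 \<Omega>" for n using Gn[of n] by (simp add: weak_gradient_iff)
  have "(\<lambda>n. L2_ip \<Omega> (vn n) (\<lambda>x. classical_grad \<phi> x \<bullet> b)) \<longlonglongrightarrow> L2_ip \<Omega> v (\<lambda>x. classical_grad \<phi> x \<bullet> b)"
    by (rule L2_ip_tendsto[OF vn v test_L2_components(1)[OF phi \<Omega>] cv])
  moreover have "(\<lambda>n. - L2_ip \<Omega> (Gn n) (\<lambda>x. \<phi> x *\<^sub>R b)) \<longlonglongrightarrow> - L2_ip \<Omega> G (\<lambda>x. \<phi> x *\<^sub>R b)"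
    by (intro tendsto_minus L2_ip_tendsto[OF GL G test_L2_components(2)[OF phi \<Omega>] cG])
  moreover have "L2_ip \<Omega> (vn n) (\<lambda>x. classical_grad \<phi> x \<bullet> b) = - L2_ip \<Omega> (Gn n) (\<lambda>x. \<phi> x *\<^sub>R b)" for n
    using Gn[of n] phi b by (simp add: weak_gradient_iff)
  ultimately show "L2_ip \<Omega> v (\<lambda>x. classical_grad \<phi> x \<bullet> b) = - L2_ip \<Omega> G (\<lambda>x. \<phi> x *\<^sub>R b)"
    using LIMSEQ_unique by fastforce
qed

section \<open>The fundamental lemma of the calculus of variations and uniqueness of weak
  gradients\<close>

lemma AE_lebesgue_on_iff: "\<omega> \<in> sets lebesgue \<Longrightarrow> (AE x in lebesgue_on \<omega>. P x) \<longleftrightarrow> (AE x in lebesgue. x \<in> \<omega> \<longrightarrow> P x)"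
  by (rule AE_restrict_space_iff) simp

lemma L2_const: "\<omega> \<in> lmeasurable \<Longrightarrow> (\<lambda>x. c) \<in> L2 \<omega>"
  using finite_measure.integrable_const[OF finite_measure_lebesgue_on] by (auto simp: L2_def)

lemma L2_indicator_box:
  fixes a b :: "'a::euclidean_space"
  assumes "box a b \<subseteq> \<Omega>" "\<Omega> \<in> sets lebesgue"
  shows "(\<lambda>x. indicator (box a b) x :: real) \<in> L2 \<Omega>"
  using L2_indicator[OF L2_const[of "box a b" "1::real"] assms(1,2)] by (simp add: lmeasurable_box)

text \<open>The indicator of a box is a dominated pointwise limit of test functions, so
  orthogonality passes to it.\<close>

lemma L2_ip_indicator_box_eq_0:
  fixes h :: "'a::euclidean_space \<Rightarrow> real"
  assumes \<Omega>: "\<Omega> \<in> sets lebesgue" and h: "h \<in> L2 \<Omega>"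
    and orth: "\<And>\<phi>. \<phi> \<in> test_functions \<Omega> \<Longrightarrow> L2_ip \<Omega> h \<phi> = 0" and box: "box a b \<subseteq> \<Omega>"
  shows "L2_ip \<Omega> h (indicator (box a b)) = 0"
proof -
  \<comment> \<open>With \<open>k = Suc n\<close>, a factor \<open>flat 1 (k s - 1)\<close> vanishes
    for \<open>s \<le> 1 / k\<close>, which keeps the support in a compact part of the box, and
    tends to 1 for every positive \<open>s\<close> as \<open>k\<close> grows.\<close>
  define \<phi> where "\<phi> n x = (\<Prod>i\<in>Basis. flat 1 (real (Suc n) * (x \<bullet> i - a \<bullet> i) - 1) *
      flat 1 (real (Suc n) * (b \<bullet> i - x \<bullet> i) - 1))" for n :: nat and x :: 'a
  have sm: "smooth (\<phi> n)" for n
  proof -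
    have aff: "smooth (\<lambda>x::'a. flat 1 (c * (x \<bullet> i) + d))" for c d and i :: 'a
      by (rule smooth_affine[OF _ smooth_flat])
         (intro bounded_linear_intros)
    have "smooth (\<lambda>x::'a. flat 1 (m * (x \<bullet> i - a \<bullet> i) - 1))" "smooth (\<lambda>x::'a. flat 1 (m * (b \<bullet> i - x \<bullet> i) - 1))" for m i
      using aff[of m i "- m * (a \<bullet> i) - 1"] aff[of "- m" i "m * (b \<bullet> i) - 1"] by (simp_all add: algebra_simps)
    then show ?thesis unfolding \<phi>_def by (intro smooth_prod smooth_intros(3))
  qed
  have test: "\<phi> n \<in> test_functions \<Omega>" for n
  proof (rule test_functionsI[OF sm])
    let ?K = "cbox (a + inverse (real (Suc n)) *\<^sub>R One) (b - inverse (real (Suc n)) *\<^sub>R One)"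
    show "compact ?K" by simp
    have pos: "0 < inverse (real (Suc n))" by simp
    have "?K \<subseteq> box a b"
    proof
      fix x assume x: "x \<in> ?K"
      show "x \<in> box a b" unfolding mem_box
      proof
        fix i :: 'a assume "i \<in> Basis"
        then have "a \<bullet> i + inverse (real (Suc n)) \<le> x \<bullet> i" "x \<bullet> i \<le> b \<bullet> i - inverse (real (Suc n))"
          using x unfolding mem_box by (auto simp: inner_simps)
        then show "a \<bullet> i < x \<bullet> i \<and> x \<bullet> i < b \<bullet> i" using pos by linarith
      qed
    qed
    with box show "?K \<subseteq> \<Omega>" by blast
    fix x assume "x \<notin> ?K"
    then obtain i where i: "i \<in> Basis"
      "x \<bullet> i < a \<bullet> i + inverse (real (Suc n)) \<or> b \<bullet> i - inverse (real (Suc n)) < x \<bullet> i"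
      unfolding mem_box by (auto simp: inner_simps not_le)
    then have "real (Suc n) * (x \<bullet> i - a \<bullet> i) - 1 \<le> 0 \<or> real (Suc n) * (b \<bullet> i - x \<bullet> i) - 1 \<le> 0"
      by (auto simp: field_simps)
    then show "\<phi> n x = 0" using i(1) unfolding \<phi>_def
      by (intro prod_zero) (auto simp: flat_1_eq_0_iff)
  qed
  have \<phi>01: "0 \<le> \<phi> n x" "\<phi> n x \<le> 1" for n x
    unfolding \<phi>_def by (auto intro!: prod_nonneg prod_le_1 mult_le_one simp: flat_1_nonneg flat_1_le_1)
  have flat_lim: "(\<lambda>n. flat 1 (real (Suc n) * s - 1)) \<longlonglongrightarrow> (if 0 < s then 1 else 0)" for s
  proof (cases "0 < s")
    case True
    have "filterlim (\<lambda>n. real (Suc n) * s - 1) at_top sequentially"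
    proof -
      have "filterlim (\<lambda>n. - 1 + s * real (Suc n)) at_top sequentially"
        using True by (intro filterlim_tendsto_add_at_top[OF tendsto_const]
          filterlim_tendsto_pos_mult_at_top[OF tendsto_const] filterlim_compose[OF filterlim_real_sequentially filterlim_Suc])
      then show ?thesis by (simp add: algebra_simps)
    qed
    then have "(\<lambda>n. exp (- (1 / (real (Suc n) * s - 1)))) \<longlonglongrightarrow> exp (- 0)"
      by (intro tendsto_intros tendsto_divide_0[OF tendsto_const] filterlim_at_top_imp_at_infinity)
    moreover have "\<forall>\<^sub>F n in sequentially. exp (- (1 / (real (Suc n) * s - 1))) = flat 1 (real (Suc n) * s - 1)"
      using filterlim_at_top_dense[THEN iffD1, OF \<open>filterlim (\<lambda>n. real (Suc n) * s - 1) at_top sequentially\<close>, rule_format, of 0]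
      by eventually_elim (simp add: flat_def)
    ultimately have "(\<lambda>n. flat 1 (real (Suc n) * s - 1)) \<longlonglongrightarrow> exp (- 0)"
      by (rule Lim_transform_eventually)
    then show ?thesis using True by simp
  next
    case False
    then have "real (Suc n) * s - 1 \<le> 0" for n
      using mult_nonneg_nonpos[of "real (Suc n)" s] by simp
    then have "flat 1 (real (Suc n) * s - 1) = 0" for n by (simp add: flat_1_eq_0_iff)
    then show ?thesis using False by simp
  qed
  have lim: "(\<lambda>n. \<phi> n x) \<longlonglongrightarrow> indicator (box a b) x" for x
  proof -
    have "(\<lambda>n. \<phi> n x) \<longlonglongrightarrow> (\<Prod>i\<in>Basis. (if 0 < x \<bullet> i - a \<bullet> i then 1 else 0) * (if 0 < b \<bullet> i - x \<bullet> i then 1 else 0))"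
      unfolding \<phi>_def by (intro tendsto_prod tendsto_mult flat_lim)
    also have "(\<Prod>i\<in>Basis. (if 0 < x \<bullet> i - a \<bullet> i then 1 else 0) * (if 0 < b \<bullet> i - x \<bullet> i then 1 else 0))
       = (indicator (box a b) x :: real)"
    proof (cases "x \<in> box a b")
      case True then show ?thesis by (auto simp: mem_box intro!: prod.neutral)
    next
      case False then show ?thesis by (auto simp: mem_box intro!: prod_zero)
    qed
    finally show ?thesis .
  qed
  have zero: "\<phi> n x = 0" if "x \<notin> box a b" for n x
  proof -
    obtain i where "i \<in> Basis" "x \<bullet> i - a \<bullet> i \<le> 0 \<or> b \<bullet> i - x \<bullet> i \<le> 0"
      using \<open>x \<notin> box a b\<close> by (auto simp: mem_box not_less)
    moreover have "s \<le> 0 \<Longrightarrow> real (Suc n) * s - 1 \<le> 0" for s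
      using mult_nonneg_nonpos[of "real (Suc n)" s] by simp
    ultimately show ?thesis unfolding \<phi>_def by (intro prod_zero bexI[of _ i]) (auto simp: flat_1_eq_0_iff)
  qed
  have "(\<lambda>n. L2_ip \<Omega> h (\<phi> n)) \<longlonglongrightarrow> L2_ip \<Omega> h (indicator (box a b))"
    unfolding L2_ip_def
  proof (rule integral_dominated_convergence[where w = "\<lambda>x. norm (h x \<bullet> indicator (box a b) x)"])
    show "(\<lambda>x. h x \<bullet> indicator (box a b) x) \<in> borel_measurable (lebesgue_on \<Omega>)"
      and "integrable (lebesgue_on \<Omega>) (\<lambda>x. norm (h x \<bullet> indicat_real (box a b) x))"
      using L2_integrable_ip[OF h L2_indicator_box[OF box \<Omega>]] by auto
    show "(\<lambda>x. h x \<bullet> \<phi> n x) \<in> borel_measurable (lebesgue_on \<Omega>)" for n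
      using L2_integrable_ip[OF h test_L2(1)[OF test \<Omega>]] by auto
    show "AE x in lebesgue_on \<Omega>. (\<lambda>n. h x \<bullet> \<phi> n x) \<longlonglongrightarrow> h x \<bullet> indicator (box a b) x"
      by (intro AE_I2 tendsto_inner tendsto_const lim)
    show "AE x in lebesgue_on \<Omega>. norm (h x \<bullet> \<phi> n x) \<le> norm (h x \<bullet> indicat_real (box a b) x)" for n
    proof (intro AE_I2)
      fix x
      show "norm (h x \<bullet> \<phi> n x) \<le> norm (h x \<bullet> indicat_real (box a b) x)"
        using \<phi>01[of n x] zero[of x n] mult_left_le[of "\<phi> n x" "\<bar>h x\<bar>"]
        by (cases "x \<in> box a b") (auto simp: abs_mult)
    qed
  qed
  then show ?thesis using orth[OF test] by (simp add: LIMSEQ_const_iff)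
qed

text \<open>Boxes generate the Borel sets and are stable under intersection, so a Dynkin argument
  carries the vanishing of integrals to all Borel sets. The integral over the whole space is listed
  separately because complements are taken in it and it is not a box.\<close>

lemma AE_zero_of_box_integrals:
  fixes H :: "'a::euclidean_space \<Rightarrow> real"
  assumes int: "integrable lebesgue H" and boxes: "\<And>c d. (LINT x|lebesgue. indicator (box c d) x * H x) = 0"
    and total: "(LINT x|lebesgue. H x) = 0"
  shows "AE x in lebesgue. H x = 0"
proof -
  \<comment> \<open>A Borel representative is needed, since the generated sets are Borel
    sets.\<close>
  obtain H' where H': "H' \<in> borel_measurable lborel" "AE x in lborel. H x = H' x"
    using completion_ex_borel_measurable_real[of H lborel] int by auto
  then have [measurable]: "H' \<in> borel_measurable borel" by simp
  have ae: "AE x in lebesgue. H x = H' x" using H'(2) by (simp add: AE_completion_iff)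
  have "integrable lebesgue H'"
    using int ae H'(1) by (subst integrable_cong_AE[where g = H]) (auto simp: measurable_completion elim: eventually_mono)
  then have int': "integrable lborel H'" using H'(1) by (simp add: integrable_completion)
  have eq: "set_lebesgue_integral lborel A H' = (LINT x|lebesgue. indicator A x * H x)" if A: "A \<in> sets borel" for A
  proof -
    have "set_lebesgue_integral lborel A H' = (LINT x|lebesgue. indicator A x * H' x)"
      using A by (simp add: set_lebesgue_integral_def integral_completion)
    also have "\<dots> = (LINT x|lebesgue. indicator A x * H x)"
    proof (rule integral_cong_AE)
      show "(\<lambda>x. indicator A x * H' x) \<in> borel_measurable lebesgue"
        using A H'(1) by (simp add: measurable_completion)
      have "(\<lambda>x. indicator A x *\<^sub>R H x) \<in> borel_measurable lebesgue"
        using A int by (intro borel_measurable_scaleR borel_measurable_indicator borel_measurable_integrable) auto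
      then show "(\<lambda>x. indicator A x * H x) \<in> borel_measurable lebesgue" by simp
    qed (use ae in eventually_elim, simp)
    finally show ?thesis .
  qed
  have "AE x in lborel. H' x = 0"
  proof (rule sigma_finite_measure.density_zero[OF sigma_finite_lborel int'])
    fix A :: "'a set" assume "A \<in> sets lborel"
    then have sig: "A \<in> sigma_sets UNIV (range (\<lambda>(a, b). box a b))" by (simp add: borel_eq_box)
    have stable: "Int_stable (range (\<lambda>(a, b). box a b :: 'a set))" by (auto simp: Int_stable_def box_Int_box)
    have "range (\<lambda>(a, b). box a b :: 'a set) \<subseteq> Pow UNIV" by auto
    from stable this sig show "set_lebesgue_integral lborel A H' = 0"
    proof (induction rule: sigma_sets_induct_disjoint)
      case (basic A)
      then show ?case using eq boxes by auto
    next
      case (compl A)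
      then have A: "A \<in> sets borel" by (simp add: borel_eq_box)
      have "set_lebesgue_integral lborel (UNIV - A) H' = (LINT x|lborel. H' x - indicator A x *\<^sub>R H' x)"
        unfolding set_lebesgue_integral_def
        by (intro Bochner_Integration.integral_cong) (auto simp: indicator_def)
      also have "\<dots> = (LINT x|lborel. H' x) - set_lebesgue_integral lborel A H'"
        using int' A unfolding set_lebesgue_integral_def
        by (intro Bochner_Integration.integral_diff integrable_mult_indicator) auto
      also have "(LINT x|lborel. H' x) = 0" using eq[of UNIV] total by (simp add: set_lebesgue_integral_def)
      finally show ?case using compl by simp
    next
      case (union A)
      then have A: "A i \<in> sets borel" for i by (auto simp: borel_eq_box)
      have "set_integrable lborel (\<Union>i. A i) H'"
        using A int' unfolding set_integrable_def by (intro integrable_mult_indicator) auto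
      then have "set_lebesgue_integral lborel (\<Union>i. A i) H' = (\<Sum>i. set_lebesgue_integral lborel (A i) H')"
        using A union(1) by (intro lebesgue_integral_countable_add) (auto simp: disjoint_family_on_def)
      then show ?case using union by simp
    qed (auto simp: set_lebesgue_integral_def)
  qed
  then have "AE x in lebesgue. H' x = 0" by (simp add: AE_completion_iff)
  with ae show ?thesis by eventually_elim simp
qed

text \<open>The claim is local: it is proved on each box inside \<Omega> and collected over the
  countably many boxes with rational corners that fill \<Omega>.\<close>

lemma fundamental_lemma:
  fixes h :: "'a::euclidean_space \<Rightarrow> real"
  assumes "open \<Omega>" and h: "h \<in> L2 \<Omega>" and orth: "\<And>\<phi>. \<phi> \<in> test_functions \<Omega> \<Longrightarrow> L2_ip \<Omega> h \<phi> = 0"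
  shows "AE x in lebesgue_on \<Omega>. h x = 0"
proof -
  have \<Omega>: "\<Omega> \<in> sets lebesgue" using assms(1) by auto
  have box: "AE x in lebesgue. x \<in> box a b \<longrightarrow> h x = 0" if sub: "box a b \<subseteq> \<Omega>" for a b
  proof -
    define H where "H x = indicator (box a b) x * h x" for x
    have int: "integrable lebesgue H"
      using L2_integrable_ip[OF L2_indicator_box[OF sub \<Omega>] h] \<Omega> sub
      by (auto simp: integrable_restrict_space H_def indicator_def fun_eq_iff
          elim!: back_subst[where P = "integrable lebesgue"])
    have boxes: "(LINT x|lebesgue. indicator (box c d) x * H x) = 0" for c d
    proof -
      \<comment> \<open>The intersection of two boxes is a box, and this one lies in \<Omega>, where
        box integrals of \<open>h\<close> vanish.\<close>
      obtain c' d' where cd: "box c d \<inter> box a b = box c' d'" by (rule that[OF box_Int_box])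
      have "L2_ip \<Omega> h (indicator (box c' d')) = 0"
        using cd sub by (intro L2_ip_indicator_box_eq_0[OF \<Omega> h orth]) auto
      then have "(LINT x|lebesgue. indicator \<Omega> x * (h x * indicator (box c' d') x)) = 0"
        by (simp add: L2_ip_indicator[OF \<Omega>])
      moreover have "indicator \<Omega> x * (h x * indicator (box c' d') x) = indicator (box c d) x * H x" for x
        unfolding H_def cd[symmetric] using sub by (auto simp: indicator_def)
      ultimately show ?thesis by simp
    qed
    have "(\<lambda>x. indicat_real (box a b) x * H x) = H" by (auto simp: H_def indicator_def fun_eq_iff)
    then have "(LINT x|lebesgue. H x) = 0" using boxes[of a b] by simp
    with int boxes have "AE x in lebesgue. H x = 0" by (rule AE_zero_of_box_integrals)
    then show ?thesis by eventually_elim (auto simp: H_def)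
  qed
  define A B where "A f = (\<Sum>(i::'a)\<in>Basis. fst (f i :: real \<times> real) *\<^sub>R i)"
    and "B f = (\<Sum>(i::'a)\<in>Basis. snd (f i :: real \<times> real) *\<^sub>R i)" for f
  define I where "I = {f \<in> (Basis :: 'a set) \<rightarrow>\<^sub>E \<rat> \<times> (\<rat> :: real set). box (A f) (B f) \<subseteq> \<Omega>}"
  have \<Omega>_eq: "\<Omega> = (\<Union>f\<in>I. box (A f) (B f))"
    unfolding I_def A_def B_def using assms(1) by (rule open_UNION_box)
  have "countable I"
    unfolding I_def by (rule countable_subset[of _ "Basis \<rightarrow>\<^sub>E \<rat> \<times> \<rat>"])
      (auto intro!: countable_PiE countable_SIGMA countable_rat)
  moreover have "AE x in lebesgue. x \<in> box (A f) (B f) \<longrightarrow> h x = 0" if "f \<in> I" for f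
    using that by (intro box) (auto simp: I_def)
  ultimately have "AE x in lebesgue. \<forall>f\<in>I. x \<in> box (A f) (B f) \<longrightarrow> h x = 0"
    by (subst AE_ball_countable) auto
  then show ?thesis
    unfolding AE_lebesgue_on_iff[OF \<Omega>] by eventually_elim (auto simp: \<Omega>_eq)
qed

text \<open>The fundamental lemma, applied to each component of the difference. Allowing two
  functions that agree almost everywhere also covers a change of representative.\<close>

lemma weak_gradient_unique:
  fixes v :: "'a::euclidean_space \<Rightarrow> real"
  assumes "open \<Omega>" "v \<in> L2 \<Omega>" "v' \<in> L2 \<Omega>" "AE x in lebesgue_on \<Omega>. v x = v' x"
    and G: "weak_gradient \<Omega> v G" and G': "weak_gradient \<Omega> v' G'"
  shows "AE x in lebesgue_on \<Omega>. G x = G' x"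
proof -
  have \<Omega>: "\<Omega> \<in> sets lebesgue" using assms(1) by auto
  have L: "G \<in> L2 \<Omega>" "G' \<in> L2 \<Omega>" using G G' by (auto simp: weak_gradient_iff)
  have "AE x in lebesgue_on \<Omega>. (G x - G' x) \<bullet> b = 0" if b: "b \<in> Basis" for b
  proof (rule fundamental_lemma[OF assms(1)])
    show "(\<lambda>x. (G x - G' x) \<bullet> b) \<in> L2 \<Omega>"
      using L2_D(1)[OF L(1)] L2_D(1)[OF L(2)]
      by (intro L2_bound[OF L2_diff[OF L], where c = "norm b"])
         (auto simp: mult.commute[of "norm b"] Cauchy_Schwarz_ineq2)
    fix \<phi> :: "'a \<Rightarrow> real" assume phi: "\<phi> \<in> test_functions \<Omega>"
    have "L2_ip \<Omega> (\<lambda>x. (G x - G' x) \<bullet> b) \<phi> = L2_ip \<Omega> (\<lambda>x. G x - G' x) (\<lambda>x. \<phi> x *\<^sub>R b)"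
      by (simp add: L2_ip_def mult.commute)
    also have "\<dots> = L2_ip \<Omega> G (\<lambda>x. \<phi> x *\<^sub>R b) - L2_ip \<Omega> G' (\<lambda>x. \<phi> x *\<^sub>R b)"
      by (rule L2_ip_diff_left[OF L test_L2_components(2)[OF phi \<Omega>]])
    also have "\<dots> = L2_ip \<Omega> v' (\<lambda>x. classical_grad \<phi> x \<bullet> b) - L2_ip \<Omega> v (\<lambda>x. classical_grad \<phi> x \<bullet> b)"
      using G G' phi b by (simp add: weak_gradient_iff)
    also have "\<dots> = 0"
      using L2_ip_cong_AE[OF assms(2) test_L2_components(1)[OF phi \<Omega>] assms(3) test_L2_components(1)[OF phi \<Omega>] assms(4), of b b]
      by simp
    finally show "L2_ip \<Omega> (\<lambda>x. (G x - G' x) \<bullet> b) \<phi> = 0" .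
  qed
  then have "AE x in lebesgue_on \<Omega>. \<forall>b\<in>Basis. (G x - G' x) \<bullet> b = 0"
    by (simp add: AE_finite_all)
  then show ?thesis by eventually_elim (metis (no_types, lifting) euclidean_all_zero_iff right_minus_eq)
qed

section \<open>The spaces \<open>H1\<close> and \<open>H10\<close>\<close>

lemma H1_D:
  assumes "v \<in> H1 \<Omega>"
  shows "v \<in> L2 \<Omega>" "weak_gradient \<Omega> v (grad \<Omega> v)" "grad \<Omega> v \<in> L2 \<Omega>"
proof -
  show "v \<in> L2 \<Omega>" using assms by (simp add: H1_def)
  show "weak_gradient \<Omega> v (grad \<Omega> v)" using assms unfolding H1_def grad_def by (auto intro: someI_ex[of "weak_gradient \<Omega> v"])
  then show "grad \<Omega> v \<in> L2 \<Omega>" by (simp add: weak_gradient_def)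
qed

text \<open>This is how the choice \<open>grad\<close> is evaluated: any weak gradient agrees with
  it almost everywhere.\<close>

lemma H1_I:
  assumes "open \<Omega>" "v \<in> L2 \<Omega>" "weak_gradient \<Omega> v G"
  shows "v \<in> H1 \<Omega>" "AE x in lebesgue_on \<Omega>. grad \<Omega> v x = G x"
proof -
  show v: "v \<in> H1 \<Omega>" using assms by (auto simp: H1_def)
  show "AE x in lebesgue_on \<Omega>. grad \<Omega> v x = G x"
    by (rule weak_gradient_unique[OF assms(1,2,2) _ H1_D(2)[OF v] assms(3)]) simp
qed

lemma H1_test:
  assumes "open \<Omega>" "\<phi> \<in> test_functions \<Omega>"
  shows "\<phi> \<in> H1 \<Omega>" "AE x in lebesgue_on \<Omega>. grad \<Omega> \<phi> x = classical_grad \<phi> x"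
  using H1_I[OF assms(1) test_L2(1)[OF assms(2)] weak_gradient_test[OF assms(2)]] assms(1) by auto

lemma H1_add:
  assumes "open \<Omega>" "v \<in> H1 \<Omega>" "w \<in> H1 \<Omega>"
  shows "(\<lambda>x. v x + w x) \<in> H1 \<Omega>"
    "AE x in lebesgue_on \<Omega>. grad \<Omega> (\<lambda>x. v x + w x) x = grad \<Omega> v x + grad \<Omega> w x"
  using H1_I[OF assms(1) L2_add weak_gradient_add, OF H1_D(1)[OF assms(2)] H1_D(1)[OF assms(3)] _
      H1_D(1)[OF assms(2)] H1_D(1)[OF assms(3)] H1_D(2)[OF assms(2)] H1_D(2)[OF assms(3)]] assms(1) by auto

lemma H1_cmult:
  assumes "open \<Omega>" "v \<in> H1 \<Omega>"
  shows "(\<lambda>x. c * v x) \<in> H1 \<Omega>"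
    "AE x in lebesgue_on \<Omega>. grad \<Omega> (\<lambda>x. c * v x) x = c *\<^sub>R grad \<Omega> v x"
  using H1_I[OF assms(1) L2_mult weak_gradient_cmult, OF H1_D(1)[OF assms(2)] H1_D(2)[OF assms(2)]] by auto

lemma H1_diff:
  assumes "open \<Omega>" "v \<in> H1 \<Omega>" "w \<in> H1 \<Omega>"
  shows "(\<lambda>x. v x - w x) \<in> H1 \<Omega>"
    "AE x in lebesgue_on \<Omega>. grad \<Omega> (\<lambda>x. v x - w x) x = grad \<Omega> v x - grad \<Omega> w x"
proof -
  note c = H1_cmult[OF assms(1,3), of "-1"]
  note a = H1_add[OF assms(1,2) c(1)]
  show "(\<lambda>x. v x - w x) \<in> H1 \<Omega>" using a(1) by simp
  show "AE x in lebesgue_on \<Omega>. grad \<Omega> (\<lambda>x. v x - w x) x = grad \<Omega> v x - grad \<Omega> w x"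
    using a(2) c(2) by eventually_elim simp
qed

text \<open>The defining \<open>H1\<close> norm contains the chosen gradient of a difference. Here
  it is replaced by two \<open>L2\<close> conditions in which the test functions carry their
  classical gradients.\<close>

lemma test_approx_iff:
  assumes "open \<Omega>" "v \<in> H1 \<Omega>"
  shows "test_approx \<Omega> \<phi> v \<longleftrightarrow> (\<forall>n. \<phi> n \<in> test_functions \<Omega>) \<and>
    (\<lambda>n. L2_norm \<Omega> (\<lambda>x. \<phi> n x - v x)) \<longlonglongrightarrow> 0 \<and>
    (\<lambda>n. L2_norm \<Omega> (\<lambda>x. classical_grad (\<phi> n) x - grad \<Omega> v x)) \<longlonglongrightarrow> 0"
proof (cases "\<forall>n. \<phi> n \<in> test_functions \<Omega>")
  case True
  have \<Omega>: "\<Omega> \<in> sets lebesgue" using assms(1) by auto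
  define a b where "a n = L2_norm \<Omega> (\<lambda>x. \<phi> n x - v x)"
    and "b n = L2_norm \<Omega> (\<lambda>x. classical_grad (\<phi> n) x - grad \<Omega> v x)" for n
  have "L2_norm \<Omega> (grad \<Omega> (\<lambda>x. \<phi> n x - v x)) = b n" for n
  proof -
    have t: "\<phi> n \<in> test_functions \<Omega>" using True by simp
    note d = H1_diff[OF assms(1) H1_test(1)[OF assms(1) t] assms(2)]
    show ?thesis unfolding b_def
    proof (rule L2_norm_cong_AE[OF H1_D(3)[OF d(1)]])
      show "(\<lambda>x. classical_grad (\<phi> n) x - grad \<Omega> v x) \<in> L2 \<Omega>"
        by (intro L2_diff test_L2(2)[OF t \<Omega>] H1_D(3)[OF assms(2)])
      show "AE x in lebesgue_on \<Omega>. grad \<Omega> (\<lambda>x. \<phi> n x - v x) x = classical_grad (\<phi> n) x - grad \<Omega> v x"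
        using d(2) H1_test(2)[OF assms(1) t] by eventually_elim simp
    qed
  qed
  then have H: "H1_norm \<Omega> (\<lambda>x. \<phi> n x - v x) = sqrt ((a n)\<^sup>2 + (b n)\<^sup>2)" for n
    by (simp add: H1_norm_def a_def)
  have pos: "0 \<le> a n" "0 \<le> b n" for n by (auto simp: a_def b_def)
  have "(\<lambda>n. sqrt ((a n)\<^sup>2 + (b n)\<^sup>2)) \<longlonglongrightarrow> 0 \<longleftrightarrow> a \<longlonglongrightarrow> 0 \<and> b \<longlonglongrightarrow> 0"
  proof safe
    assume *: "(\<lambda>n. sqrt ((a n)\<^sup>2 + (b n)\<^sup>2)) \<longlonglongrightarrow> 0"
    show "a \<longlonglongrightarrow> 0" using pos
      by (intro Lim_null_comparison[OF _ *] always_eventually) (auto intro!: real_le_rsqrt)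
    show "b \<longlonglongrightarrow> 0" using pos
      by (intro Lim_null_comparison[OF _ *] always_eventually) (auto intro!: real_le_rsqrt)
  next
    assume "a \<longlonglongrightarrow> 0" "b \<longlonglongrightarrow> 0"
    then have "(\<lambda>n. sqrt ((a n)\<^sup>2 + (b n)\<^sup>2)) \<longlonglongrightarrow> sqrt (0\<^sup>2 + 0\<^sup>2)" by (intro tendsto_intros)
    then show "(\<lambda>n. sqrt ((a n)\<^sup>2 + (b n)\<^sup>2)) \<longlonglongrightarrow> 0" by simp
  qed
  then show ?thesis using True by (simp add: test_approx_def H a_def[abs_def] b_def[abs_def])
qed (auto simp: test_approx_def)

text \<open>By closedness of weak differentiation the limit \<open>G\<close> of the gradients is a
  gradient of the limit \<open>v\<close>. Functions constructed as limits enter \<open>H10\<close>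
  this way, and their gradients come along.\<close>

lemma test_approxI:
  assumes "open \<Omega>" "\<And>n. \<phi> n \<in> test_functions \<Omega>" "v \<in> L2 \<Omega>" "G \<in> L2 \<Omega>"
    "(\<lambda>n. L2_norm \<Omega> (\<lambda>x. \<phi> n x - v x)) \<longlonglongrightarrow> 0"
    "(\<lambda>n. L2_norm \<Omega> (\<lambda>x. classical_grad (\<phi> n) x - G x)) \<longlonglongrightarrow> 0"
  shows "v \<in> H10 \<Omega>" "test_approx \<Omega> \<phi> v" "AE x in lebesgue_on \<Omega>. grad \<Omega> v x = G x"
proof -
  have \<Omega>: "\<Omega> \<in> sets lebesgue" using assms(1) by auto
  have "weak_gradient \<Omega> v G"
    by (rule weak_gradient_limit[OF \<Omega> test_L2(1)[OF assms(2) \<Omega>] weak_gradient_test[OF assms(2) \<Omega>] assms(3-6)])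
  note v = H1_I[OF assms(1,3) this]
  show "AE x in lebesgue_on \<Omega>. grad \<Omega> v x = G x" by (rule v(2))
  have "L2_norm \<Omega> (\<lambda>x. classical_grad (\<phi> n) x - grad \<Omega> v x) = L2_norm \<Omega> (\<lambda>x. classical_grad (\<phi> n) x - G x)" for n
    using v(2) by (intro L2_norm_cong_AE L2_diff test_L2(2)[OF assms(2) \<Omega>] H1_D(3)[OF v(1)] assms(4)) auto
  then show "test_approx \<Omega> \<phi> v" using assms(2,5,6) by (simp add: test_approx_iff[OF assms(1) v(1)])
  then show "v \<in> H10 \<Omega>" using v(1) by (auto simp: H10_def)
qed

lemma test_approxD:
  assumes "open \<Omega>" "v \<in> H1 \<Omega>" "test_approx \<Omega> \<phi> v"
  shows "\<phi> n \<in> test_functions \<Omega>" "(\<lambda>n. L2_norm \<Omega> (\<lambda>x. \<phi> n x - v x)) \<longlonglongrightarrow> 0"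
    "(\<lambda>n. L2_norm \<Omega> (\<lambda>x. classical_grad (\<phi> n) x - grad \<Omega> v x)) \<longlonglongrightarrow> 0"
  using assms test_approx_iff[OF assms(1,2)] by auto

lemma H10_H1: "v \<in> H10 \<Omega> \<Longrightarrow> v \<in> H1 \<Omega>"
  by (simp add: H10_def)

lemma test_approx_add:
  assumes "open \<Omega>" "v \<in> H1 \<Omega>" "w \<in> H1 \<Omega>" "test_approx \<Omega> \<phi> v" "test_approx \<Omega> \<psi> w"
  shows "test_approx \<Omega> (\<lambda>n x. \<phi> n x + \<psi> n x) (\<lambda>x. v x + w x)"
proof (rule test_approxI(2)[OF assms(1)])
  have \<Omega>: "\<Omega> \<in> sets lebesgue" using assms(1) by auto
  note v = test_approxD[OF assms(1,2,4)] and w = test_approxD[OF assms(1,3,5)]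
  show "(\<lambda>x. \<phi> n x + \<psi> n x) \<in> test_functions \<Omega>" for n by (intro test_add v(1) w(1))
  show "(\<lambda>x. v x + w x) \<in> L2 \<Omega>" "(\<lambda>x. grad \<Omega> v x + grad \<Omega> w x) \<in> L2 \<Omega>"
    by (intro L2_add H1_D(1,3) assms)+
  have "(\<lambda>n. L2_norm \<Omega> (\<lambda>x. (\<phi> n x - v x) + (\<psi> n x - w x))) \<longlonglongrightarrow> 0"
    by (intro L2_norm_add_tendsto_0 v(2) w(2) L2_diff test_L2(1)[OF v(1) \<Omega>] test_L2(1)[OF w(1) \<Omega>] H1_D(1) assms)
  then show "(\<lambda>n. L2_norm \<Omega> (\<lambda>x. (\<phi> n x + \<psi> n x) - (v x + w x))) \<longlonglongrightarrow> 0" by (simp add: algebra_simps)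
  have "(\<lambda>n. L2_norm \<Omega> (\<lambda>x. (classical_grad (\<phi> n) x - grad \<Omega> v x) + (classical_grad (\<psi> n) x - grad \<Omega> w x))) \<longlonglongrightarrow> 0"
    by (intro L2_norm_add_tendsto_0 v(3) w(3) L2_diff test_L2(2)[OF v(1) \<Omega>] test_L2(2)[OF w(1) \<Omega>] H1_D(3) assms)
  then show "(\<lambda>n. L2_norm \<Omega> (\<lambda>x. classical_grad (\<lambda>x. \<phi> n x + \<psi> n x) x - (grad \<Omega> v x + grad \<Omega> w x))) \<longlonglongrightarrow> 0"
    by (simp add: classical_grad_add test_smooth[OF v(1)] test_smooth[OF w(1)] algebra_simps)
qed

text \<open>For test functions the product rule is classical, and both of its terms depend
  continuously on the approximated function because \<open>h\<close> and its gradient are bounded on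
  \<Omega>.\<close>

lemma test_approx_mult:
  fixes h :: "'a::euclidean_space \<Rightarrow> real"
  assumes \<Omega>o: "open \<Omega>" and v: "v \<in> H1 \<Omega>" "test_approx \<Omega> \<phi> v" and h: "smooth h"
    and B: "\<And>x. x \<in> \<Omega> \<Longrightarrow> \<bar>h x\<bar> \<le> B" "\<And>x. x \<in> \<Omega> \<Longrightarrow> norm (classical_grad h x) \<le> B"
  shows "test_approx \<Omega> (\<lambda>n x. h x * \<phi> n x) (\<lambda>x. h x * v x)" "(\<lambda>x. h x * v x) \<in> H10 \<Omega>"
    "AE x in lebesgue_on \<Omega>. grad \<Omega> (\<lambda>x. h x * v x) x = h x *\<^sub>R grad \<Omega> v x + v x *\<^sub>R classical_grad h x"
proof -
  have \<Omega>: "\<Omega> \<in> sets lebesgue" using \<Omega>o by auto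
  have meas: "h \<in> borel_measurable (lebesgue_on \<Omega>)" "classical_grad h \<in> borel_measurable (lebesgue_on \<Omega>)"
    using h \<Omega> by (auto intro!: continuous_imp_measurable_on_sets_lebesgue smooth_continuous_on continuous_on_classical_grad)
  have m1: "(\<lambda>x. h x *\<^sub>R f x) \<in> L2 \<Omega>" "L2_norm \<Omega> (\<lambda>x. h x *\<^sub>R f x) \<le> \<bar>B\<bar> * L2_norm \<Omega> f" if f: "f \<in> L2 \<Omega>" for f :: "'a \<Rightarrow> 'c::euclidean_space"
  proof -
    have bd: "norm (h x *\<^sub>R f x) \<le> \<bar>B\<bar> * norm (f x)" if "x \<in> \<Omega>" for x
      using B(1)[OF that] by (auto intro!: mult_right_mono)
    show *: "(\<lambda>x. h x *\<^sub>R f x) \<in> L2 \<Omega>"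
      using L2_D(1)[OF f] meas(1) by (intro L2_bound[OF f _ bd]) auto
    show "L2_norm \<Omega> (\<lambda>x. h x *\<^sub>R f x) \<le> \<bar>B\<bar> * L2_norm \<Omega> f" by (rule L2_norm_mono[OF * f bd]) auto
  qed
  have m2: "(\<lambda>x. f x *\<^sub>R classical_grad h x) \<in> L2 \<Omega>"
    "L2_norm \<Omega> (\<lambda>x. f x *\<^sub>R classical_grad h x) \<le> \<bar>B\<bar> * L2_norm \<Omega> f" if f: "f \<in> L2 \<Omega>" for f :: "'a \<Rightarrow> real"
  proof -
    have bd: "norm (f x *\<^sub>R classical_grad h x) \<le> \<bar>B\<bar> * norm (f x)" if "x \<in> \<Omega>" for x
    proof -
      have "norm (classical_grad h x) \<le> \<bar>B\<bar>" using B(2)[OF that] by simp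
      from mult_left_mono[OF this, of "\<bar>f x\<bar>"] show ?thesis by (simp add: mult.commute)
    qed
    show *: "(\<lambda>x. f x *\<^sub>R classical_grad h x) \<in> L2 \<Omega>"
      using L2_D(1)[OF f] meas(2) by (intro L2_bound[OF f _ bd]) auto
    show "L2_norm \<Omega> (\<lambda>x. f x *\<^sub>R classical_grad h x) \<le> \<bar>B\<bar> * L2_norm \<Omega> f" by (rule L2_norm_mono[OF * f bd]) auto
  qed
  note a = test_approxD[OF \<Omega>o v]
  note L = H1_D(1)[OF v(1)] H1_D(3)[OF v(1)]
  have d: "(\<lambda>x. \<phi> n x - v x) \<in> L2 \<Omega>" "(\<lambda>x. classical_grad (\<phi> n) x - grad \<Omega> v x) \<in> L2 \<Omega>" for n
    by (intro L2_diff test_L2[OF a(1) \<Omega>] L)+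
  have t1: "\<And>n. (\<lambda>x. h x * \<phi> n x) \<in> test_functions \<Omega>" by (rule test_mult_smooth[OF a(1) h])
  have t2: "(\<lambda>x. h x * v x) \<in> L2 \<Omega>" using m1(1)[OF L(1)] by simp
  have t3: "(\<lambda>x. h x *\<^sub>R grad \<Omega> v x + v x *\<^sub>R classical_grad h x) \<in> L2 \<Omega>" by (intro L2_add m1(1) m2(1) L)
  have lim0: "(\<lambda>n. \<bar>B\<bar> * L2_norm \<Omega> (\<lambda>x. \<phi> n x - v x)) \<longlonglongrightarrow> 0" using tendsto_mult_left[OF a(2), of "\<bar>B\<bar>"] by simp
  have lim1: "(\<lambda>n. \<bar>B\<bar> * L2_norm \<Omega> (\<lambda>x. classical_grad (\<phi> n) x - grad \<Omega> v x)) \<longlonglongrightarrow> 0"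
    using tendsto_mult_left[OF a(3), of "\<bar>B\<bar>"] by simp
  have t4: "(\<lambda>n. L2_norm \<Omega> (\<lambda>x. h x * \<phi> n x - h x * v x)) \<longlonglongrightarrow> 0"
    using m1(2)[OF d(1)] by (intro Lim_null_comparison[OF _ lim0] always_eventually) (simp add: right_diff_distrib)
  have "(\<lambda>n. L2_norm \<Omega> (\<lambda>x. h x *\<^sub>R (classical_grad (\<phi> n) x - grad \<Omega> v x) + (\<phi> n x - v x) *\<^sub>R classical_grad h x)) \<longlonglongrightarrow> 0"
  proof (rule L2_norm_add_tendsto_0[OF m1(1)[OF d(2)] m2(1)[OF d(1)]])
    show "(\<lambda>n. L2_norm \<Omega> (\<lambda>x. h x *\<^sub>R (classical_grad (\<phi> n) x - grad \<Omega> v x))) \<longlonglongrightarrow> 0"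
      using m1(2)[OF d(2)] by (intro Lim_null_comparison[OF _ lim1] always_eventually) simp
    show "(\<lambda>n. L2_norm \<Omega> (\<lambda>x. (\<phi> n x - v x) *\<^sub>R classical_grad h x)) \<longlonglongrightarrow> 0"
      using m2(2)[OF d(1)] by (intro Lim_null_comparison[OF _ lim0] always_eventually) simp
  qed
  then have t5: "(\<lambda>n. L2_norm \<Omega> (\<lambda>x. classical_grad (\<lambda>x. h x * \<phi> n x) x - (h x *\<^sub>R grad \<Omega> v x + v x *\<^sub>R classical_grad h x))) \<longlonglongrightarrow> 0"
    by (simp add: classical_grad_mult h test_smooth[OF a(1)] algebra_simps)
  show "test_approx \<Omega> (\<lambda>n x. h x * \<phi> n x) (\<lambda>x. h x * v x)" "(\<lambda>x. h x * v x) \<in> H10 \<Omega>"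
    "AE x in lebesgue_on \<Omega>. grad \<Omega> (\<lambda>x. h x * v x) x = h x *\<^sub>R grad \<Omega> v x + v x *\<^sub>R classical_grad h x"
    using test_approxI[OF \<Omega>o t1 t2 t3 t4 t5] by auto
qed

lemma H10_D:
  assumes "open \<Omega>" "v \<in> H10 \<Omega>"
  obtains \<phi> where "test_approx \<Omega> \<phi> v"
  using assms by (auto simp: H10_def)

lemma H10_add: "open \<Omega> \<Longrightarrow> v \<in> H10 \<Omega> \<Longrightarrow> w \<in> H10 \<Omega> \<Longrightarrow> (\<lambda>x. v x + w x) \<in> H10 \<Omega>"
  using test_approx_add H1_add(1) unfolding H10_def by blast

lemma test_approx_cmult:
  assumes "open \<Omega>" "v \<in> H1 \<Omega>" "test_approx \<Omega> \<phi> v"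
  shows "test_approx \<Omega> (\<lambda>n x. c * \<phi> n x) (\<lambda>x. c * v x)"
  using test_approx_mult(1)[OF assms smooth_intros(1), of c "\<bar>c\<bar>"] by (simp add: classical_grad_const)

lemma H10_cmult: "open \<Omega> \<Longrightarrow> v \<in> H10 \<Omega> \<Longrightarrow> (\<lambda>x. c * v x) \<in> H10 \<Omega>"
  using test_approx_cmult H1_cmult(1) unfolding H10_def by blast

lemma test_approx_diff:
  assumes "open \<Omega>" "v \<in> H1 \<Omega>" "w \<in> H1 \<Omega>" "test_approx \<Omega> \<phi> v" "test_approx \<Omega> \<psi> w"
  shows "test_approx \<Omega> (\<lambda>n x. \<phi> n x - \<psi> n x) (\<lambda>x. v x - w x)"
  using test_approx_add[OF assms(1,2) H1_cmult(1)[OF assms(1,3)] assms(4) test_approx_cmult[OF assms(1,3,5)], of "-1"]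
  by simp

lemma H10_diff: "open \<Omega> \<Longrightarrow> v \<in> H10 \<Omega> \<Longrightarrow> w \<in> H10 \<Omega> \<Longrightarrow> (\<lambda>x. v x - w x) \<in> H10 \<Omega>"
  using test_approx_diff H1_diff(1) unfolding H10_def by blast

lemma H10_test: "open \<Omega> \<Longrightarrow> \<phi> \<in> test_functions \<Omega> \<Longrightarrow> \<phi> \<in> H10 \<Omega>"
  using test_approxI(1)[of \<Omega> "\<lambda>n. \<phi>" \<phi> "classical_grad \<phi>"] test_L2[of \<phi> \<Omega> \<Omega>] by auto

section \<open>Geometry of the chain of subdomains\<close>

definition reflect :: "real \<Rightarrow> real \<times> real \<Rightarrow> real \<times> real" where
  "reflect c x = (2 * c - fst x, snd x)"

lemma reflect_reflect [simp]: "reflect c (reflect c x) = x"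
  by (simp add: reflect_def)

lemma fst_reflect [simp]: "fst (reflect c x) = 2 * c - fst x"
  and snd_reflect [simp]: "snd (reflect c x) = snd x"
  by (simp_all add: reflect_def)

lemma continuous_on_reflect: "continuous_on A (reflect c)"
  unfolding reflect_def by (intro continuous_intros)

text \<open>The abscissa in the first subdomain of the point corresponding to \<open>x\<close> in subdomain \<open>j\<close>.\<close>

definition base_abscissa :: "nat \<Rightarrow> real \<Rightarrow> real" where
  "base_abscissa j s = (if odd j then s - (real j - 1) else real j - s)"

text \<open>Unwinds the recursion. Each reflection reverses the orientation, so odd subdomains are
  translates of the first one and even subdomains are its mirror images.\<close>

lemma subdomain_iff:
  assumes "1 \<le> j"
  shows "x \<in> subdomain r1 r2 j \<longleftrightarrow> real j - 1 < fst x \<and> fst x < real j \<and>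
    r1 (base_abscissa j (fst x)) < snd x \<and> snd x < r2 (base_abscissa j (fst x))"
  using assms
proof (induction r1 r2 j arbitrary: x rule: subdomain.induct)
  case (3 r1 r2 i)
  have u: "base_abscissa (Suc (Suc i)) s = base_abscissa (Suc i) (2 * real (Suc i) - s)" for s
    by (auto simp: base_abscissa_def)
  have "x \<in> subdomain r1 r2 (Suc (Suc i)) \<longleftrightarrow> (2 * real (Suc i) - fst x, snd x) \<in> subdomain r1 r2 (Suc i)"
    by (cases x) simp
  also have "\<dots> \<longleftrightarrow> real (Suc i) - 1 < 2 * real (Suc i) - fst x \<and> 2 * real (Suc i) - fst x < real (Suc i) \<and>
    r1 (base_abscissa (Suc i) (2 * real (Suc i) - fst x)) < snd x \<and> snd x < r2 (base_abscissa (Suc i) (2 * real (Suc i) - fst x))"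
    by (subst 3) auto
  finally show ?case unfolding u by auto
qed (auto simp: base_abscissa_def)

text \<open>Subdomain \<open>k\<close> lies over the interval from \<open>k - 1\<close> to
  \<open>k\<close>, and the mirror image of that interval in \<open>i\<close> runs from
  \<open>2 i - k\<close> to \<open>2 i + 1 - k\<close>. The new index has the other parity, in
  accordance with the reversed orientation.\<close>

lemma subdomain_reflect:
  assumes "1 \<le> k" "k \<le> 2 * i"
  shows "reflect (real i) x \<in> subdomain r1 r2 k \<longleftrightarrow> x \<in> subdomain r1 r2 (2 * i + 1 - k)"
proof -
  have "base_abscissa k (2 * real i - fst x) = base_abscissa (2 * i + 1 - k) (fst x)"
    using assms by (auto simp: base_abscissa_def of_nat_diff)
  then show ?thesis using assms by (subst (1 2) subdomain_iff) (auto simp: of_nat_diff)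
qed

text \<open>Lipschitz profiles enter through continuity and a common bound \<open>B\<close>. Both
  concern the open interval, on which continuity alone yields no bound; \<open>B\<close> makes the
  domain bounded.\<close>

locale chain =
  fixes N :: nat and r1 r2 :: "real \<Rightarrow> real" and B :: real
  assumes N_pos: "0 < N"
    and cont: "continuous_on {0<..<1} r1" "continuous_on {0<..<1} r2"
    and bound: "\<And>t. t \<in> {0<..<1} \<Longrightarrow> \<bar>r1 t\<bar> \<le> B" "\<And>t. t \<in> {0<..<1} \<Longrightarrow> \<bar>r2 t\<bar> \<le> B"
    and r1_less_r2: "\<And>t. t \<in> {0<..<1} \<Longrightarrow> r1 t < r2 t"
begin

abbreviation S :: "nat \<Rightarrow> (real \<times> real) set" where "S \<equiv> subdomain r1 r2"
abbreviation Om :: "(real \<times> real) set" where "Om \<equiv> domain N r1 r2"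

lemma base_abscissa_in_unit: "1 \<le> j \<Longrightarrow> real j - 1 < s \<Longrightarrow> s < real j \<Longrightarrow> base_abscissa j s \<in> {0<..<1}"
  by (auto simp: base_abscissa_def)

lemma continuous_on_profile:
  assumes "1 \<le> j"
  shows "continuous_on ({real j - 1<..<real j} \<times> (UNIV :: real set)) (\<lambda>x. r1 (base_abscissa j (fst x)))"
    "continuous_on ({real j - 1<..<real j} \<times> (UNIV :: real set)) (\<lambda>x. r2 (base_abscissa j (fst x)))"
proof -
  have u: "continuous_on X (\<lambda>x::real \<times> real. base_abscissa j (fst x))" for X
    unfolding base_abscissa_def by (cases "odd j") (auto intro!: continuous_intros)
  show "continuous_on ({real j - 1<..<real j} \<times> (UNIV :: real set)) (\<lambda>x. r1 (base_abscissa j (fst x)))"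
    using continuous_on_compose2[OF cont(1) u[of "{real j - 1<..<real j} \<times> UNIV"]] base_abscissa_in_unit[OF assms]
    by (force simp: image_subset_iff)
  show "continuous_on ({real j - 1<..<real j} \<times> (UNIV :: real set)) (\<lambda>x. r2 (base_abscissa j (fst x)))"
    using continuous_on_compose2[OF cont(2) u[of "{real j - 1<..<real j} \<times> UNIV"]] base_abscissa_in_unit[OF assms]
    by (force simp: image_subset_iff)
qed

lemma open_strip: "open ({a<..<b::real} \<times> (UNIV :: real set))"
  by (intro open_Times) auto

text \<open>The first two sets intersect in \<open>S j\<close>. The other two are disjoint from it
  and, being open, from its closure, so that closure points over the strip lie between the
  profiles.\<close>

lemma open_subgraphs:
  assumes "1 \<le> j"
  shows "open {x. real j - 1 < fst x \<and> fst x < real j \<and> r1 (base_abscissa j (fst x)) < snd x}" (is "open ?A")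
    "open {x. real j - 1 < fst x \<and> fst x < real j \<and> snd x < r2 (base_abscissa j (fst x))}" (is "open ?B")
    "open {x. real j - 1 < fst x \<and> fst x < real j \<and> snd x < r1 (base_abscissa j (fst x))}" (is "open ?C")
    "open {x. real j - 1 < fst x \<and> fst x < real j \<and> r2 (base_abscissa j (fst x)) < snd x}" (is "open ?D")
proof -
  let ?U = "{real j - 1<..<real j} \<times> (UNIV :: real set)"
  have *: "open (?U \<inter> f -` {0<..})" if "continuous_on ?U f" for f :: "real \<times> real \<Rightarrow> real"
    using that by (intro continuous_open_preimage open_strip) auto
  have "?A = ?U \<inter> (\<lambda>x. snd x - r1 (base_abscissa j (fst x))) -` {0<..}"
    "?B = ?U \<inter> (\<lambda>x. r2 (base_abscissa j (fst x)) - snd x) -` {0<..}"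
    "?C = ?U \<inter> (\<lambda>x. r1 (base_abscissa j (fst x)) - snd x) -` {0<..}"
    "?D = ?U \<inter> (\<lambda>x. snd x - r2 (base_abscissa j (fst x))) -` {0<..}" by auto
  then show "open ?A" "open ?B" "open ?C" "open ?D"
    using continuous_on_profile[OF assms]
    by (auto simp only: intro!: * continuous_intros)
qed

lemma open_S: assumes "1 \<le> j" shows "open (S j)"
proof -
  have "S j = {x. real j - 1 < fst x \<and> fst x < real j \<and> r1 (base_abscissa j (fst x)) < snd x} \<inter>
      {x. real j - 1 < fst x \<and> fst x < real j \<and> snd x < r2 (base_abscissa j (fst x))}"
    using subdomain_iff[OF assms] by auto
  then show ?thesis using open_subgraphs[OF assms] by auto
qed

lemma S_bounds: "1 \<le> j \<Longrightarrow> x \<in> S j \<Longrightarrow> real j - 1 < fst x \<and> fst x < real j \<and> \<bar>snd x\<bar> \<le> B"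
  using bound[OF base_abscissa_in_unit, of j "fst x"] by (force simp: subdomain_iff)

lemma closure_S_bounds:
  assumes "1 \<le> j" "x \<in> closure (S j)" shows "real j - 1 \<le> fst x" "fst x \<le> real j" "\<bar>snd x\<bar> \<le> B"
proof -
  have "S j \<subseteq> {real j - 1..real j} \<times> {-B..B}" using S_bounds[OF assms(1)] by (fastforce simp: abs_le_iff)
  then have "closure (S j) \<subseteq> {real j - 1..real j} \<times> {-B..B}" by (intro closure_minimal closed_Times) auto
  then show "real j - 1 \<le> fst x" "fst x \<le> real j" "\<bar>snd x\<bar> \<le> B" using assms(2)
    by (auto simp: abs_le_iff mem_Times_iff)
qed

lemma closure_S_strip:
  assumes j: "1 \<le> j" and x: "x \<in> closure (S j)" "real j - 1 < fst x" "fst x < real j"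
  shows "r1 (base_abscissa j (fst x)) \<le> snd x" "snd x \<le> r2 (base_abscissa j (fst x))"
proof -
  note ue = base_abscissa_in_unit[OF j]
  show "r1 (base_abscissa j (fst x)) \<le> snd x"
  proof (rule ccontr)
    assume "\<not> ?thesis"
    then have "x \<in> {x. real j - 1 < fst x \<and> fst x < real j \<and> snd x < r1 (base_abscissa j (fst x))}" using x by auto
    then have "{x. real j - 1 < fst x \<and> fst x < real j \<and> snd x < r1 (base_abscissa j (fst x))} \<inter> S j \<noteq> {}"
      using x(1) open_Int_closure_eq_empty[OF open_subgraphs(3)[OF j], of "S j"] by blast
    then show False using subdomain_iff[OF j] by force
  qed
  show "snd x \<le> r2 (base_abscissa j (fst x))"
  proof (rule ccontr)
    assume "\<not> ?thesis"
    then have "x \<in> {x. real j - 1 < fst x \<and> fst x < real j \<and> r2 (base_abscissa j (fst x)) < snd x}" using x by auto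
    then have "{x. real j - 1 < fst x \<and> fst x < real j \<and> r2 (base_abscissa j (fst x)) < snd x} \<inter> S j \<noteq> {}"
      using x(1) open_Int_closure_eq_empty[OF open_subgraphs(4)[OF j], of "S j"] by blast
    then show False using subdomain_iff[OF j] by force
  qed
qed

section \<open>The assembled domain and its symmetries\<close>

lemma open_Om: "open Om"
  by (simp add: domain_def)

lemma Om_D:
  assumes "x \<in> Om"
  obtains k where "k \<in> {1..N}" "x \<in> closure (S k)"
  using assms interior_subset[of "\<Union>i\<in>{1..N}. closure (S i)"] unfolding domain_def by blast

lemma Om_subset: "Om \<subseteq> {0<..<real N} \<times> {-B<..<B}"
proof -
  have "(\<Union>i\<in>{1..N}. closure (S i)) \<subseteq> {0..real N} \<times> {-B..B}"
  proof
    fix x assume "x \<in> (\<Union>i\<in>{1..N}. closure (S i))"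
    then obtain i where i: "1 \<le> i" "i \<le> N" "x \<in> closure (S i)" by auto
    have "1 \<le> real i" "real i \<le> real N" using i by auto
    then show "x \<in> {0..real N} \<times> {-B..B}"
      using closure_S_bounds[OF i(1,3)] by (cases x) (auto simp: abs_le_iff)
  qed
  from interior_mono[OF this] show ?thesis
    unfolding domain_def interior_Times by (simp add: interior_atLeastAtMost_real)
qed

lemma S_subset_Om: assumes "j \<in> {1..N}" shows "S j \<subseteq> Om"
proof -
  have "S j \<subseteq> (\<Union>i\<in>{1..N}. closure (S i))" using assms closure_subset by blast
  then show ?thesis using assms unfolding domain_def by (intro interior_maximal open_S) auto
qed

text \<open>Over an open strip the interior of the union of closures adds nothing to
  \<open>S j\<close>: a whole neighborhood of \<open>x\<close> lies in the closure, so
  \<open>x\<close> can be moved up and down a little, which turns the weak inequalities between the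
  profiles into strict ones.\<close>

lemma Om_strip:
  assumes j: "j \<in> {1..N}" and x: "x \<in> Om" "real j - 1 < fst x" "fst x < real j"
  shows "x \<in> S j"
proof -
  have j1: "1 \<le> j" using j by simp
  define W where "W = Om \<inter> ({real j - 1<..<real j} \<times> UNIV)"
  have W: "y \<in> closure (S j)" if y: "y \<in> W" for y
  proof -
    obtain k where k: "k \<in> {1..N}" "y \<in> closure (S k)" using y Om_D by (auto simp: W_def)
    have "real k - 1 \<le> fst y" "fst y \<le> real k" using closure_S_bounds[of k y] k by auto
    moreover have "real j - 1 < fst y" "fst y < real j" using y by (auto simp: W_def)
    ultimately have "real k < real j + 1" "real j < real k + 1" by linarith+
    then have "k = j" by linarith
    then show ?thesis using k by simp
  qed
  have "open W" unfolding W_def by (intro open_Int open_Om open_strip)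
  moreover have "x \<in> W" using x by (cases x) (auto simp: W_def)
  ultimately obtain e where e: "e > 0" "ball x e \<subseteq> W" using openE by blast
  have pt: "(fst x, snd x + d) \<in> W" if "\<bar>d\<bar> < e" for d
    using e(2) that by (cases x) (auto simp: dist_Pair_Pair dist_real_def)
  have "r1 (base_abscissa j (fst x)) \<le> snd x - e / 2" "snd x + e / 2 \<le> r2 (base_abscissa j (fst x))"
    using closure_S_strip[OF j1 W[OF pt[of "- e / 2"]]] closure_S_strip[OF j1 W[OF pt[of "e / 2"]]] x e(1) by auto
  then show ?thesis using x e(1) by (auto simp: subdomain_iff[OF j1])
qed

lemma closure_S_reflect:
  assumes "1 \<le> k" "k \<le> 2 * i" "reflect (real i) x \<in> closure (S k)"
  shows "x \<in> closure (S (2 * i + 1 - k))"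
proof -
  have "reflect (real i) ` closure (S k) \<subseteq> closure (reflect (real i) ` S k)"
    by (rule continuous_image_closure_subset[OF continuous_on_reflect[of UNIV]]) simp
  moreover have "reflect (real i) ` S k \<subseteq> S (2 * i + 1 - k)"
  proof (intro image_subsetI)
    fix y assume "y \<in> S k"
    then show "reflect (real i) y \<in> S (2 * i + 1 - k)"
      using subdomain_reflect[OF assms(1,2), of "reflect (real i) y" r1 r2] by simp
  qed
  ultimately have "reflect (real i) ` closure (S k) \<subseteq> closure (S (2 * i + 1 - k))"
    using closure_mono by blast
  then show ?thesis using assms(3) by force
qed

text \<open>A point of the line \<open>x1 = i\<close> is fixed by the reflection that exchanges
  \<open>S i\<close> and \<open>S (Suc i)\<close>, so it lies in both closures as soon as it lies in
  one.\<close>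

lemma Om_interface:
  assumes i: "1 \<le> i" and x: "x \<in> Om" "fst x = real i"
  shows "x \<in> interface r1 r2 i"
proof -
  obtain k where k: "k \<in> {1..N}" "x \<in> closure (S k)" using x(1) by (rule Om_D)
  have rx: "reflect (real i) x = x" using x(2) by (simp add: reflect_def prod_eq_iff)
  have "real k - 1 \<le> real i" "real i \<le> real k" using closure_S_bounds[of k x] k x(2) by auto
  then have "k = i \<or> k = Suc i" by linarith
  then have "x \<in> closure (S i) \<and> x \<in> closure (S (Suc i))"
    using closure_S_reflect[of i i x] closure_S_reflect[of "Suc i" i x] k(2) i rx by auto
  moreover have "x \<notin> S i" "x \<notin> S (Suc i)" using x(2) i by (auto simp: subdomain_iff)
  ultimately show ?thesis
    using open_S[of i] open_S[of "Suc i"] i by (simp add: interface_def frontier_def interior_open)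
qed

text \<open>Reflection in \<open>i\<close> maps the subdomains with indices \<open>a + 1\<close> to
  \<open>b\<close> onto those with indices \<open>2 i + 1 - b\<close> to \<open>2 i - a\<close>; the
  two inequalities keep these between 1 and \<open>N\<close>. As the domain is an interior, an open
  set around the image is placed in the union of closures.\<close>

lemma reflect_Om:
  assumes "b \<le> 2 * i" "2 * i \<le> a + N" and x: "x \<in> Om" "real a < fst x" "fst x < real b"
  shows "reflect (real i) x \<in> Om"
proof -
  define W where "W = reflect (real i) -` (Om \<inter> ({real a<..<real b} \<times> UNIV))"
  have "open W" unfolding W_def
    by (intro open_vimage[OF open_Int[OF open_Om open_strip]] continuous_on_reflect)
  moreover have "W \<subseteq> (\<Union>i\<in>{1..N}. closure (S i))"
  proof
    fix y assume y: "y \<in> W"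
    then obtain k where k: "k \<in> {1..N}" "reflect (real i) y \<in> closure (S k)" using Om_D unfolding W_def by blast
    have "real k - 1 \<le> fst (reflect (real i) y)" "fst (reflect (real i) y) \<le> real k"
      using closure_S_bounds[of k "reflect (real i) y"] k by auto
    moreover have "real a < fst (reflect (real i) y)" "fst (reflect (real i) y) < real b"
      using y by (simp_all add: W_def mem_Times_iff)
    ultimately have "real a < real k" "real k < real b + 1" by linarith+
    then have ak: "a < k" "k \<le> b" by auto
    then have "k \<le> 2 * i" using assms by simp
    then have "y \<in> closure (S (2 * i + 1 - k))" using closure_S_reflect[of k i y] k by simp
    moreover have "2 * i + 1 - k \<in> {1..N}" using ak assms(1,2) k(1) by auto
    ultimately show "y \<in> (\<Union>i\<in>{1..N}. closure (S i))" by blast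
  qed
  ultimately have "W \<subseteq> Om" unfolding domain_def by (metis interior_maximal)
  moreover have "reflect (real i) x \<in> W" using x by (cases x) (auto simp: W_def)
  ultimately show ?thesis by blast
qed

section \<open>Measurability of the domain, its pieces and the interfaces\<close>

lemma bounded_Om: "bounded Om"
  by (rule bounded_subset[OF _ Om_subset]) (auto intro: bounded_Times)

lemma sets_Om [simp, intro]: "Om \<in> sets lebesgue"
  using open_Om by auto

lemma sets_S [intro]: "1 \<le> j \<Longrightarrow> S j \<in> sets lebesgue"
  using open_S by auto

lemma lmeasurable_Om [simp, intro]: "Om \<in> lmeasurable"
  by (rule lmeasurable_open[OF bounded_Om open_Om])

lemma disjoint_S: "disjoint_family_on S {1..N}"
  unfolding disjoint_family_on_def
proof (intro ballI impI equals0I)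
  fix i j x assume ij: "i \<in> {1..N}" "j \<in> {1..N}" "i \<noteq> j" and x: "x \<in> S i \<inter> S j"
  then have "real i - 1 < fst x" "fst x < real i" "real j - 1 < fst x" "fst x < real j"
    by (auto simp: subdomain_iff)
  then have "i = j" by linarith
  then show False using ij by simp
qed

text \<open>The points left out lie on the lines \<open>x1 = j\<close>, which are null sets.
  Elsewhere the index of the subdomain is the abscissa rounded up.\<close>

lemma AE_in_S: "AE x in lebesgue_on Om. x \<in> (\<Union>i\<in>{1..N}. S i)"
proof -
  have "negligible (\<Union>j\<in>{..N}. {x :: real \<times> real. x \<bullet> (1, 0) = real j})"
    by (intro negligible_Union) (auto intro!: negligible_standard_hyperplane simp: Basis_prod_def)
  then have "AE x in lebesgue. x \<notin> (\<Union>j\<in>{..N}. {x :: real \<times> real. x \<bullet> (1, 0) = real j})"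
    unfolding negligible_iff_null_sets by (rule AE_not_in)
  then show ?thesis unfolding AE_lebesgue_on_iff[OF sets_Om]
  proof eventually_elim
    fix x :: "real \<times> real" assume nx: "x \<notin> (\<Union>j\<in>{..N}. {x. x \<bullet> (1, 0) = real j})"
    show "x \<in> Om \<longrightarrow> x \<in> (\<Union>i\<in>{1..N}. S i)"
    proof
      assume x: "x \<in> Om"
      then have fx: "0 < fst x" "fst x < real N" using Om_subset by auto
      define j where "j = nat \<lceil>fst x\<rceil>"
      have j: "real j - 1 < fst x" "fst x \<le> real j" "0 < j" using fx(1) unfolding j_def by linarith+
      then have jN: "j \<le> N" using fx(2) by linarith
      have "fst x \<noteq> real j" using nx jN by (cases x) auto
      then have "x \<in> S j" using j jN x by (intro Om_strip) auto
      then show "x \<in> (\<Union>i\<in>{1..N}. S i)" using j jN by auto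
    qed
  qed
qed

lemma closed_interface: "closed (interface r1 r2 i)"
  by (simp add: interface_def closed_Int)

lemma on_line_closed: "closed (on_line c (interface r1 r2 i))"
proof -
  have "on_line c (interface r1 r2 i) = (\<lambda>t. (c, t)) -` interface r1 r2 i" by (auto simp: on_line_def)
  then show ?thesis using closed_interface by (simp add: closed_vimage continuous_on_Pair)
qed

lemma on_line_bounded: assumes "1 \<le> i" shows "bounded (on_line c (interface r1 r2 i))"
proof -
  have "\<bar>t\<bar> \<le> B" if "t \<in> on_line c (interface r1 r2 i)" for t
    using that closure_S_bounds(3)[OF assms, of "(c, t)"]
    by (auto simp: on_line_def interface_def frontier_def)
  then show ?thesis by (auto simp: bounded_iff)
qed

lemma on_line_lmeasurable: "1 \<le> i \<Longrightarrow> on_line c (interface r1 r2 i) \<in> lmeasurable"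
  using on_line_closed on_line_bounded by (intro lmeasurable_compact) (auto simp: compact_eq_bounded_closed)

lemma L2_ip_Om:
  assumes "f \<in> L2 Om" "g \<in> L2 Om" shows "L2_ip Om f g = (\<Sum>i = 1..N. L2_ip (S i) f g)"
  using assms S_subset_Om disjoint_S AE_in_S by (intro L2_ip_partition) auto

end

section \<open>Estimates on vertical lines\<close>

text \<open>This and the next quantity integrate over a full line or the full plane with respect to
  \<open>lborel\<close>: test functions vanish off the domain, and the product structure of
  \<open>lborel\<close> makes Fubini's theorem available.\<close>

definition line_sq :: "(real \<times> real \<Rightarrow> real) \<Rightarrow> real \<Rightarrow> real" where
  "line_sq \<phi> c = (LINT t|lborel. (\<phi> (c, t))\<^sup>2)"

definition strip_energy :: "(real \<times> real \<Rightarrow> real) \<Rightarrow> real set \<Rightarrow> real" where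
  "strip_energy \<phi> A = (LINT x|lborel. indicator A (fst x) * (norm (classical_grad \<phi> x))\<^sup>2)"

lemma L2_UNIV_integrable:
  assumes "f \<in> L2 UNIV" "f \<in> borel_measurable borel" shows "integrable lborel (\<lambda>x. (norm (f x))\<^sup>2)"
  using L2_D(2)[OF assms(1)] assms(2) by (simp add: lebesgue_on_UNIV_eq integrable_completion)

lemma test_borel_measurable [measurable_dest]:
  assumes "\<phi> \<in> test_functions \<Omega>"
  shows "\<phi> \<in> borel_measurable borel" "classical_grad \<phi> \<in> borel_measurable borel"
  using test_smooth[OF assms]
  by (auto intro!: borel_measurable_continuous_onI smooth_continuous_on continuous_on_classical_grad)

lemma integrable_test_sq:
  assumes "\<phi> \<in> test_functions \<Omega>"
  shows "integrable lborel (\<lambda>x. (\<phi> x)\<^sup>2)" "integrable lborel (\<lambda>x. (norm (classical_grad \<phi> x))\<^sup>2)"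
  using L2_UNIV_integrable[OF test_L2(1)[OF assms] test_borel_measurable(1)[OF assms]]
    L2_UNIV_integrable[OF test_L2(2)[OF assms] test_borel_measurable(2)[OF assms]] by simp_all

lemma integrable_indicator_fst:
  fixes f :: "real \<times> real \<Rightarrow> real"
  assumes "integrable lborel f" and A: "A \<in> sets borel"
  shows "integrable lborel (\<lambda>x. indicator A (fst x) * f x)"
proof -
  have "integrable lborel (\<lambda>x. indicator (fst -` A) x *\<^sub>R f x)"
  proof (rule integrable_mult_indicator[OF _ assms(1)])
    have "fst -` A \<inter> space (borel :: (real \<times> real) measure) \<in> sets borel"
      using A by (intro measurable_sets[of fst borel borel]) (auto intro!: borel_measurable_continuous_onI continuous_intros)
    then show "fst -` A \<in> sets (lborel :: (real \<times> real) measure)" by simp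
  qed
  then show ?thesis by (simp add: indicator_vimage[unfolded o_def] indicator_def vimage_def)
qed

lemma line_L2:
  assumes "\<phi> \<in> test_functions \<Omega>" shows "(\<lambda>t. \<phi> (c, t)) \<in> L2 UNIV"
proof -
  obtain K where K: "compact K" "\<And>x. x \<notin> K \<Longrightarrow> \<phi> x = 0" by (rule test_functionsE[OF assms]) blast
  show ?thesis
  proof (rule continuous_compact_support_L2)
    show "continuous_on UNIV (\<lambda>t. \<phi> (c, t))"
      by (rule continuous_on_compose2[OF smooth_continuous_on[OF test_smooth[OF assms], of UNIV]])
         (auto intro!: continuous_intros)
    show "compact (snd ` K)" using K(1) by (intro compact_continuous_image continuous_intros)
    show "\<phi> (c, t) = 0" if "t \<notin> snd ` K" for t using that by (intro K(2)) force
  qed auto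
qed

lemma line_borel_measurable:
  assumes "\<phi> \<in> test_functions \<Omega>" shows "(\<lambda>t. \<phi> (c, t)) \<in> borel_measurable borel"
  by (rule borel_measurable_continuous_onI)
     (rule continuous_on_compose2[OF smooth_continuous_on[OF test_smooth[OF assms], of UNIV]],
       auto intro!: continuous_intros)

lemma integrable_line:
  assumes "\<phi> \<in> test_functions \<Omega>" shows "integrable lborel (\<lambda>t. (\<phi> (c, t))\<^sup>2)"
  using L2_UNIV_integrable[OF line_L2[OF assms] line_borel_measurable[OF assms]] by simp

lemma line_sq_nonneg [simp]: "0 \<le> line_sq \<phi> c"
  by (simp add: line_sq_def)

lemma strip_energy_nonneg [simp]: "0 \<le> strip_energy \<phi> A"
  unfolding strip_energy_def by (intro Bochner_Integration.integral_nonneg) auto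

lemma strip_energy_mono:
  assumes "\<phi> \<in> test_functions \<Omega>" "A \<subseteq> A'" "A \<in> sets borel" "A' \<in> sets borel"
  shows "strip_energy \<phi> A \<le> strip_energy \<phi> A'"
  unfolding strip_energy_def using assms(2)
  by (intro integral_mono integrable_indicator_fst integrable_test_sq(2)[OF assms(1)] assms)
     (auto simp: indicator_def)

text \<open>The fundamental theorem of calculus along a horizontal segment, followed by the
  Cauchy-Schwarz inequality against the constant 1, whose squared norm is
  \<open>b - a\<close>.\<close>

lemma line_difference_pointwise:
  assumes phi: "\<phi> \<in> test_functions \<Omega>" and ab: "a \<le> b"
  shows "(\<phi> (b, t) - \<phi> (a, t))\<^sup>2
    \<le> (b - a) * (LINT s|lborel. indicator {a..b} s * (norm (classical_grad \<phi> (s, t)))\<^sup>2)"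
proof -
  note sm = test_smooth[OF phi]
  define g where "g s = classical_grad \<phi> (s, t) \<bullet> (1, 0)" for s
  have cg: "continuous_on UNIV (\<lambda>s. classical_grad \<phi> (s, t))"
    by (rule continuous_on_compose2[OF continuous_on_classical_grad[OF sm, of UNIV]]) (auto intro!: continuous_intros)
  have g: "continuous_on UNIV g" unfolding g_def by (intro continuous_intros cg)
  have gm [measurable]: "g \<in> borel_measurable borel" using g by (rule borel_measurable_continuous_onI)
  have d: "((\<lambda>s. \<phi> (s, t)) has_real_derivative g s) (at s)" for s
  proof -
    have "((\<lambda>s. (s, t)) has_derivative (\<lambda>h. (h, 0))) (at s)" by (auto intro!: derivative_eq_intros)
    from diff_chain_at[OF this smooth_has_gradient[OF sm]]
    have "((\<lambda>s. \<phi> (s, t)) has_derivative (\<lambda>h. classical_grad \<phi> (s, t) \<bullet> (h, 0))) (at s)" by (simp add: o_def)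
    moreover have "classical_grad \<phi> (s, t) \<bullet> (h, 0) = g s * h" for h by (simp add: g_def inner_prod_def)
    ultimately show ?thesis by (simp add: has_field_derivative_def)
  qed
  have ftc: "(LINT s|lborel. g s * indicator {a..b} s) = \<phi> (b, t) - \<phi> (a, t)"
    using g d ab by (intro integral_FTC_Icc_real) (auto simp: continuous_on_eq_continuous_at)
  have one: "(\<lambda>s::real. 1::real) \<in> L2 {a..b}" by (rule L2_const) auto
  have int: "integrable lborel (\<lambda>s. indicator {a..b} s *\<^sub>R (g s)\<^sup>2)"
    using g by (intro borel_integrable_compact continuous_intros) (auto intro: continuous_on_subset)
  then have gL2: "g \<in> L2 {a..b}"
    using gm by (simp add: L2_def integrable_restrict_space integrable_completion
      measurable_restrict_space1 measurable_completion)
  have "\<bar>L2_ip {a..b} g (\<lambda>s. 1)\<bar>\<^sup>2 \<le> (L2_norm {a..b} g * L2_norm {a..b} (\<lambda>s. 1::real))\<^sup>2"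
    using L2_Cauchy_Schwarz[OF gL2 one] by (rule power_mono) simp
  moreover have "L2_ip {a..b} g (\<lambda>s. 1) = \<phi> (b, t) - \<phi> (a, t)"
    using gm ftc by (simp add: L2_ip_indicator integral_completion mult.commute)
  moreover have "(L2_norm {a..b} (\<lambda>s::real. 1::real))\<^sup>2 = b - a"
    using ab by (simp add: L2_norm_power2 L2_ip_indicator integral_completion)
  moreover have "(L2_norm {a..b} g)\<^sup>2 = (LINT s|lborel. indicator {a..b} s * (g s)\<^sup>2)"
    unfolding L2_norm_power2 using gm
    by (subst L2_ip_indicator) (simp_all add: integral_completion flip: power2_eq_square)
  ultimately have "(\<phi> (b, t) - \<phi> (a, t))\<^sup>2 \<le> (b - a) * (LINT s|lborel. indicator {a..b} s * (g s)\<^sup>2)"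
    by (simp add: power_mult_distrib mult.commute)
  also have "\<dots> \<le> (b - a) * (LINT s|lborel. indicator {a..b} s * (norm (classical_grad \<phi> (s, t)))\<^sup>2)"
  proof (rule mult_left_mono)
    show "(LINT s|lborel. indicator {a..b} s * (g s)\<^sup>2)
        \<le> (LINT s|lborel. indicator {a..b} s * (norm (classical_grad \<phi> (s, t)))\<^sup>2)"
    proof (rule integral_mono)
      show "integrable lborel (\<lambda>s. indicator {a..b} s * (g s)\<^sup>2)" using int by simp
      have "integrable lborel (\<lambda>s. indicator {a..b} s *\<^sub>R (norm (classical_grad \<phi> (s, t)))\<^sup>2)"
        by (intro borel_integrable_compact continuous_intros continuous_on_subset[OF cg]) auto
      then show "integrable lborel (\<lambda>s. indicator {a..b} s * (norm (classical_grad \<phi> (s, t)))\<^sup>2)" by simp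
      fix s
      have "\<bar>g s\<bar> \<le> norm (classical_grad \<phi> (s, t))"
        using Cauchy_Schwarz_ineq2[of "classical_grad \<phi> (s, t)" "(1, 0)"] by (simp add: g_def norm_Pair)
      then have "(g s)\<^sup>2 \<le> (norm (classical_grad \<phi> (s, t)))\<^sup>2"
        by (metis abs_ge_zero power2_abs power_mono)
      then show "indicator {a..b} s * (g s)\<^sup>2 \<le> indicator {a..b} s * (norm (classical_grad \<phi> (s, t)))\<^sup>2"
        by (intro mult_left_mono) auto
    qed
  qed (use ab in simp)
  finally show ?thesis .
qed

text \<open>The horizontal estimate is integrated over the ordinate \<open>t\<close>; Fubini's
  theorem turns the iterated integral into the energy of the strip.\<close>

lemma line_difference:
  assumes phi: "\<phi> \<in> test_functions \<Omega>" and ab: "a \<le> b"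
  shows "(LINT t|lborel. (\<phi> (b, t) - \<phi> (a, t))\<^sup>2) \<le> (b - a) * strip_energy \<phi> {a..b}"
proof -
  define F where "F s t = indicator {a..b} s * (norm (classical_grad \<phi> (s, t)))\<^sup>2" for s t
  have int: "integrable (lborel \<Otimes>\<^sub>M lborel) (case_prod F)"
    using integrable_indicator_fst[OF integrable_test_sq(2)[OF phi], of "{a..b}"]
    by (simp add: lborel_prod F_def case_prod_beta')
  have E: "strip_energy \<phi> {a..b} = (LINT t|lborel. LINT s|lborel. F s t)"
    by (subst lborel_pair.integral_snd[OF int])
       (simp add: lborel_prod strip_energy_def F_def case_prod_beta')
  have "(LINT t|lborel. (\<phi> (b, t) - \<phi> (a, t))\<^sup>2) \<le> (LINT t|lborel. (b - a) * (LINT s|lborel. F s t))"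
  proof (rule integral_mono)
    have "(\<lambda>t. \<phi> (b, t) - \<phi> (a, t)) \<in> L2 UNIV" by (intro L2_diff line_L2[OF phi])
    from L2_UNIV_integrable[OF this] show "integrable lborel (\<lambda>t. (\<phi> (b, t) - \<phi> (a, t))\<^sup>2)"
      using line_borel_measurable[OF phi] by simp
    show "integrable lborel (\<lambda>t. (b - a) * (LINT s|lborel. F s t))"
      by (intro integrable_mult_right lborel_pair.integrable_snd[OF int])
    show "(\<phi> (b, t) - \<phi> (a, t))\<^sup>2 \<le> (b - a) * (LINT s|lborel. F s t)" for t
      unfolding F_def by (rule line_difference_pointwise[OF assms])
  qed
  then show ?thesis by (simp add: E)
qed

text \<open>The values on the line \<open>x1 = s\<close> are those on \<open>x1 = c\<close> plus a
  difference, and \<open>(p + q)^2 \<le> 2 p^2 + 2 q^2\<close>.\<close>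

lemma line_sq_near:
  assumes phi: "\<phi> \<in> test_functions \<Omega>" and d: "\<bar>s - c\<bar> \<le> d"
  shows "line_sq \<phi> s \<le> 2 * line_sq \<phi> c + 2 * (d * strip_energy \<phi> {c - d..c + d})"
proof -
  have diff: "(LINT t|lborel. (\<phi> (s, t) - \<phi> (c, t))\<^sup>2) \<le> d * strip_energy \<phi> {c - d..c + d}"
  proof (cases "c \<le> s")
    case True
    have "(LINT t|lborel. (\<phi> (s, t) - \<phi> (c, t))\<^sup>2) \<le> (s - c) * strip_energy \<phi> {c..s}"
      by (rule line_difference[OF phi True])
    also have "\<dots> \<le> d * strip_energy \<phi> {c - d..c + d}"
      using d True by (intro mult_mono strip_energy_mono[OF phi]) auto
    finally show ?thesis .
  next
    case False
    have "(LINT t|lborel. (\<phi> (c, t) - \<phi> (s, t))\<^sup>2) \<le> (c - s) * strip_energy \<phi> {s..c}"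
      by (rule line_difference[OF phi]) (use False in simp)
    also have "\<dots> \<le> d * strip_energy \<phi> {c - d..c + d}"
      using d False by (intro mult_mono strip_energy_mono[OF phi]) auto
    finally show ?thesis by (simp add: power2_commute)
  qed
  have i2: "integrable lborel (\<lambda>t. (\<phi> (s, t) - \<phi> (c, t))\<^sup>2)"
    using L2_UNIV_integrable[OF L2_diff[OF line_L2[OF phi] line_L2[OF phi]], of s c]
      line_borel_measurable[OF phi] by simp
  have "line_sq \<phi> s \<le> (LINT t|lborel. 2 * (\<phi> (c, t))\<^sup>2 + 2 * (\<phi> (s, t) - \<phi> (c, t))\<^sup>2)"
    unfolding line_sq_def
  proof (rule integral_mono)
    show "(\<phi> (s, t))\<^sup>2 \<le> 2 * (\<phi> (c, t))\<^sup>2 + 2 * (\<phi> (s, t) - \<phi> (c, t))\<^sup>2" for t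
      using sum_squares_bound[of "\<phi> (c, t)" "\<phi> (s, t) - \<phi> (c, t)"] by (simp add: power2_diff algebra_simps power2_eq_square)
  qed (use i2 integrable_line[OF phi] in auto)
  also have "\<dots> = 2 * line_sq \<phi> c + 2 * (LINT t|lborel. (\<phi> (s, t) - \<phi> (c, t))\<^sup>2)"
    using i2 integrable_line[OF phi] by (simp add: line_sq_def)
  finally show ?thesis using diff by simp
qed

lemma strip_integral_le:
  assumes phi: "\<phi> \<in> test_functions \<Omega>" and ab: "a \<le> b" and M: "\<And>s. s \<in> {a..b} \<Longrightarrow> line_sq \<phi> s \<le> M"
  shows "(LINT x|lborel. indicator {a..b} (fst x) * (\<phi> x)\<^sup>2) \<le> (b - a) * M"
proof -
  define F where "F s t = indicat_real {a..b} s * (\<phi> (s, t))\<^sup>2" for s t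
  have int: "integrable (lborel \<Otimes>\<^sub>M lborel) (case_prod F)"
    using integrable_indicator_fst[OF integrable_test_sq(1)[OF phi], of "{a..b}"]
    by (simp add: lborel_prod F_def case_prod_beta')
  have "(LINT x|lborel. indicator {a..b} (fst x) * (\<phi> x)\<^sup>2) = (LINT s|lborel. LINT t|lborel. F s t)"
    by (subst lborel_pair.integral_fst[OF int]) (simp add: lborel_prod F_def case_prod_beta')
  also have "\<dots> \<le> (LINT s|lborel. indicator {a..b} s * M)"
  proof (rule integral_mono)
    show "integrable lborel (\<lambda>s. LINT t|lborel. F s t)" by (rule lborel_pair.integrable_fst[OF int])
    show "(LINT t|lborel. F s t) \<le> indicator {a..b} s * M" for s
      using M[of s] by (auto simp: F_def line_sq_def indicator_def)
  qed (use ab in \<open>auto intro!: integrable_mult_left\<close>)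
  also have "\<dots> = (b - a) * M" using ab by simp
  finally show ?thesis .
qed

context chain
begin

section \<open>Trace and Poincare inequalities for test functions\<close>

lemma Om_fst: "x \<in> Om \<Longrightarrow> 0 < fst x \<and> fst x < real N"
  using Om_subset by auto

lemma L2_ip_Om_test:
  fixes f :: "real \<times> real \<Rightarrow> 'b::euclidean_space"
  assumes "f \<in> borel_measurable borel" "\<And>x. x \<notin> Om \<Longrightarrow> f x = 0"
  shows "(L2_norm Om f)\<^sup>2 = (LINT x|lborel. (norm (f x))\<^sup>2)"
proof -
  have "(L2_norm Om f)\<^sup>2 = (LINT x|lebesgue. (norm (f x))\<^sup>2)"
    unfolding L2_norm_power2 L2_ip_indicator[OF sets_Om] using assms(2)
    by (intro Bochner_Integration.integral_cong) (auto simp: indicator_def power2_norm_eq_inner)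
  then show ?thesis using assms(1) by (simp add: integral_completion)
qed

lemma strip_energy_eq:
  assumes "\<phi> \<in> test_functions Om" "A \<in> sets borel"
  shows "strip_energy \<phi> A = (L2_norm Om (\<lambda>x. indicator A (fst x) *\<^sub>R classical_grad \<phi> x))\<^sup>2"
proof -
  have [measurable]: "fst \<in> borel \<rightarrow>\<^sub>M (borel :: real measure)"
    by (intro borel_measurable_continuous_onI continuous_intros)
  have "(\<lambda>x. indicat_real A (fst x) *\<^sub>R classical_grad \<phi> x) \<in> borel_measurable borel"
    using test_borel_measurable(2)[OF assms(1)] assms(2) by measurable
  then show ?thesis
    using test_grad_zero[OF assms(1)]
    by (subst L2_ip_Om_test) (auto simp: strip_energy_def indicator_def intro!: Bochner_Integration.integral_cong)
qed

lemma strip_energy_UNIV: "\<phi> \<in> test_functions Om \<Longrightarrow> strip_energy \<phi> UNIV = (L2_norm Om (classical_grad \<phi>))\<^sup>2"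
  using strip_energy_eq[of \<phi> UNIV] by simp

lemma line_sq_outside: "\<phi> \<in> test_functions Om \<Longrightarrow> c \<notin> {0<..<real N} \<Longrightarrow> line_sq \<phi> c = 0"
  using test_zero[of \<phi> Om] Om_fst unfolding line_sq_def by (subst Bochner_Integration.integral_cong[OF refl, where g = "\<lambda>_. 0"]) force+

text \<open>Comparison with the line \<open>x1 = 0\<close>: it misses the domain, so the test
  function vanishes there, and its distance is at most \<open>N\<close>.\<close>

lemma trace_bound:
  assumes phi: "\<phi> \<in> test_functions Om"
  shows "line_sq \<phi> c \<le> real N * (L2_norm Om (classical_grad \<phi>))\<^sup>2"
proof (cases "c \<in> {0<..<real N}")
  case True
  have z: "\<phi> (0, t) = 0" for t using test_zero[OF phi] Om_fst by force
  have "line_sq \<phi> c \<le> (c - 0) * strip_energy \<phi> {0..c}"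
    using line_difference[OF phi, of 0 c] True by (simp add: line_sq_def z)
  also have "\<dots> \<le> real N * strip_energy \<phi> UNIV"
    using True by (intro mult_mono strip_energy_mono[OF phi]) auto
  finally show ?thesis by (simp add: strip_energy_UNIV[OF phi])
qed (simp add: line_sq_outside[OF phi])

text \<open>The trace inequality integrated over abscissas from 0 to \<open>N\<close>. Under the
  square, one factor \<open>N\<close> is the distance to the line \<open>x1 = 0\<close> and the
  other the width of the domain.\<close>

lemma poincare_test:
  assumes phi: "\<phi> \<in> test_functions Om"
  shows "L2_norm Om \<phi> \<le> real N * L2_norm Om (classical_grad \<phi>)"
proof (rule power2_le_imp_le)
  have "(L2_norm Om \<phi>)\<^sup>2 = (LINT x|lborel. (\<phi> x)\<^sup>2)"
    using L2_ip_Om_test[OF test_borel_measurable(1)[OF phi] test_zero[OF phi]] by simp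
  also have "\<dots> = (LINT x|lborel. indicator {0..real N} (fst x) * (\<phi> x)\<^sup>2)"
  proof (rule Bochner_Integration.integral_cong[OF refl])
    fix x show "(\<phi> x)\<^sup>2 = indicator {0..real N} (fst x) * (\<phi> x)\<^sup>2"
      using Om_fst[of x] test_zero[OF phi, of x] by (cases "x \<in> Om") (auto simp: indicator_def)
  qed
  also have "\<dots> \<le> (real N - 0) * (real N * (L2_norm Om (classical_grad \<phi>))\<^sup>2)"
    by (intro strip_integral_le[OF phi] trace_bound[OF phi]) auto
  finally show "(L2_norm Om \<phi>)\<^sup>2 \<le> (real N * L2_norm Om (classical_grad \<phi>))\<^sup>2"
    by (simp add: power2_eq_square mult_ac)
qed simp

text \<open>The width \<open>2 d\<close> of the strip times the bound on each of its lines. The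
  factor \<open>d^2\<close> in front of the energy is what later pays for a cutoff with gradient of
  order \<open>1 / d\<close>.\<close>

lemma near_line_test:
  assumes phi: "\<phi> \<in> test_functions Om" and d: "0 \<le> d"
  shows "(L2_norm Om (\<lambda>x. indicat_real {c - d..c + d} (fst x) * \<phi> x))\<^sup>2
    \<le> 4 * d * line_sq \<phi> c + 4 * d\<^sup>2 * (L2_norm Om (\<lambda>x. indicat_real {c - d..c + d} (fst x) *\<^sub>R classical_grad \<phi> x))\<^sup>2"
proof -
  have [measurable]: "fst \<in> borel \<rightarrow>\<^sub>M (borel :: real measure)"
    by (intro borel_measurable_continuous_onI continuous_intros)
  have m: "(\<lambda>x. indicat_real {c - d..c + d} (fst x) * \<phi> x) \<in> borel_measurable borel"
    using test_borel_measurable(1)[OF phi] by measurable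
  have eq: "(norm (indicat_real A s * r))\<^sup>2 = indicator A s * r\<^sup>2" for A s and r :: real
    by (auto simp: indicator_def)
  have z: "indicat_real {c - d..c + d} (fst x) * \<phi> x = 0" if "x \<notin> Om" for x
    using test_zero[OF phi that] by simp
  have "(L2_norm Om (\<lambda>x. indicat_real {c - d..c + d} (fst x) * \<phi> x))\<^sup>2
      = (LINT x|lborel. (norm (indicat_real {c - d..c + d} (fst x) * \<phi> x))\<^sup>2)"
    by (rule L2_ip_Om_test[OF m]) (rule z)
  also have "\<dots> = (LINT x|lborel. indicator {c - d..c + d} (fst x) * (\<phi> x)\<^sup>2)"
    by (simp only: eq)
  also have "\<dots> \<le> ((c + d) - (c - d)) * (2 * line_sq \<phi> c + 2 * (d * strip_energy \<phi> {c - d..c + d}))"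
    using d by (intro strip_integral_le[OF phi] line_sq_near[OF phi]) auto
  finally show ?thesis by (simp add: strip_energy_eq[OF phi] algebra_simps power2_eq_square)
qed

end

section \<open>Traces on the interfaces\<close>

lemma classical_grad_diff_fun:
  assumes "smooth f" "smooth g"
  shows "classical_grad (\<lambda>x. f x - g x) = (\<lambda>x. classical_grad f x - classical_grad g x)"
  using classical_grad_diff[OF assms] by auto

context chain
begin

text \<open>By the Poincare inequality, convergence of the gradients forces convergence of the
  functions.\<close>

lemma H10_limit:
  assumes phi: "\<And>n. \<phi> n \<in> test_functions Om"
    and Cauchy: "\<And>e. 0 < e \<Longrightarrow>
      \<exists>K. \<forall>i\<ge>K. \<forall>j\<ge>K. L2_norm Om (\<lambda>x. classical_grad (\<phi> i) x - classical_grad (\<phi> j) x) < e"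
  obtains u where "u \<in> H10 Om" "test_approx Om \<phi> u"
proof -
  obtain G where G: "G \<in> L2 Om" "(\<lambda>n. L2_norm Om (\<lambda>x. classical_grad (\<phi> n) x - G x)) \<longlonglongrightarrow> 0"
    by (rule L2_complete[OF lmeasurable_Om test_L2(2)[OF phi sets_Om] Cauchy])
  obtain u where u: "u \<in> L2 Om" "(\<lambda>n. L2_norm Om (\<lambda>x. \<phi> n x - u x)) \<longlonglongrightarrow> 0"
  proof (rule L2_complete[OF lmeasurable_Om test_L2(1)[OF phi sets_Om]])
    fix e :: real assume e: "0 < e"
    then obtain K where K: "\<And>i j. i \<ge> K \<Longrightarrow> j \<ge> K \<Longrightarrow>
        L2_norm Om (\<lambda>x. classical_grad (\<phi> i) x - classical_grad (\<phi> j) x) < e / real N"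
      using Cauchy[of "e / real N"] N_pos by auto
    have "L2_norm Om (\<lambda>x. \<phi> i x - \<phi> j x) < e" if "i \<ge> K" "j \<ge> K" for i j
    proof -
      have "L2_norm Om (\<lambda>x. \<phi> i x - \<phi> j x)
          \<le> real N * L2_norm Om (\<lambda>x. classical_grad (\<phi> i) x - classical_grad (\<phi> j) x)"
        using poincare_test[OF test_diff[OF phi phi], of i j]
        by (simp add: classical_grad_diff_fun test_smooth[OF phi])
      also have "\<dots> < e" using K[OF that] N_pos by (simp add: field_simps)
      finally show ?thesis .
    qed
    then show "\<exists>K. \<forall>i\<ge>K. \<forall>j\<ge>K. L2_norm Om (\<lambda>x. \<phi> i x - \<phi> j x) < e" by blast
  qed
  show ?thesis using test_approxI(1,2)[OF open_Om phi u(1) G(1) u(2) G(2)] by (rule that)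
qed

lemma poincare_H10:
  assumes "u \<in> H10 Om" shows "L2_norm Om u \<le> real N * L2_norm Om (grad Om u)"
proof -
  obtain \<phi> where phi: "test_approx Om \<phi> u" using open_Om assms by (rule H10_D)
  note u = H10_H1[OF assms]
  note a = test_approxD[OF open_Om u phi]
  have "(\<lambda>n. L2_norm Om (\<phi> n)) \<longlonglongrightarrow> L2_norm Om u"
    by (rule L2_norm_tendsto[OF test_L2(1)[OF a(1) sets_Om] H1_D(1)[OF u] a(2)])
  moreover have "(\<lambda>n. real N * L2_norm Om (classical_grad (\<phi> n))) \<longlonglongrightarrow> real N * L2_norm Om (grad Om u)"
    by (intro tendsto_mult_left L2_norm_tendsto[OF test_L2(2)[OF a(1) sets_Om] H1_D(3)[OF u] a(3)])
  ultimately show ?thesis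
    by (rule LIMSEQ_le) (use poincare_test[OF a(1)] in auto)
qed

abbreviation trace_of :: "nat \<Rightarrow> (real \<times> real \<Rightarrow> real) \<Rightarrow> (real \<Rightarrow> real) \<Rightarrow> bool" where
  "trace_of \<equiv> interface_trace N r1 r2"

abbreviation Gam :: "nat \<Rightarrow> real set" where
  "Gam i \<equiv> on_line (real i) (interface r1 r2 i)"

lemma Gam_lebesgue: "1 \<le> i \<Longrightarrow> Gam i \<in> sets lebesgue"
  using on_line_lmeasurable by blast

lemma line_L2_Gam: "\<phi> \<in> test_functions Om \<Longrightarrow> 1 \<le> i \<Longrightarrow> (\<lambda>t. \<phi> (c, t)) \<in> L2 (Gam i)"
  by (rule L2_subset[OF line_L2]) (auto simp: Gam_lebesgue)

text \<open>The part of the line \<open>x1 = i\<close> inside the domain belongs to the interface,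
  so a test function vanishes on the rest of the line. Estimates on full lines thereby become
  estimates of traces.\<close>

lemma line_norm_Gam:
  assumes phi: "\<phi> \<in> test_functions Om" and i: "1 \<le> i"
  shows "(L2_norm (Gam i) (\<lambda>t. \<phi> (real i, t)))\<^sup>2 = line_sq \<phi> (real i)"
proof -
  have z: "\<phi> (real i, t) = 0" if "t \<notin> Gam i" for t
    using that Om_interface[OF i, of "(real i, t)"] test_zero[OF phi] by (auto simp: on_line_def)
  have "(L2_norm (Gam i) (\<lambda>t. \<phi> (real i, t)))\<^sup>2 = (LINT t|lebesgue. (\<phi> (real i, t))\<^sup>2)"
    unfolding L2_norm_power2 L2_ip_indicator[OF Gam_lebesgue[OF i]]
  proof (rule Bochner_Integration.integral_cong[OF refl])
    fix t show "indicat_real (Gam i) t * (\<phi> (real i, t) \<bullet> \<phi> (real i, t)) = (\<phi> (real i, t))\<^sup>2"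
      using z[of t] by (cases "t \<in> Gam i") (auto simp: power2_eq_square)
  qed
  then show ?thesis
    using line_borel_measurable[OF phi] by (simp add: integral_completion line_sq_def)
qed

lemma line_norm_Gam_le:
  assumes phi: "\<phi> \<in> test_functions Om" and i: "1 \<le> i"
  shows "L2_norm (Gam i) (\<lambda>t. \<phi> (real i, t)) \<le> sqrt (real N) * L2_norm Om (classical_grad \<phi>)"
proof (rule power2_le_imp_le)
  show "(L2_norm (Gam i) (\<lambda>t. \<phi> (real i, t)))\<^sup>2 \<le> (sqrt (real N) * L2_norm Om (classical_grad \<phi>))\<^sup>2"
    unfolding line_norm_Gam[OF assms] using trace_bound[OF phi] by (simp add: power_mult_distrib)
qed simp

text \<open>The definition of a trace asks for one approximating sequence. Two such sequences differ
  by test functions with gradients tending to 0, whose restrictions to the interface tend to 0 as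
  well, so every sequence serves. Linearity of traces rests on this.\<close>

lemma trace_seq:
  assumes i: "1 \<le> i" and u: "u \<in> H10 Om" and tr: "trace_of i u g" and phi: "test_approx Om \<phi> u"
  shows "(\<lambda>n. L2_norm (Gam i) (\<lambda>t. \<phi> n (real i, t) - g t)) \<longlonglongrightarrow> 0"
proof -
  note u1 = H10_H1[OF u]
  obtain \<psi> where psi: "test_approx Om \<psi> u" and g: "g \<in> L2 (Gam i)"
    and c: "(\<lambda>n. L2_norm (Gam i) (\<lambda>t. \<psi> n (real i, t) - g t)) \<longlonglongrightarrow> 0"
    using tr by (auto simp: interface_trace_def has_trace_def)
  note a = test_approxD[OF open_Om u1 phi] and b = test_approxD[OF open_Om u1 psi]
  have "(\<lambda>n. L2_norm Om (\<lambda>x. (classical_grad (\<phi> n) x - grad Om u x) + (grad Om u x - classical_grad (\<psi> n) x))) \<longlonglongrightarrow> 0"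
    using a(3) b(3)
    by (intro L2_norm_add_tendsto_0 L2_diff test_L2(2)[OF a(1) sets_Om] test_L2(2)[OF b(1) sets_Om] H1_D(3) u1)
       (simp_all add: L2_norm_diff_commute[of Om "grad Om u"])
  then have "(\<lambda>n. L2_norm Om (\<lambda>x. classical_grad (\<phi> n) x - classical_grad (\<psi> n) x)) \<longlonglongrightarrow> 0" by simp
  from tendsto_mult_left[OF this, of "sqrt (real N)"]
  have "(\<lambda>n. sqrt (real N) * L2_norm Om (\<lambda>x. classical_grad (\<phi> n) x - classical_grad (\<psi> n) x)) \<longlonglongrightarrow> 0" by simp
  then have "(\<lambda>n. L2_norm (Gam i) (\<lambda>t. \<phi> n (real i, t) - \<psi> n (real i, t))) \<longlonglongrightarrow> 0"
  proof (rule Lim_null_comparison[rotated], intro always_eventually allI)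
    fix n
    show "norm (L2_norm (Gam i) (\<lambda>t. \<phi> n (real i, t) - \<psi> n (real i, t)))
       \<le> sqrt (real N) * L2_norm Om (\<lambda>x. classical_grad (\<phi> n) x - classical_grad (\<psi> n) x)"
      using line_norm_Gam_le[OF test_diff[OF a(1) b(1)] i, of n n]
      by (simp add: classical_grad_diff_fun test_smooth[OF a(1)] test_smooth[OF b(1)])
  qed
  then have "(\<lambda>n. L2_norm (Gam i) (\<lambda>t. (\<phi> n (real i, t) - \<psi> n (real i, t)) + (\<psi> n (real i, t) - g t))) \<longlonglongrightarrow> 0"
    by (intro L2_norm_add_tendsto_0 L2_diff line_L2_Gam a(1) b(1) i g c)
  then show ?thesis by simp
qed

lemma trace_ofI:
  assumes "test_approx Om \<phi> u" "g \<in> L2 (Gam i)" "(\<lambda>n. L2_norm (Gam i) (\<lambda>t. \<phi> n (real i, t) - g t)) \<longlonglongrightarrow> 0"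
  shows "trace_of i u g"
  using assms by (auto simp: interface_trace_def has_trace_def)

lemma trace_of_L2: "trace_of i u g \<Longrightarrow> g \<in> L2 (Gam i)"
  by (simp add: interface_trace_def has_trace_def)

text \<open>By the trace inequality the restrictions of an approximating sequence are Cauchy on the
  interface, and \<open>L2\<close> is complete.\<close>

lemma trace_exists:
  assumes i: "1 \<le> i" and u: "u \<in> H10 Om"
  obtains g where "trace_of i u g"
proof -
  obtain \<phi> where phi: "test_approx Om \<phi> u" using open_Om u by (rule H10_D)
  note u1 = H10_H1[OF u]
  note a = test_approxD[OF open_Om u1 phi]
  have Cauchy: "\<exists>K. \<forall>m\<ge>K. \<forall>n\<ge>K. L2_norm (Gam i) (\<lambda>t. \<phi> m (real i, t) - \<phi> n (real i, t)) < e" if e: "0 < e" for e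
  proof -
    have sN: "0 < sqrt (real N)" using N_pos by simp
    obtain K where K: "\<And>n. n \<ge> K \<Longrightarrow> L2_norm Om (\<lambda>x. classical_grad (\<phi> n) x - grad Om u x) < e / (2 * sqrt (real N))"
      using LIMSEQ_D[OF a(3), of "e / (2 * sqrt (real N))"] e sN by auto
    have "L2_norm (Gam i) (\<lambda>t. \<phi> m (real i, t) - \<phi> n (real i, t)) < e" if "m \<ge> K" "n \<ge> K" for m n
    proof -
      have "L2_norm (Gam i) (\<lambda>t. \<phi> m (real i, t) - \<phi> n (real i, t))
          \<le> sqrt (real N) * L2_norm Om (\<lambda>x. classical_grad (\<phi> m) x - classical_grad (\<phi> n) x)"
        using line_norm_Gam_le[OF test_diff[OF a(1) a(1)] i, of m n]
        by (simp add: classical_grad_diff_fun test_smooth[OF a(1)])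
      also have "\<dots> \<le> sqrt (real N) * (L2_norm Om (\<lambda>x. classical_grad (\<phi> m) x - grad Om u x) +
          L2_norm Om (\<lambda>x. classical_grad (\<phi> n) x - grad Om u x))"
        using L2_norm_triangle_diff[OF test_L2(2)[OF a(1) sets_Om] H1_D(3)[OF u1] test_L2(2)[OF a(1) sets_Om], of m n]
        by (intro mult_left_mono) (auto simp: L2_norm_diff_commute[of Om "grad Om u"])
      also have "\<dots> < sqrt (real N) * (e / (2 * sqrt (real N)) + e / (2 * sqrt (real N)))"
        using K[OF that(1)] K[OF that(2)] sN by (intro mult_strict_left_mono add_strict_mono)
      also have "\<dots> = e" using sN by (simp add: field_simps)
      finally show ?thesis .
    qed
    then show ?thesis by blast
  qed
  obtain g where "g \<in> L2 (Gam i)" "(\<lambda>n. L2_norm (Gam i) (\<lambda>t. \<phi> n (real i, t) - g t)) \<longlonglongrightarrow> 0"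
    by (rule L2_complete[OF on_line_lmeasurable[OF i] line_L2_Gam[OF a(1) i] Cauchy])
  then show ?thesis using trace_ofI[OF phi] that by blast
qed

lemma trace_add:
  assumes i: "1 \<le> i" and u: "u \<in> H10 Om" "v \<in> H10 Om" and tr: "trace_of i u g" "trace_of i v h"
  shows "trace_of i (\<lambda>x. u x + v x) (\<lambda>t. g t + h t)"
proof -
  obtain \<phi> \<psi> where phi: "test_approx Om \<phi> u" and psi: "test_approx Om \<psi> v"
    using H10_D[OF open_Om u(1)] H10_D[OF open_Om u(2)] by metis
  note a = test_approxD[OF open_Om H10_H1[OF u(1)] phi] and b = test_approxD[OF open_Om H10_H1[OF u(2)] psi]
  note gh = trace_of_L2[OF tr(1)] trace_of_L2[OF tr(2)]
  have "(\<lambda>n. L2_norm (Gam i) (\<lambda>t. (\<phi> n (real i, t) - g t) + (\<psi> n (real i, t) - h t))) \<longlonglongrightarrow> 0"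
    by (intro L2_norm_add_tendsto_0 L2_diff line_L2_Gam a(1) b(1) i gh
        trace_seq[OF i u(1) tr(1) phi] trace_seq[OF i u(2) tr(2) psi])
  then show ?thesis
    by (intro trace_ofI[OF test_approx_add[OF open_Om H10_H1[OF u(1)] H10_H1[OF u(2)] phi psi]] L2_add gh)
       (simp add: algebra_simps)
qed

text \<open>The closure of the bounded domain is compact.\<close>

lemma smooth_bounded_on_Om:
  assumes "smooth h"
  obtains C where "\<And>x. x \<in> Om \<Longrightarrow> \<bar>h x\<bar> \<le> C" "\<And>x. x \<in> Om \<Longrightarrow> norm (classical_grad h x) \<le> C"
proof -
  have cl: "compact (closure Om)" using bounded_Om by (simp add: compact_closure)
  have "bounded (h ` closure Om)"
    by (intro compact_imp_bounded compact_continuous_image smooth_continuous_on assms cl)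
  then obtain C1 where C1: "\<And>x. x \<in> closure Om \<Longrightarrow> \<bar>h x\<bar> \<le> C1"
    unfolding bounded_iff by (metis image_eqI real_norm_def)
  have "bounded (classical_grad h ` closure Om)"
    by (intro compact_imp_bounded compact_continuous_image continuous_on_classical_grad assms cl)
  then obtain C2 where C2: "\<And>x. x \<in> closure Om \<Longrightarrow> norm (classical_grad h x) \<le> C2"
    unfolding bounded_iff by (metis image_eqI)
  show ?thesis
  proof (rule that[of "max C1 C2"])
    fix x assume "x \<in> Om"
    then have "x \<in> closure Om" using closure_subset by blast
    then show "\<bar>h x\<bar> \<le> max C1 C2" "norm (classical_grad h x) \<le> max C1 C2"
      using C1[of x] C2[of x] by auto
  qed
qed

text \<open>Used with constants and with Lagrange polynomials in the abscissa, which take the value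
  1 on one interface and 0 on the others.\<close>

lemma trace_mult:
  assumes i: "1 \<le> i" and u: "u \<in> H10 Om" and tr: "trace_of i u g"
    and h: "smooth h" "\<And>t. h (real i, t) = c"
  shows "trace_of i (\<lambda>x. h x * u x) (\<lambda>t. c * g t)"
proof -
  obtain \<phi> where phi: "test_approx Om \<phi> u" using open_Om u by (rule H10_D)
  note u1 = H10_H1[OF u]
  obtain C where C: "\<And>x. x \<in> Om \<Longrightarrow> \<bar>h x\<bar> \<le> C" "\<And>x. x \<in> Om \<Longrightarrow> norm (classical_grad h x) \<le> C"
    using smooth_bounded_on_Om[OF h(1)] by blast
  have "(\<lambda>n. \<bar>c\<bar> * L2_norm (Gam i) (\<lambda>t. \<phi> n (real i, t) - g t)) \<longlonglongrightarrow> \<bar>c\<bar> * 0"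
    by (intro tendsto_mult_left trace_seq[OF i u tr phi])
  moreover have "\<bar>c\<bar> * L2_norm (Gam i) (\<lambda>t. \<phi> n (real i, t) - g t)
      = L2_norm (Gam i) (\<lambda>t. h (real i, t) * \<phi> n (real i, t) - c * g t)" for n
    using L2_norm_scaleR[of "Gam i" c "\<lambda>t. \<phi> n (real i, t) - g t"] by (simp add: h(2) right_diff_distrib)
  ultimately have "(\<lambda>n. L2_norm (Gam i) (\<lambda>t. h (real i, t) * \<phi> n (real i, t) - c * g t)) \<longlonglongrightarrow> 0"
    by (simp only: mult_zero_right)
  then show ?thesis
    by (intro trace_ofI[OF test_approx_mult(1)[OF open_Om u1 phi h(1) C]] L2_mult trace_of_L2[OF tr])
qed

lemma trace_cmult:
  assumes "1 \<le> i" "u \<in> H10 Om" "trace_of i u g" shows "trace_of i (\<lambda>x. c * u x) (\<lambda>t. c * g t)"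
  using assms by (intro trace_mult smooth_intros) auto

lemma trace_diff:
  assumes "1 \<le> i" "u \<in> H10 Om" "v \<in> H10 Om" "trace_of i u g" "trace_of i v h"
  shows "trace_of i (\<lambda>x. u x - v x) (\<lambda>t. g t - h t)"
  using trace_add[OF assms(1,2) H10_cmult[OF open_Om assms(3)] assms(4) trace_cmult[OF assms(1,3,5)], of "-1"]
  by simp

lemma trace_zero_line:
  assumes i: "1 \<le> i" and u: "u \<in> H10 Om" and tr: "trace_of i u (\<lambda>_. 0)" and phi: "test_approx Om \<phi> u"
  shows "(\<lambda>n. line_sq (\<phi> n) (real i)) \<longlonglongrightarrow> 0"
proof -
  note a = test_approxD(1)[OF open_Om H10_H1[OF u] phi]
  have "(\<lambda>n. (L2_norm (Gam i) (\<lambda>t. \<phi> n (real i, t)))\<^sup>2) \<longlonglongrightarrow> 0\<^sup>2"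
    using trace_seq[OF i u tr phi] by (intro tendsto_power) simp
  then show ?thesis by (simp add: line_norm_Gam[OF a i])
qed

lemma trace_zeroI:
  assumes "test_approx Om \<phi> u" "\<And>n t. \<phi> n (real i, t) = 0"
  shows "trace_of i u (\<lambda>_. 0)"
  using assms by (intro trace_ofI[OF assms(1)]) auto

lemma H10_zero: "(\<lambda>x. 0) \<in> H10 Om"
  by (rule H10_test[OF open_Om test_zero_function])

lemma H10_sum: "(\<And>i. i \<in> I \<Longrightarrow> f i \<in> H10 Om) \<Longrightarrow> (\<lambda>x. \<Sum>i\<in>I. f i x) \<in> H10 Om"
  by (induction I rule: infinite_finite_induct) (auto intro: H10_zero H10_add[OF open_Om])

lemma trace_of_zero: "1 \<le> i \<Longrightarrow> trace_of i (\<lambda>x. 0) (\<lambda>_. 0)"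
  using trace_zeroI[OF test_approxI(2)[OF open_Om, of "\<lambda>n x. 0" "\<lambda>x. 0" "\<lambda>x. 0"]]
  by (simp add: test_zero_function classical_grad_const)

lemma trace_sum:
  assumes i: "1 \<le> i" and f: "\<And>j. j \<in> I \<Longrightarrow> f j \<in> H10 Om" "\<And>j. j \<in> I \<Longrightarrow> trace_of i (f j) (g j)"
  shows "trace_of i (\<lambda>x. \<Sum>j\<in>I. f j x) (\<lambda>t. \<Sum>j\<in>I. g j t)"
  using f by (induction I rule: infinite_finite_induct) (auto intro!: trace_of_zero i trace_add H10_sum)

section \<open>The gradient forms on the subdomains\<close>

abbreviation A :: "nat \<Rightarrow> (real \<times> real \<Rightarrow> real) \<Rightarrow> (real \<times> real \<Rightarrow> real) \<Rightarrow> real" where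
  "A k \<equiv> grad_ip N r1 r2 (S k)"

text \<open>The energy norm with unit coefficients. It does not involve \<open>y\<close>, so
  constants obtained for it are uniform in \<open>y\<close>; \<open>m\<close> and \<open>M\<close>
  compare it with the energy norm.\<close>

definition gnorm :: "(real \<times> real \<Rightarrow> real) \<Rightarrow> real" where
  "gnorm u = L2_norm Om (grad Om u)"

lemma grad_L2: "u \<in> H10 Om \<Longrightarrow> grad Om u \<in> L2 Om"
  by (rule H1_D(3)[OF H10_H1])

lemma grad_L2_S: "u \<in> H10 Om \<Longrightarrow> k \<in> {1..N} \<Longrightarrow> grad Om u \<in> L2 (S k)"
  using S_subset_Om by (intro L2_subset[OF grad_L2]) auto

lemma AE_Om_S:
  assumes "AE x in lebesgue_on Om. P x" "k \<in> {1..N}" shows "AE x in lebesgue_on (S k). P x"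
proof -
  have "S k \<in> sets lebesgue" using assms(2) by auto
  then show ?thesis using assms S_subset_Om[OF assms(2)]
    unfolding AE_lebesgue_on_iff[OF sets_Om] AE_lebesgue_on_iff[OF \<open>S k \<in> sets lebesgue\<close>]
    by (auto elim!: eventually_mono)
qed

lemma A_commute: "A k u v = A k v u"
  by (simp add: grad_ip_def L2_ip_commute)

text \<open>The forms see a function through its gradient alone, so functions with almost everywhere
  equal gradients may be exchanged.\<close>

lemma A_cong:
  assumes "u \<in> H10 Om" "u' \<in> H10 Om" "v \<in> H10 Om" "AE x in lebesgue_on Om. grad Om u x = grad Om u' x" "k \<in> {1..N}"
  shows "A k u v = A k u' v"
  unfolding grad_ip_def
  by (rule L2_ip_cong_AE[OF grad_L2_S grad_L2_S grad_L2_S grad_L2_S AE_Om_S]) (use assms in auto)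

lemma A_add_left:
  assumes "u \<in> H10 Om" "v \<in> H10 Om" "w \<in> H10 Om" "k \<in> {1..N}"
  shows "A k (\<lambda>x. u x + v x) w = A k u w + A k v w"
proof -
  have "A k (\<lambda>x. u x + v x) w = L2_ip (S k) (\<lambda>x. grad Om u x + grad Om v x) (grad Om w)"
    unfolding grad_ip_def
    by (rule L2_ip_cong_AE[OF grad_L2_S grad_L2_S L2_add[OF grad_L2_S grad_L2_S] grad_L2_S AE_Om_S[OF H1_add(2)]])
       (use assms H10_add[OF open_Om] open_Om H10_H1 in auto)
  then show ?thesis using assms by (simp add: L2_ip_add_left grad_L2_S grad_ip_def)
qed

lemma A_cmult_left:
  assumes "u \<in> H10 Om" "w \<in> H10 Om" "k \<in> {1..N}" shows "A k (\<lambda>x. c * u x) w = c * A k u w"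
proof -
  have "A k (\<lambda>x. c * u x) w = L2_ip (S k) (\<lambda>x. c *\<^sub>R grad Om u x) (grad Om w)"
    unfolding grad_ip_def
    by (rule L2_ip_cong_AE[OF grad_L2_S grad_L2_S L2_scaleR[OF grad_L2_S] grad_L2_S AE_Om_S[OF H1_cmult(2)]])
       (use assms H10_cmult[OF open_Om] open_Om H10_H1 in auto)
  then show ?thesis by (simp add: L2_ip_scaleR_left grad_ip_def)
qed

lemma A_diff_left:
  assumes "u \<in> H10 Om" "v \<in> H10 Om" "w \<in> H10 Om" "k \<in> {1..N}"
  shows "A k (\<lambda>x. u x - v x) w = A k u w - A k v w"
  using A_add_left[OF assms(1) H10_cmult[OF open_Om assms(2)] assms(3,4), of "-1"] A_cmult_left[OF assms(2-4), of "-1"]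
  by simp

lemma A_nonneg: "0 \<le> A k u u"
  by (simp add: grad_ip_def)

lemma A_Cauchy_Schwarz:
  assumes "u \<in> H10 Om" "v \<in> H10 Om" "k \<in> {1..N}"
  shows "\<bar>A k u v\<bar> \<le> grad_norm N r1 r2 (S k) u * grad_norm N r1 r2 (S k) v"
  using L2_Cauchy_Schwarz[OF grad_L2_S grad_L2_S] assms by (simp add: grad_ip_def grad_norm_def)

lemma grad_norm_power2: "(grad_norm N r1 r2 \<omega> u)\<^sup>2 = grad_ip N r1 r2 \<omega> u u"
  by (simp add: grad_norm_def grad_ip_def L2_norm_power2)

lemma gnorm_nonneg [simp]: "0 \<le> gnorm u"
  by (simp add: gnorm_def)

lemma grad_norm_nonneg [simp]: "0 \<le> grad_norm N r1 r2 \<omega> u"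
  by (simp add: grad_norm_def)

lemma grad_norm_le_gnorm: "u \<in> H10 Om \<Longrightarrow> k \<in> {1..N} \<Longrightarrow> grad_norm N r1 r2 (S k) u \<le> gnorm u"
  unfolding grad_norm_def gnorm_def using S_subset_Om by (intro L2_norm_subset grad_L2) auto

lemma grad_ip_Om:
  assumes "u \<in> H10 Om" "v \<in> H10 Om" shows "grad_ip N r1 r2 Om u v = (\<Sum>k = 1..N. A k u v)"
  using L2_ip_Om[OF grad_L2 grad_L2] assms by (simp add: grad_ip_def)

lemma gnorm_power2: "u \<in> H10 Om \<Longrightarrow> (gnorm u)\<^sup>2 = (\<Sum>k = 1..N. A k u u)"
  using grad_ip_Om[of u u] by (simp add: gnorm_def L2_norm_power2 grad_ip_def)

lemma gnorm_eq_0: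
  assumes "u \<in> H10 Om" "gnorm u = 0" shows "AE x in lebesgue_on Om. grad Om u x = 0"
  using assms L2_norm_eq_0_iff[OF grad_L2[OF assms(1)]] by (simp add: gnorm_def)

end

section \<open>Cutting off at interfaces with vanishing trace\<close>

text \<open>A product of two smooth steps in the abscissa at scale \<delta>. \<open>K\<close> bounds
  the derivative of the step and depends neither on the lines nor on \<delta>.\<close>

lemma cutoff_exists:
  obtains K where "0 \<le> K" "\<And>a b \<delta>. 0 < \<delta> \<Longrightarrow> \<exists>\<eta> :: real \<times> real \<Rightarrow> real. smooth \<eta> \<and>
    (\<forall>x. 0 \<le> \<eta> x \<and> \<eta> x \<le> 1) \<and> (\<forall>x. \<eta> x \<noteq> 0 \<longrightarrow> a + \<delta> \<le> fst x \<and> fst x \<le> b - \<delta>) \<and>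
    (\<forall>x. a + 2 * \<delta> \<le> fst x \<and> fst x \<le> b - 2 * \<delta> \<longrightarrow> \<eta> x = 1) \<and>
    (\<forall>x. norm (classical_grad \<eta> x) \<le> K / \<delta> *
      (indicator {a - 2 * \<delta>..a + 2 * \<delta>} (fst x) + indicator {b - 2 * \<delta>..b + 2 * \<delta>} (fst x)))"
proof -
  obtain K s' where s': "\<And>x. (smooth_step has_real_derivative s' x) (at x)" "\<And>x. \<bar>s' x\<bar> \<le> K" "0 \<le> K"
    "\<And>x. x \<notin> {0..1} \<Longrightarrow> s' x = 0" by (rule smooth_step_deriv) blast
  show ?thesis
  proof (rule that[OF s'(3)])
    fix a b \<delta> :: real assume \<delta>: "0 < \<delta>"
    \<comment> \<open>The shift by 1 keeps the support at distance \<delta> from both lines, so that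
      multiples of test functions have compact support inside the open strip.\<close>
    define \<eta> where "\<eta> x = smooth_step ((fst x - a) / \<delta> - 1) * smooth_step ((b - fst x) / \<delta> - 1)" for x :: "real \<times> real"
    have aff: "smooth (\<lambda>x :: real \<times> real. smooth_step (c * fst x + d))" for c d
      by (rule smooth_affine[OF _ smooth_smooth_step]) (intro bounded_linear_intros)
    have "smooth (\<lambda>x :: real \<times> real. smooth_step ((fst x - a) / \<delta> - 1))"
      "smooth (\<lambda>x :: real \<times> real. smooth_step ((b - fst x) / \<delta> - 1))"
      using aff[of "1 / \<delta>" "- a / \<delta> - 1"] aff[of "- 1 / \<delta>" "b / \<delta> - 1"]
      by (simp_all add: diff_divide_distrib algebra_simps)
    then have sm: "smooth \<eta>" unfolding \<eta>_def by (rule smooth_intros(3))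
    have bnd: "0 \<le> \<eta> x \<and> \<eta> x \<le> 1" for x
      unfolding \<eta>_def using smooth_step_bounds by (auto intro!: mult_nonneg_nonneg mult_le_one)
    have supp: "a + \<delta> \<le> fst x \<and> fst x \<le> b - \<delta>" if "\<eta> x \<noteq> 0" for x
    proof -
      have "\<not> (fst x - a) / \<delta> - 1 \<le> 0" "\<not> (b - fst x) / \<delta> - 1 \<le> 0"
        using that smooth_step_eq_0 by (auto simp: \<eta>_def)
      then show ?thesis using \<delta> by (auto simp: field_simps)
    qed
    have one: "\<eta> x = 1" if "a + 2 * \<delta> \<le> fst x" "fst x \<le> b - 2 * \<delta>" for x
      unfolding \<eta>_def using that \<delta> by (auto simp: smooth_step_eq_1 field_simps)
    have gr: "norm (classical_grad \<eta> x) \<le> K / \<delta> *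
      (indicator {a - 2 * \<delta>..a + 2 * \<delta>} (fst x) + indicator {b - 2 * \<delta>..b + 2 * \<delta>} (fst x))" for x
    proof -
      define p q where "p = (fst x - a) / \<delta> - 1" and "q = (b - fst x) / \<delta> - 1"
      define d where "d = s' p / \<delta> * smooth_step q - smooth_step p * (s' q / \<delta>)"
      have "((\<lambda>x. smooth_step ((fst x - a) / \<delta> - 1)) has_derivative (\<lambda>h. s' p * (fst h / \<delta>))) (at x)"
        unfolding p_def
        by (rule has_derivative_compose[where g = smooth_step and f = "\<lambda>x. (fst x - a) / \<delta> - 1",
              OF _ s'(1)[unfolded has_field_derivative_def]]) (use \<delta> in \<open>auto intro!: derivative_eq_intros\<close>)
      moreover have "((\<lambda>x. smooth_step ((b - fst x) / \<delta> - 1)) has_derivative (\<lambda>h. s' q * (- fst h / \<delta>))) (at x)"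
        unfolding q_def
        by (rule has_derivative_compose[where g = smooth_step and f = "\<lambda>x. (b - fst x) / \<delta> - 1",
              OF _ s'(1)[unfolded has_field_derivative_def]]) (use \<delta> in \<open>auto intro!: derivative_eq_intros\<close>)
      ultimately have "(\<eta> has_derivative (\<lambda>h. (d, 0) \<bullet> h)) (at x)"
        unfolding \<eta>_def
        by (rule has_derivative_eq_rhs[OF has_derivative_mult])
           (use \<delta> in \<open>auto simp: d_def p_def q_def fun_eq_iff inner_prod_def field_simps\<close>)
      then have "classical_grad \<eta> x = (d, 0)" by (rule classical_grad_eqI)
      then have "norm (classical_grad \<eta> x) = \<bar>d\<bar>" by (simp add: norm_Pair)
      also have "\<dots> \<le> \<bar>s' p / \<delta> * smooth_step q\<bar> + \<bar>smooth_step p * (s' q / \<delta>)\<bar>" unfolding d_def by linarith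
      also have "\<bar>s' p / \<delta> * smooth_step q\<bar> \<le> \<bar>s' p\<bar> / \<delta> * 1"
        using \<delta> smooth_step_bounds[of q] unfolding abs_mult by (intro mult_mono) auto
      also have "\<bar>smooth_step p * (s' q / \<delta>)\<bar> \<le> 1 * (\<bar>s' q\<bar> / \<delta>)"
        using \<delta> smooth_step_bounds[of p] unfolding abs_mult by (intro mult_mono) auto
      also have "\<bar>s' p\<bar> \<le> K * indicator {a - 2 * \<delta>..a + 2 * \<delta>} (fst x)"
        using s'(2)[of p] s'(4)[of p] \<delta> s'(3) by (cases "p \<in> {0..1}") (auto simp: p_def indicator_def field_simps)
      also have "\<bar>s' q\<bar> \<le> K * indicator {b - 2 * \<delta>..b + 2 * \<delta>} (fst x)"
        using s'(2)[of q] s'(4)[of q] \<delta> s'(3) by (cases "q \<in> {0..1}") (auto simp: q_def indicator_def field_simps)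
      finally show ?thesis using \<delta> by (simp add: divide_right_mono algebra_simps add_divide_distrib)
    qed
    show "\<exists>\<eta> :: real \<times> real \<Rightarrow> real. smooth \<eta> \<and> (\<forall>x. 0 \<le> \<eta> x \<and> \<eta> x \<le> 1) \<and>
      (\<forall>x. \<eta> x \<noteq> 0 \<longrightarrow> a + \<delta> \<le> fst x \<and> fst x \<le> b - \<delta>) \<and>
      (\<forall>x. a + 2 * \<delta> \<le> fst x \<and> fst x \<le> b - 2 * \<delta> \<longrightarrow> \<eta> x = 1) \<and>
      (\<forall>x. norm (classical_grad \<eta> x) \<le> K / \<delta> *
        (indicator {a - 2 * \<delta>..a + 2 * \<delta>} (fst x) + indicator {b - 2 * \<delta>..b + 2 * \<delta>} (fst x)))"
      using sm bnd supp one gr by blast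
  qed
qed

lemma measurable_indicator_fst:
  assumes "C \<in> sets borel"
  shows "(\<lambda>x :: real \<times> real. indicator C (fst x) :: real) \<in> borel_measurable (lebesgue_on \<omega>)"
proof -
  have "fst \<in> borel \<rightarrow>\<^sub>M (borel :: real measure)"
    by (intro borel_measurable_continuous_onI continuous_intros)
  then have "(\<lambda>x :: real \<times> real. indicator C (fst x) :: real) \<in> borel_measurable borel"
    using assms by measurable
  then show ?thesis by (intro measurable_restrict_space1 measurable_completion) simp
qed

lemma L2_indicator_fst:
  fixes F :: "real \<times> real \<Rightarrow> 'b::euclidean_space"
  assumes "F \<in> L2 \<omega>" "C \<in> sets borel" shows "(\<lambda>x. indicator C (fst x) *\<^sub>R F x) \<in> L2 \<omega>"
  using measurable_indicator_fst[OF assms(2)] L2_D(1)[OF assms(1)]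
  by (intro L2_bound[OF assms(1), where c = 1]) (auto simp: indicator_def)

text \<open>Dominated convergence: a point off the line is eventually outside the shrinking strips,
  and the line is a null set.\<close>

lemma L2_norm_near_line_tendsto_0:
  fixes F :: "real \<times> real \<Rightarrow> 'b::euclidean_space"
  assumes F: "F \<in> L2 \<omega>" and \<omega>: "\<omega> \<in> sets lebesgue"
  shows "(\<lambda>m. L2_norm \<omega> (\<lambda>x. indicat_real {c - inverse (real (Suc m))..c + inverse (real (Suc m))} (fst x) *\<^sub>R F x)) \<longlonglongrightarrow> 0"
proof -
  let ?I = "\<lambda>m x. indicat_real {c - inverse (real (Suc m))..c + inverse (real (Suc m))} (fst x)"
  have "(\<lambda>m. LINT x|lebesgue_on \<omega>. (norm (?I m x *\<^sub>R F x))\<^sup>2) \<longlonglongrightarrow> (LINT x|lebesgue_on \<omega>. 0)"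
  proof (rule integral_dominated_convergence[where w = "\<lambda>x. (norm (F x))\<^sup>2"])
    show "integrable (lebesgue_on \<omega>) (\<lambda>x. (norm (F x))\<^sup>2)" by (rule L2_D(2)[OF F])
    show "(\<lambda>x. (norm (?I m x *\<^sub>R F x))\<^sup>2) \<in> borel_measurable (lebesgue_on \<omega>)" for m
      using L2_D(2)[OF L2_indicator_fst[OF F, of "{c - inverse (real (Suc m))..c + inverse (real (Suc m))}"]] by auto
    show "AE x in lebesgue_on \<omega>. norm ((norm (?I m x *\<^sub>R F x))\<^sup>2) \<le> (norm (F x))\<^sup>2" for m
      by (auto simp: indicator_def)
    have "negligible {x :: real \<times> real. x \<bullet> (1, 0) = c}"
      by (intro negligible_standard_hyperplane) (auto simp: Basis_prod_def)
    then have "AE x in lebesgue. x \<notin> {x :: real \<times> real. x \<bullet> (1, 0) = c}"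
      unfolding negligible_iff_null_sets by (rule AE_not_in)
    then show "AE x in lebesgue_on \<omega>. (\<lambda>m. (norm (?I m x *\<^sub>R F x))\<^sup>2) \<longlonglongrightarrow> 0"
      unfolding AE_lebesgue_on_iff[OF \<omega>]
    proof eventually_elim
      fix x :: "real \<times> real" assume "x \<notin> {x. x \<bullet> (1, 0) = c}"
      then have "0 < \<bar>fst x - c\<bar>" by (cases x) auto
      then have "\<forall>\<^sub>F m in sequentially. inverse (real (Suc m)) < \<bar>fst x - c\<bar>"
        by (rule order_tendstoD(2)[OF LIMSEQ_inverse_real_of_nat])
      then have "\<forall>\<^sub>F m in sequentially. (norm (?I m x *\<^sub>R F x))\<^sup>2 = 0"
        by eventually_elim (auto simp: indicator_def abs_real_def split: if_splits)
      then show "x \<in> \<omega> \<longrightarrow> (\<lambda>m. (norm (?I m x *\<^sub>R F x))\<^sup>2) \<longlonglongrightarrow> 0"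
        by (simp add: tendsto_eventually)
    qed
  qed auto
  from tendsto_real_sqrt[OF this] show ?thesis by (simp add: L2_norm_def L2_ip_self)
qed

context chain
begin

abbreviation strip :: "nat \<Rightarrow> nat \<Rightarrow> (real \<times> real) set" where
  "strip a b \<equiv> Om \<inter> ({real a<..<real b} \<times> UNIV)"

text \<open>The lines at 0 and from \<open>N\<close> on miss the domain, so every function of
  \<open>H10\<close> counts as vanishing there. With this convention the subdomains at the ends are
  treated like the others.\<close>

definition zero_trace :: "nat \<Rightarrow> (real \<times> real \<Rightarrow> real) \<Rightarrow> bool" where
  "zero_trace i u \<longleftrightarrow> i = 0 \<or> N \<le> i \<or> trace_of i u (\<lambda>_. 0)"

lemma zero_trace_line:
  assumes "u \<in> H10 Om" "zero_trace i u" "test_approx Om \<phi> u"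
  shows "(\<lambda>n. line_sq (\<phi> n) (real i)) \<longlonglongrightarrow> 0"
proof (cases "i = 0 \<or> N \<le> i")
  case True
  then have "line_sq (\<phi> n) (real i) = 0" for n
    using test_approxD(1)[OF open_Om H10_H1[OF assms(1)] assms(3)] by (intro line_sq_outside) auto
  then show ?thesis by simp
next
  case False then show ?thesis using assms by (intro trace_zero_line) (auto simp: zero_trace_def)
qed

text \<open>A cutoff of width \<open>d\<close> costs \<open>1 / d\<close> times the norm of the function near the interface. That norm
  is \<open>O(d)\<close> times the energy near the interface, because the trace on the interface tends to 0.\<close>

lemma cutoff_error:
  assumes e: "0 < e" and u: "u \<in> H10 Om" and za: "zero_trace a u" and zb: "zero_trace b u" and ab: "a < b"
  obtains \<psi> where "\<psi> \<in> test_functions (strip a b)"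
    "L2_norm Om (\<lambda>x. \<psi> x - indicat_real {real a<..<real b} (fst x) * u x) < e"
    "L2_norm Om (\<lambda>x. classical_grad \<psi> x - indicat_real {real a<..<real b} (fst x) *\<^sub>R grad Om u x) < e"
proof -
  obtain K where K: "0 \<le> K" "\<And>a b \<delta>. 0 < \<delta> \<Longrightarrow> \<exists>\<eta> :: real \<times> real \<Rightarrow> real. smooth \<eta> \<and>
    (\<forall>x. 0 \<le> \<eta> x \<and> \<eta> x \<le> 1) \<and> (\<forall>x. \<eta> x \<noteq> 0 \<longrightarrow> a + \<delta> \<le> fst x \<and> fst x \<le> b - \<delta>) \<and>
    (\<forall>x. a + 2 * \<delta> \<le> fst x \<and> fst x \<le> b - 2 * \<delta> \<longrightarrow> \<eta> x = 1) \<and>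
    (\<forall>x. norm (classical_grad \<eta> x) \<le> K / \<delta> *
      (indicator {a - 2 * \<delta>..a + 2 * \<delta>} (fst x) + indicator {b - 2 * \<delta>..b + 2 * \<delta>} (fst x)))"
    using cutoff_exists by blast
  obtain \<phi> where phi: "test_approx Om \<phi> u" using open_Om u by (rule H10_D)
  note u1 = H10_H1[OF u]
  note ap = test_approxD[OF open_Om u1 phi]
  note uL = H1_D(1)[OF u1] and gL = H1_D(3)[OF u1]
  \<comment> \<open>The error of the gradient will add up to \<open>5 + 16 K\<close> such units; 8
    in place of 5 leaves some room.\<close>
  define e' where "e' = e / (8 + 16 * K)"
  have e': "0 < e'" "e' * (8 + 16 * K) = e" using e K(1) by (auto simp: e'_def)
  define J where "J c d x = indicat_real {real c - d..real c + d} (fst x)" for c d and x :: "real \<times> real"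
  \<comment> \<open>The width of the cutoff is fixed from \<open>u\<close> and the tolerance alone.
    The approximating test function is chosen afterwards, with an accuracy that depends on the
    width.\<close>
  have "\<exists>m. \<forall>F \<in> {L2_norm Om (\<lambda>x. J a (inverse (real (Suc m))) x *\<^sub>R u x), L2_norm Om (\<lambda>x. J b (inverse (real (Suc m))) x *\<^sub>R u x),
     L2_norm Om (\<lambda>x. J a (inverse (real (Suc m))) x *\<^sub>R grad Om u x), L2_norm Om (\<lambda>x. J b (inverse (real (Suc m))) x *\<^sub>R grad Om u x)}. F < e'"
  proof -
    note near = L2_norm_near_line_tendsto_0[OF _ sets_Om, THEN order_tendstoD(2), OF _ e'(1)]
    have "\<forall>\<^sub>F m in sequentially. \<forall>F \<in> {L2_norm Om (\<lambda>x. J a (inverse (real (Suc m))) x *\<^sub>R u x), L2_norm Om (\<lambda>x. J b (inverse (real (Suc m))) x *\<^sub>R u x),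
     L2_norm Om (\<lambda>x. J a (inverse (real (Suc m))) x *\<^sub>R grad Om u x), L2_norm Om (\<lambda>x. J b (inverse (real (Suc m))) x *\<^sub>R grad Om u x)}. F < e'"
      unfolding J_def using near[OF uL, of "real a"] near[OF uL, of "real b"] near[OF gL, of "real a"] near[OF gL, of "real b"]
      by eventually_elim blast
    then show ?thesis using eventually_happens by fastforce
  qed
  then obtain m where m: "L2_norm Om (\<lambda>x. J a (inverse (real (Suc m))) x *\<^sub>R u x) < e'"
    "L2_norm Om (\<lambda>x. J b (inverse (real (Suc m))) x *\<^sub>R u x) < e'"
    "L2_norm Om (\<lambda>x. J a (inverse (real (Suc m))) x *\<^sub>R grad Om u x) < e'"
    "L2_norm Om (\<lambda>x. J b (inverse (real (Suc m))) x *\<^sub>R grad Om u x) < e'" by auto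
  define d where "d = inverse (real (Suc m))"
  have d: "0 < d" by (simp add: d_def)
  note m = m[folded d_def]
  obtain \<eta> where \<eta>: "smooth \<eta>" "\<And>x. 0 \<le> \<eta> x" "\<And>x. \<eta> x \<le> 1"
    "\<And>x. \<eta> x \<noteq> 0 \<Longrightarrow> real a + d / 2 \<le> fst x \<and> fst x \<le> real b - d / 2"
    "\<And>x. real a + d \<le> fst x \<Longrightarrow> fst x \<le> real b - d \<Longrightarrow> \<eta> x = 1"
    "\<And>x. norm (classical_grad \<eta> x) \<le> 2 * K / d * (J a d x + J b d x)"
  proof -
    have eq: "2 * (d / 2) = d" "K / (d / 2) = 2 * K / d" by simp_all
    have "0 < d / 2" using d by simp
    from K(2)[OF this, of "real a" "real b", unfolded eq] show thesis
      by (elim exE conjE) (rule that[unfolded J_def], blast+)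
  qed
  \<comment> \<open>Chosen so that \<open>2 K / d\<close> times \<open>2 sqrt d k\<close> equals
    \<open>e' K / (K + 1)\<close>, which is at most \<open>e'\<close>; \<open>K + 1\<close> avoids a
    division by 0.\<close>
  define k where "k = e' * d / (2 * (K + 1)) / (2 * sqrt d)"
  have k: "0 < k" using e' d K(1) by (auto simp: k_def)
  have sm1: "\<forall>\<^sub>F n in sequentially. sqrt (line_sq (\<phi> n) (real c)) < k" if "zero_trace c u" for c
  proof -
    have "(\<lambda>n. sqrt (line_sq (\<phi> n) (real c))) \<longlonglongrightarrow> sqrt 0"
      by (intro tendsto_real_sqrt zero_trace_line[OF u that phi])
    then show ?thesis using order_tendstoD(2) k by fastforce
  qed
  have "\<forall>\<^sub>F n in sequentially. sqrt (line_sq (\<phi> n) (real a)) < k \<and> sqrt (line_sq (\<phi> n) (real b)) < k \<and>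
      L2_norm Om (\<lambda>x. \<phi> n x - u x) < e' \<and> L2_norm Om (\<lambda>x. classical_grad (\<phi> n) x - grad Om u x) < e'"
    using sm1[OF za] sm1[OF zb] order_tendstoD(2)[OF ap(2) e'(1)] order_tendstoD(2)[OF ap(3) e'(1)]
    by eventually_elim blast
  then obtain n where n: "sqrt (line_sq (\<phi> n) (real a)) < k" "sqrt (line_sq (\<phi> n) (real b)) < k"
    "L2_norm Om (\<lambda>x. \<phi> n x - u x) < e'" "L2_norm Om (\<lambda>x. classical_grad (\<phi> n) x - grad Om u x) < e'"
    using eventually_happens by fastforce
  define f where "f = \<phi> n"
  have f: "f \<in> test_functions Om" using ap(1) by (simp add: f_def)
  note fL = test_L2[OF f sets_Om]
  define I where "I x = indicat_real {real a<..<real b} (fst x)" for x :: "real \<times> real"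
  have \<eta>m: "\<eta> \<in> borel_measurable (lebesgue_on Om)" "classical_grad \<eta> \<in> borel_measurable (lebesgue_on Om)"
    using \<eta>(1) by (auto intro!: continuous_imp_measurable_on_sets_lebesgue smooth_continuous_on continuous_on_classical_grad)
  have Im: "I \<in> borel_measurable (lebesgue_on Om)" unfolding I_def by (rule measurable_indicator_fst) simp
  have JL: "(\<lambda>x. J c d x *\<^sub>R F x) \<in> L2 Om" if "F \<in> L2 Om" for c and F :: "real \<times> real \<Rightarrow> 'c::euclidean_space"
    unfolding J_def using that by (rule L2_indicator_fst) simp
  \<comment> \<open>The cutoff differs from the indicator by at most 1, and only within distance
    \<open>d\<close> of the two lines.\<close>
  have \<eta>I: "\<bar>\<eta> x - I x\<bar> \<le> J a d x + J b d x" for x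
  proof (cases "fst x \<in> {real a<..<real b}")
    case True
    show ?thesis
    proof (cases "real a + d \<le> fst x \<and> fst x \<le> real b - d")
      case True
      then show ?thesis using \<eta>(5)[of x] \<open>fst x \<in> _\<close> by (simp add: I_def J_def)
    next
      case False
      then have "1 \<le> J a d x + J b d x" using \<open>fst x \<in> _\<close> d by (auto simp: J_def indicator_def)
      moreover have "\<bar>\<eta> x - I x\<bar> \<le> 1" using \<eta>(2,3)[of x] \<open>fst x \<in> _\<close> by (simp add: I_def)
      ultimately show ?thesis by simp
    qed
  next
    case False
    then have "\<eta> x = 0" using \<eta>(4)[of x] d by force
    then show ?thesis using False by (simp add: I_def J_def)
  qed
  have mult\<eta>: "(\<lambda>x. \<eta> x *\<^sub>R F x) \<in> L2 Om" "L2_norm Om (\<lambda>x. \<eta> x *\<^sub>R F x) \<le> L2_norm Om F"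
    if F: "F \<in> L2 Om" for F :: "real \<times> real \<Rightarrow> 'c::euclidean_space"
  proof -
    have bd: "norm (\<eta> x *\<^sub>R F x) \<le> 1 * norm (F x)" for x
      using \<eta>(2,3)[of x] by (simp add: mult_left_le_one_le)
    show *: "(\<lambda>x. \<eta> x *\<^sub>R F x) \<in> L2 Om" using L2_D(1)[OF F] \<eta>m by (intro L2_bound[OF F _ bd]) auto
    show "L2_norm Om (\<lambda>x. \<eta> x *\<^sub>R F x) \<le> L2_norm Om F" using L2_norm_mono[OF * F bd] by simp
  qed
  have mult\<eta>I: "(\<lambda>x. (\<eta> x - I x) *\<^sub>R F x) \<in> L2 Om"
    "L2_norm Om (\<lambda>x. (\<eta> x - I x) *\<^sub>R F x) \<le> L2_norm Om (\<lambda>x. J a d x *\<^sub>R F x) + L2_norm Om (\<lambda>x. J b d x *\<^sub>R F x)"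
    if F: "F \<in> L2 Om" for F :: "real \<times> real \<Rightarrow> 'c::euclidean_space"
  proof -
    have bd: "norm ((\<eta> x - I x) *\<^sub>R F x) \<le> 1 * norm (J a d x *\<^sub>R F x + J b d x *\<^sub>R F x)" for x
      using mult_right_mono[OF \<eta>I[of x] norm_ge_zero[of "F x"]]
      by (simp add: J_def flip: scaleR_add_left)
    note JJ = L2_add[OF JL[OF F] JL[OF F]]
    show *: "(\<lambda>x. (\<eta> x - I x) *\<^sub>R F x) \<in> L2 Om"
      using L2_D(1)[OF F] \<eta>m Im by (intro L2_bound[OF JJ _ bd]) auto
    show "L2_norm Om (\<lambda>x. (\<eta> x - I x) *\<^sub>R F x) \<le> L2_norm Om (\<lambda>x. J a d x *\<^sub>R F x) + L2_norm Om (\<lambda>x. J b d x *\<^sub>R F x)"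
      using L2_norm_mono[OF * JJ bd] L2_norm_triangle[OF JL[OF F] JL[OF F], of a b] by simp
  qed
  \<comment> \<open>This bounds the term with the gradient of the cutoff. The first summand is the
    contribution of the trace, by the choice of \<open>k\<close>; the second is that of the energy
    near the line, in which \<open>d\<close> cancels.\<close>
  have Jf: "2 * K / d * L2_norm Om (\<lambda>x. J c d x *\<^sub>R f x) \<le> e' + 8 * K * e'"
    if ls: "sqrt (line_sq f (real c)) < k" and mc: "L2_norm Om (\<lambda>x. J c d x *\<^sub>R grad Om u x) < e'" for c
  proof -
    let ?g = "L2_norm Om (\<lambda>x. J c d x *\<^sub>R classical_grad f x)"
    have "?g \<le> L2_norm Om (\<lambda>x. J c d x *\<^sub>R classical_grad f x - J c d x *\<^sub>R grad Om u x) + L2_norm Om (\<lambda>x. J c d x *\<^sub>R grad Om u x)"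
      by (rule L2_norm_le_add[OF JL[OF fL(2)] JL[OF gL]])
    also have "L2_norm Om (\<lambda>x. J c d x *\<^sub>R classical_grad f x - J c d x *\<^sub>R grad Om u x)
        \<le> 1 * L2_norm Om (\<lambda>x. classical_grad f x - grad Om u x)"
      by (intro L2_norm_mono L2_diff JL fL gL) (auto simp: J_def indicator_def)
    finally have g: "?g \<le> 2 * e'" using n(4) mc by (simp add: f_def)
    have "(L2_norm Om (\<lambda>x. J c d x *\<^sub>R f x))\<^sup>2 \<le> 4 * d * line_sq f (real c) + 4 * d\<^sup>2 * ?g\<^sup>2"
      using near_line_test[OF f, of d "real c"] d by (simp add: J_def)
    also have "\<dots> = (2 * sqrt d * sqrt (line_sq f (real c)))\<^sup>2 + (2 * d * ?g)\<^sup>2"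
      using d by (simp add: power_mult_distrib)
    also have "\<dots> \<le> (2 * sqrt d * sqrt (line_sq f (real c)) + 2 * d * ?g)\<^sup>2"
      using d by (simp add: power2_sum)
    finally have "L2_norm Om (\<lambda>x. J c d x *\<^sub>R f x) \<le> 2 * sqrt d * sqrt (line_sq f (real c)) + 2 * d * ?g"
      by (rule power2_le_imp_le) (use d in simp)
    also have "\<dots> \<le> 2 * sqrt d * k + 2 * d * (2 * e')"
      using ls g d by (intro add_mono mult_left_mono) auto
    finally have "2 * K / d * L2_norm Om (\<lambda>x. J c d x *\<^sub>R f x) \<le> 2 * K / d * (2 * sqrt d * k + 2 * d * (2 * e'))"
      using d K(1) by (intro mult_left_mono) auto
    also have "\<dots> = e' * (K / (K + 1)) + 8 * K * e'"
    proof -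
      have "2 * sqrt d * k = e' * d / (2 * (K + 1))" using d by (simp add: k_def)
      moreover have "2 * K / d * (e' * d / (2 * (K + 1)) + 2 * d * (2 * e')) = e' * (K / (K + 1)) + 8 * K * e'"
      proof -
        have "K + 1 \<noteq> 0" "d \<noteq> 0" using K(1) d by auto
        then show ?thesis by (simp add: divide_simps) (simp add: algebra_simps)
      qed
      ultimately show ?thesis by simp
    qed
    also have "\<dots> \<le> e' + 8 * K * e'"
    proof -
      have "K / (K + 1) \<le> 1" using K(1) by simp
      from mult_left_mono[OF this, of e'] show ?thesis using e'(1) by simp
    qed
    finally show ?thesis .
  qed
  have G\<eta>: "(\<lambda>x. f x *\<^sub>R classical_grad \<eta> x) \<in> L2 Om"
    "L2_norm Om (\<lambda>x. f x *\<^sub>R classical_grad \<eta> x) \<le> 2 * e' + 16 * K * e'"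
  proof -
    have bd: "norm (f x *\<^sub>R classical_grad \<eta> x) \<le> 2 * K / d * norm (J a d x *\<^sub>R f x + J b d x *\<^sub>R f x)" for x
    proof -
      have "\<bar>f x\<bar> * norm (classical_grad \<eta> x) \<le> \<bar>f x\<bar> * (2 * K / d * (J a d x + J b d x))"
        by (intro mult_left_mono \<eta>(6)) auto
      also have "\<dots> = 2 * K / d * \<bar>(J a d x + J b d x) * f x\<bar>" by (simp add: abs_mult J_def)
      finally show ?thesis by (simp add: distrib_right)
    qed
    note JJ = L2_add[OF JL[OF fL(1), of a] JL[OF fL(1), of b]]
    show *: "(\<lambda>x. f x *\<^sub>R classical_grad \<eta> x) \<in> L2 Om"
      using L2_D(1)[OF fL(1)] \<eta>m by (intro L2_bound[OF JJ _ bd]) auto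
    have Kd: "0 \<le> 2 * K / d" using K(1) d by simp
    have "L2_norm Om (\<lambda>x. f x *\<^sub>R classical_grad \<eta> x) \<le> 2 * K / d * L2_norm Om (\<lambda>x. J a d x *\<^sub>R f x + J b d x *\<^sub>R f x)"
      by (rule L2_norm_mono[OF * JJ bd Kd])
    also have "\<dots> \<le> 2 * K / d * (L2_norm Om (\<lambda>x. J a d x *\<^sub>R f x) + L2_norm Om (\<lambda>x. J b d x *\<^sub>R f x))"
      by (intro mult_left_mono L2_norm_triangle JL fL Kd)
    also have "\<dots> \<le> 2 * e' + 16 * K * e'"
      using Jf[of a] Jf[of b] n m(3,4) by (simp add: f_def distrib_left)
    finally show "L2_norm Om (\<lambda>x. f x *\<^sub>R classical_grad \<eta> x) \<le> 2 * e' + 16 * K * e'" .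
  qed
  define \<psi> where "\<psi> x = \<eta> x * f x" for x
  have "\<psi> \<in> test_functions (strip a b)"
  proof -
    obtain Q where Q: "compact Q" "Q \<subseteq> Om" "\<And>x. x \<notin> Q \<Longrightarrow> f x = 0" by (rule test_functionsE[OF f]) blast
    show ?thesis
    proof (rule test_functionsI)
      show "smooth \<psi>" unfolding \<psi>_def by (intro smooth_intros \<eta>(1) test_smooth[OF f])
      have "closed ({real a + d / 2..real b - d / 2} \<times> (UNIV :: real set))" by (intro closed_Times) auto
      then show "compact (Q \<inter> ({real a + d / 2..real b - d / 2} \<times> UNIV))" using Q(1) by (rule compact_Int_closed[rotated])
      show "Q \<inter> ({real a + d / 2..real b - d / 2} \<times> UNIV) \<subseteq> strip a b" using Q(2) d by auto
      show "\<psi> x = 0" if "x \<notin> Q \<inter> ({real a + d / 2..real b - d / 2} \<times> UNIV)" for x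
        using that Q(3)[of x] \<eta>(4)[of x] by (cases x) (auto simp: \<psi>_def)
    qed
  qed
  moreover have "L2_norm Om (\<lambda>x. \<psi> x - I x * u x) < e"
  proof -
    have "L2_norm Om (\<lambda>x. \<psi> x - I x * u x) = L2_norm Om (\<lambda>x. \<eta> x *\<^sub>R (f x - u x) + (\<eta> x - I x) *\<^sub>R u x)"
      by (simp add: \<psi>_def algebra_simps)
    also have "\<dots> \<le> L2_norm Om (\<lambda>x. \<eta> x *\<^sub>R (f x - u x)) + L2_norm Om (\<lambda>x. (\<eta> x - I x) *\<^sub>R u x)"
      by (intro L2_norm_triangle mult\<eta>(1) mult\<eta>I(1) L2_diff fL uL)
    also have "\<dots> \<le> L2_norm Om (\<lambda>x. f x - u x) + (L2_norm Om (\<lambda>x. J a d x *\<^sub>R u x) + L2_norm Om (\<lambda>x. J b d x *\<^sub>R u x))"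
      by (intro add_mono mult\<eta>(2) mult\<eta>I(2) L2_diff fL uL)
    also have "\<dots> < e' + (e' + e')" using n(3) m(1,2) by (simp add: f_def)
    also have "\<dots> \<le> e' * (8 + 16 * K)" using e'(1) K(1) by (simp add: algebra_simps)
    finally show ?thesis using e' by simp
  qed
  moreover have "L2_norm Om (\<lambda>x. classical_grad \<psi> x - I x *\<^sub>R grad Om u x) < e"
  proof -
    \<comment> \<open>Three errors: the approximation of \<open>u\<close>, the deviation of the
      cutoff from the indicator, and the gradient of the cutoff.\<close>
    have "L2_norm Om (\<lambda>x. classical_grad \<psi> x - I x *\<^sub>R grad Om u x)
       = L2_norm Om (\<lambda>x. (\<eta> x *\<^sub>R (classical_grad f x - grad Om u x) + (\<eta> x - I x) *\<^sub>R grad Om u x) + f x *\<^sub>R classical_grad \<eta> x)"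
      unfolding \<psi>_def by (simp add: classical_grad_mult \<eta>(1) test_smooth[OF f] algebra_simps)
    also have "\<dots> \<le> L2_norm Om (\<lambda>x. \<eta> x *\<^sub>R (classical_grad f x - grad Om u x) + (\<eta> x - I x) *\<^sub>R grad Om u x)
        + L2_norm Om (\<lambda>x. f x *\<^sub>R classical_grad \<eta> x)"
      by (intro L2_norm_triangle L2_add mult\<eta>(1) mult\<eta>I(1) L2_diff fL gL G\<eta>(1))
    also have "\<dots> \<le> (L2_norm Om (\<lambda>x. \<eta> x *\<^sub>R (classical_grad f x - grad Om u x)) + L2_norm Om (\<lambda>x. (\<eta> x - I x) *\<^sub>R grad Om u x))
        + (2 * e' + 16 * K * e')"
      by (intro add_mono L2_norm_triangle mult\<eta>(1) mult\<eta>I(1) L2_diff fL gL G\<eta>(2))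
    also have "\<dots> \<le> (L2_norm Om (\<lambda>x. classical_grad f x - grad Om u x) +
        (L2_norm Om (\<lambda>x. J a d x *\<^sub>R grad Om u x) + L2_norm Om (\<lambda>x. J b d x *\<^sub>R grad Om u x))) + (2 * e' + 16 * K * e')"
      by (intro add_mono mult\<eta>(2) mult\<eta>I(2) L2_diff fL gL order_refl)
    also have "\<dots> < (e' + (e' + e')) + (2 * e' + 16 * K * e')" using n(4) m(3,4) by (simp add: f_def)
    also have "\<dots> \<le> e' * (8 + 16 * K)" using e'(1) by (simp add: algebra_simps)
    finally show ?thesis using e' by simp
  qed
  ultimately show ?thesis using that unfolding I_def by blast
qed

text \<open>Sharp truncation produces no jump where the trace vanishes: cutoffs with errors below
  \<open>1 / (n + 1)\<close> converge to the truncated function together with its truncated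
  gradient. The approximants are test functions of the open strip, which later makes them admissible
  in orthogonality relations.\<close>

lemma cut:
  assumes u: "u \<in> H10 Om" and z: "zero_trace a u" "zero_trace b u" and ab: "a < b"
  defines "w \<equiv> \<lambda>x. indicat_real {real a<..<real b} (fst x) * u x"
  obtains \<psi> where "\<And>n. \<psi> n \<in> test_functions (strip a b)" "test_approx Om \<psi> w" "w \<in> H10 Om"
    "AE x in lebesgue_on Om. grad Om w x = indicat_real {real a<..<real b} (fst x) *\<^sub>R grad Om u x"
proof -
  have pos: "0 < inverse (real (Suc n))" for n by simp
  have "\<forall>n. \<exists>\<psi>. \<psi> \<in> test_functions (strip a b) \<and>
    L2_norm Om (\<lambda>x. \<psi> x - w x) < inverse (real (Suc n)) \<and>
    L2_norm Om (\<lambda>x. classical_grad \<psi> x - indicat_real {real a<..<real b} (fst x) *\<^sub>R grad Om u x) < inverse (real (Suc n))"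
    unfolding w_def
  proof
    fix n show "\<exists>\<psi>. \<psi> \<in> test_functions (strip a b) \<and>
      L2_norm Om (\<lambda>x. \<psi> x - indicat_real {real a<..<real b} (fst x) * u x) < inverse (real (Suc n)) \<and>
      L2_norm Om (\<lambda>x. classical_grad \<psi> x - indicat_real {real a<..<real b} (fst x) *\<^sub>R grad Om u x) < inverse (real (Suc n))"
      by (rule cutoff_error[OF pos[of n] u z ab]) blast
  qed
  then obtain \<psi> where psi: "\<And>n. \<psi> n \<in> test_functions (strip a b)"
    "\<And>n. L2_norm Om (\<lambda>x. \<psi> n x - w x) < inverse (real (Suc n))"
    "\<And>n. L2_norm Om (\<lambda>x. classical_grad (\<psi> n) x - indicat_real {real a<..<real b} (fst x) *\<^sub>R grad Om u x) < inverse (real (Suc n))"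
    by (elim choice[THEN exE]) blast
  have T: "\<psi> n \<in> test_functions Om" for n by (rule test_mono[OF psi(1)]) auto
  have wL: "w \<in> L2 Om" using L2_indicator_fst[OF H1_D(1)[OF H10_H1[OF u]], of "{real a<..<real b}"] by (simp add: w_def)
  have gL: "(\<lambda>x. indicat_real {real a<..<real b} (fst x) *\<^sub>R grad Om u x) \<in> L2 Om"
    by (rule L2_indicator_fst[OF grad_L2[OF u]]) simp
  have c: "(\<lambda>n. L2_norm Om (\<lambda>x. \<psi> n x - w x)) \<longlonglongrightarrow> 0"
    "(\<lambda>n. L2_norm Om (\<lambda>x. classical_grad (\<psi> n) x - indicat_real {real a<..<real b} (fst x) *\<^sub>R grad Om u x)) \<longlonglongrightarrow> 0"
    using psi(2,3) by (intro Lim_null_comparison[OF _ LIMSEQ_inverse_real_of_nat] always_eventually; simp add: less_imp_le)+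
  show ?thesis by (rule that) (rule psi(1) test_approxI[OF open_Om T wL gL c])+
qed

end

section \<open>Functions harmonic in every subdomain\<close>

context chain
begin

abbreviation SS :: "(real \<times> real) set" where "SS \<equiv> (\<Union>k\<in>{1..N}. S k)"

abbreviation VG :: "(real \<times> real \<Rightarrow> real) set" where "VG \<equiv> V_Gamma N r1 r2"

abbreviation VGi :: "nat \<Rightarrow> (real \<times> real \<Rightarrow> real) set" where "VGi \<equiv> V_Gamma_i N r1 r2"

lemma SS_subset_Om: "SS \<subseteq> Om"
  using S_subset_Om by blast

text \<open>Hence test functions of \<open>SS\<close> vanish on all interfaces, and subtracting a
  limit of them changes no trace.\<close>

lemma SS_not_on_line: "(real i, t) \<notin> SS"
proof
  assume "(real i, t) \<in> SS"
  then obtain k where k: "k \<in> {1..N}" "(real i, t) \<in> S k" by blast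
  then have "real k - 1 < real i" "real i < real k" by (auto simp: subdomain_iff)
  then have "k < Suc i" "i < k" by linarith+
  then show False by simp
qed

lemma test_grad_ip:
  assumes "u \<in> H10 Om" "\<phi> \<in> test_functions Om"
  shows "grad_ip N r1 r2 Om u \<phi> = L2_ip Om (grad Om u) (classical_grad \<phi>)"
  unfolding grad_ip_def using H1_test[OF open_Om assms(2)]
  by (intro L2_ip_cong_AE grad_L2 assms(1) H10_test[OF open_Om assms(2)] test_L2(2)[OF assms(2) sets_Om]) auto

lemma V_Omega_test:
  assumes "k \<in> {1..N}" "\<phi> \<in> test_functions (S k)" shows "\<phi> \<in> V_Omega N r1 r2 k"
proof -
  have "\<phi> \<in> H10 Om" by (rule H10_test[OF open_Om test_mono[OF assms(2) S_subset_Om[OF assms(1)]]])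
  moreover have "\<phi> \<in> H10 (S k)" using assms by (intro H10_test open_S) auto
  moreover have "AE x in lebesgue_on Om. \<phi> x = (if x \<in> S k then \<phi> x else 0)"
    using test_zero[OF assms(2)] by (intro AE_I2) auto
  ultimately show ?thesis unfolding V_Omega_def by blast
qed

text \<open>An approximating sequence on the subdomain is extended by zero; its distances to the
  extended function over the domain equal those over the subdomain.\<close>

lemma V_Omega_approx:
  assumes k: "k \<in> {1..N}" and v: "v \<in> V_Omega N r1 r2 k"
  obtains \<phi> where "\<And>n. \<phi> n \<in> test_functions (S k)" "test_approx Om \<phi> v"
proof -
  have oS: "open (S k)" and sS: "S k \<in> sets lebesgue" and sub: "S k \<subseteq> Om"
    using k open_S S_subset_Om by auto
  obtain w where vH: "v \<in> H10 Om" and w: "w \<in> H10 (S k)"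
    and ae: "AE x in lebesgue_on Om. v x = (if x \<in> S k then w x else 0)"
    using v by (auto simp: V_Omega_def)
  obtain \<phi> where phi: "test_approx (S k) \<phi> w" using oS w by (rule H10_D)
  note w1 = H10_H1[OF w]
  note a = test_approxD[OF oS w1 phi]
  have T: "\<phi> n \<in> test_functions Om" for n by (rule test_mono[OF a(1) sub])
  define G where "G x = indicat_real (S k) x *\<^sub>R grad (S k) w x" for x
  have GL: "G \<in> L2 Om" unfolding G_def by (rule L2_indicator[OF H1_D(3)[OF w1] sub sets_Om sS])
  have vL: "v \<in> L2 Om" by (rule H1_D(1)[OF H10_H1[OF vH]])
  have wL: "(\<lambda>x. indicat_real (S k) x *\<^sub>R w x) \<in> L2 Om" by (rule L2_indicator[OF H1_D(1)[OF w1] sub sets_Om sS])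
  have norm_eq: "L2_norm Om (\<lambda>x. F x - indicat_real (S k) x *\<^sub>R H x) = L2_norm (S k) (\<lambda>x. F x - H x)"
    if "\<And>x. x \<notin> S k \<Longrightarrow> F x = 0" for F H :: "real \<times> real \<Rightarrow> 'c::euclidean_space"
  proof -
    have "L2_ip Om (\<lambda>x. F x - indicat_real (S k) x *\<^sub>R H x) (\<lambda>x. F x - indicat_real (S k) x *\<^sub>R H x) =
        L2_ip (S k) (\<lambda>x. F x - H x) (\<lambda>x. F x - H x)"
      unfolding L2_ip_indicator[OF sets_Om] L2_ip_indicator[OF sS]
      using that sub by (intro Bochner_Integration.integral_cong) (auto simp: indicator_def)
    then show ?thesis by (simp add: L2_norm_def)
  qed
  have c1: "(\<lambda>n. L2_norm Om (\<lambda>x. \<phi> n x - v x)) \<longlonglongrightarrow> 0"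
  proof -
    have "L2_norm Om (\<lambda>x. \<phi> n x - v x) = L2_norm Om (\<lambda>x. \<phi> n x - indicat_real (S k) x *\<^sub>R w x)" for n
      using ae by (intro L2_norm_cong_AE L2_diff test_L2(1)[OF T] vL wL sets_Om)
        (auto elim!: eventually_mono simp: indicator_def)
    also have "\<dots> n = L2_norm (S k) (\<lambda>x. \<phi> n x - w x)" for n by (rule norm_eq) (rule test_zero[OF a(1)])
    finally show ?thesis using a(2) by simp
  qed
  have c2: "(\<lambda>n. L2_norm Om (\<lambda>x. classical_grad (\<phi> n) x - G x)) \<longlonglongrightarrow> 0"
    unfolding G_def using a(3) by (subst norm_eq) (auto simp: test_grad_zero[OF a(1)])
  show ?thesis by (rule that[OF a(1) test_approxI(2)[OF open_Om T vL GL c1 c2]])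
qed

lemma VG_D:
  assumes "u \<in> VG" shows "u \<in> H10 Om"
    "k \<in> {1..N} \<Longrightarrow> \<phi> \<in> test_functions (S k) \<Longrightarrow> L2_ip Om (grad Om u) (classical_grad \<phi>) = 0"
proof -
  show u: "u \<in> H10 Om" using assms by (simp add: V_Gamma_def)
  assume k: "k \<in> {1..N}" and phi: "\<phi> \<in> test_functions (S k)"
  have "grad_ip N r1 r2 Om u \<phi> = 0" using assms k V_Omega_test[OF k phi] by (auto simp: V_Gamma_def)
  then show "L2_ip Om (grad Om u) (classical_grad \<phi>) = 0"
    using test_grad_ip[OF u test_mono[OF phi S_subset_Om[OF k]]] by simp
qed

text \<open>Testing with smooth functions of the subdomains suffices, since they approximate every
  function of \<open>V_Omega\<close>.\<close>

lemma VG_I: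
  assumes u: "u \<in> H10 Om"
    and orth: "\<And>k \<phi>. k \<in> {1..N} \<Longrightarrow> \<phi> \<in> test_functions (S k) \<Longrightarrow> L2_ip Om (grad Om u) (classical_grad \<phi>) = 0"
  shows "u \<in> VG"
  unfolding V_Gamma_def
proof (intro CollectI conjI ballI u)
  fix k v assume k: "k \<in> {1..N}" and v: "v \<in> V_Omega N r1 r2 k"
  obtain \<phi> where phi: "\<And>n. \<phi> n \<in> test_functions (S k)" "test_approx Om \<phi> v"
    using k v by (rule V_Omega_approx) blast
  have vH: "v \<in> H10 Om" using v by (simp add: V_Omega_def)
  note a = test_approxD[OF open_Om H10_H1[OF vH] phi(2)]
  have "(\<lambda>n. L2_ip Om (classical_grad (\<phi> n)) (grad Om u)) \<longlonglongrightarrow> L2_ip Om (grad Om v) (grad Om u)"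
    by (rule L2_ip_tendsto[OF test_L2(2)[OF a(1) sets_Om] grad_L2[OF vH] grad_L2[OF u] a(3)])
  then show "grad_ip N r1 r2 Om u v = 0"
    using orth[OF k phi(1)] by (simp add: L2_ip_commute[of Om _ "grad Om u"] LIMSEQ_const_iff grad_ip_def)
qed

lemma VG_H10: "u \<in> VG \<Longrightarrow> u \<in> H10 Om"
  by (rule VG_D(1))

lemma grad_add_AE: "u \<in> H10 Om \<Longrightarrow> v \<in> H10 Om \<Longrightarrow> AE x in lebesgue_on Om. grad Om (\<lambda>x. u x + v x) x = grad Om u x + grad Om v x"
  by (rule H1_add(2)[OF open_Om H10_H1 H10_H1])

lemma VG_add: assumes "u \<in> VG" "v \<in> VG" shows "(\<lambda>x. u x + v x) \<in> VG"
proof (rule VG_I)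
  note H = VG_H10[OF assms(1)] VG_H10[OF assms(2)]
  show "(\<lambda>x. u x + v x) \<in> H10 Om" by (rule H10_add[OF open_Om H])
  fix k \<phi> assume k: "k \<in> {1..N}" and phi: "\<phi> \<in> test_functions (S k)"
  note pL = test_L2(2)[OF phi sets_Om]
  have "L2_ip Om (grad Om (\<lambda>x. u x + v x)) (classical_grad \<phi>) = L2_ip Om (\<lambda>x. grad Om u x + grad Om v x) (classical_grad \<phi>)"
    using grad_add_AE[OF H] by (intro L2_ip_cong_AE L2_add grad_L2 H pL H10_add[OF open_Om]) auto
  then show "L2_ip Om (grad Om (\<lambda>x. u x + v x)) (classical_grad \<phi>) = 0"
    using VG_D(2)[OF assms(1) k phi] VG_D(2)[OF assms(2) k phi] by (simp add: L2_ip_add_left grad_L2 H pL)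
qed

lemma VG_cmult: assumes "u \<in> VG" shows "(\<lambda>x. c * u x) \<in> VG"
proof (rule VG_I)
  note H = VG_H10[OF assms(1)]
  show "(\<lambda>x. c * u x) \<in> H10 Om" by (rule H10_cmult[OF open_Om H])
  fix k \<phi> assume k: "k \<in> {1..N}" and phi: "\<phi> \<in> test_functions (S k)"
  note pL = test_L2(2)[OF phi sets_Om]
  have "L2_ip Om (grad Om (\<lambda>x. c * u x)) (classical_grad \<phi>) = L2_ip Om (\<lambda>x. c *\<^sub>R grad Om u x) (classical_grad \<phi>)"
    using H1_cmult(2)[OF open_Om H10_H1[OF H]] by (intro L2_ip_cong_AE L2_scaleR grad_L2 H pL H10_cmult[OF open_Om]) auto
  then show "L2_ip Om (grad Om (\<lambda>x. c * u x)) (classical_grad \<phi>) = 0"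
    using VG_D(2)[OF assms(1) k phi] by (simp add: L2_ip_scaleR_left)
qed

lemma VG_diff: "u \<in> VG \<Longrightarrow> v \<in> VG \<Longrightarrow> (\<lambda>x. u x - v x) \<in> VG"
  using VG_add[OF _ VG_cmult, of u v "-1"] by simp

lemma VG_zero: "(\<lambda>x. 0) \<in> VG"
proof (rule VG_I[OF H10_zero])
  fix k \<phi> assume "k \<in> {1..N}" and phi: "\<phi> \<in> test_functions (S k)"
  have "L2_ip Om (grad Om (\<lambda>x. 0)) (classical_grad \<phi>) = L2_ip Om (\<lambda>x. 0) (classical_grad \<phi>)"
    using H1_test(2)[OF open_Om test_zero_function] by (intro L2_ip_cong_AE grad_L2 H10_zero test_L2(2)[OF phi])
      (auto simp: classical_grad_const)
  then show "L2_ip Om (grad Om (\<lambda>x. 0)) (classical_grad \<phi>) = 0" by simp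
qed

lemma VG_sum: "(\<And>i. i \<in> I \<Longrightarrow> f i \<in> VG) \<Longrightarrow> (\<lambda>x. \<Sum>i\<in>I. f i x) \<in> VG"
  by (induction I rule: infinite_finite_induct) (auto intro: VG_zero VG_add)

lemma VGi_VG: "u \<in> VGi j \<Longrightarrow> u \<in> VG"
  by (simp add: V_Gamma_i_def)

lemma VGi_H10: "u \<in> VGi j \<Longrightarrow> u \<in> H10 Om"
  using VGi_VG VG_H10 by blast

lemma VGi_zero_trace: "u \<in> VGi j \<Longrightarrow> k \<noteq> j \<Longrightarrow> zero_trace k u"
  by (force simp: V_Gamma_i_def zero_trace_def not_le less_eq_Suc_le)

lemma VGi_diff:
  assumes "u \<in> VGi j" "v \<in> VGi j" shows "(\<lambda>x. u x - v x) \<in> VGi j"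
proof -
  have "trace_of k (\<lambda>x. u x - v x) (\<lambda>_. 0)" if "k \<in> {1..N - 1}" "k \<noteq> j" for k
    using trace_diff[of k u v "\<lambda>_. 0" "\<lambda>_. 0"] assms that VGi_H10 by (auto simp: V_Gamma_i_def)
  moreover have "(\<lambda>x. u x - v x) \<in> VG" by (intro VG_diff VGi_VG[OF assms(1)] VGi_VG[OF assms(2)])
  ultimately show ?thesis by (simp add: V_Gamma_i_def)
qed

text \<open>The energy projection onto the functions vanishing on all interfaces, as the limit of a minimizing
  sequence, which is Cauchy by the parallelogram law.\<close>

lemma projection_exists:
  assumes w: "w \<in> H10 Om"
  obtains p \<phi> where "p \<in> H10 Om" "\<And>n. \<phi> n \<in> test_functions SS" "test_approx Om \<phi> p"
    "\<And>\<psi>. \<psi> \<in> test_functions SS \<Longrightarrow> L2_ip Om (\<lambda>x. grad Om w x - grad Om p x) (classical_grad \<psi>) = 0"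
proof -
  define F where "F = grad Om w"
  have F: "F \<in> L2 Om" unfolding F_def by (rule grad_L2[OF w])
  define q where "q \<phi> = L2_ip Om (\<lambda>x. F x - classical_grad \<phi> x) (\<lambda>x. F x - classical_grad \<phi> x)" for \<phi>
  define d where "d = Inf (q ` test_functions SS)"
  have bdd: "bdd_below (q ` test_functions SS)" by (rule bdd_belowI[of _ 0]) (auto simp: q_def)
  have d_le: "d \<le> q \<phi>" if "\<phi> \<in> test_functions SS" for \<phi>
    unfolding d_def using bdd that by (intro cInf_lower) auto
  have "\<exists>\<phi>. \<phi> \<in> test_functions SS \<and> q \<phi> < d + inverse (real (Suc n))" for n
  proof -
    have "Inf (q ` test_functions SS) < d + inverse (real (Suc n))" by (simp add: d_def)
    then show ?thesis using test_zero_function by (subst (asm) cInf_less_iff[OF _ bdd]) auto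
  qed
  then obtain \<phi> where phi: "\<And>n. \<phi> n \<in> test_functions SS" "\<And>n. q (\<phi> n) < d + inverse (real (Suc n))" by metis
  have T: "\<psi> \<in> test_functions Om" if "\<psi> \<in> test_functions SS" for \<psi> by (rule test_mono[OF that SS_subset_Om])
  have gL: "classical_grad \<psi> \<in> L2 Om" if "\<psi> \<in> test_functions SS" for \<psi> by (rule test_L2(2)[OF that sets_Om])
  have FL: "(\<lambda>x. F x - classical_grad \<psi> x) \<in> L2 Om" if "\<psi> \<in> test_functions SS" for \<psi> by (intro L2_diff F gL that)
  \<comment> \<open>Perturbed test functions cannot fall below the infimum \<open>d\<close>. The
    discriminant then bounds the first variation at \<psi> by the defect
    \<open>q \<psi> - d\<close>.\<close>
  have expand: "0 \<le> (q \<psi> - d) + 2 * t * (- L2_ip Om (\<lambda>x. F x - classical_grad \<psi> x) (classical_grad \<xi>))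
      + t\<^sup>2 * L2_ip Om (classical_grad \<xi>) (classical_grad \<xi>)"
    if \<psi>: "\<psi> \<in> test_functions SS" and \<xi>: "\<xi> \<in> test_functions SS" for \<psi> \<xi> t
  proof -
    have "q (\<lambda>x. \<psi> x + t * \<xi> x) = L2_ip Om (\<lambda>x. (F x - classical_grad \<psi> x) - t *\<^sub>R classical_grad \<xi> x)
        (\<lambda>x. (F x - classical_grad \<psi> x) - t *\<^sub>R classical_grad \<xi> x)"
      using test_smooth[OF \<psi>] test_smooth[OF \<xi>]
      by (simp add: q_def classical_grad_add classical_grad_cmult smooth_intros(3)[OF smooth_intros(1)] diff_diff_eq)
    also have "\<dots> = q \<psi> - 2 * L2_ip Om (\<lambda>x. F x - classical_grad \<psi> x) (\<lambda>x. t *\<^sub>R classical_grad \<xi> x)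
        + L2_ip Om (\<lambda>x. t *\<^sub>R classical_grad \<xi> x) (\<lambda>x. t *\<^sub>R classical_grad \<xi> x)"
      unfolding q_def by (rule L2_diff_ip_self[OF FL[OF \<psi>] L2_scaleR[OF gL[OF \<xi>]]])
    finally show ?thesis
      using d_le[OF test_add[OF \<psi> test_cmult[OF \<xi>]], of t]
      by (simp add: L2_ip_scaleR_left L2_ip_scaleR_right power2_eq_square algebra_simps)
  qed
  have small: "(L2_ip Om (\<lambda>x. F x - classical_grad \<psi> x) (classical_grad \<xi>))\<^sup>2
      \<le> (q \<psi> - d) * L2_ip Om (classical_grad \<xi>) (classical_grad \<xi>)"
    if "\<psi> \<in> test_functions SS" "\<xi> \<in> test_functions SS" for \<psi> \<xi>
    using psd_quadratic_discriminant[OF L2_ip_self_nonneg expand[OF that]] by simp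
  have diffsq: "(L2_norm Om (\<lambda>x. classical_grad (\<phi> i) x - classical_grad (\<phi> j) x))\<^sup>2
      \<le> 4 * ((q (\<phi> i) - d) + (q (\<phi> j) - d))" for i j
  proof -
    define X where "X = L2_norm Om (\<lambda>x. classical_grad (\<phi> i) x - classical_grad (\<phi> j) x)"
    have c: "classical_grad (\<lambda>x. \<phi> i x - \<phi> j x) = (\<lambda>x. classical_grad (\<phi> i) x - classical_grad (\<phi> j) x)"
      by (rule classical_grad_diff_fun) (rule test_smooth[OF phi(1)])+
    have D: "(\<lambda>x. \<phi> i x - \<phi> j x) \<in> test_functions SS" by (intro test_diff phi)
    let ?\<xi> = "\<lambda>x. classical_grad (\<phi> i) x - classical_grad (\<phi> j) x"
    \<comment> \<open>First variations at the two members of the sequence in the direction of their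
      difference. \<open>P j - P i\<close> is the squared norm of that direction, while near
      minimality makes both variations small relative to it.\<close>
    define P where "P k = L2_ip Om (\<lambda>x. F x - classical_grad (\<phi> k) x) ?\<xi>" for k
    have P: "(P k)\<^sup>2 \<le> (q (\<phi> k) - d) * X\<^sup>2" for k
      using small[OF phi(1)[of k] D] by (simp add: P_def X_def c L2_norm_power2)
    have "X\<^sup>2 = P j - P i"
    proof -
      have "P j - P i = L2_ip Om (\<lambda>x. (F x - classical_grad (\<phi> j) x) - (F x - classical_grad (\<phi> i) x)) ?\<xi>"
        unfolding P_def by (intro L2_ip_diff_left[symmetric] FL L2_diff gL phi)
      then show ?thesis by (simp add: X_def L2_norm_power2)
    qed
    then have "(X\<^sup>2)\<^sup>2 = (P j - P i)\<^sup>2" by simp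
    also have "\<dots> \<le> 2 * (P j)\<^sup>2 + 2 * (P i)\<^sup>2"
      using sum_squares_bound[of "P j" "- P i"] by (simp add: power2_diff)
    also have "\<dots> \<le> 4 * ((q (\<phi> i) - d) + (q (\<phi> j) - d)) * X\<^sup>2"
      using P[of i] P[of j] d_le[OF phi(1)[of i]] d_le[OF phi(1)[of j]]
        mult_nonneg_nonneg[of "q (\<phi> i) - d" "X\<^sup>2"] mult_nonneg_nonneg[of "q (\<phi> j) - d" "X\<^sup>2"]
      by (simp add: algebra_simps)
    finally have le: "X\<^sup>2 * X\<^sup>2 \<le> 4 * ((q (\<phi> i) - d) + (q (\<phi> j) - d)) * X\<^sup>2" by (simp add: power2_eq_square)
    show ?thesis
    proof (cases "X\<^sup>2 = 0")
      case True
      then show ?thesis using d_le[OF phi(1)[of i]] d_le[OF phi(1)[of j]] by (simp add: X_def)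
    next
      case False
      then have "0 < X\<^sup>2" by simp
      with le show ?thesis unfolding X_def[symmetric] by (rule mult_right_le_imp_le)
    qed
  qed
  have "\<exists>K. \<forall>i\<ge>K. \<forall>j\<ge>K. L2_norm Om (\<lambda>x. classical_grad (\<phi> i) x - classical_grad (\<phi> j) x) < e" if e: "0 < e" for e
  proof -
    obtain K where K: "inverse (real (Suc K)) < e\<^sup>2 / 8" using reals_Archimedean[of "e\<^sup>2 / 8"] e by auto
    have "L2_norm Om (\<lambda>x. classical_grad (\<phi> i) x - classical_grad (\<phi> j) x) < e" if "i \<ge> K" "j \<ge> K" for i j
    proof (rule power2_less_imp_less)
      have s: "q (\<phi> i) - d < e\<^sup>2 / 8" if "i \<ge> K" for i
      proof -
        have "inverse (real (Suc i)) \<le> inverse (real (Suc K))" using that by (intro le_imp_inverse_le) auto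
        then show ?thesis using phi(2)[of i] K by linarith
      qed
      show "(L2_norm Om (\<lambda>x. classical_grad (\<phi> i) x - classical_grad (\<phi> j) x))\<^sup>2 < e\<^sup>2"
      proof (rule order.strict_trans1[OF diffsq])
        have "(q (\<phi> i) - d) + (q (\<phi> j) - d) < e\<^sup>2 / 8 + e\<^sup>2 / 8"
          by (intro add_strict_mono s that)
        then show "4 * ((q (\<phi> i) - d) + (q (\<phi> j) - d)) < e\<^sup>2" by simp
      qed
    qed (use e in simp)
    then show ?thesis by blast
  qed
  then obtain p where p: "p \<in> H10 Om" "test_approx Om \<phi> p"
    using H10_limit[of \<phi>] T[OF phi(1)] by blast
  note a = test_approxD[OF open_Om H10_H1[OF p(1)] p(2)]
  \<comment> \<open>The first variation at \<open>\<phi> n\<close> is controlled by the defect,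
    which tends to 0.\<close>
  have orth: "L2_ip Om (\<lambda>x. grad Om w x - grad Om p x) (classical_grad \<psi>) = 0" if \<psi>: "\<psi> \<in> test_functions SS" for \<psi>
  proof -
    have "(\<lambda>n. L2_ip Om (\<lambda>x. F x - classical_grad (\<phi> n) x) (classical_grad \<psi>)) \<longlonglongrightarrow> L2_ip Om (\<lambda>x. F x - grad Om p x) (classical_grad \<psi>)"
    proof (rule L2_ip_tendsto[OF FL[OF phi(1)] L2_diff[OF F grad_L2[OF p(1)]] gL[OF \<psi>]])
      show "(\<lambda>n. L2_norm Om (\<lambda>x. F x - classical_grad (\<phi> n) x - (F x - grad Om p x))) \<longlonglongrightarrow> 0"
        using a(3) by (simp add: L2_norm_diff_commute[of Om "grad Om p"])
    qed
    then have l1: "(\<lambda>n. (L2_ip Om (\<lambda>x. F x - classical_grad (\<phi> n) x) (classical_grad \<psi>))\<^sup>2) \<longlonglongrightarrow> (L2_ip Om (\<lambda>x. F x - grad Om p x) (classical_grad \<psi>))\<^sup>2"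
      by (rule tendsto_power)
    have l2: "(\<lambda>n. inverse (real (Suc n)) * L2_ip Om (classical_grad \<psi>) (classical_grad \<psi>)) \<longlonglongrightarrow> 0 * L2_ip Om (classical_grad \<psi>) (classical_grad \<psi>)"
      by (intro tendsto_mult_right LIMSEQ_inverse_real_of_nat)
    have "(L2_ip Om (\<lambda>x. F x - grad Om p x) (classical_grad \<psi>))\<^sup>2 \<le> 0 * L2_ip Om (classical_grad \<psi>) (classical_grad \<psi>)"
    proof (rule LIMSEQ_le[OF l1 l2], intro exI[of _ 0] allI impI)
      fix n
      have "(L2_ip Om (\<lambda>x. F x - classical_grad (\<phi> n) x) (classical_grad \<psi>))\<^sup>2 \<le> (q (\<phi> n) - d) * L2_ip Om (classical_grad \<psi>) (classical_grad \<psi>)"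
        by (rule small[OF phi(1) \<psi>])
      also have "\<dots> \<le> inverse (real (Suc n)) * L2_ip Om (classical_grad \<psi>) (classical_grad \<psi>)"
        using phi(2)[of n] by (intro mult_right_mono) auto
      finally show "(L2_ip Om (\<lambda>x. F x - classical_grad (\<phi> n) x) (classical_grad \<psi>))\<^sup>2
          \<le> inverse (real (Suc n)) * L2_ip Om (classical_grad \<psi>) (classical_grad \<psi>)" .
    qed
    then show ?thesis by (simp add: F_def)
  qed
  show ?thesis by (rule that[OF p(1) phi(1) p(2) orth])
qed

text \<open>Subtracting the projection makes the function orthogonal to all functions of the
  subdomains. The projection is a limit of test functions that vanish on the interfaces, so the
  traces stay.\<close>

lemma harmonic_extension:
  assumes w: "w \<in> H10 Om"
  obtains v where "v \<in> VG" "\<And>i g. 1 \<le> i \<Longrightarrow> trace_of i w g \<Longrightarrow> trace_of i v g"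
proof -
  obtain p \<phi> where p: "p \<in> H10 Om" "\<And>n. \<phi> n \<in> test_functions SS" "test_approx Om \<phi> p"
    "\<And>\<psi>. \<psi> \<in> test_functions SS \<Longrightarrow> L2_ip Om (\<lambda>x. grad Om w x - grad Om p x) (classical_grad \<psi>) = 0"
    using w by (rule projection_exists) blast
  define v where "v x = w x - p x" for x
  have vH: "v \<in> H10 Om" unfolding v_def by (rule H10_diff[OF open_Om w p(1)])
  have "v \<in> VG"
  proof (rule VG_I[OF vH])
    fix k \<phi> assume k: "k \<in> {1..N}" and phi: "\<phi> \<in> test_functions (S k)"
    have "L2_ip Om (grad Om v) (classical_grad \<phi>) = L2_ip Om (\<lambda>x. grad Om w x - grad Om p x) (classical_grad \<phi>)"
      using H1_diff(2)[OF open_Om H10_H1[OF w] H10_H1[OF p(1)]]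
      by (intro L2_ip_cong_AE grad_L2 vH L2_diff w p(1) test_L2(2)[OF phi]) (auto simp: v_def[abs_def])
    also have "\<dots> = 0" using k by (intro p(4) test_mono[OF phi]) auto
    finally show "L2_ip Om (grad Om v) (classical_grad \<phi>) = 0" .
  qed
  moreover have "trace_of i v g" if i: "1 \<le> i" and tr: "trace_of i w g" for i g
  proof -
    have "trace_of i p (\<lambda>_. 0)"
      by (rule trace_zeroI[OF p(3)]) (rule test_zero[OF p(2) SS_not_on_line])
    then show ?thesis using trace_diff[OF i w p(1) tr, of "\<lambda>_. 0"] by (simp add: v_def[abs_def])
  qed
  ultimately show ?thesis by (rule that)
qed

lemma strip_unit_subset_S:
  assumes "k \<in> {1..N}" shows "strip (k - 1) k \<subseteq> S k"
proof
  fix x assume "x \<in> strip (k - 1) k"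
  then show "x \<in> S k" using assms by (intro Om_strip) (auto simp: of_nat_diff mem_Times_iff)
qed

text \<open>Thanks to the zero traces, the truncation of \<open>w\<close> to subdomain
  \<open>k\<close> is a limit of test functions of that subdomain, and \<open>v\<close> is
  orthogonal to those.\<close>

lemma harmonic_orthogonal:
  assumes v: "v \<in> VG" and w: "w \<in> H10 Om" and k: "k \<in> {1..N}" and z: "zero_trace (k - 1) w" "zero_trace k w"
  shows "A k v w = 0"
proof -
  have lt: "k - 1 < k" using k by auto
  define w' where "w' x = indicat_real {real (k - 1)<..<real k} (fst x) * w x" for x
  obtain \<psi> where psi: "\<And>n. \<psi> n \<in> test_functions (strip (k - 1) k)" "test_approx Om \<psi> w'" "w' \<in> H10 Om"
    "AE x in lebesgue_on Om. grad Om w' x = indicat_real {real (k - 1)<..<real k} (fst x) *\<^sub>R grad Om w x"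
    unfolding w'_def by (rule cut[OF w z lt]) blast
  note a = test_approxD[OF open_Om H10_H1[OF psi(3)] psi(2)]
  note vH = VG_H10[OF v]
  have "(\<lambda>n. L2_ip Om (classical_grad (\<psi> n)) (grad Om v)) \<longlonglongrightarrow> L2_ip Om (grad Om w') (grad Om v)"
    by (rule L2_ip_tendsto[OF test_L2(2)[OF a(1) sets_Om] grad_L2[OF psi(3)] grad_L2[OF vH] a(3)])
  moreover have "L2_ip Om (classical_grad (\<psi> n)) (grad Om v) = 0" for n
    using VG_D(2)[OF v k test_mono[OF psi(1) strip_unit_subset_S[OF k]]] by (simp add: L2_ip_commute)
  ultimately have "L2_ip Om (grad Om w') (grad Om v) = 0" by (simp add: LIMSEQ_const_iff)
  moreover have "A k v w = L2_ip Om (\<lambda>x. indicat_real (S k) x *\<^sub>R grad Om w x) (grad Om v)"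
    unfolding grad_ip_def using k by (subst L2_ip_commute) (intro L2_ip_subset_indicator S_subset_Om sets_S sets_Om; simp)
  moreover have "\<dots> = L2_ip Om (grad Om w') (grad Om v)"
  proof (rule L2_ip_cong_AE[OF _ grad_L2[OF vH] grad_L2[OF psi(3)] grad_L2[OF vH]])
    show "(\<lambda>x. indicat_real (S k) x *\<^sub>R grad Om w x) \<in> L2 Om"
      using k by (intro L2_indicator grad_L2_S w S_subset_Om sets_S) auto
    have "indicat_real (S k) x = indicat_real {real (k - 1)<..<real k} (fst x)" if "x \<in> Om" for x
      using Om_strip[OF k that] S_bounds[of k x] k by (auto simp: indicator_def of_nat_diff)
    then have "AE x in lebesgue_on Om. indicat_real (S k) x = indicat_real {real (k - 1)<..<real k} (fst x)"
      by (intro AE_I2) simp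
    then show "AE x in lebesgue_on Om. indicat_real (S k) x *\<^sub>R grad Om w x = grad Om w' x"
      using psi(4) by eventually_elim simp
  qed simp
  ultimately show ?thesis by simp
qed

text \<open>On each subdomain \<open>v\<close> is orthogonal to itself. Applied to differences, this
  shows that a harmonic function is determined by its traces up to a vanishing gradient.\<close>

lemma harmonic_zero_traces:
  assumes v: "v \<in> VG" and z: "\<And>i. zero_trace i v" shows "gnorm v = 0"
proof -
  have "(gnorm v)\<^sup>2 = 0"
    unfolding gnorm_power2[OF VG_H10[OF v]]
    by (intro sum.neutral ballI harmonic_orthogonal v VG_H10[OF v] z) auto
  then show ?thesis by simp
qed

lemma A_eq_0_of_self:
  assumes "u \<in> H10 Om" "w \<in> H10 Om" "k \<in> {1..N}" "A k u u = 0" shows "A k u w = 0" "A k w u = 0"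
proof -
  have "grad_norm N r1 r2 (S k) u = 0" using grad_norm_power2[of "S k" u] assms(4) by simp
  then show "A k u w = 0" using A_Cauchy_Schwarz[OF assms(1-3)] by simp
  then show "A k w u = 0" by (simp add: A_commute)
qed

lemma VGi_support:
  assumes v: "v \<in> VGi j" and w: "w \<in> H10 Om" and k: "k \<in> {1..N}" "k \<noteq> j" "k \<noteq> Suc j"
  shows "A k v w = 0"
proof -
  have "A k v v = 0"
    using k by (intro harmonic_orthogonal VGi_VG[OF v] VGi_H10[OF v] VGi_zero_trace[OF v]) auto
  then show ?thesis using A_eq_0_of_self(1)[OF VGi_H10[OF v] w k(1)] by simp
qed

text \<open>Multiplication by a Lagrange polynomial in the abscissa isolates the trace on one interface.\<close>

definition lagrange :: "nat \<Rightarrow> real \<times> real \<Rightarrow> real" where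
  "lagrange j x = (\<Prod>k\<in>{1..N - 1} - {j}. (fst x - real k) / (real j - real k))"

lemma smooth_lagrange: "smooth (lagrange j)"
proof -
  have "smooth (\<lambda>x :: real \<times> real. (1 / c) * fst x + - (real k / c))" for c k
    by (intro smooth_intros smooth_fst)
  then have "smooth (\<lambda>x :: real \<times> real. (fst x - real k) / c)" for c k by (simp add: diff_divide_distrib)
  then show ?thesis unfolding lagrange_def by (intro smooth_prod)
qed

lemma lagrange_same: "lagrange j (real j, t) = 1"
  unfolding lagrange_def by (intro prod.neutral) auto

lemma lagrange_other: "k \<in> {1..N - 1} \<Longrightarrow> k \<noteq> j \<Longrightarrow> lagrange j (real k, t) = 0"
  unfolding lagrange_def by (intro prod_zero) auto

text \<open>By the product rule one term contains the undifferentiated function; the Poincare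
  inequality controls it, whence the factor \<open>1 + real N\<close>.\<close>

lemma lagrange_mult_bound:
  obtains C where "0 \<le> C" "\<And>w. w \<in> H10 Om \<Longrightarrow> (\<lambda>x. lagrange j x * w x) \<in> H10 Om"
    "\<And>w. w \<in> H10 Om \<Longrightarrow> gnorm (\<lambda>x. lagrange j x * w x) \<le> C * gnorm w"
proof -
  obtain C where C: "\<And>x. x \<in> Om \<Longrightarrow> \<bar>lagrange j x\<bar> \<le> C" "\<And>x. x \<in> Om \<Longrightarrow> norm (classical_grad (lagrange j) x) \<le> C"
    using smooth_bounded_on_Om[OF smooth_lagrange] by blast
  show ?thesis
  proof (rule that[of "\<bar>C\<bar> * (1 + real N)"])
    fix w assume w: "w \<in> H10 Om"
    obtain \<phi> where phi: "test_approx Om \<phi> w" using open_Om w by (rule H10_D)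
    note m = test_approx_mult[OF open_Om H10_H1[OF w] phi smooth_lagrange C]
    show H: "(\<lambda>x. lagrange j x * w x) \<in> H10 Om" by (rule m(2))
    note wL = H1_D(1)[OF H10_H1[OF w]]
    have mm: "lagrange j \<in> borel_measurable (lebesgue_on Om)" "classical_grad (lagrange j) \<in> borel_measurable (lebesgue_on Om)"
      using smooth_lagrange by (auto intro!: continuous_imp_measurable_on_sets_lebesgue smooth_continuous_on continuous_on_classical_grad)
    have b1: "norm (lagrange j x *\<^sub>R grad Om w x) \<le> \<bar>C\<bar> * norm (grad Om w x)" if "x \<in> Om" for x
      using C(1)[OF that] by (auto intro!: mult_right_mono)
    have b2: "norm (w x *\<^sub>R classical_grad (lagrange j) x) \<le> \<bar>C\<bar> * norm (w x)" if "x \<in> Om" for x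
    proof -
      have "norm (classical_grad (lagrange j) x) \<le> \<bar>C\<bar>" using C(2)[OF that] by simp
      from mult_left_mono[OF this, of "\<bar>w x\<bar>"] show ?thesis by (simp add: mult.commute)
    qed
    have L1: "(\<lambda>x. lagrange j x *\<^sub>R grad Om w x) \<in> L2 Om"
      using L2_D(1)[OF grad_L2[OF w]] mm by (intro L2_bound[OF grad_L2[OF w] _ b1]) auto
    have L2: "(\<lambda>x. w x *\<^sub>R classical_grad (lagrange j) x) \<in> L2 Om"
      using L2_D(1)[OF wL] mm by (intro L2_bound[OF wL _ b2]) auto
    have "gnorm (\<lambda>x. lagrange j x * w x) = L2_norm Om (\<lambda>x. lagrange j x *\<^sub>R grad Om w x + w x *\<^sub>R classical_grad (lagrange j) x)"
      unfolding gnorm_def by (rule L2_norm_cong_AE[OF grad_L2[OF H] L2_add[OF L1 L2] m(3)])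
    also have "\<dots> \<le> L2_norm Om (\<lambda>x. lagrange j x *\<^sub>R grad Om w x) + L2_norm Om (\<lambda>x. w x *\<^sub>R classical_grad (lagrange j) x)"
      by (rule L2_norm_triangle[OF L1 L2])
    also have "\<dots> \<le> \<bar>C\<bar> * gnorm w + \<bar>C\<bar> * L2_norm Om w"
      unfolding gnorm_def by (intro add_mono L2_norm_mono[OF L1 grad_L2[OF w] b1] L2_norm_mono[OF L2 wL b2]) auto
    also have "\<dots> \<le> \<bar>C\<bar> * gnorm w + \<bar>C\<bar> * (real N * gnorm w)"
      using poincare_H10[OF w] by (intro add_left_mono mult_left_mono) (auto simp: gnorm_def)
    finally show "gnorm (\<lambda>x. lagrange j x * w x) \<le> \<bar>C\<bar> * (1 + real N) * gnorm w" by (simp add: algebra_simps)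
  qed simp
qed

lemma lagrange_traces:
  assumes w: "w \<in> H10 Om" and k: "k \<in> {1..N - 1}"
  shows "k \<noteq> j \<Longrightarrow> trace_of k (\<lambda>x. lagrange j x * w x) (\<lambda>_. 0)"
    "trace_of j w g \<Longrightarrow> k = j \<Longrightarrow> trace_of j (\<lambda>x. lagrange j x * w x) g"
proof -
  have k1: "1 \<le> k" using k by simp
  obtain h where h: "trace_of k w h" using k1 w by (rule trace_exists)
  show "trace_of k (\<lambda>x. lagrange j x * w x) (\<lambda>_. 0)" if "k \<noteq> j"
    using trace_mult[OF k1 w h smooth_lagrange lagrange_other[OF k that]] by simp
  show "trace_of j (\<lambda>x. lagrange j x * w x) g" if "trace_of j w g" "k = j"
    using trace_mult[OF _ w that(1) smooth_lagrange lagrange_same] k1 that by simp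
qed

text \<open>Multiplication by the Lagrange polynomial removes the traces on the other interfaces
  before the harmonic extension is taken.\<close>

lemma VGi_extension:
  assumes w: "w \<in> H10 Om" and j: "j \<in> {1..N - 1}" and tr: "trace_of j w g"
  obtains v where "v \<in> VGi j" "trace_of j v g"
proof -
  have H: "(\<lambda>x. lagrange j x * w x) \<in> H10 Om" using lagrange_mult_bound[of j] w by blast
  obtain v where v: "v \<in> VG" "\<And>i g. 1 \<le> i \<Longrightarrow> trace_of i (\<lambda>x. lagrange j x * w x) g \<Longrightarrow> trace_of i v g"
    using H by (rule harmonic_extension) blast
  have "v \<in> VGi j" unfolding V_Gamma_i_def using v lagrange_traces(1)[OF w] by auto
  moreover have "trace_of j v g" using v(2) lagrange_traces(2)[OF w j tr] j by auto
  ultimately show ?thesis by (rule that)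
qed

text \<open>The traces of \<open>w\<close> on the other interfaces are arbitrary. Multiplied by the
  Lagrange polynomial, \<open>w\<close> acquires exactly the traces of \<open>v\<close> and hence
  has at least its energy; the constant is that of the multiplication. This takes the place of a
  lifting from the trace space.\<close>

lemma stability:
  obtains C where "0 \<le> C" "\<And>j v w g. j \<in> {1..N - 1} \<Longrightarrow> v \<in> VGi j \<Longrightarrow> w \<in> H10 Om \<Longrightarrow> trace_of j v g \<Longrightarrow>
    trace_of j w g \<Longrightarrow> gnorm v \<le> C * gnorm w"
proof -
  have "\<forall>j. \<exists>C. 0 \<le> C \<and> (\<forall>w\<in>H10 Om. gnorm (\<lambda>x. lagrange j x * w x) \<le> C * gnorm w)"
    using lagrange_mult_bound by metis
  then obtain c where c: "\<And>j. 0 \<le> c j" "\<And>j w. w \<in> H10 Om \<Longrightarrow> gnorm (\<lambda>x. lagrange j x * w x) \<le> c j * gnorm w" by metis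
  show ?thesis
  \<comment> \<open>The sum serves as one constant for all interfaces.\<close>
  proof (rule that[of "\<Sum>j\<in>{1..N - 1}. c j"])
    show "0 \<le> (\<Sum>j\<in>{1..N - 1}. c j)" by (intro sum_nonneg c)
    fix j v w g assume j: "j \<in> {1..N - 1}" and v: "v \<in> VGi j" and w: "w \<in> H10 Om"
      and tr: "trace_of j v g" "trace_of j w g"
    define h where "h x = lagrange j x * w x" for x
    have hH: "h \<in> H10 Om" unfolding h_def using lagrange_mult_bound[of j] w by blast
    note vH = VGi_H10[OF v]
    have dH: "(\<lambda>x. h x - v x) \<in> H10 Om" by (rule H10_diff[OF open_Om hH vH])
    have z: "zero_trace k (\<lambda>x. h x - v x)" for k
    proof (cases "k \<in> {1..N - 1}")
      case True
      show ?thesis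
      proof (cases "k = j")
        case True
        have "trace_of j (\<lambda>x. h x - v x) (\<lambda>t. g t - g t)"
          using j lagrange_traces(2)[OF w j tr(2)] by (intro trace_diff hH vH tr(1)) (auto simp: h_def[abs_def])
        then show ?thesis using True by (simp add: zero_trace_def)
      next
        case False
        have "trace_of k (\<lambda>x. h x - v x) (\<lambda>t. 0 - 0)"
          using \<open>k \<in> {1..N - 1}\<close> False v lagrange_traces(1)[OF w \<open>k \<in> {1..N - 1}\<close> False]
          by (intro trace_diff hH vH) (auto simp: h_def[abs_def] V_Gamma_i_def)
        then show ?thesis by (simp add: zero_trace_def)
      qed
    next
      case False then show ?thesis by (auto simp: zero_trace_def)
    qed
    \<comment> \<open>\<open>h\<close> and \<open>v\<close> have equal traces on all interfaces, so
      the harmonic function \<open>v\<close> is orthogonal to their difference on each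
      subdomain.\<close>
    have eq: "A k v h = A k v v" if k: "k \<in> {1..N}" for k
    proof -
      have "A k v (\<lambda>x. h x - v x) = 0" by (rule harmonic_orthogonal[OF VGi_VG[OF v] dH k z z])
      then show ?thesis using A_diff_left[OF hH vH vH k] by (simp add: A_commute)
    qed
    have "(gnorm v)\<^sup>2 = grad_ip N r1 r2 Om v h"
      unfolding gnorm_power2[OF vH] grad_ip_Om[OF vH hH] by (rule sum.cong) (auto simp: eq)
    also have "\<dots> \<le> gnorm v * gnorm h"
      using L2_Cauchy_Schwarz[OF grad_L2[OF vH] grad_L2[OF hH]] by (simp add: grad_ip_def gnorm_def)
    finally have "gnorm v * gnorm v \<le> gnorm v * gnorm h" by (simp add: power2_eq_square)
    then have "gnorm v \<le> gnorm h" by (cases "gnorm v = 0") (auto simp: mult_le_cancel_left order_less_le)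
    also have "\<dots> \<le> c j * gnorm w" unfolding h_def by (rule c(2)[OF w])
    also have "\<dots> \<le> (\<Sum>j\<in>{1..N - 1}. c j) * gnorm w"
      using j c(1) by (intro mult_right_mono member_le_sum) auto
    finally show "gnorm v \<le> (\<Sum>j\<in>{1..N - 1}. c j) * gnorm w" .
  qed
qed

end

section \<open>Reflection in an interface\<close>

text \<open>The linear part of \<open>reflect\<close>; it is the map that acts on gradients.\<close>

definition flip :: "real \<times> real \<Rightarrow> real \<times> real" where
  "flip u = (- fst u, snd u)"

lemma flip_simps [simp]: "flip (flip u) = u" "flip u \<bullet> flip v = u \<bullet> v" "flip 0 = 0" "norm (flip u) = norm u"
  "flip u - flip v = flip (u - v)"
  by (simp_all add: flip_def inner_prod_def norm_prod_def zero_prod_def)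

lemma flip_inner: "flip u \<bullet> v = u \<bullet> flip v"
  by (simp add: flip_def inner_prod_def)

lemma continuous_on_flip: "continuous_on X flip"
  unfolding flip_def by (intro continuous_intros)

lemma measurable_flip: "f \<in> borel_measurable M \<Longrightarrow> (\<lambda>x. flip (f x)) \<in> borel_measurable M"
  by (rule measurable_compose[OF _ borel_measurable_continuous_onI[OF continuous_on_flip]])

lemma L2_flip: "F \<in> L2 \<omega> \<Longrightarrow> (\<lambda>x. flip (F x)) \<in> L2 \<omega>"
  by (rule L2_bound[where f = F and c = 1, OF _ measurable_flip[OF L2_D(1)]]) simp_all

text \<open>Lebesgue measure under a diagonal affine map: \<open>s\<close> lists the diagonal
  entries, -1 for the abscissa and 1 for the ordinate, so the determinant has modulus 1.\<close>

lemma reflect_lebesgue: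
  "lebesgue = distr lebesgue lebesgue (reflect c)" "reflect c \<in> lebesgue \<rightarrow>\<^sub>M lebesgue"
proof -
  define s where "s j = (if j = (1, 0) then - 1 else 1 :: real)" for j :: "real \<times> real"
  have s: "s j \<noteq> 0" for j by (simp add: s_def)
  have T: "(\<lambda>x. (2 * c, 0) + (\<Sum>j\<in>Basis. (s j * (x \<bullet> j)) *\<^sub>R j)) = reflect c"
    by (auto simp: fun_eq_iff Basis_prod_def s_def reflect_def sum.union_disjoint)
  have p: "(\<Prod>j\<in>Basis. \<bar>s j\<bar>) = 1" by (intro prod.neutral) (simp add: s_def)
  show "lebesgue = distr lebesgue lebesgue (reflect c)"
    using lebesgue_affine_euclidean[of s "(2 * c, 0)"] s unfolding T p by (simp add: density_1)
  show "reflect c \<in> lebesgue \<rightarrow>\<^sub>M lebesgue"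
    using lebesgue_affine_measurable[of s "(2 * c, 0)"] s unfolding T by simp
qed

lemma integral_reflect:
  fixes f :: "real \<times> real \<Rightarrow> real"
  assumes "f \<in> borel_measurable lebesgue"
  shows "(LINT x|lebesgue. f (reflect c x)) = (LINT x|lebesgue. f x)"
proof -
  have "(LINT x|lebesgue. f x) = (LINT x|distr lebesgue lebesgue (reflect c). f x)"
    using reflect_lebesgue(1) by simp
  also have "\<dots> = (LINT x|lebesgue. f (reflect c x))"
    by (rule integral_distr[OF reflect_lebesgue(2) assms])
  finally show ?thesis by simp
qed

lemma integrable_reflect:
  fixes f :: "real \<times> real \<Rightarrow> real"
  assumes "integrable lebesgue f" shows "integrable lebesgue (\<lambda>x. f (reflect c x))"
proof -
  have "integrable (distr lebesgue lebesgue (reflect c)) f"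
    using assms reflect_lebesgue(1)[of c] by simp
  then show ?thesis using reflect_lebesgue(2) by (rule integrable_distr[rotated])
qed

lemma vimage_reflect_lebesgue: "P \<in> sets lebesgue \<Longrightarrow> reflect c -` P \<in> sets lebesgue"
  using measurable_sets[OF reflect_lebesgue(2), of P c] by simp

lemma L2_reflect:
  fixes F :: "real \<times> real \<Rightarrow> 'b::euclidean_space"
  assumes F: "F \<in> L2 P" and P: "P \<in> sets lebesgue"
  shows "(\<lambda>x. F (reflect c x)) \<in> L2 (reflect c -` P)"
proof -
  note P' = vimage_reflect_lebesgue[OF P, of c]
  have "(\<lambda>x. indicator P x *\<^sub>R F x) \<in> borel_measurable lebesgue"
    using L2_D(1)[OF F] P by (simp add: borel_measurable_restrict_space_iff)
  then have "(\<lambda>x. indicator P (reflect c x) *\<^sub>R F (reflect c x)) \<in> borel_measurable lebesgue"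
    by (rule measurable_compose[OF reflect_lebesgue(2)])
  moreover have "indicat_real P (reflect c x) = indicat_real (reflect c -` P) x" for x by (simp add: indicator_def)
  ultimately have "(\<lambda>x. F (reflect c x)) \<in> borel_measurable (lebesgue_on (reflect c -` P))"
    using P' by (simp add: borel_measurable_restrict_space_iff)
  moreover have "integrable (lebesgue_on (reflect c -` P)) (\<lambda>x. (norm (F (reflect c x)))\<^sup>2)"
  proof -
    have "integrable lebesgue (\<lambda>x. indicator P x *\<^sub>R (norm (F x))\<^sup>2)"
      using L2_D(2)[OF F] P by (simp add: integrable_restrict_space)
    from integrable_reflect[OF this, of c] show ?thesis
      using P' by (simp add: integrable_restrict_space indicator_def)
  qed
  ultimately show ?thesis by (simp add: L2_def)
qed

lemma L2_ip_reflect: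
  fixes F G :: "real \<times> real \<Rightarrow> 'b::euclidean_space"
  assumes F: "F \<in> L2 P" and G: "G \<in> L2 P" and P: "P \<in> sets lebesgue"
  shows "L2_ip (reflect c -` P) (\<lambda>x. F (reflect c x)) (\<lambda>x. G (reflect c x)) = L2_ip P F G"
proof -
  have "integrable lebesgue (\<lambda>x. indicator P x *\<^sub>R (F x \<bullet> G x))"
    using L2_integrable_ip[OF F G] P by (simp add: integrable_restrict_space)
  then have "(\<lambda>x. indicator P x * (F x \<bullet> G x)) \<in> borel_measurable lebesgue" by auto
  from integral_reflect[OF this, of c] show ?thesis
    unfolding L2_ip_indicator[OF P] L2_ip_indicator[OF vimage_reflect_lebesgue[OF P]]
    by (simp add: indicator_def)
qed

lemma L2_norm_indicator:
  assumes "P \<subseteq> \<omega>" "P \<in> sets lebesgue" "\<omega> \<in> sets lebesgue"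
  shows "L2_norm \<omega> (\<lambda>x. indicat_real P x *\<^sub>R H x) = L2_norm P H"
proof -
  have "L2_ip \<omega> (\<lambda>x. indicat_real P x *\<^sub>R H x) (\<lambda>x. indicat_real P x *\<^sub>R H x) = L2_ip P H H"
    unfolding L2_ip_indicator[OF assms(2)] L2_ip_indicator[OF assms(3)]
    using assms(1) by (intro Bochner_Integration.integral_cong) (auto simp: indicator_def)
  then show ?thesis by (simp add: L2_norm_def)
qed

lemma smooth_reflect: assumes "smooth f" shows "smooth (\<lambda>x. f (reflect c x))"
proof -
  have "reflect c x = flip x + (2 * c, 0)" for x by (simp add: reflect_def flip_def prod_eq_iff)
  moreover have "bounded_linear flip"
    unfolding flip_def[abs_def]
    by (intro bounded_linear_Pair bounded_linear_minus bounded_linear_fst bounded_linear_snd)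
  ultimately show ?thesis using smooth_affine[OF _ assms, of flip "(2 * c, 0)"] by simp
qed

lemma classical_grad_reflect:
  assumes "smooth f" shows "classical_grad (\<lambda>x. f (reflect c x)) x = flip (classical_grad f (reflect c x))"
proof (rule classical_grad_eqI)
  have "(reflect c has_derivative flip) (at x)"
    unfolding reflect_def[abs_def] flip_def[abs_def] by (auto intro!: derivative_eq_intros)
  from diff_chain_at[OF this smooth_has_gradient[OF assms]]
  show "((\<lambda>x. f (reflect c x)) has_derivative (\<lambda>h. flip (classical_grad f (reflect c x)) \<bullet> h)) (at x)"
    by (simp add: o_def flip_inner)
qed

lemma test_reflect:
  assumes f: "f \<in> test_functions P" and sub: "reflect c -` P \<subseteq> \<omega>"
  shows "(\<lambda>x. f (reflect c x)) \<in> test_functions \<omega>"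
proof -
  obtain K where K: "compact K" "K \<subseteq> P" "\<And>x. x \<notin> K \<Longrightarrow> f x = 0" by (rule test_functionsE[OF f]) blast
  show ?thesis
  proof (rule test_functionsI[OF smooth_reflect[OF test_smooth[OF f]]])
    show "compact (reflect c ` K)" by (intro compact_continuous_image continuous_on_reflect K(1))
    have "reflect c ` K \<subseteq> reflect c -` P" using K(2) by auto
    then show "reflect c ` K \<subseteq> \<omega>" using sub by blast
    show "f (reflect c x) = 0" if "x \<notin> reflect c ` K" for x
    proof (rule K(3))
      show "reflect c x \<notin> K"
      proof
        assume "reflect c x \<in> K"
        then have "reflect c (reflect c x) \<in> reflect c ` K" by (rule imageI)
        then show False using that by simp
      qed
    qed
  qed
qed

context chain
begin

section \<open>Reflected harmonic functions\<close>

lemma vimage_reflect_S: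
  assumes "1 \<le> k" "k \<le> 2 * i" shows "reflect (real i) -` S k = S (2 * i + 1 - k)"
  unfolding vimage_def subdomain_reflect[OF assms] by simp

lemma S_in_strip:
  assumes "k = j \<or> k = Suc j" "1 \<le> j" "k \<in> {1..N}" shows "S k \<subseteq> strip (j - 1) (Suc j)"
  using assms S_subset_Om[OF assms(3)] S_bounds[of k] by (fastforce simp: mem_Times_iff of_nat_diff)

text \<open>Truncation to the two subdomains adjacent to interface \<open>j\<close> changes nothing:
  the gradient vanishes on all the others, and by the Poincare inequality equal gradients mean equal
  functions. Approximants confined to this strip can be reflected although the whole domain need not
  be symmetric.\<close>

lemma VGi_approx:
  assumes v: "v \<in> VGi j" and j: "j \<in> {1..N - 1}"
  obtains \<psi> where "\<And>n. \<psi> n \<in> test_functions (strip (j - 1) (Suc j))" "test_approx Om \<psi> v"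
proof -
  have j1: "1 \<le> j" and lt: "j - 1 < Suc j" and nj: "j - 1 \<noteq> j" "Suc j \<noteq> j" using j by auto
  note vH = VGi_H10[OF v]
  define w where "w x = indicat_real {real (j - 1)<..<real (Suc j)} (fst x) * v x" for x
  obtain \<psi> where psi: "\<And>n. \<psi> n \<in> test_functions (strip (j - 1) (Suc j))" "test_approx Om \<psi> w" "w \<in> H10 Om"
    "AE x in lebesgue_on Om. grad Om w x = indicat_real {real (j - 1)<..<real (Suc j)} (fst x) *\<^sub>R grad Om v x"
    unfolding w_def by (rule cut[OF vH VGi_zero_trace[OF v nj(1)] VGi_zero_trace[OF v nj(2)] lt]) blast
  have "AE x in lebesgue. x \<in> S k \<longrightarrow> k = j \<or> k = Suc j \<or> grad Om v x = 0" if k: "k \<in> {1..N}" for k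
  proof (cases "k = j \<or> k = Suc j")
    case True
    then show ?thesis by (intro AE_I2) auto
  next
    case False
    then have "A k v v = 0" using VGi_support[OF v vH k] by simp
    then have "L2_norm (S k) (grad Om v) = 0" by (simp add: L2_norm_def grad_ip_def)
    then have "AE x in lebesgue_on (S k). grad Om v x = 0"
      using L2_norm_eq_0_iff[OF grad_L2_S[OF vH k]] by simp
    then show ?thesis using k by (subst (asm) AE_lebesgue_on_iff) (auto elim!: eventually_mono)
  qed
  then have "AE x in lebesgue. \<forall>k\<in>{1..N}. x \<in> S k \<longrightarrow> k = j \<or> k = Suc j \<or> grad Om v x = 0"
    by (subst AE_finite_all) auto
  moreover have "AE x in lebesgue. x \<in> Om \<longrightarrow> x \<in> SS"
    using AE_in_S unfolding AE_lebesgue_on_iff[OF sets_Om] .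
  moreover note psi(4)[unfolded AE_lebesgue_on_iff[OF sets_Om]]
  ultimately have "AE x in lebesgue. x \<in> Om \<longrightarrow> grad Om w x = grad Om v x"
  proof eventually_elim
    fix x assume a: "\<forall>k\<in>{1..N}. x \<in> S k \<longrightarrow> k = j \<or> k = Suc j \<or> grad Om v x = 0" "x \<in> Om \<longrightarrow> x \<in> SS"
      "x \<in> Om \<longrightarrow> grad Om w x = indicat_real {real (j - 1)<..<real (Suc j)} (fst x) *\<^sub>R grad Om v x"
    show "x \<in> Om \<longrightarrow> grad Om w x = grad Om v x"
    proof
      assume x: "x \<in> Om"
      then obtain k where k: "k \<in> {1..N}" "x \<in> S k" using a(2) by blast
      show "grad Om w x = grad Om v x"
      proof (cases "k = j \<or> k = Suc j")
        case True
        then have "fst x \<in> {real (j - 1)<..<real (Suc j)}"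
          using S_in_strip[OF True j1 k(1)] k(2) by (auto simp: mem_Times_iff)
        then show ?thesis using a(3) x by simp
      next
        case False
        then have "grad Om v x = 0" using a(1) k by blast
        then show ?thesis using a(3) x by simp
      qed
    qed
  qed
  then have gw: "AE x in lebesgue_on Om. grad Om w x = grad Om v x" by (simp add: AE_lebesgue_on_iff)
  have dH: "(\<lambda>x. v x - w x) \<in> H10 Om" by (rule H10_diff[OF open_Om vH psi(3)])
  have "AE x in lebesgue_on Om. grad Om (\<lambda>x. v x - w x) x = 0"
    using H1_diff(2)[OF open_Om H10_H1[OF vH] H10_H1[OF psi(3)]] gw by eventually_elim simp
  then have "L2_norm Om (grad Om (\<lambda>x. v x - w x)) = 0" using L2_norm_eq_0_iff[OF grad_L2[OF dH]] by simp
  then have "L2_norm Om (\<lambda>x. v x - w x) = 0" using poincare_H10[OF dH] L2_norm_nonneg[of Om "\<lambda>x. v x - w x"] by simp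
  then have vw: "AE x in lebesgue_on Om. v x = w x"
    using L2_norm_eq_0_iff[OF H1_D(1)[OF H10_H1[OF dH]]] by simp
  note a = test_approxD[OF open_Om H10_H1[OF psi(3)] psi(2)]
  have "L2_norm Om (\<lambda>x. \<psi> n x - w x) = L2_norm Om (\<lambda>x. \<psi> n x - v x)" for n
    using vw by (intro L2_norm_cong_AE L2_diff test_L2(1)[OF a(1) sets_Om] H1_D(1) H10_H1 vH psi(3)) (auto elim!: eventually_mono)
  moreover have "L2_norm Om (\<lambda>x. classical_grad (\<psi> n) x - grad Om w x) = L2_norm Om (\<lambda>x. classical_grad (\<psi> n) x - grad Om v x)" for n
    using gw by (intro L2_norm_cong_AE L2_diff test_L2(2)[OF a(1) sets_Om] grad_L2 vH psi(3)) (auto elim!: eventually_mono)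
  ultimately have "test_approx Om \<psi> v"
    using a by (simp add: test_approx_iff[OF open_Om H10_H1[OF vH]])
  with psi(1) show ?thesis by (rule that)
qed

text \<open>Stated for gradients, which are all that the forms see. The indicator takes care of
  points whose mirror image lies outside the domain, where \<open>grad\<close> carries no
  information.\<close>

definition is_reflection :: "nat \<Rightarrow> nat \<Rightarrow> (real \<times> real \<Rightarrow> real) \<Rightarrow> (real \<times> real \<Rightarrow> real) \<Rightarrow> bool" where
  "is_reflection i j v v' \<longleftrightarrow> (AE x in lebesgue_on Om. grad Om v' x =
     flip (indicat_real (strip (j - 1) (Suc j)) (reflect (real i) x) *\<^sub>R grad Om v (reflect (real i) x)))"

text \<open>The index conditions say that the strip around interface \<open>j\<close> is mapped into
  the domain, onto the strip around interface \<open>2 i - j\<close>. The approximants are composed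
  with the reflection, and harmonicity follows by carrying test functions back.\<close>

lemma reflect_VGi:
  assumes v: "v \<in> VGi j" and j: "j \<in> {1..N - 1}" and i: "j < 2 * i" "2 * i + 1 \<le> j + N"
  obtains v' where "v' \<in> VGi (2 * i - j)" "is_reflection i j v v'"
    "\<And>g. i = j \<Longrightarrow> trace_of i v g \<Longrightarrow> trace_of i v' g"
proof -
  obtain \<psi> where psi: "\<And>n. \<psi> n \<in> test_functions (strip (j - 1) (Suc j))" "test_approx Om \<psi> v"
    using v j by (rule VGi_approx) blast
  note vH = VGi_H10[OF v]
  note a = test_approxD[OF open_Om H10_H1[OF vH] psi(2)]
  define R where "R = reflect (real i)"
  define P where "P = strip (j - 1) (Suc j)"
  define j' where "j' = 2 * i - j"
  have j': "1 \<le> j'" "j' \<le> N - 1" "real j' = 2 * real i - real j" "j \<le> 2 * i"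
    using j i by (auto simp: j'_def of_nat_diff)
  have "open P" unfolding P_def by (intro open_Int open_Om open_strip)
  then have Ps: "P \<in> sets lebesgue" by auto
  have PO: "P \<subseteq> Om" by (auto simp: P_def)
  have RPs: "R -` P \<in> sets lebesgue" unfolding R_def by (rule vimage_reflect_lebesgue[OF Ps])
  have RP_O: "R -` P \<subseteq> Om"
  proof
    fix x assume "x \<in> R -` P"
    then have "R x \<in> Om" "real (j - 1) < fst (R x)" "fst (R x) < real (Suc j)" by (auto simp: P_def mem_Times_iff)
    moreover have "Suc j \<le> 2 * i" "2 * i \<le> j - 1 + N" using i j by auto
    ultimately have "reflect (real i) (R x) \<in> Om" by (intro reflect_Om[of "Suc j" i "j - 1"])
    then show "x \<in> Om" by (simp add: R_def)
  qed
  have RP_fst: "real (j' - 1) < fst x \<and> fst x < real (Suc j')" if "x \<in> R -` P" for x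
    using that j' j by (auto simp: P_def R_def mem_Times_iff of_nat_diff)
  have RP_strip: "R -` P \<subseteq> strip (j' - 1) (Suc j')"
    using RP_O RP_fst by (fastforce simp: mem_Times_iff)
  define \<psi>' where "\<psi>' n x = \<psi> n (R x)" for n x
  have T': "\<psi>' n \<in> test_functions (strip (j' - 1) (Suc j'))" for n
    unfolding \<psi>'_def R_def by (rule test_reflect[OF psi(1)]) (use RP_strip in \<open>simp add: R_def P_def\<close>)
  have TO: "\<psi>' n \<in> test_functions Om" for n by (rule test_mono[OF T']) auto
  have g\<psi>': "classical_grad (\<psi>' n) x = flip (classical_grad (\<psi> n) (R x))" for n x
    unfolding \<psi>'_def R_def by (rule classical_grad_reflect[OF test_smooth[OF psi(1)]])
  define v' where "v' x = indicat_real P (R x) * v (R x)" for x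
  define G where "G x = flip (indicat_real P (R x) *\<^sub>R grad Om v (R x))" for x
  have indR: "indicat_real P (R x) = indicat_real (R -` P) x" for x by (simp add: indicator_def)
  have vP: "v \<in> L2 P" by (rule L2_subset[OF H1_D(1)[OF H10_H1[OF vH]] PO sets_Om Ps])
  have gP: "grad Om v \<in> L2 P" by (rule L2_subset[OF grad_L2[OF vH] PO sets_Om Ps])
  have v'L: "v' \<in> L2 Om"
    using L2_indicator[OF L2_reflect[OF vP Ps, of "real i", folded R_def] RP_O sets_Om RPs]
    by (simp add: v'_def[abs_def] indR)
  have GL: "G \<in> L2 Om"
    using L2_flip[OF L2_indicator[OF L2_reflect[OF gP Ps, of "real i", folded R_def] RP_O sets_Om RPs]]
    by (simp add: G_def[abs_def] indR)
  have pL: "\<psi> n \<in> L2 P" "classical_grad (\<psi> n) \<in> L2 P" for n by (rule test_L2[OF a(1) Ps])+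
  have n1: "L2_norm Om (\<lambda>x. \<psi>' n x - v' x) = L2_norm P (\<lambda>x. \<psi> n x - v x)" for n
  proof -
    \<comment> \<open>Off the reflected strip both terms vanish, so an indicator may be put in front
      of the difference.\<close>
    have "(\<lambda>x. \<psi>' n x - v' x) = (\<lambda>x. indicat_real (R -` P) x *\<^sub>R (\<psi> n (R x) - v (R x)))"
      using test_zero[OF psi(1)] by (auto simp: fun_eq_iff \<psi>'_def v'_def P_def indicator_def)
    then have "L2_norm Om (\<lambda>x. \<psi>' n x - v' x) = L2_norm (R -` P) (\<lambda>x. \<psi> n (R x) - v (R x))"
      by (simp only: L2_norm_indicator[OF RP_O RPs sets_Om])
    also have "\<dots> = L2_norm P (\<lambda>x. \<psi> n x - v x)"
      unfolding L2_norm_def R_def by (subst L2_ip_reflect[OF L2_diff[OF pL(1) vP] L2_diff[OF pL(1) vP] Ps]) simp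
    finally show ?thesis .
  qed
  have n2: "L2_norm Om (\<lambda>x. classical_grad (\<psi>' n) x - G x) = L2_norm P (\<lambda>x. classical_grad (\<psi> n) x - grad Om v x)" for n
  proof -
    have "(\<lambda>x. classical_grad (\<psi>' n) x - G x)
        = (\<lambda>x. indicat_real (R -` P) x *\<^sub>R flip (classical_grad (\<psi> n) (R x) - grad Om v (R x)))"
      using test_grad_zero[OF psi(1)] by (auto simp: fun_eq_iff g\<psi>' G_def P_def indicator_def)
    then have "L2_norm Om (\<lambda>x. classical_grad (\<psi>' n) x - G x)
        = L2_norm (R -` P) (\<lambda>x. flip (classical_grad (\<psi> n) (R x) - grad Om v (R x)))"
      by (simp only: L2_norm_indicator[OF RP_O RPs sets_Om])
    also have "\<dots> = L2_norm (R -` P) (\<lambda>x. classical_grad (\<psi> n) (R x) - grad Om v (R x))"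
      by (simp add: L2_norm_def L2_ip_def)
    also have "\<dots> = L2_norm P (\<lambda>x. classical_grad (\<psi> n) x - grad Om v x)"
      unfolding L2_norm_def R_def by (subst L2_ip_reflect[OF L2_diff[OF pL(2) gP] L2_diff[OF pL(2) gP] Ps]) simp
    finally show ?thesis .
  qed
  have c1: "(\<lambda>n. L2_norm Om (\<lambda>x. \<psi>' n x - v' x)) \<longlonglongrightarrow> 0"
  proof (rule Lim_null_comparison[OF _ a(2)], intro always_eventually allI)
    fix n show "norm (L2_norm Om (\<lambda>x. \<psi>' n x - v' x)) \<le> L2_norm Om (\<lambda>x. \<psi> n x - v x)"
      unfolding n1 using L2_norm_subset[OF L2_diff[OF test_L2(1)[OF a(1) sets_Om] H1_D(1)[OF H10_H1[OF vH]]] PO sets_Om Ps]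
      by simp
  qed
  have c2: "(\<lambda>n. L2_norm Om (\<lambda>x. classical_grad (\<psi>' n) x - G x)) \<longlonglongrightarrow> 0"
  proof (rule Lim_null_comparison[OF _ a(3)], intro always_eventually allI)
    fix n show "norm (L2_norm Om (\<lambda>x. classical_grad (\<psi>' n) x - G x)) \<le> L2_norm Om (\<lambda>x. classical_grad (\<psi> n) x - grad Om v x)"
      unfolding n2 using L2_norm_subset[OF L2_diff[OF test_L2(2)[OF a(1) sets_Om] grad_L2[OF vH]] PO sets_Om Ps]
      by simp
  qed
  note v' = test_approxI[OF open_Om TO v'L GL c1 c2]
  have "v' \<in> VG"
  proof (rule VG_I[OF v'(1)])
    fix k \<phi> assume k: "k \<in> {1..N}" and phi: "\<phi> \<in> test_functions (S k)"
    have "L2_ip Om (grad Om v') (classical_grad \<phi>) = L2_ip Om G (classical_grad \<phi>)"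
      using v'(3) by (intro L2_ip_cong_AE grad_L2 v'(1) GL test_L2(2)[OF phi]) auto
    also have "\<dots> = L2_ip Om (\<lambda>x. indicat_real (R -` P) x *\<^sub>R flip (grad Om v (R x))) (classical_grad \<phi>)"
    proof -
      have "G = (\<lambda>x. indicat_real (R -` P) x *\<^sub>R flip (grad Om v (R x)))"
        by (auto simp: G_def indicator_def fun_eq_iff)
      then show ?thesis by simp
    qed
    also have "\<dots> = L2_ip (R -` P) (\<lambda>x. flip (grad Om v (R x))) (classical_grad \<phi>)"
      by (rule L2_ip_subset_indicator[OF RP_O sets_Om RPs, symmetric])
    also have "\<dots> = 0"
    \<comment> \<open>The subdomains adjacent to interface \<open>j'\<close> are mirror images of
      those adjacent to \<open>j\<close>; all others miss the reflected strip.\<close>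
    proof (cases "k = j' \<or> k = Suc j'")
      case True
      then have k2: "k \<le> 2 * i" using j' j by (auto simp: j'_def)
      define k' where "k' = 2 * i + 1 - k"
      have k': "k' \<in> {1..N}" "k' = j \<or> k' = Suc j" using True j' j k2 by (auto simp: k'_def j'_def)
      have vi: "R -` S k = S k'" using vimage_reflect_S[of k i] k k2 by (simp add: R_def k'_def)
      define \<phi>R where "\<phi>R x = \<phi> (R x)" for x
      \<comment> \<open>The test function is carried back to the subdomain \<open>k'\<close>, on
        which \<open>v\<close> is known to be harmonic.\<close>
      have pR: "\<phi>R \<in> test_functions (S k')"
        unfolding \<phi>R_def R_def by (rule test_reflect[OF phi]) (use vi in \<open>simp add: R_def\<close>)
      have gr: "classical_grad \<phi> x = flip (classical_grad \<phi>R (R x))" for x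
        using classical_grad_reflect[OF test_smooth[OF phi], of "real i" "R x"]
        by (simp add: \<phi>R_def[abs_def] R_def)
      have "L2_ip (R -` P) (\<lambda>x. flip (grad Om v (R x))) (classical_grad \<phi>)
          = L2_ip (R -` P) (\<lambda>x. grad Om v (R x)) (\<lambda>x. classical_grad \<phi>R (R x))"
        by (simp add: L2_ip_def gr)
      also have "\<dots> = L2_ip P (grad Om v) (classical_grad \<phi>R)"
        unfolding R_def by (rule L2_ip_reflect[OF gP test_L2(2)[OF pR Ps] Ps])
      also have "\<dots> = L2_ip Om (grad Om v) (classical_grad \<phi>R)"
        unfolding L2_ip_indicator[OF Ps] L2_ip_indicator[OF sets_Om]
      proof (rule Bochner_Integration.integral_cong[OF refl])
        fix x
        have "S k' \<subseteq> P" unfolding P_def using k' j by (intro S_in_strip) auto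
        then show "indicat_real P x * (grad Om v x \<bullet> classical_grad \<phi>R x) = indicat_real Om x * (grad Om v x \<bullet> classical_grad \<phi>R x)"
          using test_grad_zero[OF pR, of x] PO by (cases "x \<in> S k'") (auto simp: indicator_def)
      qed
      also have "\<dots> = 0" by (rule VG_D(2)[OF VGi_VG[OF v] k'(1) pR])
      finally show ?thesis .
    next
      case False
      have "classical_grad \<phi> x = 0" if "x \<in> R -` P" for x
      proof (rule test_grad_zero[OF phi], rule notI)
        assume "x \<in> S k"
        then have "real k - 1 < fst x" "fst x < real k" using k S_bounds by auto
        moreover have "real j' - 1 < fst x" "fst x < real j' + 1" using RP_fst[OF that] j' by (auto simp: of_nat_diff)
        ultimately have "real k < real j' + 2" "real j' < real k + 1" by linarith+
        then show False using False by linarith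
      qed
      then have "(LINT x|lebesgue_on (R -` P). flip (grad Om v (R x)) \<bullet> classical_grad \<phi> x) = (LINT x|lebesgue_on (R -` P). 0)"
        by (intro Bochner_Integration.integral_cong) auto
      then show ?thesis by (simp add: L2_ip_def)
    qed
    finally show "L2_ip Om (grad Om v') (classical_grad \<phi>) = 0" .
  qed
  moreover have "trace_of l v' (\<lambda>_. 0)" if "l \<in> {1..N - 1}" "l \<noteq> j'" for l
  proof (rule trace_zeroI[OF v'(2)], rule test_zero[OF T'])
    fix t show "(real l, t) \<notin> strip (j' - 1) (Suc j')" using that j' by (auto simp: of_nat_diff)
  qed
  ultimately have "v' \<in> VGi j'" by (simp add: V_Gamma_i_def)
  moreover have "is_reflection i j v v'" using v'(3) by (simp add: is_reflection_def G_def P_def R_def)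
  moreover have "trace_of i v' g" if "i = j" "trace_of i v g" for g
  proof (rule trace_ofI[OF v'(2) trace_of_L2[OF that(2)]])
    \<comment> \<open>Points of the line \<open>x1 = i\<close> are fixed, so the approximants keep
      their values on interface \<open>i\<close>.\<close>
    have "\<psi>' n (real i, t) = \<psi> n (real i, t)" for n t by (simp add: \<psi>'_def R_def reflect_def)
    then show "(\<lambda>n. L2_norm (Gam i) (\<lambda>t. \<psi>' n (real i, t) - g t)) \<longlonglongrightarrow> 0"
      using trace_seq[OF _ vH that(2) psi(2)] j that(1) by simp
  qed
  ultimately show ?thesis using that by (simp add: j'_def)
qed

text \<open>A change of variables on a subdomain contained in both strips; the two factors
  \<open>flip\<close> cancel in the inner product.\<close>

lemma A_reflection:
  assumes v: "v \<in> H10 Om" "v' \<in> H10 Om" "is_reflection i j v v'" and w: "w \<in> H10 Om" "w' \<in> H10 Om" "is_reflection i l w w'"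
    and j: "1 \<le> j" "1 \<le> l" and k: "k \<in> {1..N}" "k = j \<or> k = Suc j" "k = l \<or> k = Suc l" "k \<le> 2 * i"
    and k': "2 * i + 1 - k \<in> {1..N}"
  shows "A (2 * i + 1 - k) v' w' = A k v w"
proof -
  define R where "R = reflect (real i)"
  have vi: "R -` S k = S (2 * i + 1 - k)" using vimage_reflect_S[of k i] k by (simp add: R_def)
  have Sk: "S k \<in> sets lebesgue" using k by auto
  have Sk': "S (2 * i + 1 - k) \<in> sets lebesgue" using k' by auto
  have Lv: "(\<lambda>x. grad Om v (R x)) \<in> L2 (S (2 * i + 1 - k))" "(\<lambda>x. grad Om w (R x)) \<in> L2 (S (2 * i + 1 - k))"
    using L2_reflect[OF grad_L2_S[OF v(1) k(1)] Sk, of "real i"] L2_reflect[OF grad_L2_S[OF w(1) k(1)] Sk, of "real i"] vi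
    by (simp_all add: R_def)
  have ae: "AE x in lebesgue_on (S (2 * i + 1 - k)). grad Om u' x = flip (grad Om u (R x))"
    if "is_reflection i j u u'" "1 \<le> j" "k = j \<or> k = Suc j" for j u u'
    using AE_Om_S[OF that(1)[unfolded is_reflection_def] k'] unfolding AE_lebesgue_on_iff[OF Sk']
  proof eventually_elim
    fix x assume a: "x \<in> S (2 * i + 1 - k) \<longrightarrow> grad Om u' x =
      flip (indicat_real (strip (j - 1) (Suc j)) (reflect (real i) x) *\<^sub>R grad Om u (reflect (real i) x))"
    show "x \<in> S (2 * i + 1 - k) \<longrightarrow> grad Om u' x = flip (grad Om u (R x))"
    proof
      assume x: "x \<in> S (2 * i + 1 - k)"
      then have "reflect (real i) x \<in> S k" using vi by (auto simp: R_def)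
      then have "reflect (real i) x \<in> strip (j - 1) (Suc j)" using S_in_strip[OF that(3,2) k(1)] by blast
      then show "grad Om u' x = flip (grad Om u (R x))" using a x by (simp add: R_def)
    qed
  qed
  have "A (2 * i + 1 - k) v' w' = L2_ip (S (2 * i + 1 - k)) (\<lambda>x. flip (grad Om v (R x))) (\<lambda>x. flip (grad Om w (R x)))"
    unfolding grad_ip_def
    by (intro L2_ip_cong_AE grad_L2_S v w k' L2_flip Lv ae[OF v(3) j(1) k(2)] ae[OF w(3) j(2) k(3)])
  also have "\<dots> = L2_ip (R -` S k) (\<lambda>x. grad Om v (R x)) (\<lambda>x. grad Om w (R x))"
    unfolding vi by (simp add: L2_ip_def)
  also have "\<dots> = A k v w"
    unfolding grad_ip_def R_def by (rule L2_ip_reflect[OF grad_L2_S[OF v(1) k(1)] grad_L2_S[OF w(1) k(1)] Sk])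
  finally show ?thesis .
qed

text \<open>A function in \<open>VGi i\<close> has the same traces as its reflection in interface \<open>i\<close>, hence the same gradient.\<close>

lemma reflect_pairing:
  assumes z: "z \<in> VGi i" and w: "w \<in> VGi (i - 1)" and i: "2 \<le> i" "i \<le> N - 2"
  obtains w' where "w' \<in> VGi (i + 1)" "A (i + 1) z w' = A i z w" "A (i + 1) w' w' = A i w w" "A (i + 1) z z = A i z z"
proof -
  have i1: "i \<in> {1..N - 1}" "i - 1 \<in> {1..N - 1}" and iN: "i \<in> {1..N}" "i + 1 \<in> {1..N}" using i by auto
  \<comment> \<open>The last inequality is where \<open>i \<le> N - 2\<close> enters: interface
    \<open>i - 1\<close> is mirrored to interface \<open>i + 1\<close>, which must not lie beyond
    \<open>N - 1\<close>.\<close>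
  have c: "i < 2 * i" "2 * i + 1 \<le> i + N" "i - 1 < 2 * i" "2 * i + 1 \<le> (i - 1) + N" using i by auto
  have e: "2 * i - i = i" "2 * i - (i - 1) = i + 1" using i by auto
  obtain z' where z': "z' \<in> VGi i" "is_reflection i i z z'" "\<And>g. trace_of i z g \<Longrightarrow> trace_of i z' g"
  proof (rule reflect_VGi[OF z i1(1) c(1,2), unfolded e])
    fix v' assume "v' \<in> VGi i" "is_reflection i i z v'" "\<And>g. i = i \<Longrightarrow> trace_of i z g \<Longrightarrow> trace_of i v' g"
    then show thesis by (intro that[of v']) auto
  qed
  obtain w' where w': "w' \<in> VGi (i + 1)" "is_reflection i (i - 1) w w'"
    by (rule reflect_VGi[OF w i1(2) c(3,4), unfolded e]) (rule that)
  note zH = VGi_H10[OF z] and z'H = VGi_H10[OF z'(1)] and wH = VGi_H10[OF w] and w'H = VGi_H10[OF w'(1)]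
  define d where "d x = z x - z' x" for x
  have dV: "d \<in> VGi i" unfolding d_def by (rule VGi_diff[OF z z'(1)])
  have "zero_trace l d" for l
  proof (cases "l = i")
    case True
    obtain g where g: "trace_of i z g" using trace_exists[OF _ zH, of i] i by auto
    have "trace_of i d (\<lambda>t. g t - g t)"
      unfolding d_def using i by (intro trace_diff zH z'H g z'(3)) auto
    then show ?thesis using True by (simp add: zero_trace_def)
  qed (rule VGi_zero_trace[OF dV])
  then have "gnorm d = 0" by (rule harmonic_zero_traces[OF VGi_VG[OF dV]])
  then have "AE x in lebesgue_on Om. grad Om d x = 0" by (rule gnorm_eq_0[OF VGi_H10[OF dV]])
  then have gz: "AE x in lebesgue_on Om. grad Om z x = grad Om z' x"
    using H1_diff(2)[OF open_Om H10_H1[OF zH] H10_H1[OF z'H]] unfolding d_def by eventually_elim simp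
  have k: "2 * i + 1 - i = i + 1" by simp
  have "A (i + 1) z w' = A (i + 1) z' w'" by (rule A_cong[OF zH z'H w'H gz iN(2)])
  also have "\<dots> = A i z w"
    using A_reflection[OF zH z'H z'(2) wH w'H w'(2), of i] i iN unfolding k by auto
  finally have 1: "A (i + 1) z w' = A i z w" .
  have 2: "A (i + 1) w' w' = A i w w"
    using A_reflection[OF wH w'H w'(2) wH w'H w'(2), of i] i iN unfolding k by auto
  have "A (i + 1) z z = A (i + 1) z' z" by (rule A_cong[OF zH z'H zH gz iN(2)])
  also have "\<dots> = A (i + 1) z z'" by (rule A_commute)
  also have "\<dots> = A (i + 1) z' z'" by (rule A_cong[OF zH z'H z'H gz iN(2)])
  also have "\<dots> = A i z z"
    using A_reflection[OF zH z'H z'(2) zH z'H z'(2), of i] i iN unfolding k by auto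
  finally show ?thesis using w'(1) 1 2 by (intro that)
qed

end

section \<open>The interaction estimate\<close>

context chain
begin

lemma gnorm_add:
  assumes "u \<in> H10 Om" "v \<in> H10 Om" shows "gnorm (\<lambda>x. u x + v x) \<le> gnorm u + gnorm v"
proof -
  have "gnorm (\<lambda>x. u x + v x) = L2_norm Om (\<lambda>x. grad Om u x + grad Om v x)"
    unfolding gnorm_def
    by (intro L2_norm_cong_AE L2_add grad_L2 assms grad_add_AE H10_add[OF open_Om])
  also have "\<dots> \<le> gnorm u + gnorm v"
    unfolding gnorm_def by (intro L2_norm_triangle grad_L2 assms)
  finally show ?thesis .
qed

lemma gnorm_zero: "gnorm (\<lambda>x. 0) = 0"
  by (rule harmonic_zero_traces[OF VG_zero]) (auto simp: zero_trace_def intro: trace_of_zero)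

lemma gnorm_sum:
  assumes "\<And>i. i \<in> I \<Longrightarrow> f i \<in> H10 Om" shows "gnorm (\<lambda>x. \<Sum>i\<in>I. f i x) \<le> (\<Sum>i\<in>I. gnorm (f i))"
  using assms
proof (induction I rule: infinite_finite_induct)
  case (insert i I)
  have "gnorm (\<lambda>x. f i x + (\<Sum>i\<in>I. f i x)) \<le> gnorm (f i) + gnorm (\<lambda>x. \<Sum>i\<in>I. f i x)"
    using insert by (intro gnorm_add H10_sum) auto
  then show ?case using insert by simp
qed (auto simp: gnorm_zero)

abbreviation bl :: "(nat \<Rightarrow> real) \<Rightarrow> (real \<times> real \<Rightarrow> real) \<Rightarrow> (real \<times> real \<Rightarrow> real) \<Rightarrow> real" where
  "bl \<equiv> bilin N r1 r2"

lemma bl_commute: "bl y u v = bl y v u"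
  by (simp add: bilin_def A_commute)

lemma bl_add_left:
  assumes "u \<in> H10 Om" "v \<in> H10 Om" "w \<in> H10 Om" shows "bl y (\<lambda>x. u x + v x) w = bl y u w + bl y v w"
  unfolding bilin_def sum.distrib[symmetric] using A_add_left[OF assms]
  by (intro sum.cong) (auto simp: distrib_left)

lemma bl_diff_left:
  assumes "u \<in> H10 Om" "v \<in> H10 Om" "w \<in> H10 Om" shows "bl y (\<lambda>x. u x - v x) w = bl y u w - bl y v w"
  unfolding bilin_def sum_subtractf[symmetric] using A_diff_left[OF assms]
  by (intro sum.cong) (auto simp: right_diff_distrib)

lemma bl_sum_left:
  assumes "\<And>i. i \<in> I \<Longrightarrow> f i \<in> H10 Om" "w \<in> H10 Om" "finite I"
  shows "bl y (\<lambda>x. \<Sum>i\<in>I. f i x) w = (\<Sum>i\<in>I. bl y (f i) w)"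
  using assms(3,1)
proof (induction I)
  case empty
  have "bl y (\<lambda>x. 0 + 0) w = bl y (\<lambda>x. 0) w + bl y (\<lambda>x. 0) w"
    by (rule bl_add_left[OF H10_zero H10_zero assms(2)])
  then show ?case by simp
next
  case (insert i I)
  have "bl y (\<lambda>x. f i x + (\<Sum>i\<in>I. f i x)) w = bl y (f i) w + bl y (\<lambda>x. \<Sum>i\<in>I. f i x) w"
    using insert by (intro bl_add_left H10_sum assms(2)) auto
  then show ?case using insert by simp
qed

lemma bl_cong:
  assumes "u \<in> H10 Om" "u' \<in> H10 Om" "v \<in> H10 Om" "AE x in lebesgue_on Om. grad Om u x = grad Om u' x"
  shows "bl y u v = bl y u' v"
  unfolding bilin_def using A_cong[OF assms] by (intro sum.cong) auto

lemma bl_bounds: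
  assumes "v \<in> H10 Om" "\<And>k. k \<in> {1..N} \<Longrightarrow> m \<le> y k \<and> y k \<le> M"
  shows "m * (gnorm v)\<^sup>2 \<le> bl y v v" "bl y v v \<le> M * (gnorm v)\<^sup>2"
  unfolding gnorm_power2[OF assms(1)] bilin_def sum_distrib_left
  using assms(2) A_nonneg by (auto intro!: sum_mono mult_right_mono)

lemma VGi_zero: "(\<lambda>x. 0) \<in> VGi j"
  unfolding V_Gamma_i_def using VG_zero by (auto intro: trace_of_zero)

lemma VGi_uminus: "u \<in> VGi j \<Longrightarrow> (\<lambda>x. - u x) \<in> VGi j"
  using VGi_diff[OF VGi_zero, of u j] by simp

section \<open>Bounds by the suprema of interaction quotients\<close>

lemma grad_norm_zero_AE:
  assumes z: "z \<in> H10 Om" "AE x in lebesgue_on Om. z x = 0" and k: "k \<in> {1..N}"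
  shows "grad_norm N r1 r2 (S k) z = 0"
proof -
  note z1 = H10_H1[OF z(1)]
  have wg: "weak_gradient Om (\<lambda>x. 0) (classical_grad (\<lambda>x. 0))" by (rule weak_gradient_test[OF test_zero_function sets_Om])
  have "AE x in lebesgue_on Om. grad Om z x = classical_grad (\<lambda>x. 0) x"
    by (rule weak_gradient_unique[OF open_Om H1_D(1)[OF z1] L2_zero z(2) H1_D(2)[OF z1] wg])
  then have "AE x in lebesgue_on (S k). grad Om z x = 0"
    using AE_Om_S[OF _ k] by (simp add: classical_grad_const)
  then show ?thesis using L2_norm_eq_0_iff[OF grad_L2_S[OF z(1) k]] by (simp add: grad_norm_def)
qed

text \<open>The Cauchy-Schwarz inequality bounds each quotient by 1. A nonzero function may have no
  energy on the subdomain; its quotients are 0 by the convention for division.\<close>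

lemma interaction_bdd:
  assumes "Z \<subseteq> H10 Om" "W \<subseteq> H10 Om" "k \<in> {1..N}"
  shows "bdd_above (insert 0 {A k z w / (grad_norm N r1 r2 (S k) z * grad_norm N r1 r2 (S k) w) | z w.
    z \<in> Z \<and> w \<in> W \<and> \<not> (AE x in lebesgue_on Om. z x = 0) \<and> \<not> (AE x in lebesgue_on Om. w x = 0)})"
proof (rule bdd_aboveI[of _ 1])
  have *: "A k z w / (grad_norm N r1 r2 (S k) z * grad_norm N r1 r2 (S k) w) \<le> 1" if "z \<in> Z" "w \<in> W" for z w
  proof -
    let ?p = "grad_norm N r1 r2 (S k) z * grad_norm N r1 r2 (S k) w"
    have "z \<in> H10 Om" "w \<in> H10 Om" using that assms(1,2) by auto
    then have le: "A k z w \<le> ?p" using A_Cauchy_Schwarz[of z w k] assms(3) by linarith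
    have "0 \<le> ?p" by simp
    show ?thesis
    proof (cases "?p = 0")
      case True
      then show ?thesis by (simp only: div_by_0 zero_le_one)
    next
      case False
      with \<open>0 \<le> ?p\<close> have "0 < ?p" by (metis less_le)
      then show ?thesis using le by (simp only: divide_le_eq_1) simp
    qed
  qed
  fix q
  assume "q \<in> insert 0 {A k z w / (grad_norm N r1 r2 (S k) z * grad_norm N r1 r2 (S k) w) | z w.
    z \<in> Z \<and> w \<in> W \<and> \<not> (AE x in lebesgue_on Om. z x = 0) \<and> \<not> (AE x in lebesgue_on Om. w x = 0)}"
  then show "q \<le> 1" using * by auto
qed

lemma interaction_nonneg:
  assumes "Z \<subseteq> H10 Om" "W \<subseteq> H10 Om" "k \<in> {1..N}" shows "0 \<le> interaction N r1 r2 (S k) Z W"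
  unfolding interaction_def by (rule cSup_upper[OF _ interaction_bdd[OF assms]]) simp

text \<open>In multiplied form the bound also covers vanishing denominators, for which the
  Cauchy-Schwarz inequality makes the left side 0. A positive denominator ensures that neither
  function is zero almost everywhere, so the quotient takes part in the supremum.\<close>

lemma interaction_bound:
  assumes Z: "Z \<subseteq> H10 Om" and W: "W \<subseteq> H10 Om" and k: "k \<in> {1..N}" and zw: "z \<in> Z" "w \<in> W"
  shows "A k z w \<le> interaction N r1 r2 (S k) Z W * (grad_norm N r1 r2 (S k) z * grad_norm N r1 r2 (S k) w)"
proof -
  let ?p = "grad_norm N r1 r2 (S k) z * grad_norm N r1 r2 (S k) w"
  have zH: "z \<in> H10 Om" "w \<in> H10 Om" using zw Z W by auto
  show ?thesis
  proof (cases "?p = 0")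
    case True
    have "A k z w = 0" using A_Cauchy_Schwarz[OF zH k] unfolding True by simp
    then show ?thesis unfolding True by simp
  next
    case False
    then have p: "0 < ?p" by (simp add: less_le)
    have "\<not> (AE x in lebesgue_on Om. z x = 0)" "\<not> (AE x in lebesgue_on Om. w x = 0)"
      using False grad_norm_zero_AE[OF zH(1) _ k] grad_norm_zero_AE[OF zH(2) _ k] by auto
    then have "A k z w / ?p \<le> interaction N r1 r2 (S k) Z W"
      unfolding interaction_def using zw by (intro cSup_upper[OF _ interaction_bdd[OF Z W k]]) blast
    then show ?thesis using p by (simp add: divide_le_eq)
  qed
qed

lemma V_part_VGi: "v \<in> V_part N r1 r2 Y i \<Longrightarrow> v \<in> VGi i"
  by (simp add: V_part_def)

lemma V_part_H10: "V_part N r1 r2 Y i \<subseteq> H10 Om"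
  using V_part_VGi VGi_H10 by blast

lemma VGi_subset_H10: "VGi i \<subseteq> H10 Om"
  using VGi_H10 by blast

text \<open>The error within one slow or fast space is a difference of two of its members and
  therefore an admissible test function.\<close>

lemma V_part_diff:
  assumes "lin_subspace (Y i)" "1 \<le> i" "v \<in> V_part N r1 r2 Y i" "w \<in> V_part N r1 r2 Y i"
  shows "(\<lambda>x. v x - w x) \<in> V_part N r1 r2 Y i"
proof -
  obtain g h where gh: "g \<in> Y i" "trace_of i v g" "h \<in> Y i" "trace_of i w h"
    using assms(3,4) by (auto simp: V_part_def)
  note lin = assms(1)[unfolded lin_subspace_def]
  have "(\<lambda>t. - 1 * h t) \<in> Y i" using gh(3) by (rule lin[THEN conjunct2, THEN conjunct2, rule_format])
  with gh(1) have "(\<lambda>t. g t + - 1 * h t) \<in> Y i" by (rule lin[THEN conjunct2, THEN conjunct1, rule_format])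
  then have Y: "(\<lambda>t. g t - h t) \<in> Y i" by simp
  have "trace_of i (\<lambda>x. v x - w x) (\<lambda>t. g t - h t)"
    by (rule trace_diff[OF assms(2) VGi_H10[OF V_part_VGi[OF assms(3)]] VGi_H10[OF V_part_VGi[OF assms(4)]] gh(2,4)])
  moreover have "(\<lambda>x. v x - w x) \<in> VGi i" using assms(3,4) by (intro VGi_diff V_part_VGi)
  ultimately show ?thesis unfolding V_part_def using Y by blast
qed

text \<open>The supremum is one-sided; passing from \<open>w\<close> to its negative gives the bound
  for the absolute value.\<close>

lemma A_abs_le:
  assumes z: "z \<in> V_part N r1 r2 Y i" and w: "w \<in> VGi j" and k: "k \<in> {1..N}"
  shows "\<bar>A k z w\<bar> \<le> interaction N r1 r2 (S k) (V_part N r1 r2 Y i) (VGi j) *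
    (grad_norm N r1 r2 (S k) z * grad_norm N r1 r2 (S k) w)"
proof -
  have zH: "z \<in> H10 Om" using z V_part_H10 by blast
  note wH = VGi_H10[OF w]
  have "A k z (\<lambda>x. - w x) = - A k z w"
    using A_cmult_left[OF wH zH k, of "- 1"] by (simp add: A_commute)
  moreover have "grad_norm N r1 r2 (S k) (\<lambda>x. - w x) = grad_norm N r1 r2 (S k) w"
  proof -
    have nH: "(\<lambda>x. - w x) \<in> H10 Om" using VGi_H10[OF VGi_uminus[OF w]] .
    have "A k (\<lambda>x. - w x) (\<lambda>x. - w x) = A k w w"
      using A_cmult_left[OF wH nH k, of "- 1"] A_cmult_left[OF wH wH k, of "- 1"] by (simp add: A_commute)
    then show ?thesis by (simp add: grad_norm_def grad_ip_def L2_norm_def)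
  qed
  ultimately show ?thesis
    using interaction_bound[OF V_part_H10 VGi_subset_H10 k z w]
      interaction_bound[OF V_part_H10 VGi_subset_H10 k z VGi_uminus[OF w]] by (simp add: abs_le_iff)
qed

lemma fast_interaction_ge:
  assumes "i \<in> {1..N - 2}"
  shows "interaction N r1 r2 (S (i + 1)) (V_part N r1 r2 Yf i) (VGi (i + 1)) \<le> fast_interaction N r1 r2 Yf"
  unfolding fast_interaction_def using assms by (intro Max_ge) auto

lemma fast_interaction_nonneg:
  assumes "2 < N" shows "0 \<le> fast_interaction N r1 r2 Yf"
proof -
  have "1 \<in> {1..N - 2}" "1 + 1 \<in> {1..N}" using assms by auto
  then show ?thesis
    using order_trans[OF interaction_nonneg[OF V_part_H10 VGi_subset_H10] fast_interaction_ge] by blast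
qed

lemma bl_single:
  assumes "k \<in> {1..N}" "\<And>l. l \<in> {1..N} \<Longrightarrow> l \<noteq> k \<Longrightarrow> A l z w = 0"
  shows "bl y z w = y k * A k z w"
proof -
  have "bl y z w = (\<Sum>l\<in>{k}. y l * A l z w)"
    unfolding bilin_def using assms by (intro sum.mono_neutral_right) auto
  then show ?thesis by simp
qed

text \<open>Each function has energy only on the two subdomains adjacent to its interface, so only
  subdomains adjacent to both interfaces contribute.\<close>

lemma VGi_pair:
  assumes "z \<in> VGi i" "w \<in> VGi j" "l \<in> {1..N}" "\<not> ((l = i \<or> l = Suc i) \<and> (l = j \<or> l = Suc j))"
  shows "A l z w = 0"
  using assms VGi_support[OF assms(1) VGi_H10[OF assms(2)] assms(3)]
    VGi_support[OF assms(2) VGi_H10[OF assms(1)] assms(3)] A_commute[of l z w] by auto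

text \<open>The pairing with the previous interface reduces to the next one by reflection, except at the last
  interface.\<close>

lemma fast_pairing:
  assumes N: "2 < N" and last: "last_interaction N r1 r2 Yf \<le> \<kappa> * fast_interaction N r1 r2 Yf"
    and ij: "i \<in> {1..N - 1}" "j \<in> {1..N - 1}" "i \<noteq> j"
    and z: "z \<in> V_part N r1 r2 Yf i" and w: "w \<in> VGi j"
    and y: "\<And>k. k \<in> {1..N} \<Longrightarrow> 0 \<le> y k \<and> y k \<le> M" and M: "0 \<le> M"
  shows "\<bar>bl y z w\<bar> \<le> M * max 1 \<kappa> * fast_interaction N r1 r2 Yf * (gnorm z * gnorm w)"
proof -
  define \<epsilon> where "\<epsilon> = fast_interaction N r1 r2 Yf"
  have \<epsilon>: "0 \<le> \<epsilon>" unfolding \<epsilon>_def by (rule fast_interaction_nonneg[OF N])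
  \<comment> \<open>The factor \<open>max 1 \<kappa>\<close> covers both kinds of pairings: 1 for
    those governed by \<open>fast_interaction\<close>, \<kappa> for the one governed by
    \<open>last_interaction\<close>.\<close>
  have \<epsilon>1: "\<epsilon> \<le> max 1 \<kappa> * \<epsilon>" using mult_right_mono[OF max.cobounded1[of 1 \<kappa>] \<epsilon>] by simp
  note zV = V_part_VGi[OF z] 
  note zH = VGi_H10[OF zV] and wH = VGi_H10[OF w]
  have p0: "0 \<le> gnorm z * gnorm w" by simp
  have gn: "grad_norm N r1 r2 (S k) z * grad_norm N r1 r2 (S k) w \<le> gnorm z * gnorm w" if "k \<in> {1..N}" for k
    using that by (intro mult_mono grad_norm_le_gnorm zH wH) auto
  have finish: "\<bar>bl y z w\<bar> \<le> M * max 1 \<kappa> * \<epsilon> * (gnorm z * gnorm w)"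
    if k: "k \<in> {1..N}" and off: "\<And>l. l \<in> {1..N} \<Longrightarrow> l \<noteq> k \<Longrightarrow> A l z w = 0"
      and le: "\<bar>A k z w\<bar> \<le> max 1 \<kappa> * \<epsilon> * (gnorm z * gnorm w)" for k
  proof -
    have "\<bar>bl y z w\<bar> = y k * \<bar>A k z w\<bar>" using bl_single[OF k off] y[OF k] by (simp add: abs_mult)
    also have "\<dots> \<le> M * (max 1 \<kappa> * \<epsilon> * (gnorm z * gnorm w))"
      using y[OF k] le M by (intro mult_mono) auto
    finally show ?thesis by (simp add: mult.assoc)
  qed
  have weaken: "\<bar>A k z w\<bar> \<le> max 1 \<kappa> * \<epsilon> * (gnorm z * gnorm w)"
    if k: "k \<in> {1..N}" and le: "\<bar>A k z w\<bar> \<le> \<gamma> * (grad_norm N r1 r2 (S k) z * grad_norm N r1 r2 (S k) w)"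
      and \<gamma>: "\<gamma> \<le> max 1 \<kappa> * \<epsilon>" for k \<gamma>
  proof -
    have "\<bar>A k z w\<bar> \<le> (max 1 \<kappa> * \<epsilon>) * (grad_norm N r1 r2 (S k) z * grad_norm N r1 r2 (S k) w)"
      using le mult_right_mono[OF \<gamma>, of "grad_norm N r1 r2 (S k) z * grad_norm N r1 r2 (S k) w"] by simp
    also have "\<dots> \<le> (max 1 \<kappa> * \<epsilon>) * (gnorm z * gnorm w)"
      using gn[OF k] \<epsilon> \<epsilon>1 by (intro mult_left_mono) auto
    finally show ?thesis .
  qed
  \<comment> \<open>The next interface; the previous one with room for the reflection; the previous
    one at the end of the chain; interfaces without a common subdomain.\<close>
  consider "j = Suc i" | "i = Suc j" "i \<le> N - 2" | "i = Suc j" "i = N - 1" | "Suc i < j \<or> Suc j < i"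
    using ij by (cases "j = Suc i"; cases "i = Suc j"; force)
  then have "\<bar>bl y z w\<bar> \<le> M * max 1 \<kappa> * \<epsilon> * (gnorm z * gnorm w)"
  proof cases
    case 1
    then have k: "i + 1 \<in> {1..N}" and i: "i \<in> {1..N - 2}" using ij by auto
    show ?thesis
    proof (rule finish[OF k])
      show "A l z w = 0" if "l \<in> {1..N}" "l \<noteq> i + 1" for l
        using that 1 by (intro VGi_pair[OF zV w]) auto
      show "\<bar>A (i + 1) z w\<bar> \<le> max 1 \<kappa> * \<epsilon> * (gnorm z * gnorm w)"
      proof (rule weaken[OF k A_abs_le[OF z _ k]])
        show "w \<in> VGi (i + 1)" using w 1 by simp
        show "interaction N r1 r2 (S (i + 1)) (V_part N r1 r2 Yf i) (VGi (i + 1)) \<le> max 1 \<kappa> * \<epsilon>"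
          using fast_interaction_ge[OF i, of Yf] \<epsilon>1 by (simp add: \<epsilon>_def)
      qed
    qed
  next
    case 2
    then have k: "i \<in> {1..N}" "i + 1 \<in> {1..N}" and i: "2 \<le> i" "i \<in> {1..N - 2}" and j: "j = i - 1" using ij by auto
    obtain w' where w': "w' \<in> VGi (i + 1)" "A (i + 1) z w' = A i z w" "A (i + 1) w' w' = A i w w" "A (i + 1) z z = A i z z"
      using reflect_pairing[OF zV w[unfolded j] i(1) 2(2)] by blast
    \<comment> \<open>Equal energies on mirror subdomains mean equal norms, so a bound on subdomain
      \<open>i + 1\<close> can be read on subdomain \<open>i\<close>.\<close>
    have sw: "grad_norm N r1 r2 (S (i + 1)) v' = grad_norm N r1 r2 (S i) v" if "A (i + 1) v' v' = A i v v" for v v'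
      using that by (simp add: grad_norm_def grad_ip_def L2_norm_def)
    show ?thesis
    proof (rule finish[OF k(1)])
      show "A l z w = 0" if "l \<in> {1..N}" "l \<noteq> i" for l
        using that 2 by (intro VGi_pair[OF zV w]) auto
      show "\<bar>A i z w\<bar> \<le> max 1 \<kappa> * \<epsilon> * (gnorm z * gnorm w)"
      proof (rule weaken[OF k(1)])
        show "\<bar>A i z w\<bar> \<le> interaction N r1 r2 (S (i + 1)) (V_part N r1 r2 Yf i) (VGi (i + 1)) *
            (grad_norm N r1 r2 (S i) z * grad_norm N r1 r2 (S i) w)"
          using A_abs_le[OF z w'(1) k(2)] unfolding w'(2) sw[OF w'(3)] sw[OF w'(4)] .
        show "interaction N r1 r2 (S (i + 1)) (V_part N r1 r2 Yf i) (VGi (i + 1)) \<le> max 1 \<kappa> * \<epsilon>"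
          using fast_interaction_ge[OF i(2), of Yf] \<epsilon>1 by (simp add: \<epsilon>_def)
      qed
    qed
  next
    case 3
    then have k: "i \<in> {1..N}" and j: "j = N - 2" using ij by auto
    have \<kappa>: "last_interaction N r1 r2 Yf \<le> max 1 \<kappa> * \<epsilon>"
      using last mult_right_mono[OF max.cobounded2[of \<kappa> 1] \<epsilon>] by (simp add: \<epsilon>_def)
    show ?thesis
    proof (rule finish[OF k])
      show "A l z w = 0" if "l \<in> {1..N}" "l \<noteq> i" for l
        using that 3 by (intro VGi_pair[OF zV w]) auto
      show "\<bar>A i z w\<bar> \<le> max 1 \<kappa> * \<epsilon> * (gnorm z * gnorm w)"
        using A_abs_le[OF z w k] \<kappa> unfolding last_interaction_def 3(2)[symmetric] j[symmetric]
        by (rule weaken[OF k])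
    qed
  next
    case 4
    have "bl y z w = 0"
      unfolding bilin_def using 4 by (intro sum.neutral ballI) (auto intro!: VGi_pair[OF zV w])
    then show ?thesis using M \<epsilon> by simp
  qed
  then show ?thesis by (simp add: \<epsilon>_def)
qed

section \<open>Splitting into slow and fast parts, and the error estimate\<close>

text \<open>The trace \<open>g\<close> of \<open>u\<close> on interface \<open>i\<close> is written
  as a slow trace \<open>a\<close> plus a fast trace \<open>b\<close>. Only \<open>g\<close> and
  \<open>a\<close> are lifted to harmonic functions: the difference of the liftings has trace
  \<open>b\<close>, and the two parts then add up to the lifting of \<open>g\<close>.\<close>

lemma decomposition:
  assumes u: "u \<in> H10 Om" and i: "i \<in> {1..N - 1}" and dec: "trace_decomposition N r1 r2 i (Ys i) (Yf i)"
  obtains s f g where "s \<in> V_part N r1 r2 Ys i" "f \<in> V_part N r1 r2 Yf i"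
    "trace_of i u g" "trace_of i (\<lambda>x. s x + f x) g"
proof -
  have i1: "1 \<le> i" using i by simp
  obtain g where g: "trace_of i u g" using i1 u by (rule trace_exists)
  obtain U where U: "U \<in> VGi i" "trace_of i U g" using u i g by (rule VGi_extension)
  have H: "H_half_00 N r1 r2 i = {(\<lambda>t. g t + h t) | g h. g \<in> Ys i \<and> h \<in> Yf i}" and z: "(\<lambda>_. 0) \<in> Yf i"
    using dec by (simp_all add: trace_decomposition_def lin_subspace_def)
  have "g \<in> H_half_00 N r1 r2 i" unfolding H_half_00_def using u g by (intro CollectI bexI)
  then obtain a b where ab: "g = (\<lambda>t. a t + b t)" "a \<in> Ys i" "b \<in> Yf i"
    unfolding H by (elim CollectE exE conjE) (rule that)
  \<comment> \<open>Adding the zero of the fast space exhibits \<open>a\<close> as an element of the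
    trace space.\<close>
  have "(\<lambda>t. a t + 0) \<in> H_half_00 N r1 r2 i"
    unfolding H by (intro CollectI exI[of _ a] exI[of _ "\<lambda>_. 0"] conjI refl ab(2) z)
  then have "a \<in> H_half_00 N r1 r2 i" by simp
  then obtain v where v: "v \<in> H10 Om" "trace_of i v a"
    unfolding H_half_00_def by (elim CollectE bexE) (rule that)
  obtain s where s: "s \<in> VGi i" "trace_of i s a" using v(1) i v(2) by (rule VGi_extension)
  have "trace_of i (\<lambda>x. U x - s x) (\<lambda>t. g t - a t)"
    by (rule trace_diff[OF i1 VGi_H10[OF U(1)] VGi_H10[OF s(1)] U(2) s(2)])
  then have tf: "trace_of i (\<lambda>x. U x - s x) b" by (simp add: ab(1))
  show ?thesis
  proof (rule that[OF _ _ g])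
    show "s \<in> V_part N r1 r2 Ys i" using s ab(2) by (auto simp: V_part_def)
    show "(\<lambda>x. U x - s x) \<in> V_part N r1 r2 Yf i"
      using VGi_diff[OF U(1) s(1)] tf ab(3) by (auto simp: V_part_def)
    show "trace_of i (\<lambda>x. s x + (U x - s x)) g" using U(2) by simp
  qed
qed

text \<open>All summands other than \<open>w i\<close> have zero trace on interface
  \<open>i\<close>.\<close>

lemma sum_VGi_trace:
  assumes "\<And>j. j \<in> {1..N - 1} \<Longrightarrow> w j \<in> VGi j" and i: "i \<in> {1..N - 1}" and tr: "trace_of i (w i) g"
  shows "trace_of i (\<lambda>x. \<Sum>j = 1..N - 1. w j x) g"
proof -
  have "trace_of i (\<lambda>x. \<Sum>j = 1..N - 1. w j x) (\<lambda>t. \<Sum>j = 1..N - 1. if j = i then g t else 0)"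
  proof (rule trace_sum)
    show "1 \<le> i" using i by simp
    show "w j \<in> H10 Om" if "j \<in> {1..N - 1}" for j using assms(1)[OF that] VGi_H10 by blast
    show "trace_of i (w j) (\<lambda>t. if j = i then g t else 0)" if "j \<in> {1..N - 1}" for j
      using assms(1)[OF that] i tr by (cases "j = i") (auto simp: V_Gamma_i_def)
  qed
  then show ?thesis using i by (simp add: sum.delta)
qed

text \<open>Turns an inequality obtained by testing with the error itself into a bound of its norm.
  For \<open>g = 0\<close> the claim is that \<open>c / m\<close> is nonnegative.\<close>

lemma absorb:
  fixes g c m :: real
  assumes "m * g\<^sup>2 \<le> c * g" "0 < m" "0 \<le> g" "0 \<le> c" shows "g \<le> c / m"
proof (cases "g = 0")
  case False
  then have "m * g \<le> c" using assms by (simp add: power2_eq_square flip: mult.assoc)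
  then show ?thesis using assms(2) by (simp add: field_simps)
qed (use assms in simp)

text \<open>There are at most \<open>N\<close> fast errors, each bounded by
  \<open>N K C0 / m\<close> times the norm of \<open>u\<close>; the slow error contributes
  \<open>N^2 K q C0^2 / m\<close> with \<open>q = sqrt (M / m)\<close>. The first conclusion is
  there so that the norm comparison can be applied to the total error.\<close>

lemma error_estimate:
  assumes N: "2 < N" and m: "0 < m" and M: "0 < M"
    and y: "\<And>k. k \<in> {1..N} \<Longrightarrow> m \<le> y k \<and> y k \<le> M"
    and C0: "0 \<le> C0" "\<And>j v w g. j \<in> {1..N - 1} \<Longrightarrow> v \<in> VGi j \<Longrightarrow> w \<in> H10 Om \<Longrightarrow> trace_of j v g \<Longrightarrow>
      trace_of j w g \<Longrightarrow> gnorm v \<le> C0 * gnorm w"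
    and dec: "\<And>i. i \<in> {1..N - 1} \<Longrightarrow> trace_decomposition N r1 r2 i (Ys i) (Yf i)"
    and orth: "\<And>i z w. i \<in> {1..N - 1} \<Longrightarrow> z \<in> V_part N r1 r2 Ys i \<Longrightarrow> w \<in> V_part N r1 r2 Yf i \<Longrightarrow> bl y z w = 0"
    and last: "last_interaction N r1 r2 Yf \<le> \<kappa> * fast_interaction N r1 r2 Yf"
    and u: "solves_in N r1 r2 y f VG u"
    and uf: "\<And>i. i \<in> {1..N - 1} \<Longrightarrow> solves_in N r1 r2 y f (V_part N r1 r2 Yf i) (uf i)"
    and us: "solves_in N r1 r2 y f (V_slow N r1 r2 Ys) us"
  defines "K \<equiv> M * max 1 \<kappa> * fast_interaction N r1 r2 Yf"
  shows "(\<lambda>x. u x - ((\<Sum>i = 1..N - 1. uf i x) + us x)) \<in> H10 Om"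
    "gnorm (\<lambda>x. u x - ((\<Sum>i = 1..N - 1. uf i x) + us x))
      \<le> (real N)\<^sup>2 * C0 / m * (1 + sqrt (M / m) * C0) * K * gnorm u"
proof -
  let ?I = "{1..N - 1}"
  have K: "0 \<le> K" unfolding K_def using M fast_interaction_nonneg[OF N] by simp
  have uV: "u \<in> VG" using u by (simp add: solves_in_def)
  note uH = VG_H10[OF uV]
  have sv: "bl y u v = bl y (uf i) v" if "i \<in> ?I" "v \<in> V_part N r1 r2 Yf i" for i v
    using u uf[OF that(1)] that(2) VGi_VG[OF V_part_VGi[OF that(2)]] by (simp add: solves_in_def)
  have ufV: "uf i \<in> V_part N r1 r2 Yf i" if "i \<in> ?I" for i using uf[OF that] by (simp add: solves_in_def)
  obtain w where w: "us = (\<lambda>x. \<Sum>i\<in>?I. w i x)" "\<And>i. i \<in> ?I \<Longrightarrow> w i \<in> V_part N r1 r2 Ys i"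
    using us by (auto simp: solves_in_def V_slow_def)
  define P where "P i s f g \<longleftrightarrow> s \<in> V_part N r1 r2 Ys i \<and> f \<in> V_part N r1 r2 Yf i \<and>
    trace_of i u g \<and> trace_of i (\<lambda>x. s x + f x) g" for i s f g
  have "\<exists>s f g. P i s f g" if i: "i \<in> ?I" for i
    unfolding P_def by (rule decomposition[where Ys = Ys and Yf = Yf, OF uH i dec[OF i]]) blast
  then obtain s F G where "\<And>i. i \<in> ?I \<Longrightarrow> P i (s i) (F i) (G i)" by metis
  then have sF: "\<And>i. i \<in> ?I \<Longrightarrow> s i \<in> V_part N r1 r2 Ys i" "\<And>i. i \<in> ?I \<Longrightarrow> F i \<in> V_part N r1 r2 Yf i"
    "\<And>i. i \<in> ?I \<Longrightarrow> trace_of i u (G i)" "\<And>i. i \<in> ?I \<Longrightarrow> trace_of i (\<lambda>x. s i x + F i x) (G i)"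
    by (simp_all only: P_def)
  define U where "U i x = s i x + F i x" for i x
  have sV: "s i \<in> VGi i" and FV: "F i \<in> VGi i" if "i \<in> ?I" for i using sF(1,2)[OF that] V_part_VGi by auto
  have sH: "s i \<in> H10 Om" and FH: "F i \<in> H10 Om" if "i \<in> ?I" for i using sV FV that VGi_H10 by blast+
  have UV: "U i \<in> VGi i" if "i \<in> ?I" for i
    using VGi_diff[OF sV[OF that] VGi_uminus[OF FV[OF that]]] by (simp add: U_def[abs_def])
  have UH: "U i \<in> H10 Om" if "i \<in> ?I" for i using UV[OF that] VGi_H10 by blast
  have Utr: "trace_of i (U i) (G i)" if "i \<in> ?I" for i using sF(4)[OF that] by (simp add: U_def[abs_def])
  have Ug: "gnorm (U i) \<le> C0 * gnorm u" if "i \<in> ?I" for i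
    by (rule C0(2)[OF that UV[OF that] uH Utr[OF that] sF(3)[OF that]])

  have sumUH: "(\<lambda>x. \<Sum>i\<in>?I. U i x) \<in> H10 Om" by (rule H10_sum[OF UH])
  \<comment> \<open>The sum of the \<open>U i\<close> has the same traces as \<open>u\<close>, so
    \<open>d\<close> has no energy. It remains in the formula for the error because it need not be
    the zero function.\<close>
  define d where "d x = u x - (\<Sum>i\<in>?I. U i x)" for x
  have dV: "d \<in> VG" unfolding d_def by (intro VG_diff uV VG_sum VGi_VG[OF UV])
  note dH = VG_H10[OF dV]
  have "zero_trace l d" for l
  proof (cases "l \<in> ?I")
    case True
    have "trace_of l d (\<lambda>t. G l t - G l t)"
      unfolding d_def using True
      by (intro trace_diff uH sumUH sF(3) sum_VGi_trace UV Utr) auto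
    then show ?thesis by (simp add: zero_trace_def)
  next
    case False then show ?thesis by (auto simp: zero_trace_def)
  qed
  then have d0: "gnorm d = 0" by (rule harmonic_zero_traces[OF dV])
  have gu: "AE x in lebesgue_on Om. grad Om u x = grad Om (\<lambda>x. \<Sum>i\<in>?I. U i x) x"
    using gnorm_eq_0[OF dH d0] H1_diff(2)[OF open_Om H10_H1[OF uH] H10_H1[OF sumUH]]
    unfolding d_def by eventually_elim simp
  have blu: "bl y u v = (\<Sum>i\<in>?I. bl y (U i) v)" if "v \<in> H10 Om" for v
    using bl_cong[OF uH sumUH that gu] bl_sum_left[of ?I U v y] UH that by simp
  have pair: "\<bar>bl y z v\<bar> \<le> K * (gnorm z * gnorm v)" if "i \<in> ?I" "j \<in> ?I" "i \<noteq> j" "z \<in> V_part N r1 r2 Yf i" "v \<in> VGi j" for i j z v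
  proof -
    have y0: "0 \<le> y k \<and> y k \<le> M" if "k \<in> {1..N}" for k using y[OF that] m by linarith
    show ?thesis unfolding K_def by (rule fast_pairing[OF N last that y0 less_imp_le[OF M]])
  qed
  have blo: "m * (gnorm v)\<^sup>2 \<le> bl y v v" "bl y v v \<le> M * (gnorm v)\<^sup>2" if "v \<in> H10 Om" for v
    by (rule bl_bounds(1)[OF that y], assumption) (rule bl_bounds(2)[OF that y], assumption)

  define x where "x i z = F i z - uf i z" for i z
  have xV: "x i \<in> V_part N r1 r2 Yf i" if "i \<in> ?I" for i
    unfolding x_def using dec[OF that] that
    by (intro V_part_diff sF(2) ufV) (auto simp: trace_decomposition_def)
  have xH: "x i \<in> H10 Om" if "i \<in> ?I" for i using xV[OF that] V_part_H10 by blast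
  have xg: "gnorm (x i) \<le> real N * (K * (C0 * gnorm u)) / m" if i: "i \<in> ?I" for i
  proof (rule absorb[OF _ m])
    have ufH: "uf i \<in> H10 Om" using ufV[OF i] V_part_H10 by blast
    \<comment> \<open>Splitting off the summand \<open>i\<close> isolates the pairing with
      \<open>s i\<close>, which orthogonality removes. Every other summand pairs the fast function
      \<open>x i\<close> with another interface.\<close>
    have "bl y u (x i) = bl y (U i) (x i) + (\<Sum>j\<in>?I - {i}. bl y (U j) (x i))"
      unfolding blu[OF xH[OF i]] using i by (intro sum.remove) auto
    also have "bl y (U i) (x i) = bl y (s i) (x i) + bl y (F i) (x i)"
      unfolding U_def by (rule bl_add_left[OF sH[OF i] FH[OF i] xH[OF i]])
    also have "bl y (s i) (x i) = 0" by (rule orth[OF i sF(1)[OF i] xV[OF i]])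
    finally have "bl y (F i) (x i) - bl y (uf i) (x i) = - (\<Sum>j\<in>?I - {i}. bl y (U j) (x i))"
      using sv[OF i xV[OF i]] by simp
    then have eq: "bl y (x i) (x i) = - (\<Sum>j\<in>?I - {i}. bl y (U j) (x i))"
      using bl_diff_left[OF FH[OF i] ufH xH[OF i], of y] by (simp add: x_def[abs_def])
    have "m * (gnorm (x i))\<^sup>2 \<le> bl y (x i) (x i)" by (rule blo(1)[OF xH[OF i]])
    also have "\<dots> \<le> (\<Sum>j\<in>?I - {i}. \<bar>bl y (U j) (x i)\<bar>)"
      unfolding eq using sum_abs[of "\<lambda>j. bl y (U j) (x i)" "?I - {i}"] by linarith
    also have "\<dots> \<le> (\<Sum>j\<in>?I - {i}. K * (C0 * gnorm u) * gnorm (x i))"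
    proof (rule sum_mono)
      fix j assume j: "j \<in> ?I - {i}"
      have "\<bar>bl y (U j) (x i)\<bar> \<le> K * (gnorm (x i) * gnorm (U j))"
        using pair[OF i _ _ xV[OF i] UV, of j] j by (simp add: bl_commute[of y "U j"])
      also have "\<dots> \<le> K * (gnorm (x i) * (C0 * gnorm u))"
        using j K by (intro mult_left_mono Ug) auto
      finally show "\<bar>bl y (U j) (x i)\<bar> \<le> K * (C0 * gnorm u) * gnorm (x i)" by (simp add: mult_ac)
    qed
    also have "\<dots> \<le> real N * (K * (C0 * gnorm u) * gnorm (x i))"
      using K C0(1) by (simp add: mult_right_mono card_Diff_singleton_if)
    finally show "m * (gnorm (x i))\<^sup>2 \<le> real N * (K * (C0 * gnorm u)) * gnorm (x i)" by (simp add: mult_ac)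
  qed (use K C0(1) in auto)

  define X where "X i z = s i z - w i z" for i z
  have XV: "X i \<in> V_part N r1 r2 Ys i" if "i \<in> ?I" for i
    unfolding X_def using dec[OF that] that
    by (intro V_part_diff sF(1) w(2)) (auto simp: trace_decomposition_def)
  have XVi: "X i \<in> VGi i" and XH: "X i \<in> H10 Om" if "i \<in> ?I" for i
    using XV[OF that] V_part_VGi VGi_H10 by blast+
  define xs where "xs z = (\<Sum>i\<in>?I. X i z)" for z
  have xsH: "xs \<in> H10 Om" unfolding xs_def by (rule H10_sum[OF XH])
  have usH: "us \<in> H10 Om" unfolding w(1) using w(2) V_part_H10 by (intro H10_sum) blast
  have sumsH: "(\<lambda>z. \<Sum>i\<in>?I. s i z) \<in> H10 Om" by (rule H10_sum[OF sH])
  have xs_eq: "xs = (\<lambda>z. (\<Sum>i\<in>?I. s i z) - us z)"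
    by (simp add: xs_def[abs_def] X_def w(1) sum_subtractf)
  \<comment> \<open>Testing controls the slow error only as a sum. Its component on interface
    \<open>j\<close> has the same trace there, so stability bounds the component by the sum.\<close>
  have Xg: "gnorm (X j) \<le> C0 * gnorm xs" if j: "j \<in> ?I" for j
  proof -
    obtain h where h: "trace_of j (X j) h" using XV[OF j] by (auto simp: V_part_def)
    have "trace_of j xs h" unfolding xs_def by (rule sum_VGi_trace[OF XVi j h])
    then show ?thesis using C0(2)[OF j XVi[OF j] xsH h] by simp
  qed
  define q where "q = sqrt (M / m)"
  have q: "0 \<le> q" "q\<^sup>2 = M / m" unfolding q_def using m M by auto
  \<comment> \<open>Slow and fast parts are orthogonal in the energy form. By Pythagoras
    \<open>F i\<close> has at most the energy of \<open>U i\<close>, and passing to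
    \<open>gnorm\<close> on both sides costs the factor \<open>q\<close>.\<close>
  have Fg: "gnorm (F i) \<le> q * (C0 * gnorm u)" if i: "i \<in> ?I" for i
  proof -
    have 0: "bl y (s i) (F i) = 0" by (rule orth[OF i sF(1)[OF i] sF(2)[OF i]])
    have "bl y (U i) (U i) = bl y (s i) (U i) + bl y (F i) (U i)"
      unfolding U_def by (rule bl_add_left[OF sH[OF i] FH[OF i] UH[OF i, unfolded U_def[abs_def]]])
    also have "bl y (s i) (U i) = bl y (s i) (s i) + bl y (F i) (s i)"
      unfolding U_def by (subst bl_commute) (rule bl_add_left[OF sH[OF i] FH[OF i] sH[OF i]])
    also have "bl y (F i) (U i) = bl y (s i) (F i) + bl y (F i) (F i)"
      unfolding U_def by (subst bl_commute) (rule bl_add_left[OF sH[OF i] FH[OF i] FH[OF i]])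
    finally have e: "bl y (U i) (U i) = bl y (s i) (s i) + bl y (F i) (F i)"
      using 0 bl_commute[of y "F i" "s i"] by simp
    have "0 \<le> bl y (s i) (s i)"
    proof (rule order_trans[OF _ blo(1)[OF sH[OF i]]])
      show "0 \<le> m * (gnorm (s i))\<^sup>2" using m by simp
    qed
    then have "m * (gnorm (F i))\<^sup>2 \<le> M * (gnorm (U i))\<^sup>2"
      using blo(1)[OF FH[OF i]] blo(2)[OF UH[OF i]] e by linarith
    then have "(gnorm (F i))\<^sup>2 \<le> (q * gnorm (U i))\<^sup>2"
      using m by (simp add: power_mult_distrib q(2) field_simps)
    then have "gnorm (F i) \<le> q * gnorm (U i)" by (rule power2_le_imp_le) (use q in simp)
    also have "\<dots> \<le> q * (C0 * gnorm u)" by (intro mult_left_mono Ug i q(1))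
    finally show ?thesis .
  qed
  have xsg: "gnorm xs \<le> (real N)\<^sup>2 * (K * (q * (C0 * gnorm u) * C0)) / m"
  proof (rule absorb[OF _ m])
    have xsS: "xs \<in> V_slow N r1 r2 Ys" unfolding V_slow_def xs_def using XV by blast
    have xsV: "xs \<in> VG" unfolding xs_def by (intro VG_sum VGi_VG[OF XVi])
    have "(\<Sum>i\<in>?I. bl y (s i) xs) + (\<Sum>i\<in>?I. bl y (F i) xs) = (\<Sum>i\<in>?I. bl y (U i) xs)"
      unfolding sum.distrib[symmetric] U_def
      by (rule sum.cong[OF refl]) (simp add: bl_add_left[OF sH FH xsH])
    also have "\<dots> = bl y us xs"
      using blu[OF xsH] u us xsS xsV by (simp add: solves_in_def)
    finally have "bl y xs xs = - (\<Sum>i\<in>?I. bl y (F i) xs)"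
      using bl_diff_left[OF sumsH usH xsH, of y] bl_sum_left[of ?I s xs y] sH xsH
        arg_cong[OF xs_eq, of "\<lambda>h. bl y h xs"] by simp
    also have "\<dots> \<le> (\<Sum>i\<in>?I. \<bar>bl y (F i) xs\<bar>)" using sum_abs[of "\<lambda>i. bl y (F i) xs" ?I] by linarith
    also have "\<dots> \<le> (\<Sum>i\<in>?I. real N * (K * (q * (C0 * gnorm u) * (C0 * gnorm xs))))"
    proof (rule sum_mono)
      fix i assume i: "i \<in> ?I"
      have "bl y (F i) xs = (\<Sum>j\<in>?I. bl y (X j) (F i))"
        unfolding xs_def using FH[OF i] XH by (subst bl_commute) (rule bl_sum_left, auto)
      then have "\<bar>bl y (F i) xs\<bar> \<le> (\<Sum>j\<in>?I. \<bar>bl y (X j) (F i)\<bar>)" by simp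
      also have "\<dots> \<le> (\<Sum>j\<in>?I. K * (q * (C0 * gnorm u) * (C0 * gnorm xs)))"
      proof (rule sum_mono)
        fix j assume j: "j \<in> ?I"
        have pos: "0 \<le> K * (q * (C0 * gnorm u) * (C0 * gnorm xs))" using K q(1) C0(1) by simp
        show "\<bar>bl y (X j) (F i)\<bar> \<le> K * (q * (C0 * gnorm u) * (C0 * gnorm xs))"
        \<comment> \<open>On the same interface slow and fast functions are orthogonal, so only
          pairings of different interfaces need the interaction bound.\<close>
        proof (cases "i = j")
          case True
          then show ?thesis using orth[OF i XV[OF i] sF(2)[OF i]] pos by simp
        next
          case False
          have "\<bar>bl y (X j) (F i)\<bar> \<le> K * (gnorm (F i) * gnorm (X j))"
            using pair[OF i j False sF(2)[OF i] XVi[OF j]] by (simp add: bl_commute[of y "X j"])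
          also have "\<dots> \<le> K * (q * (C0 * gnorm u) * (C0 * gnorm xs))"
            using K q(1) C0(1) by (intro mult_left_mono mult_mono Fg[OF i] Xg[OF j]) auto
          finally show ?thesis .
        qed
      qed
      also have "\<dots> \<le> real N * (K * (q * (C0 * gnorm u) * (C0 * gnorm xs)))"
        using K q(1) C0(1) by (simp add: mult_right_mono)
      finally show "\<bar>bl y (F i) xs\<bar> \<le> real N * (K * (q * (C0 * gnorm u) * (C0 * gnorm xs)))" .
    qed
    also have "\<dots> \<le> real N * (real N * (K * (q * (C0 * gnorm u) * (C0 * gnorm xs))))"
      using K q(1) C0(1) by (simp add: mult_right_mono)
    finally have "bl y xs xs \<le> real N * (real N * (K * (q * (C0 * gnorm u) * (C0 * gnorm xs))))" .
    moreover have "m * (gnorm xs)\<^sup>2 \<le> bl y xs xs" by (rule blo(1)[OF xsH])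
    ultimately show "m * (gnorm xs)\<^sup>2 \<le> (real N)\<^sup>2 * (K * (q * (C0 * gnorm u) * C0)) * gnorm xs"
      by (simp add: power2_eq_square mult_ac)
  qed (use K q(1) C0(1) in auto)

  have e_eq: "(\<lambda>z. u z - ((\<Sum>i\<in>?I. uf i z) + us z)) = (\<lambda>z. d z + ((\<Sum>i\<in>?I. x i z) + xs z))"
    by (simp add: fun_eq_iff d_def x_def xs_eq U_def sum.distrib sum_subtractf)
  have sxH: "(\<lambda>z. \<Sum>i\<in>?I. x i z) \<in> H10 Om" by (rule H10_sum[OF xH])
  have rH: "(\<lambda>z. (\<Sum>i\<in>?I. x i z) + xs z) \<in> H10 Om" by (rule H10_add[OF open_Om sxH xsH])
  show "(\<lambda>x. u x - ((\<Sum>i = 1..N - 1. uf i x) + us x)) \<in> H10 Om"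
    unfolding e_eq by (rule H10_add[OF open_Om dH rH])
  have "gnorm (\<lambda>x. u x - ((\<Sum>i = 1..N - 1. uf i x) + us x)) \<le> gnorm d + (gnorm (\<lambda>z. \<Sum>i\<in>?I. x i z) + gnorm xs)"
    unfolding e_eq using gnorm_add[OF dH rH] gnorm_add[OF sxH xsH] by linarith
  also have "\<dots> \<le> real N * (real N * (K * (C0 * gnorm u)) / m) + (real N)\<^sup>2 * (K * (q * (C0 * gnorm u) * C0)) / m"
  proof -
    have "gnorm (\<lambda>z. \<Sum>i\<in>?I. x i z) \<le> (\<Sum>i\<in>?I. gnorm (x i))" by (rule gnorm_sum[OF xH])
    also have "\<dots> \<le> (\<Sum>i\<in>?I. real N * (K * (C0 * gnorm u)) / m)" by (rule sum_mono[OF xg])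
    also have "\<dots> \<le> real N * (real N * (K * (C0 * gnorm u)) / m)"
      using K C0(1) m by (simp only: sum_constant) (intro mult_right_mono, auto)
    finally show ?thesis using d0 xsg by simp
  qed
  also have "\<dots> = (real N)\<^sup>2 * C0 / m * (1 + q * C0) * K * gnorm u"
    using m by (simp add: field_simps power2_eq_square)
  finally show "gnorm (\<lambda>x. u x - ((\<Sum>i = 1..N - 1. uf i x) + us x))
      \<le> (real N)\<^sup>2 * C0 / m * (1 + sqrt (M / m) * C0) * K * gnorm u" unfolding q_def .
qed

end

text \<open>The value at the midpoint anchors the bound, every other point of the interval being at
  distance at most 1.\<close>

lemma lipschitz_unit_interval:
  assumes "\<exists>K. K-lipschitz_on {0<..<1} (r :: real \<Rightarrow> real)"
  obtains B where "continuous_on {0<..<1} r" "\<And>t. t \<in> {0<..<1} \<Longrightarrow> \<bar>r t\<bar> \<le> B"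
proof -
  obtain K where K: "K-lipschitz_on {0<..<1} r" using assms by blast
  have K0: "0 \<le> K" using K by (rule lipschitz_on_nonneg)
  show ?thesis
  proof (rule that[of "\<bar>r (1 / 2)\<bar> + K"])
    show "continuous_on {0<..<1} r" using K by (rule lipschitz_on_continuous_on)
    fix t :: real assume t: "t \<in> {0<..<1}"
    have "\<bar>r t - r (1 / 2)\<bar> \<le> K * \<bar>t - 1 / 2\<bar>"
      using lipschitz_onD[OF K t, of "1 / 2"] by (simp add: dist_real_def)
    also have "\<dots> \<le> K * 1" using t K0 by (intro mult_left_mono) auto
    finally show "\<bar>r t\<bar> \<le> \<bar>r (1 / 2)\<bar> + K" by linarith
  qed
qed

text \<open>The error estimate in \<open>gnorm\<close> is converted to the energy norm on both
  sides. The constant is assembled from \<open>N\<close>, \<open>m\<close>, \<open>M\<close>,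
  \<kappa> and the stability constant \<open>C0\<close> of the geometry, before decompositions,
  coefficients and loads are introduced.\<close>

theorem theorem4p1:
  fixes N :: nat and r1 r2 :: "real \<Rightarrow> real" and m M :: real and D :: "(nat \<Rightarrow> real) set"
  assumes "N > 2"
    and "\<exists>K. K-lipschitz_on {0<..<1} r1" and "\<exists>K. K-lipschitz_on {0<..<1} r2"
    and "\<And>t. t \<in> {0<..<1} \<Longrightarrow> r1 t < r2 t"
    and "m > 0" and "M > 0"
    and "D \<subseteq> {1..N} \<rightarrow>\<^sub>E {m<..<M}"
  shows "\<exists>\<epsilon>0>0. \<forall>\<kappa>. \<exists>C>0. \<forall>Ys Yf :: nat \<Rightarrow> (real \<Rightarrow> real) set.
    (\<forall>i\<in>{1..N - 1}. trace_decomposition N r1 r2 i (Ys i) (Yf i)) \<longrightarrow>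
    (\<forall>y\<in>D. \<forall>i\<in>{1..N - 1}. \<forall>z\<in>V_part N r1 r2 Ys i. \<forall>w\<in>V_part N r1 r2 Yf i.
        bilin N r1 r2 y z w = 0) \<longrightarrow>
    last_interaction N r1 r2 Yf \<le> \<kappa> * fast_interaction N r1 r2 Yf \<longrightarrow>
    fast_interaction N r1 r2 Yf \<le> \<epsilon>0 \<longrightarrow>
    (\<forall>f\<in>L2 (domain N r1 r2). \<forall>y\<in>D. \<forall>u_Gamma u_s :: real \<times> real \<Rightarrow> real.
      \<forall>u_f :: nat \<Rightarrow> real \<times> real \<Rightarrow> real.
        solves_in N r1 r2 y f (V_Gamma N r1 r2) u_Gamma \<longrightarrow>
        (\<forall>i\<in>{1..N - 1}. solves_in N r1 r2 y f (V_part N r1 r2 Yf i) (u_f i)) \<longrightarrow>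
        solves_in N r1 r2 y f (V_slow N r1 r2 Ys) u_s \<longrightarrow>
        energy_norm N r1 r2 y (\<lambda>x. u_Gamma x - ((\<Sum>i = 1..N - 1. u_f i x) + u_s x))
          \<le> C * fast_interaction N r1 r2 Yf * energy_norm N r1 r2 y u_Gamma)"
proof -
  obtain B1 where B1: "continuous_on {0<..<1} r1" "\<And>t. t \<in> {0<..<1} \<Longrightarrow> \<bar>r1 t\<bar> \<le> B1"
    using assms(2) by (rule lipschitz_unit_interval) blast
  obtain B2 where B2: "continuous_on {0<..<1} r2" "\<And>t. t \<in> {0<..<1} \<Longrightarrow> \<bar>r2 t\<bar> \<le> B2"
    using assms(3) by (rule lipschitz_unit_interval) blast
  interpret chain N r1 r2 "max B1 B2"
    using assms(1,4) B1 B2 by unfold_locales (auto simp: le_max_iff_disj)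
  obtain C0 where C0: "0 \<le> C0" "\<And>j v w g. j \<in> {1..N - 1} \<Longrightarrow> v \<in> VGi j \<Longrightarrow> w \<in> H10 Om \<Longrightarrow> trace_of j v g \<Longrightarrow>
      trace_of j w g \<Longrightarrow> gnorm v \<le> C0 * gnorm w"
    by (rule stability) blast
  \<comment> \<open>\<open>sqrt M\<close> and \<open>1 / sqrt m\<close> come from the conversion
    between \<open>gnorm\<close> and the energy norm; the summand 1 makes the constant positive even
    if \<open>C0\<close> is 0.\<close>
  define C where "C \<kappa> = sqrt M * ((real N)\<^sup>2 * C0 / m * (1 + sqrt (M / m) * C0) * (M * max 1 \<kappa>)) / sqrt m + 1" for \<kappa>
  have Cpos: "0 < C \<kappa>" for \<kappa>
    unfolding C_def using assms(5,6) C0(1) by (intro add_nonneg_pos) auto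
  have main: "energy_norm N r1 r2 y (\<lambda>x. u x - ((\<Sum>i = 1..N - 1. uf i x) + us x))
      \<le> C \<kappa> * fast_interaction N r1 r2 Yf * energy_norm N r1 r2 y u"
    if dec: "\<forall>i\<in>{1..N - 1}. trace_decomposition N r1 r2 i (Ys i) (Yf i)"
      and orth: "\<forall>y\<in>D. \<forall>i\<in>{1..N - 1}. \<forall>z\<in>V_part N r1 r2 Ys i. \<forall>w\<in>V_part N r1 r2 Yf i. bl y z w = 0"
      and last: "last_interaction N r1 r2 Yf \<le> \<kappa> * fast_interaction N r1 r2 Yf"
      and y: "y \<in> D" and u: "solves_in N r1 r2 y f VG u"
      and uf: "\<forall>i\<in>{1..N - 1}. solves_in N r1 r2 y f (V_part N r1 r2 Yf i) (uf i)"
      and us: "solves_in N r1 r2 y f (V_slow N r1 r2 Ys) us"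
    for \<kappa> Ys Yf f y u us and uf :: "nat \<Rightarrow> real \<times> real \<Rightarrow> real"
  proof -
    define \<epsilon> where "\<epsilon> = fast_interaction N r1 r2 Yf"
    have \<epsilon>: "0 \<le> \<epsilon>" unfolding \<epsilon>_def by (rule fast_interaction_nonneg[OF assms(1)])
    define e where "e = (\<lambda>x. u x - ((\<Sum>i = 1..N - 1. uf i x) + us x))"
    define R where "R = (real N)\<^sup>2 * C0 / m * (1 + sqrt (M / m) * C0)"
    have R: "0 \<le> R" unfolding R_def using assms(5,6) C0(1) by auto
    have yb: "m \<le> y k \<and> y k \<le> M" if "k \<in> {1..N}" for k
    proof -
      have "y \<in> {1..N} \<rightarrow>\<^sub>E {m<..<M}" using assms(7) y by blast
      from PiE_mem[OF this that] show ?thesis by simp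
    qed
    have E: "e \<in> H10 Om" "gnorm e \<le> R * (M * max 1 \<kappa> * \<epsilon>) * gnorm u"
    proof -
      note est = error_estimate[OF assms(1,5,6) yb C0 dec[rule_format] orth[rule_format, OF y] last u uf[rule_format] us]
      show "e \<in> H10 Om" unfolding e_def by (rule est(1))
      show "gnorm e \<le> R * (M * max 1 \<kappa> * \<epsilon>) * gnorm u" unfolding e_def R_def \<epsilon>_def by (rule est(2))
    qed
    have uH: "u \<in> H10 Om" using u VG_H10 by (auto simp: solves_in_def)
    have "sqrt m * gnorm u = sqrt (m * (gnorm u)\<^sup>2)" by (simp add: real_sqrt_mult)
    also have "\<dots> \<le> energy_norm N r1 r2 y u"
      unfolding energy_norm_def by (intro real_sqrt_le_mono bl_bounds(1)[OF uH yb])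
    finally have lo: "sqrt m * gnorm u \<le> energy_norm N r1 r2 y u" .
    then have gu: "gnorm u \<le> energy_norm N r1 r2 y u / sqrt m" using assms(5) by (simp add: field_simps)
    have en0: "0 \<le> energy_norm N r1 r2 y u"
      by (rule order_trans[OF _ lo]) (use assms(5) in simp)
    have "energy_norm N r1 r2 y e \<le> sqrt (M * (gnorm e)\<^sup>2)"
      unfolding energy_norm_def by (intro real_sqrt_le_mono bl_bounds(2)[OF E(1) yb])
    also have "\<dots> = sqrt M * gnorm e" by (simp add: real_sqrt_mult)
    also have "\<dots> \<le> sqrt M * (R * (M * max 1 \<kappa> * \<epsilon>) * (energy_norm N r1 r2 y u / sqrt m))"
    proof (rule mult_left_mono)
      have "R * (M * max 1 \<kappa> * \<epsilon>) * gnorm u \<le> R * (M * max 1 \<kappa> * \<epsilon>) * (energy_norm N r1 r2 y u / sqrt m)"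
        using gu R assms(6) \<epsilon> by (intro mult_left_mono) auto
      then show "gnorm e \<le> R * (M * max 1 \<kappa> * \<epsilon>) * (energy_norm N r1 r2 y u / sqrt m)" using E(2) by simp
    qed (use assms(6) in simp)
    also have "\<dots> = (C \<kappa> - 1) * \<epsilon> * energy_norm N r1 r2 y u" by (simp add: C_def R_def)
    also have "\<dots> \<le> C \<kappa> * \<epsilon> * energy_norm N r1 r2 y u"
      using \<epsilon> en0 by (intro mult_right_mono) auto
    finally show ?thesis by (simp add: e_def \<epsilon>_def)
  qed
  show ?thesis
  proof (rule exI[of _ 1], intro conjI allI)
    fix \<kappa>
    show "\<exists>C>0. \<forall>Ys Yf :: nat \<Rightarrow> (real \<Rightarrow> real) set.
      (\<forall>i\<in>{1..N - 1}. trace_decomposition N r1 r2 i (Ys i) (Yf i)) \<longrightarrow>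
      (\<forall>y\<in>D. \<forall>i\<in>{1..N - 1}. \<forall>z\<in>V_part N r1 r2 Ys i. \<forall>w\<in>V_part N r1 r2 Yf i.
          bilin N r1 r2 y z w = 0) \<longrightarrow>
      last_interaction N r1 r2 Yf \<le> \<kappa> * fast_interaction N r1 r2 Yf \<longrightarrow>
      fast_interaction N r1 r2 Yf \<le> 1 \<longrightarrow>
      (\<forall>f\<in>L2 (domain N r1 r2). \<forall>y\<in>D. \<forall>u_Gamma u_s :: real \<times> real \<Rightarrow> real.
        \<forall>u_f :: nat \<Rightarrow> real \<times> real \<Rightarrow> real.
          solves_in N r1 r2 y f (V_Gamma N r1 r2) u_Gamma \<longrightarrow>
          (\<forall>i\<in>{1..N - 1}. solves_in N r1 r2 y f (V_part N r1 r2 Yf i) (u_f i)) \<longrightarrow>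
          solves_in N r1 r2 y f (V_slow N r1 r2 Ys) u_s \<longrightarrow>
          energy_norm N r1 r2 y (\<lambda>x. u_Gamma x - ((\<Sum>i = 1..N - 1. u_f i x) + u_s x))
            \<le> C * fast_interaction N r1 r2 Yf * energy_norm N r1 r2 y u_Gamma)"
      by (rule exI[of _ "C \<kappa>"], intro conjI allI impI ballI, rule Cpos, rule main)
  qed simp
qed

end
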